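(* Let $T>0$ and let $k\ge 1$ be an integer. Let $\psi$ be the solution of the Schrödinger equation $$-i\epsilon\,\partial_t\psi-\frac{\epsilon^2}{2}\Delta_y\psi+V_{ext}(y)\psi=0,\qquad \psi(0,y)=\psi_{\rm in}(y)=A_{\rm in}(y)e^{iS_{\rm in}(y)/\epsilon},$$ with $|{\rm supp}(A_{\rm in})|<\infty$, and let $\psi_k^\epsilon$ be the $k$-th order phase space based Gaussian beam superposition $$\psi_k^\epsilon(t,y)=Z(n,\epsilon)\int_{\Omega(t)}\psi_{kPGB}(t,y,X)\,\delta(w(t,X))\,dX ,$$ with the initial beam data specified in the context. Then there exist $\epsilon_0>0$, a normalization parameter $Z(n,\epsilon)\sim\epsilon^{-n/2}$, and a constant $C$ independent of $\epsilon$ such that for all $\epsilon\in(0,\epsilon_0)$ and all $t\in[0,T]$ $$\|(\psi_k^\epsilon-\psi)(t,\cdot)\|_{L^2(\mathbb{R}^n)}\le C\,|{\rm supp}(A_{\rm in})|\,\epsilon^{\frac{k}{2}-\frac{n}{4}} .$$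
   Context: Setting. $V_{ext}$ is a real-valued smooth potential on $\mathbb{R}^n$, $H(x,p)=\frac12|p|^2+V_{ext}(x)$, $A_{\rm in}\in C_0^\infty(\mathbb{R}^n)$, $S_{\rm in}\in C^\infty(\mathbb{R}^n)$ real-valued. $X=(x,p)\in\mathbb{R}^{2n}$, and $X(t,X_0)=(x(t,X_0),p(t,X_0))$ is the Hamiltonian flow $\dot x=p$, $\dot p=-\nabla V_{ext}(x)$, $X(0,X_0)=X_0=(x_0,p_0)$, assumed defined on the time interval considered; it is volume preserving and invertible, with inverse $X_0(t,X)$. $\Omega(0)=\{(x_0,p_0): x_0\in{\rm supp}(A_{\rm in}),\ p_0\in{\rm range}(\nabla S_{\rm in})\}$ and $\Omega(t)=X(t,\Omega(0))$. $|\cdot|$ of a set is Lebesgue measure; $Z\sim\epsilon^{-n/2}$ means $c_1\epsilon^{-n/2}\le Z\le c_2\epsilon^{-n/2}$ with positive constants independent of $\epsilon$. The level set function $w(t,X)\in\mathbb{R}^n$ solves $\partial_t w+p\cdot\nabla_x w-\nabla V_{ext}(x)\cdot\nabla_p w=0$, $w(0,X)=p-\nabla S_{\rm in}(x)$; $\delta$ is the Dirac delta on $\mathbb{R}^n$. Since $w(t,X(t,X_0))=w(0,X_0)$ and the flow preserves volume, the integral means $$\int_{\Omega(t)}F(X)\,\delta(w(t,X))\,dX=\int_{{\rm supp}(A_{\rm in})}F\big(X(t,(x_0,\nabla S_{\rm in}(x_0)))\big)\,dx_0 .$$ The $k$-th order beam. $\psi_{kPGB}(t,y,X)=\psi_{kGB}(t,y;X_0(t,X))$,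 where, with $x=x(t,X_0)$, $$\psi_{kGB}(t,y;X_0)=\rho(y-x)\Big[\sum_{l=0}^{\lfloor (k-1)/2\rfloor}\epsilon^l a_l(t,y)\Big]\exp\Big(\frac{i}{\epsilon}\Phi_k(t,y)\Big).$$ Here $\Phi_k(t,y)=\sum_{|\alpha|\le k+1}\frac{1}{\alpha!}\Phi_\alpha(t)(y-x)^\alpha$ and $a_l(t,y)=\sum_{|\alpha|\le k-1-2l}\frac{1}{\alpha!}a_{l,\alpha}(t)(y-x)^\alpha$ are Taylor polynomials about $x(t,X_0)$ (with coefficients depending on $X_0$) determined by the following ODE systems along the trajectory: (1) Phase: $\partial_y^\alpha\big[\partial_t\Phi_k+\frac12|\nabla_y\Phi_k|^2+V_{ext}(y)\big]=0$ at $y=x(t,X_0)$ for all $|\alpha|\le k+1$. In particular $\Phi_0=S$ satisfies $\dot S=\frac12|p|^2-V_{ext}(x)$, the first-order coefficients are $\nabla_y\Phi_k(t,x)=p(t,X_0)$, and $M=\nabla^2_y\Phi_k(t,x)$ satisfies $\dot M+\nabla^2V_{ext}(x)+M^2=0$. (2) Amplitude: with $L=\partial_t+\nabla_y\Phi_k\cdot\nabla_y+\frac12\Delta_y\Phi_k$ and $a_{-1}=0$, $\partial_y^\alpha\big[La_l-\frac{i}{2}\Delta_y a_{l-1}\big]=0$ at $y=x(t,X_0)$ for all $|\alpha|\le k-1-2l$, $0\le l\le\lfloor (k-1)/2\rfloor$. Initial data at $t=0$: $\Phi_0=S_{\rm in}(x_0)$, $\nabla_y\Phi_k(0,x_0)=p_0$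 (which equals $\nabla S_{\rm in}(x_0)$ on the set $w(0,X_0)=0$), $\nabla_y^2\Phi_k(0,x_0)=\nabla^2S_{\rm in}(x_0)+iI$, $\Phi_\alpha(0)=\partial^\alpha S_{\rm in}(x_0)$ for $3\le|\alpha|\le k+1$; $a_{0,\alpha}(0)=\partial^\alpha A_{\rm in}(x_0)$ for $|\alpha|\le k-1$; $a_{l,\alpha}(0)=0$ for $l\ge1$. Cutoff: $\rho\in C_0^\infty(\mathbb{R}^n)$, $\rho\ge0$, $\rho\equiv1$ in a ball about the origin, and its support is so small that ${\rm Im}\,\Phi_k(t,y)>0$ whenever $0\ne y-x(t,X_0)\in{\rm supp}\,\rho$, for all $t\in[0,T]$ and $X_0=(x_0,\nabla S_{\rm in}(x_0))$ with $x_0\in{\rm supp}(A_{\rm in})$. *)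

theory Defs
  imports "HOL-Analysis.Analysis"
begin

section \<open>Partial derivatives, multi-indices, smooth functions\<close>

definition partial :: "'n::finite \<Rightarrow> (real^'n \<Rightarrow> 'b::real_normed_vector) \<Rightarrow> real^'n \<Rightarrow> 'b" where
  "partial i f x = vector_derivative (\<lambda>h. f (x + h *\<^sub>R axis i 1)) (at 0)"

definition grad :: "(real^'n::finite \<Rightarrow> real) \<Rightarrow> real^'n \<Rightarrow> real^'n" where
  "grad f x = (\<chi> i. partial i f x)"

definition laplacian :: "(real^'n::finite \<Rightarrow> 'b::real_normed_vector) \<Rightarrow> real^'n \<Rightarrow> 'b" where
  "laplacian f x = (\<Sum>i\<in>UNIV. partial i (partial i f) x)"

text \<open>All iterated partial derivatives, in any order, exist and are (Frechet) differentiable,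
  hence continuous; this is the same as being C-infinity.\<close>

definition smooth :: "(real^'n::finite \<Rightarrow> 'b::real_normed_vector) \<Rightarrow> bool" where
  "smooth f \<longleftrightarrow> (\<forall>is x. foldr partial is f differentiable (at x))"

definition supp :: "('a::topological_space \<Rightarrow> 'b::zero) \<Rightarrow> 'a set" where
  "supp f = closure {x. f x \<noteq> 0}"

definition test_function :: "(real^'n::finite \<Rightarrow> 'b::real_normed_vector) \<Rightarrow> bool" where
  "test_function f \<longleftrightarrow> smooth f \<and> compact (supp f)"

text \<open>A multi-index is a function from the coordinate type to the natural numbers.\<close>

definition mi_size :: "('n::finite \<Rightarrow> nat) \<Rightarrow> nat" where
  "mi_size \<alpha> = (\<Sum>i\<in>UNIV. \<alpha> i)"

definition mi_fact :: "('n::finite \<Rightarrow> nat) \<Rightarrow> nat" where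
  "mi_fact \<alpha> = (\<Prod>i\<in>UNIV. fact (\<alpha> i))"

definition mi_power :: "real^'n::finite \<Rightarrow> ('n \<Rightarrow> nat) \<Rightarrow> real" where
  "mi_power z \<alpha> = (\<Prod>i\<in>UNIV. (z $ i) ^ \<alpha> i)"

text \<open>The order in which the partial derivatives of a multi-index are taken is fixed once and for
  all by an arbitrary enumeration of the coordinates. It is irrelevant for smooth functions,
  the only ones to which \<^term>\<open>mi_deriv\<close> is applied below.\<close>

definition coords :: "'n::finite list" where
  "coords = (SOME is. distinct is \<and> set is = UNIV)"

definition mi_deriv :: "('n::finite \<Rightarrow> nat) \<Rightarrow> (real^'n \<Rightarrow> 'b::real_normed_vector) \<Rightarrow> real^'n \<Rightarrow> 'b" where
  "mi_deriv \<alpha> f = foldr (\<lambda>i. partial i ^^ \<alpha> i) coords f"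

lemma coords: "distinct (coords :: 'n::finite list)" "set (coords :: 'n list) = UNIV"
proof -
  have "\<exists>is :: 'n list. distinct is \<and> set is = UNIV"
    using finite_distinct_list[of "UNIV :: 'n set"] by auto
  then have "distinct (coords :: 'n list) \<and> set (coords :: 'n list) = UNIV"
    unfolding coords_def by (rule someI_ex)
  then show "distinct (coords :: 'n list)" "set (coords :: 'n list) = UNIV" by auto
qed

lemma finite_mi_size_le: "finite {\<alpha> :: 'n::finite \<Rightarrow> nat. mi_size \<alpha> \<le> m}"
proof (rule finite_subset)
  show "{\<alpha> :: 'n \<Rightarrow> nat. mi_size \<alpha> \<le> m} \<subseteq> PiE UNIV (\<lambda>_. {..m})"
  proof (clarsimp simp: PiE_def Pi_def mi_size_def)
    fix \<alpha> :: "'n \<Rightarrow> nat" and i assume "sum \<alpha> UNIV \<le> m"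
    moreover have "\<alpha> i \<le> sum \<alpha> UNIV" by (rule member_le_sum) auto
    ultimately show "\<alpha> i \<le> m" by simp
  qed
qed (auto intro: finite_PiE)

text \<open>The polynomial in \<open>y\<close> with Taylor coefficients \<open>c \<alpha>\<close> about \<open>x\<close>, of degree at most \<open>m\<close>.\<close>

definition taylor_poly ::
  "nat \<Rightarrow> (('n::finite \<Rightarrow> nat) \<Rightarrow> complex) \<Rightarrow> real^'n \<Rightarrow> real^'n \<Rightarrow> complex" where
  "taylor_poly m c x y =
     (\<Sum>\<alpha> | mi_size \<alpha> \<le> m. c \<alpha> / of_nat (mi_fact \<alpha>) * of_real (mi_power (y - x) \<alpha>))"

section \<open>The space of square integrable functions\<close>

definition square_integrable :: "('a::euclidean_space \<Rightarrow> complex) \<Rightarrow> bool" where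
  "square_integrable f \<longleftrightarrow>
     f \<in> borel_measurable lborel \<and> integrable lborel (\<lambda>y. (norm (f y))\<^sup>2)"

text \<open>Only meaningful together with \<^const>\<open>square_integrable\<close>: the Bochner integral of a
  non-integrable function is 0.\<close>

definition L2_norm :: "('a::euclidean_space \<Rightarrow> complex) \<Rightarrow> real" where
  "L2_norm f = sqrt (LINT y|lborel. (norm (f y))\<^sup>2)"

section \<open>The Schroedinger equation\<close>

definition wkb_data :: "(real^'n::finite \<Rightarrow> complex) \<Rightarrow> (real^'n \<Rightarrow> real) \<Rightarrow> real \<Rightarrow> real^'n \<Rightarrow> complex" where
  "wkb_data A S \<epsilon> y = A y * exp (\<i> * of_real (S y / \<epsilon>))"

text \<open>A classical solution on the closed time interval from \<open>0\<close> to \<open>T\<close>: \<open>u\<close> is continuously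
  differentiable once in time and twice in space, the equation holds pointwise, and the evolution
  is the quantum mechanical one, i.e. it stays in the space of square integrable functions and
  conserves the norm. The last condition has to be part of the notion of solution:
  the potential is only assumed smooth, so the Hamiltonian need not be essentially
  self-adjoint on the test functions, and pointwise solutions that do not conserve the norm
  (mass entering from infinity) may exist. Conversely every unitary group generated by a
  self-adjoint extension of the Hamiltonian, applied to an initial datum in the test functions,
  is a solution in this sense, by elliptic regularity.\<close>

definition schrodinger_solution ::
  "(real^'n::finite \<Rightarrow> real) \<Rightarrow> (real^'n \<Rightarrow> complex) \<Rightarrow> real \<Rightarrow> real \<Rightarrow> (real \<Rightarrow> real^'n \<Rightarrow> complex) \<Rightarrow> bool" where
  "schrodinger_solution V u_in \<epsilon> T u \<longleftrightarrow>
     (\<forall>y. u 0 y = u_in y) \<and>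
     (\<forall>t\<in>{0..T}. \<forall>y. (\<lambda>s. u s y) differentiable (at t within {0..T})) \<and>
     continuous_on ({0..T} \<times> UNIV)
       (\<lambda>(t, y). vector_derivative (\<lambda>s. u s y) (at t within {0..T})) \<and>
     (\<forall>is. length is \<le> 1 \<longrightarrow> (\<forall>t\<in>{0..T}. \<forall>y. foldr partial is (u t) differentiable (at y))) \<and>
     (\<forall>is. length is \<le> 2 \<longrightarrow>
        continuous_on ({0..T} \<times> UNIV) (\<lambda>(t, y). foldr partial is (u t) y)) \<and>
     (\<forall>t\<in>{0..T}. \<forall>y.
        - \<i> * of_real \<epsilon> * vector_derivative (\<lambda>s. u s y) (at t within {0..T})
        - of_real (\<epsilon>\<^sup>2 / 2) * laplacian (u t) y + of_real (V y) * u t y = 0) \<and>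
     (\<forall>t\<in>{0..T}. square_integrable (u t) \<and> L2_norm (u t) = L2_norm u_in)"

section \<open>Hamiltonian flow in phase space\<close>

type_synonym 'n phase = "(real^'n) \<times> (real^'n)"

definition hamiltonian_flow ::
  "(real^'n::finite \<Rightarrow> real) \<Rightarrow> real \<Rightarrow> (real \<Rightarrow> 'n phase \<Rightarrow> 'n phase) \<Rightarrow> bool" where
  "hamiltonian_flow V T X \<longleftrightarrow>
     (\<forall>X0. X 0 X0 = X0 \<and>
       (\<forall>t\<in>{0..T}. ((\<lambda>s. X s X0) has_vector_derivative
          (snd (X t X0), - grad V (fst (X t X0)))) (at t within {0..T})))"

definition Omega0 :: "(real^'n::finite \<Rightarrow> complex) \<Rightarrow> (real^'n \<Rightarrow> real) \<Rightarrow> 'n phase set" where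
  "Omega0 A S = supp A \<times> range (grad S)"

text \<open>The integral of \<open>F(X) \<delta>(w(t,X)) dX\<close> over the image under \<open>X t\<close> of \<^term>\<open>Omega0 A S\<close>.
  Here \<open>w\<close> is the level set function, which is transported by the flow:
  \<open>w(t, X t (x\<^sub>0,p\<^sub>0)) = w(0,(x\<^sub>0,p\<^sub>0)) = p\<^sub>0 - grad S x\<^sub>0\<close>. Since the flow preserves volume, pulling
  back to time \<open>0\<close> gives the integral of \<open>F(X t (x\<^sub>0,p\<^sub>0)) \<delta>(p\<^sub>0 - grad S x\<^sub>0)\<close> over
  \<^term>\<open>Omega0 A S\<close>, which is understood as the following integral over the support of \<open>A\<close>.\<close>

definition level_set_integral ::
  "(real \<Rightarrow> ('n::finite) phase \<Rightarrow> 'n phase) \<Rightarrow> (real^'n \<Rightarrow> complex) \<Rightarrow>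
   (real^'n \<Rightarrow> real) \<Rightarrow> real \<Rightarrow> ('n phase \<Rightarrow> complex) \<Rightarrow> complex" where
  "level_set_integral X A S t F = (LINT x0:supp A|lborel. F (X t (x0, grad S x0)))"

section \<open>Gaussian beams of order k\<close>

text \<open>The coefficients are functions \<open>\<phi> \<alpha> t X0\<close> and \<open>a l \<alpha> t X0\<close>. Only those with
  \<open>mi_size \<alpha> \<le> k + 1\<close>, respectively \<open>mi_size \<alpha> \<le> k - 1 - 2 * l\<close> and \<open>l \<le> (k - 1) div 2\<close>, matter.\<close>

definition beam_phase ::
  "nat \<Rightarrow> (real \<Rightarrow> ('n::finite) phase \<Rightarrow> 'n phase) \<Rightarrow>
   (('n \<Rightarrow> nat) \<Rightarrow> real \<Rightarrow> 'n phase \<Rightarrow> complex) \<Rightarrow>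
   'n phase \<Rightarrow> real \<Rightarrow> real^'n \<Rightarrow> complex" where
  "beam_phase k X \<phi> X0 t y = taylor_poly (k + 1) (\<lambda>\<alpha>. \<phi> \<alpha> t X0) (fst (X t X0)) y"

definition beam_amplitude ::
  "nat \<Rightarrow> (real \<Rightarrow> ('n::finite) phase \<Rightarrow> 'n phase) \<Rightarrow>
   (nat \<Rightarrow> ('n \<Rightarrow> nat) \<Rightarrow> real \<Rightarrow> 'n phase \<Rightarrow> complex) \<Rightarrow>
   'n phase \<Rightarrow> nat \<Rightarrow> real \<Rightarrow> real^'n \<Rightarrow> complex" where
  "beam_amplitude k X a X0 l t y = taylor_poly (k - 1 - 2 * l) (\<lambda>\<alpha>. a l \<alpha> t X0) (fst (X t X0)) y"

text \<open>In the eikonal expression the square of the gradient of the complex-valued phase is the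
  bilinear (not Hermitian) one.\<close>

definition eikonal ::
  "(real^'n::finite \<Rightarrow> real) \<Rightarrow> real \<Rightarrow> (real \<Rightarrow> real^'n \<Rightarrow> complex) \<Rightarrow> real \<Rightarrow> real^'n \<Rightarrow> complex" where
  "eikonal V T \<Phi> t y =
     vector_derivative (\<lambda>s. \<Phi> s y) (at t within {0..T})
     + 1/2 * (\<Sum>i\<in>UNIV. (partial i (\<Phi> t) y)\<^sup>2) + of_real (V y)"

definition transport ::
  "real \<Rightarrow> (real \<Rightarrow> real^'n::finite \<Rightarrow> complex) \<Rightarrow> (real \<Rightarrow> real^'n \<Rightarrow> complex) \<Rightarrow> real \<Rightarrow> real^'n \<Rightarrow> complex" where
  "transport T \<Phi> b t y =
     vector_derivative (\<lambda>s. b s y) (at t within {0..T})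
     + (\<Sum>i\<in>UNIV. partial i (\<Phi> t) y * partial i (b t) y) + 1/2 * laplacian (\<Phi> t) y * b t y"

definition phase_system ::
  "(real^'n::finite \<Rightarrow> real) \<Rightarrow> (real^'n \<Rightarrow> real) \<Rightarrow> real \<Rightarrow> nat \<Rightarrow>
   (real \<Rightarrow> 'n phase \<Rightarrow> 'n phase) \<Rightarrow>
   (('n \<Rightarrow> nat) \<Rightarrow> real \<Rightarrow> 'n phase \<Rightarrow> complex) \<Rightarrow> 'n phase \<Rightarrow> bool" where
  "phase_system V S T k X \<phi> X0 \<longleftrightarrow>
     (let \<Phi> = beam_phase k X \<phi> X0; x0 = fst X0; p0 = snd X0 in
       (\<forall>\<alpha>. mi_size \<alpha> \<le> k + 1 \<longrightarrow> (\<forall>t\<in>{0..T}.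
          (\<lambda>s. \<phi> \<alpha> s X0) differentiable (at t within {0..T}) \<and>
          mi_deriv \<alpha> (eikonal V T \<Phi> t) (fst (X t X0)) = 0)) \<and>
       \<phi> (\<lambda>_. 0) 0 X0 = of_real (S x0) \<and>
       (\<forall>i. partial i (\<Phi> 0) x0 = of_real (p0 $ i)) \<and>
       (\<forall>i j. partial i (partial j (\<Phi> 0)) x0 =
          of_real (partial i (partial j S) x0) + (if i = j then \<i> else 0)) \<and>
       (\<forall>\<alpha>. 3 \<le> mi_size \<alpha> \<and> mi_size \<alpha> \<le> k + 1 \<longrightarrow> \<phi> \<alpha> 0 X0 = of_real (mi_deriv \<alpha> S x0)))"

definition amplitude_system ::
  "(real^'n::finite \<Rightarrow> complex) \<Rightarrow> real \<Rightarrow> nat \<Rightarrow>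
   (real \<Rightarrow> 'n phase \<Rightarrow> 'n phase) \<Rightarrow>
   (('n \<Rightarrow> nat) \<Rightarrow> real \<Rightarrow> 'n phase \<Rightarrow> complex) \<Rightarrow>
   (nat \<Rightarrow> ('n \<Rightarrow> nat) \<Rightarrow> real \<Rightarrow> 'n phase \<Rightarrow> complex) \<Rightarrow> 'n phase \<Rightarrow> bool" where
  "amplitude_system A T k X \<phi> a X0 \<longleftrightarrow>
     (let \<Phi> = beam_phase k X \<phi> X0; b = beam_amplitude k X a X0; x0 = fst X0 in
       \<forall>l \<alpha>. l \<le> (k - 1) div 2 \<and> mi_size \<alpha> \<le> k - 1 - 2 * l \<longrightarrow>
         (\<forall>t\<in>{0..T}.
            (\<lambda>s. a l \<alpha> s X0) differentiable (at t within {0..T}) \<and>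
            mi_deriv \<alpha> (\<lambda>y. transport T \<Phi> (b l) t y
                - \<i>/2 * (if l = 0 then 0 else laplacian (b (l - 1) t) y)) (fst (X t X0)) = 0) \<and>
         a l \<alpha> 0 X0 = (if l = 0 then mi_deriv \<alpha> A x0 else 0))"

definition cutoff ::
  "(real^'n::finite \<Rightarrow> complex) \<Rightarrow> (real^'n \<Rightarrow> real) \<Rightarrow> real \<Rightarrow> nat \<Rightarrow>
   (real \<Rightarrow> 'n phase \<Rightarrow> 'n phase) \<Rightarrow>
   (('n \<Rightarrow> nat) \<Rightarrow> real \<Rightarrow> 'n phase \<Rightarrow> complex) \<Rightarrow> (real^'n \<Rightarrow> real) \<Rightarrow> bool" where
  "cutoff A S T k X \<phi> \<rho> \<longleftrightarrow>
     test_function \<rho> \<and> (\<forall>z. 0 \<le> \<rho> z) \<and> (\<exists>r>0. \<forall>z\<in>ball 0 r. \<rho> z = 1) \<and>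
     (\<forall>t\<in>{0..T}. \<forall>x0\<in>supp A. \<forall>y.
        let X0 = (x0, grad S x0) in
        y - fst (X t X0) \<in> supp \<rho> \<and> y - fst (X t X0) \<noteq> 0 \<longrightarrow> 0 < Im (beam_phase k X \<phi> X0 t y))"

definition gaussian_beam ::
  "nat \<Rightarrow> (real \<Rightarrow> ('n::finite) phase \<Rightarrow> 'n phase) \<Rightarrow> (real^'n \<Rightarrow> real) \<Rightarrow>
   (('n \<Rightarrow> nat) \<Rightarrow> real \<Rightarrow> 'n phase \<Rightarrow> complex) \<Rightarrow>
   (nat \<Rightarrow> ('n \<Rightarrow> nat) \<Rightarrow> real \<Rightarrow> 'n phase \<Rightarrow> complex) \<Rightarrow>
   real \<Rightarrow> real \<Rightarrow> real^'n \<Rightarrow> 'n phase \<Rightarrow> complex" where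
  "gaussian_beam k X \<rho> \<phi> a \<epsilon> t y X0 =
     of_real (\<rho> (y - fst (X t X0)))
     * (\<Sum>l\<le>(k - 1) div 2. of_real (\<epsilon> ^ l) * beam_amplitude k X a X0 l t y)
     * exp (\<i> / of_real \<epsilon> * beam_phase k X \<phi> X0 t y)"

definition phase_space_beam ::
  "nat \<Rightarrow> (real \<Rightarrow> ('n::finite) phase \<Rightarrow> 'n phase) \<Rightarrow> (real^'n \<Rightarrow> real) \<Rightarrow>
   (('n \<Rightarrow> nat) \<Rightarrow> real \<Rightarrow> 'n phase \<Rightarrow> complex) \<Rightarrow>
   (nat \<Rightarrow> ('n \<Rightarrow> nat) \<Rightarrow> real \<Rightarrow> 'n phase \<Rightarrow> complex) \<Rightarrow>
   real \<Rightarrow> real \<Rightarrow> real^'n \<Rightarrow> 'n phase \<Rightarrow> complex" where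
  "phase_space_beam k X \<rho> \<phi> a \<epsilon> t y Y = gaussian_beam k X \<rho> \<phi> a \<epsilon> t y (inv (X t) Y)"

definition beam_superposition ::
  "real \<Rightarrow> nat \<Rightarrow> (real \<Rightarrow> ('n::finite) phase \<Rightarrow> 'n phase) \<Rightarrow>
   (real^'n \<Rightarrow> complex) \<Rightarrow> (real^'n \<Rightarrow> real) \<Rightarrow> (real^'n \<Rightarrow> real) \<Rightarrow>
   (('n \<Rightarrow> nat) \<Rightarrow> real \<Rightarrow> 'n phase \<Rightarrow> complex) \<Rightarrow>
   (nat \<Rightarrow> ('n \<Rightarrow> nat) \<Rightarrow> real \<Rightarrow> 'n phase \<Rightarrow> complex) \<Rightarrow>
   real \<Rightarrow> real \<Rightarrow> real^'n \<Rightarrow> complex" where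
  "beam_superposition z k X A S \<rho> \<phi> a \<epsilon> t y =
     of_real z * level_set_integral X A S t (phase_space_beam k X \<rho> \<phi> a \<epsilon> t y)"

end

theory Submission
  imports Defs "HOL-Probability.Probability"
begin

text \<open>Every coefficient of a beam solves an ODE along its trajectory whose right-hand side depends
  smoothly on the starting point, hence all coefficients are continuous, and therefore bounded,
  on the compact set of times and starting points. The Riccati equation keeps the imaginary part
  of the Hessian of the phase positive definite, so that
  \<open>Im \<Phi>\<^sub>k \<ge> c |y - x|\<^sup>2\<close> with a uniform \<open>c\<close>. The residual of a single beam in the
  Schroedinger equation is \<open>O(\<epsilon>\<^bsup>k/2+1\<^esup>)\<close> times a Gaussian of width \<open>\<surd>\<epsilon>\<close>, because the eikonal
  and transport equations hold to high order at the centre. At time 0 the superposition of the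
  beams is a Gaussian average of the WKB datum up to \<open>O(\<epsilon>\<^bsup>k/2\<^esup>)\<close>; no boundary term arises since
  a test function vanishes to infinite order at the boundary of its support. The energy
  estimate for the Schroedinger equation carries both errors to time \<open>t\<close>.\<close>

section \<open>Partial derivatives\<close>

text \<open>The coefficients are given only as functions of the starting point, with no regularity
  in it assumed; even the integrability of the superposition has to come out of the equations. The
  solution \<open>\<psi>\<close> is controlled only locally in space, apart from its conserved L2
  norm, so the energy argument differentiates only expressions that contain the compactly supported
  superposition as a factor. The exponent is the result of several counts. The residual of order k/2
  + 1 loses one power of \<epsilon> in the energy estimate; the normalization, the reciprocal of a
  Gaussian integral, costs n/2; the L2 norm of a Gaussian of width \<open>sqrt \<epsilon>\<close>
  gives back n/4. The beams are added up by Cauchy-Schwarz, with no use of cancellation between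
  them, so that n/4 is lost altogether. The initial error is bounded pointwise and loses
  nothing.\<close>

lemma has_derivative_along_axis:
  fixes f :: "real^'n::finite \<Rightarrow> 'b::real_normed_vector"
  assumes "(f has_derivative f') (at (x + s *\<^sub>R axis i 1))"
  shows "((\<lambda>h. f (x + h *\<^sub>R axis i 1)) has_vector_derivative f' (axis i 1)) (at s)"
proof -
  have 1: "((\<lambda>h. x + h *\<^sub>R axis i (1::real)) has_derivative (\<lambda>h. h *\<^sub>R axis i 1)) (at s)"
    by (auto intro!: derivative_eq_intros)
  have "((\<lambda>h. f (x + h *\<^sub>R axis i 1)) has_derivative (\<lambda>h. f' (h *\<^sub>R axis i 1))) (at s)"
    using has_derivative_compose[OF 1, of f f'] assms by simp
  moreover have "f' (h *\<^sub>R axis i 1) = h *\<^sub>R f' (axis i 1)" for h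
    using assms has_derivative_linear linear_scale by blast
  ultimately show ?thesis by (simp add: has_vector_derivative_def)
qed

lemma partial_eqI:
  fixes f :: "real^'n::finite \<Rightarrow> 'b::real_normed_vector"
  assumes "(f has_derivative f') (at x)"
  shows "partial i f x = f' (axis i 1)"
  unfolding partial_def
  by (rule vector_derivative_at) (use has_derivative_along_axis[of f f' x 0 i] assms in simp)

lemma differentiable_imp_partial:
  fixes f :: "real^'n::finite \<Rightarrow> 'b::real_normed_vector"
  assumes "f differentiable (at (x + s *\<^sub>R axis i 1))"
  shows "((\<lambda>h. f (x + h *\<^sub>R axis i 1)) has_vector_derivative partial i f (x + s *\<^sub>R axis i 1)) (at s)"
  using assms has_derivative_along_axis partial_eqI unfolding differentiable_def by metis

lemma has_derivative_partials:
  fixes f :: "real^'n::finite \<Rightarrow> 'b::real_normed_vector"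
  assumes "f differentiable (at x)"
  shows "(f has_derivative (\<lambda>h. \<Sum>i\<in>UNIV. h $ i *\<^sub>R partial i f x)) (at x)"
proof -
  obtain f' where f': "(f has_derivative f') (at x)" using assms differentiable_def by blast
  then have lin: "linear f'" by (rule has_derivative_linear)
  have "f' h = (\<Sum>i\<in>UNIV. h $ i *\<^sub>R partial i f x)" for h
  proof -
    have "h = (\<Sum>i\<in>UNIV. h $ i *\<^sub>R axis i 1)"
      using basis_expansion[of h] by (simp add: scalar_mult_eq_scaleR)
    then have "f' h = f' (\<Sum>i\<in>UNIV. h $ i *\<^sub>R axis i 1)" by simp
    also have "\<dots> = (\<Sum>i\<in>UNIV. h $ i *\<^sub>R f' (axis i 1))"
      by (simp add: linear_sum[OF lin] linear_scale[OF lin])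
    finally show ?thesis using partial_eqI[OF f'] by simp
  qed
  then have "f' = (\<lambda>h. \<Sum>i\<in>UNIV. h $ i *\<^sub>R partial i f x)" by blast
  then show ?thesis using f' by simp
qed

lemma partial_const [simp]: "partial i (\<lambda>y. c) = (\<lambda>y. 0)"
  by (rule ext, subst partial_eqI[OF has_derivative_const]) simp

lemma partial_add:
  assumes "f differentiable (at x)" "g differentiable (at x)"
  shows "partial i (\<lambda>y. f y + g y) x = partial i f x + partial i g x"
proof -
  obtain f' g' where d: "(f has_derivative f') (at x)" "(g has_derivative g') (at x)"
    using assms differentiable_def by blast
  show ?thesis
    using partial_eqI[OF has_derivative_add[OF d]] partial_eqI[OF d(1)] partial_eqI[OF d(2)] by simp
qed

lemma partial_mult:
  fixes f g :: "real^'n::finite \<Rightarrow> 'b::real_normed_algebra"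
  assumes "f differentiable (at x)" "g differentiable (at x)"
  shows "partial i (\<lambda>y. f y * g y) x = f x * partial i g x + partial i f x * g x"
proof -
  obtain f' g' where d: "(f has_derivative f') (at x)" "(g has_derivative g') (at x)"
    using assms differentiable_def by blast
  show ?thesis
    using partial_eqI[OF has_derivative_mult[OF d]] partial_eqI[OF d(1)] partial_eqI[OF d(2)] by simp
qed

lemma partial_bounded_linear:
  assumes "bounded_linear L" "f differentiable (at x)"
  shows "partial i (\<lambda>y. L (f y)) x = L (partial i f x)"
proof -
  obtain f' where d: "(f has_derivative f') (at x)"
    using assms differentiable_def by blast
  show ?thesis
    using partial_eqI[OF bounded_linear.has_derivative[OF assms(1) d]] partial_eqI[OF d] by simp
qed

lemma partial_exp:
  fixes f :: "real^'n::finite \<Rightarrow> complex"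
  assumes "f differentiable (at x)"
  shows "partial i (\<lambda>y. exp (f y)) x = partial i f x * exp (f x)"
proof -
  obtain f' where f': "(f has_derivative f') (at x)" using assms differentiable_def by blast
  have "((\<lambda>y. exp (f y)) has_derivative (\<lambda>h. exp (f x) * f' h)) (at x)"
    using has_derivative_compose[OF f' DERIV_exp[unfolded has_field_derivative_def]] by simp
  from partial_eqI[OF this] partial_eqI[OF f'] show ?thesis by simp
qed

lemma partial_translate: "partial i (\<lambda>y. g (y - c)) x = partial i g (x - c)"
  by (simp add: partial_def algebra_simps)

lemma partial_cong_open:
  assumes "open U" "x \<in> U" "\<And>y. y \<in> U \<Longrightarrow> f y = g y"
  shows "partial i f x = partial i g x"
proof -
  have "((\<lambda>h. x + h *\<^sub>R axis i (1::real)) \<longlongrightarrow> x) (at 0)"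
    by (auto intro!: tendsto_eq_intros)
  from topological_tendstoD[OF this assms(1,2)]
  have "eventually (\<lambda>h. x + h *\<^sub>R axis i 1 \<in> U) (at 0)" .
  then have "eventually (\<lambda>h. f (x + h *\<^sub>R axis i 1) = g (x + h *\<^sub>R axis i 1)) (nhds 0)"
    using assms by (auto simp: eventually_at_filter elim!: eventually_mono)
  then show ?thesis
    unfolding partial_def by (intro vector_derivative_cong_eq) (auto elim: eventually_mono)
qed

section \<open>Smooth families\<close>

text \<open>Continuity in the parameter of all derivatives is what makes the Taylor estimates below
  uniform over compact parameter sets.\<close>

primrec sfamn :: "nat \<Rightarrow> 'p::topological_space set \<Rightarrow> ('p \<Rightarrow> real^'n::finite \<Rightarrow> 'b::real_normed_vector) \<Rightarrow> bool" where
  "sfamn 0 P f \<longleftrightarrow> (\<forall>p\<in>P. \<forall>x. f p differentiable (at x)) \<and> continuous_on (P \<times> UNIV) (\<lambda>z. f (fst z) (snd z))"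
| "sfamn (Suc m) P f \<longleftrightarrow> (\<forall>p\<in>P. \<forall>x. f p differentiable (at x)) \<and> continuous_on (P \<times> UNIV) (\<lambda>z. f (fst z) (snd z))
     \<and> (\<forall>i. sfamn m P (\<lambda>p. partial i (f p)))"

definition sfam :: "'p::topological_space set \<Rightarrow> ('p \<Rightarrow> real^'n::finite \<Rightarrow> 'b::real_normed_vector) \<Rightarrow> bool" where
  "sfam P f \<longleftrightarrow> (\<forall>m. sfamn m P f)"

lemma sfamn_base: "sfamn m P f \<Longrightarrow> sfamn 0 P f"
  by (cases m) auto

lemma sfamnD: "sfamn m P f \<Longrightarrow> p \<in> P \<Longrightarrow> f p differentiable (at x)"
  using sfamn_base[of m P f] by simp

lemma sfamn_cong: "(\<And>p. p \<in> P \<Longrightarrow> f p = g p) \<Longrightarrow> sfamn m P f \<longleftrightarrow> sfamn m P g"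
proof (induction m arbitrary: f g)
  case 0
  have "continuous_on (P \<times> UNIV) (\<lambda>z. f (fst z) (snd z)) \<longleftrightarrow> continuous_on (P \<times> UNIV) (\<lambda>z. g (fst z) (snd z))"
    by (rule continuous_on_cong) (use 0 in auto)
  then show ?case using 0 by auto
next
  case (Suc m)
  have "continuous_on (P \<times> UNIV) (\<lambda>z. f (fst z) (snd z)) \<longleftrightarrow> continuous_on (P \<times> UNIV) (\<lambda>z. g (fst z) (snd z))"
    by (rule continuous_on_cong) (use Suc in auto)
  moreover have "sfamn m P (\<lambda>p. partial i (f p)) \<longleftrightarrow> sfamn m P (\<lambda>p. partial i (g p))" for i
    by (rule Suc.IH) (use Suc.prems in auto)
  ultimately show ?case using Suc.prems by auto
qed

lemma sfam_cong: "(\<And>p. p \<in> P \<Longrightarrow> f p = g p) \<Longrightarrow> sfam P f \<longleftrightarrow> sfam P g"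
  unfolding sfam_def using sfamn_cong by blast

lemma sfam_differentiable: "sfam P f \<Longrightarrow> p \<in> P \<Longrightarrow> f p differentiable (at x)"
  unfolding sfam_def using sfamnD by blast

lemma sfam_continuous: "sfam P f \<Longrightarrow> continuous_on (P \<times> UNIV) (\<lambda>z. f (fst z) (snd z))"
  unfolding sfam_def using sfamn.simps(1) by blast

lemma sfam_continuous_comp:
  assumes "sfam P f" "continuous_on S g" "continuous_on S h" "g ` S \<subseteq> P"
  shows "continuous_on S (\<lambda>s. f (g s) (h s))"
proof -
  have "continuous_on S (\<lambda>s. (g s, h s))" by (intro continuous_intros assms)
  from continuous_on_compose2[OF sfam_continuous[OF assms(1)] this] assms(4)
  show ?thesis by auto
qed

lemma sfam_subset: "sfam P f \<Longrightarrow> Q \<subseteq> P \<Longrightarrow> sfam Q f"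
proof -
  have "sfamn m P f \<Longrightarrow> Q \<subseteq> P \<Longrightarrow> sfamn m Q f" for m
  proof (induction m arbitrary: f)
    case 0
    then show ?case by (auto intro: continuous_on_subset)
  next
    case (Suc m)
    then show ?case by (auto elim!: continuous_on_subset)
  qed
  then show "sfam P f \<Longrightarrow> Q \<subseteq> P \<Longrightarrow> sfam Q f" unfolding sfam_def by blast
qed

named_theorems sfam_intros

lemma sfam_partial [sfam_intros]: "sfam P f \<Longrightarrow> sfam P (\<lambda>p. partial i (f p))"
  unfolding sfam_def using sfamn.simps(2) by blast

lemma sfam_foldr_partial: "sfam P f \<Longrightarrow> sfam P (\<lambda>p. foldr partial is (f p))"
  by (induction "is") (auto intro: sfam_intros)

lemma sfamn_const: "continuous_on P c \<Longrightarrow> sfamn m P (\<lambda>p y. c p)"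
proof (induction m arbitrary: c)
  case 0
  then show ?case by (auto intro!: continuous_intros continuous_on_compose2[of P c])
next
  case (Suc m)
  have "sfamn 0 P (\<lambda>p y. c p)" using Suc.prems
    by (auto intro!: continuous_intros continuous_on_compose2[of P c])
  then show ?case using Suc.IH[of "\<lambda>_. 0"] by simp
qed

lemma sfam_const [sfam_intros]: "continuous_on P c \<Longrightarrow> sfam P (\<lambda>p y. c p)"
  unfolding sfam_def using sfamn_const by blast

lemma sfamn_add: "sfamn m P f \<Longrightarrow> sfamn m P g \<Longrightarrow> sfamn m P (\<lambda>p y. f p y + g p y)"
proof (induction m arbitrary: f g)
  case 0
  then show ?case by (auto intro!: continuous_intros differentiable_add)
next
  case (Suc m)
  have "sfamn m P (\<lambda>p. partial i (\<lambda>y. f p y + g p y))" for i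
  proof (subst sfamn_cong)
    show "sfamn m P (\<lambda>p y. partial i (f p) y + partial i (g p) y)"
      by (rule Suc.IH) (use Suc.prems in auto)
  qed (use Suc.prems in \<open>auto simp: partial_add\<close>)
  with Suc.prems show ?case by (auto intro!: continuous_intros differentiable_add)
qed

lemma sfam_add [sfam_intros]: "sfam P f \<Longrightarrow> sfam P g \<Longrightarrow> sfam P (\<lambda>p y. f p y + g p y)"
  unfolding sfam_def using sfamn_add by blast

lemma sfamn_mult:
  fixes f g :: "'p::topological_space \<Rightarrow> real^'n::finite \<Rightarrow> 'b::real_normed_algebra"
  shows "sfamn m P f \<Longrightarrow> sfamn m P g \<Longrightarrow> sfamn m P (\<lambda>p y. f p y * g p y)"
proof (induction m arbitrary: f g)
  case 0
  then show ?case by (auto intro!: continuous_intros differentiable_mult)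
next
  case (Suc m)
  \<comment> \<open>The product rule pairs an undifferentiated factor with a differentiated one, so
    the hypotheses of order \<open>Suc m\<close> have to be lowered to order m.\<close>
  have low: "sfamn (Suc m) P h \<Longrightarrow> sfamn m P h" for h :: "'p \<Rightarrow> real^'n \<Rightarrow> 'b"
  proof (induction m arbitrary: h)
    case (Suc m)
    then have "sfamn m P (\<lambda>p. partial i (h p))" for i by simp
    then show ?case using Suc.prems by simp
  qed simp
  have "sfamn m P (\<lambda>p. partial i (\<lambda>y. f p y * g p y))" for i
  proof (subst sfamn_cong)
    show "sfamn m P (\<lambda>p y. f p y * partial i (g p) y + partial i (f p) y * g p y)"
      using Suc.prems low by (intro sfamn_add Suc.IH) auto
  qed (use Suc.prems in \<open>auto simp: partial_mult\<close>)
  with Suc.prems show ?case by (auto intro!: continuous_intros differentiable_mult)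
qed

lemma sfam_mult [sfam_intros]:
  fixes f g :: "'p::topological_space \<Rightarrow> real^'n::finite \<Rightarrow> 'b::real_normed_algebra"
  shows "sfam P f \<Longrightarrow> sfam P g \<Longrightarrow> sfam P (\<lambda>p y. f p y * g p y)"
  unfolding sfam_def using sfamn_mult by blast

lemma sfamn_bounded_linear:
  assumes "bounded_linear L"
  shows "sfamn m P f \<Longrightarrow> sfamn m P (\<lambda>p y. L (f p y))"
proof -
  have dL: "f differentiable at x \<Longrightarrow> (\<lambda>y. L (f y)) differentiable at x" for f :: "real^'n::finite \<Rightarrow> 'a" and x
    unfolding differentiable_def using bounded_linear.has_derivative[OF assms] by blast
  show "sfamn m P f \<Longrightarrow> sfamn m P (\<lambda>p y. L (f p y))"
  proof (induction m arbitrary: f)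
    case 0
    then show ?case
      by (auto intro!: bounded_linear.continuous_on[OF assms] dL)
  next
    case (Suc m)
    have "sfamn m P (\<lambda>p. partial i (\<lambda>y. L (f p y)))" for i
    proof (subst sfamn_cong)
      show "sfamn m P (\<lambda>p y. L (partial i (f p) y))"
        by (rule Suc.IH) (use Suc.prems in auto)
    qed (use Suc.prems in \<open>auto simp: partial_bounded_linear[OF assms]\<close>)
    with Suc.prems show ?case
      by (auto intro!: bounded_linear.continuous_on[OF assms] dL)
  qed
qed

lemma sfam_bounded_linear: "bounded_linear L \<Longrightarrow> sfam P f \<Longrightarrow> sfam P (\<lambda>p y. L (f p y))"
  unfolding sfam_def using sfamn_bounded_linear by blast

lemma sfam_of_real [sfam_intros]:
  fixes f :: "'p::topological_space \<Rightarrow> real^'n::finite \<Rightarrow> real"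
  shows "sfam P f \<Longrightarrow> sfam P (\<lambda>p y. complex_of_real (f p y))"
  by (rule sfam_bounded_linear[OF bounded_linear_of_real])

lemma sfam_minus [sfam_intros]: "sfam P f \<Longrightarrow> sfam P (\<lambda>p y. - f p y)"
  by (rule sfam_bounded_linear[OF bounded_linear_minus[OF bounded_linear_ident]])

lemma sfam_diff [sfam_intros]: "sfam P f \<Longrightarrow> sfam P g \<Longrightarrow> sfam P (\<lambda>p y. f p y - g p y)"
  using sfam_add[of P f "\<lambda>p y. - g p y"] sfam_minus by auto

lemma sfam_sum [sfam_intros]:
  "(\<And>j. j \<in> J \<Longrightarrow> sfam P (f j)) \<Longrightarrow> sfam P (\<lambda>p y. \<Sum>j\<in>J. f j p y)"
proof (induction J rule: infinite_finite_induct)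
  case (insert x F)
  then show ?case by (auto intro!: sfam_add)
qed (auto intro!: sfam_const continuous_intros)

lemma sfam_prod [sfam_intros]:
  fixes f :: "'j \<Rightarrow> 'p::topological_space \<Rightarrow> real^'n::finite \<Rightarrow> 'b::{real_normed_algebra_1,comm_ring_1}"
  shows "(\<And>j. j \<in> J \<Longrightarrow> sfam P (f j)) \<Longrightarrow> sfam P (\<lambda>p y. \<Prod>j\<in>J. f j p y)"
proof (induction J rule: infinite_finite_induct)
  case (insert x F)
  then show ?case by (auto intro!: sfam_mult)
qed (auto intro!: sfam_const continuous_intros)

lemma sfam_power [sfam_intros]:
  fixes f :: "'p::topological_space \<Rightarrow> real^'n::finite \<Rightarrow> 'b::{real_normed_algebra_1,comm_ring_1}"
  shows "sfam P f \<Longrightarrow> sfam P (\<lambda>p y. f p y ^ m)"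
  by (induction m) (auto intro!: sfam_mult sfam_const continuous_intros)

lemma sfam_laplacian [sfam_intros]: "sfam P f \<Longrightarrow> sfam P (\<lambda>p y. laplacian (f p) y)"
  unfolding laplacian_def by (intro sfam_intros)

text \<open>The exponential reappears in its own derivative, so the induction on the order keeps f
  fixed. Taking f smooth to all orders makes its partial derivatives available at every
  order.\<close>

lemma sfamn_exp:
  fixes f :: "'p::topological_space \<Rightarrow> real^'n::finite \<Rightarrow> complex"
  assumes "sfam P f"
  shows "sfamn m P (\<lambda>p y. exp (f p y))"
proof -
  have dL: "(\<lambda>y. exp (f p y)) differentiable at x" if p: "p \<in> P" for p x
  proof -
    obtain f' where f': "(f p has_derivative f') (at x)"
      using sfam_differentiable[OF assms p] differentiable_def by blast
    show ?thesis
      using has_derivative_compose[OF f' DERIV_exp[unfolded has_field_derivative_def]]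
      unfolding differentiable_def by blast
  qed
  have c: "continuous_on (P \<times> UNIV) (\<lambda>z. exp (f (fst z) (snd z)))"
    by (intro continuous_intros sfam_continuous assms)
  show ?thesis
  proof (induction m)
    case 0
    then show ?case using dL c by simp
  next
    case (Suc m)
    have "sfamn m P (\<lambda>p. partial i (\<lambda>y. exp (f p y)))" for i
    proof (subst sfamn_cong)
      show "sfamn m P (\<lambda>p y. partial i (f p) y * exp (f p y))"
        using sfam_partial[OF assms] Suc by (intro sfamn_mult) (auto simp: sfam_def)
    qed (use sfam_differentiable[OF assms] in \<open>auto simp: partial_exp\<close>)
    then show ?case using dL c by simp
  qed
qed

lemma sfam_exp [sfam_intros]:
  fixes f :: "'p::topological_space \<Rightarrow> real^'n::finite \<Rightarrow> complex"
  shows "sfam P f \<Longrightarrow> sfam P (\<lambda>p y. exp (f p y))"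
  unfolding sfam_def[of P "\<lambda>p y. exp (f p y)"] using sfamn_exp by blast

section \<open>Smooth functions, translates and polynomials as families\<close>

lemma smooth_partial: "smooth f \<Longrightarrow> smooth (partial i f)"
  unfolding smooth_def
proof (intro allI)
  fix "is" x assume "\<forall>is x. foldr partial is f differentiable at x"
  then have "foldr partial (is @ [i]) f differentiable at x" by blast
  then show "foldr partial is (partial i f) differentiable at x" by simp
qed

lemma smooth_differentiable: "smooth f \<Longrightarrow> f differentiable (at x)"
  unfolding smooth_def by (metis foldr.simps(1) id_apply)

lemma smooth_continuous: "smooth f \<Longrightarrow> continuous_on S f"
  by (meson smooth_differentiable continuous_at_imp_continuous_on differentiable_imp_continuous_within)

text \<open>Derivatives in y of a translate are translates of derivatives, so continuity of the
  centre \<open>\<xi>\<close> in the parameter suffices for all orders.\<close>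

lemma sfamn_translate:
  assumes "continuous_on P \<xi>"
  shows "smooth g \<Longrightarrow> sfamn m P (\<lambda>p y. g (y - \<xi> p))"
proof (induction m arbitrary: g)
  case 0
  have "(\<lambda>y. g (y - c)) differentiable at x" for c x
  proof -
    obtain g' where "(g has_derivative g') (at (x - c))"
      using smooth_differentiable[OF 0] differentiable_def by blast
    moreover have "((\<lambda>y. y - c) has_derivative (\<lambda>h. h)) (at x)" by (auto intro!: derivative_eq_intros)
    ultimately show ?thesis unfolding differentiable_def
      using has_derivative_compose by blast
  qed
  moreover have "continuous_on (P \<times> UNIV) (\<lambda>z. g (snd z - \<xi> (fst z)))"
    by (rule continuous_on_compose2[OF smooth_continuous[OF 0, of UNIV]])
      (auto intro!: continuous_intros continuous_on_compose2[OF assms])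
  ultimately show ?case by simp
next
  case (Suc m)
  have "(\<lambda>y. g (y - c)) differentiable at x" for c x
  proof -
    obtain g' where "(g has_derivative g') (at (x - c))"
      using smooth_differentiable[OF Suc.prems] differentiable_def by blast
    moreover have "((\<lambda>y. y - c) has_derivative (\<lambda>h. h)) (at x)" by (auto intro!: derivative_eq_intros)
    ultimately show ?thesis unfolding differentiable_def
      using has_derivative_compose by blast
  qed
  moreover have "continuous_on (P \<times> UNIV) (\<lambda>z. g (snd z - \<xi> (fst z)))"
    by (rule continuous_on_compose2[OF smooth_continuous[OF Suc.prems, of UNIV]])
      (auto intro!: continuous_intros continuous_on_compose2[OF assms])
  moreover have "sfamn m P (\<lambda>p. partial i (\<lambda>y. g (y - \<xi> p)))" for i
  proof -
    have "sfamn m P (\<lambda>p y. partial i g (y - \<xi> p))"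
      by (rule Suc.IH[OF smooth_partial[OF Suc.prems]])
    then show ?thesis by (simp add: partial_translate[abs_def])
  qed
  ultimately show ?case by simp
qed

lemma sfam_translate [sfam_intros]: "smooth g \<Longrightarrow> continuous_on P \<xi> \<Longrightarrow> sfam P (\<lambda>p y. g (y - \<xi> p))"
  unfolding sfam_def using sfamn_translate by blast

lemma sfam_smooth [sfam_intros]: "smooth g \<Longrightarrow> sfam P (\<lambda>p y. g y)"
  using sfam_translate[of g P "\<lambda>_. 0"] by simp

lemma sfam_imp_smooth: "sfam P f \<Longrightarrow> p \<in> P \<Longrightarrow> smooth (f p)"
  unfolding smooth_def using sfam_foldr_partial sfam_differentiable by blast

text \<open>A one-point parameter set turns the closure rules for families into closure rules for
  single functions.\<close>

lemma smooth_iff_sfam: "smooth f \<longleftrightarrow> sfam {0::real} (\<lambda>_. f)"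
  using sfam_smooth[of f "{0::real}"] sfam_imp_smooth[of "{0::real}" "\<lambda>_. f"] by auto

lemma sfam_coordinate:
  fixes \<xi> :: "'p::topological_space \<Rightarrow> real^'n::finite"
  assumes "continuous_on P \<xi>"
  shows "sfam P (\<lambda>p y. (y - \<xi> p) $ i)"
proof -
  have d: "((\<lambda>y. (y - c) $ i) has_derivative (\<lambda>h. h $ i)) (at x)" for c x :: "real^'n"
    by (intro bounded_linear.has_derivative[OF bounded_linear_vec_nth]) (auto intro!: derivative_eq_intros)
  have p: "partial j (\<lambda>y. (y - c) $ i) = (\<lambda>y. axis j 1 $ i)" for j and c :: "real^'n"
    using partial_eqI[OF d] by blast
  have c: "continuous_on (P \<times> UNIV) (\<lambda>z. (snd z - \<xi> (fst z)) $ i)"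
    by (auto intro!: continuous_intros continuous_on_compose2[OF assms])
  have dd: "(\<lambda>y. (y - c) $ i) differentiable at x" for c x :: "real^'n"
    using d differentiable_def by blast
  have "sfamn m P (\<lambda>p y. (y - \<xi> p) $ i)" for m
  proof (cases m)
    case 0
    then show ?thesis using dd c by (simp only: sfamn.simps) blast
  next
    case (Suc m')
    have "sfamn m' P (\<lambda>p. partial j (\<lambda>y. (y - \<xi> p) $ i))" for j
      unfolding p by (rule sfamn_const) (rule continuous_on_const)
    then show ?thesis using dd c Suc by (simp only: sfamn.simps) blast
  qed
  then show ?thesis by (simp add: sfam_def)
qed

lemma sfam_mi_power: "continuous_on P \<xi> \<Longrightarrow> sfam P (\<lambda>p y. mi_power (y - \<xi> p) \<alpha>)"
  unfolding mi_power_def by (intro sfam_intros sfam_coordinate)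

lemma sfam_taylor_poly [sfam_intros]:
  assumes "continuous_on P \<xi>" "\<And>\<alpha>. mi_size \<alpha> \<le> m \<Longrightarrow> continuous_on P (\<lambda>p. c p \<alpha>)"
  shows "sfam P (\<lambda>p y. taylor_poly m (c p) (\<xi> p) y)"
  unfolding taylor_poly_def divide_inverse
  by (intro sfam_intros continuous_intros assms sfam_mi_power) auto

section \<open>Symmetry of derivatives and Taylor polynomials\<close>

lemma vector_derivative_bound:
  fixes q :: "real \<Rightarrow> 'b::real_normed_vector"
  assumes "a \<le> b" "\<And>r. r \<in> {a..b} \<Longrightarrow> (q has_vector_derivative q' r) (at r within {a..b})"
    and "\<And>r. r \<in> {a..b} \<Longrightarrow> norm (q' r) \<le> B"
  shows "norm (q b - q a) \<le> B * (b - a)"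
proof -
  have "norm (q b - q a) \<le> B * norm (b - a)"
  proof (rule differentiable_bound[of "{a..b}" q "\<lambda>r u. u *\<^sub>R q' r"])
    show "onorm (\<lambda>u. u *\<^sub>R q' r) \<le> B" if "r \<in> {a..b}" for r
    proof (rule onorm_le)
      fix u :: real
      show "norm (u *\<^sub>R q' r) \<le> B * norm u"
        using mult_left_mono[OF assms(3)[OF that], of "\<bar>u\<bar>"] by (simp add: mult.commute)
    qed
  qed (use assms in \<open>auto simp: has_vector_derivative_def\<close>)
  then show ?thesis using assms(1) by simp
qed

text \<open>The mean value inequality is applied twice: along j to the partial derivative in
  direction i, then along i to the difference of two parallel translates of f. Subtracting the
  multiple of the value c at x leaves only the oscillation of the mixed derivative, which is small
  by continuity.\<close>

lemma second_difference:
  fixes f :: "real^'n::finite \<Rightarrow> 'b::real_normed_vector"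
  assumes "smooth f" "\<eta> > 0"
  shows "\<exists>d>0. \<forall>h. 0 < h \<and> h < d \<longrightarrow>
    norm (f (x + h *\<^sub>R axis i 1 + h *\<^sub>R axis j 1) - f (x + h *\<^sub>R axis i 1)
      - f (x + h *\<^sub>R axis j 1) + f x - (h * h) *\<^sub>R partial j (partial i f) x) \<le> \<eta> * h * h"
proof -
  define c where "c = partial j (partial i f) x"
  have "isCont (partial j (partial i f)) x"
    by (meson assms(1) smooth_partial smooth_differentiable differentiable_imp_continuous_within)
  then obtain d where d: "d > 0" "\<And>y. dist y x < d \<Longrightarrow> dist (partial j (partial i f) y) c < \<eta>"
    unfolding continuous_at_eps_delta c_def using assms(2) by blast
  have ax: "norm (axis l (1::real) :: real^'n) = 1" for l by (simp add: norm_axis_1)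
  \<comment> \<open>With \<open>h < d/2\<close> every point of the square spanned by the two steps
    stays within distance d of x.\<close>
  have "norm (f (x + h *\<^sub>R axis i 1 + h *\<^sub>R axis j 1) - f (x + h *\<^sub>R axis i 1)
      - f (x + h *\<^sub>R axis j 1) + f x - (h * h) *\<^sub>R c) \<le> \<eta> * h * h" if h: "0 < h" "h < d/2" for h
  proof -
    have inner: "norm (partial i f (x + s *\<^sub>R axis i 1 + h *\<^sub>R axis j 1) - partial i f (x + s *\<^sub>R axis i 1) - h *\<^sub>R c) \<le> \<eta> * h"
      if s: "s \<in> {0..h}" for s
    proof -
      define q where "q r = partial i f (x + s *\<^sub>R axis i 1 + r *\<^sub>R axis j 1) - r *\<^sub>R c" for r
      have "norm (q h - q 0) \<le> \<eta> * (h - 0)"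
      proof (rule vector_derivative_bound)
        fix r assume r: "r \<in> {0..h}"
        let ?y = "x + s *\<^sub>R axis i 1 + r *\<^sub>R axis j 1"
        have "((\<lambda>r. partial i f (x + s *\<^sub>R axis i 1 + r *\<^sub>R axis j 1)) has_vector_derivative partial j (partial i f) ?y) (at r)"
          by (intro differentiable_imp_partial smooth_differentiable smooth_partial assms)
        then show "(q has_vector_derivative (partial j (partial i f) ?y - c)) (at r within {0..h})"
          unfolding q_def by (auto intro!: derivative_eq_intros intro: has_vector_derivative_at_within)
        have "norm (s *\<^sub>R axis i 1 + r *\<^sub>R axis j 1 :: real^'n) \<le> s + r"
          using s r by (intro order.trans[OF norm_triangle_ineq]) (auto simp: ax)
        then have "dist ?y x < d" using s r h by (auto simp: dist_norm algebra_simps)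
        from d(2)[OF this] show "norm (partial j (partial i f) ?y - c) \<le> \<eta>" by (simp add: dist_norm)
      qed (use h in auto)
      then show ?thesis by (simp add: q_def algebra_simps)
    qed
    define G where "G s = f (x + h *\<^sub>R axis j 1 + s *\<^sub>R axis i 1) - f (x + s *\<^sub>R axis i 1) - s *\<^sub>R (h *\<^sub>R c)" for s
    have "norm (G h - G 0) \<le> (\<eta> * h) * (h - 0)"
    proof (rule vector_derivative_bound)
      fix s assume s: "s \<in> {0..h}"
      have "((\<lambda>s. f (x + h *\<^sub>R axis j 1 + s *\<^sub>R axis i 1)) has_vector_derivative
          partial i f (x + h *\<^sub>R axis j 1 + s *\<^sub>R axis i 1)) (at s)"
        "((\<lambda>s. f (x + s *\<^sub>R axis i 1)) has_vector_derivative partial i f (x + s *\<^sub>R axis i 1)) (at s)"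
        by (intro differentiable_imp_partial smooth_differentiable smooth_partial assms)+
      then show "(G has_vector_derivative (partial i f (x + h *\<^sub>R axis j 1 + s *\<^sub>R axis i 1)
          - partial i f (x + s *\<^sub>R axis i 1) - h *\<^sub>R c)) (at s within {0..h})"
        unfolding G_def by (auto intro!: derivative_eq_intros intro: has_vector_derivative_at_within)
      show "norm (partial i f (x + h *\<^sub>R axis j 1 + s *\<^sub>R axis i 1)
          - partial i f (x + s *\<^sub>R axis i 1) - h *\<^sub>R c) \<le> \<eta> * h"
        using inner[OF s] by (simp add: algebra_simps)
    qed (use h in auto)
    then show ?thesis by (simp add: G_def algebra_simps)
  qed
  then show ?thesis using d(1) unfolding c_def by (intro exI[of _ "d/2"]) auto
qed

text \<open>The second difference is symmetric in the two directions, so both mixed derivatives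
  approximate the same quantity up to an arbitrarily small multiple of the squared step.\<close>

lemma partial_commute:
  fixes f :: "real^'n::finite \<Rightarrow> 'b::real_normed_vector"
  assumes "smooth f"
  shows "partial i (partial j f) = partial j (partial i f)"
proof
  fix x
  have "norm (partial i (partial j f) x - partial j (partial i f) x) \<le> e" if "e > 0" for e
  proof -
    have e: "e/2 > 0" using that by simp
    obtain d1 where d1: "d1 > 0" "\<And>h. 0 < h \<Longrightarrow> h < d1 \<Longrightarrow>
      norm (f (x + h *\<^sub>R axis i 1 + h *\<^sub>R axis j 1) - f (x + h *\<^sub>R axis i 1)
      - f (x + h *\<^sub>R axis j 1) + f x - (h * h) *\<^sub>R partial j (partial i f) x) \<le> (e/2) * h * h"
      using second_difference[OF assms e, of x i j] by blast
    obtain d2 where d2: "d2 > 0" "\<And>h. 0 < h \<Longrightarrow> h < d2 \<Longrightarrow>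
      norm (f (x + h *\<^sub>R axis j 1 + h *\<^sub>R axis i 1) - f (x + h *\<^sub>R axis j 1)
      - f (x + h *\<^sub>R axis i 1) + f x - (h * h) *\<^sub>R partial i (partial j f) x) \<le> (e/2) * h * h"
      using second_difference[OF assms e, of x j i] by blast
    define h where "h = min d1 d2 / 2"
    have h: "0 < h" "h < d1" "h < d2" using d1(1) d2(1) by (auto simp: h_def)
    let ?D = "f (x + h *\<^sub>R axis i 1 + h *\<^sub>R axis j 1) - f (x + h *\<^sub>R axis i 1) - f (x + h *\<^sub>R axis j 1) + f x"
    have D: "?D = f (x + h *\<^sub>R axis j 1 + h *\<^sub>R axis i 1) - f (x + h *\<^sub>R axis j 1)
      - f (x + h *\<^sub>R axis i 1) + f x" by (simp add: algebra_simps)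
    have 1: "norm (?D - (h * h) *\<^sub>R partial j (partial i f) x) \<le> (e/2) * h * h" by (rule d1(2)[OF h(1,2)])
    have 2: "norm (?D - (h * h) *\<^sub>R partial i (partial j f) x) \<le> (e/2) * h * h"
      unfolding D by (rule d2(2)[OF h(1,3)])
    have "(h * h) * norm (partial i (partial j f) x - partial j (partial i f) x)
       = norm ((?D - (h * h) *\<^sub>R partial j (partial i f) x) - (?D - (h * h) *\<^sub>R partial i (partial j f) x))"
      using h(1) by (simp add: scaleR_diff_right[symmetric])
    also have "\<dots> \<le> (e/2) * h * h + (e/2) * h * h"
      by (rule order.trans[OF norm_triangle_ineq4]) (use 1 2 in linarith)
    also have "\<dots> = (h * h) * e" by (simp add: algebra_simps)
    finally show ?thesis using h(1) by simp
  qed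
  then have "norm (partial i (partial j f) x - partial j (partial i f) x) \<le> 0"
    by (rule field_le_epsilon) simp
  then show "partial i (partial j f) x = partial j (partial i f) x" by simp
qed

section \<open>Reordering of derivatives: words and multi-indices\<close>

lemma smooth_foldr_partial: "smooth f \<Longrightarrow> smooth (foldr partial is f)"
  by (induction "is") (auto intro: smooth_partial)

lemma partial_foldr_commute: "smooth f \<Longrightarrow> partial i (foldr partial is f) = foldr partial is (partial i f)"
proof (induction "is")
  case (Cons j "is")
  have "partial i (partial j (foldr partial is f)) = partial j (partial i (foldr partial is f))"
    by (rule partial_commute[OF smooth_foldr_partial[OF Cons.prems]])
  also have "\<dots> = partial j (foldr partial is (partial i f))" using Cons by simp
  finally show ?case by simp
qed simp

lemma foldr_partial_perm: "smooth f \<Longrightarrow> mset is = mset js \<Longrightarrow> foldr partial is f = foldr partial js f"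
proof (induction "is" arbitrary: js)
  case (Cons i "is")
  then have "i \<in> set js" using set_mset_mset by (metis list.set_intros(1))
  then obtain us vs where js: "js = us @ i # vs" by (meson split_list)
  then have m: "mset is = mset (us @ vs)" using Cons.prems by simp
  have "foldr partial js f = foldr partial us (partial i (foldr partial vs f))" by (simp add: js)
  also have "\<dots> = partial i (foldr partial us (foldr partial vs f))"
    using partial_foldr_commute[OF smooth_foldr_partial[OF Cons.prems(1)]] by simp
  also have "\<dots> = partial i (foldr partial is f)" using Cons.IH[OF Cons.prems(1) m] by simp
  finally show ?case by simp
qed simp

text \<open>A word of coordinates with the multiplicities of \<alpha>. Words suit induction and,
  through their multisets, the comparison of derivatives taken in different orders.\<close>

definition mi_list :: "('n::finite \<Rightarrow> nat) \<Rightarrow> 'n list" where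
  "mi_list \<alpha> = concat (map (\<lambda>i. replicate (\<alpha> i) i) coords)"

lemma mi_deriv_eq_foldr: "mi_deriv \<alpha> f = foldr partial (mi_list \<alpha>) f"
proof -
  have r: "foldr partial (replicate m i) g = (partial i ^^ m) g" for m i and g :: "real^'a \<Rightarrow> 'b"
    by (induction m) auto
  have "foldr (\<lambda>i. partial i ^^ \<alpha> i) is f = foldr partial (concat (map (\<lambda>i. replicate (\<alpha> i) i) is)) f" for "is"
    by (induction "is") (auto simp: r)
  then show ?thesis by (simp add: mi_deriv_def mi_list_def)
qed

lemma count_mi_list: "count (mset (mi_list \<alpha>)) i = \<alpha> i"
proof -
  have "count (mset (concat (map (\<lambda>i. replicate (\<alpha> i) i) is))) i = (if i \<in> set is then \<alpha> i else 0)"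
    if "distinct is" for "is"
    using that by (induction "is") auto
  from this[OF coords(1)] show ?thesis unfolding mi_list_def coords(2) by (simp only: UNIV_I if_True)
qed

lemma size_mi_list: "length (mi_list \<alpha>) = mi_size \<alpha>"
  by (simp add: mi_list_def length_concat mi_size_def comp_def sum_list_distinct_conv_sum_set coords)

text \<open>The Taylor bound below runs over words, the systems for the coefficients over
  multi-indices; this translates between them.\<close>

lemma foldr_partial_eq_mi_deriv:
  assumes "smooth f"
  shows "foldr partial is f = mi_deriv (count (mset is)) f"
  unfolding mi_deriv_eq_foldr
  by (rule foldr_partial_perm[OF assms]) (auto simp: multiset_eq_iff count_mi_list)

lemma mi_size_count: "mi_size (count (mset is)) = length is"
proof -
  have "mset (mi_list (count (mset is))) = mset is"
    by (auto simp: multiset_eq_iff count_mi_list)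
  then show ?thesis using size_mi_list size_mset by metis
qed

lemma smooth_mi_deriv: "smooth f \<Longrightarrow> smooth (mi_deriv \<alpha> f)"
  by (simp add: mi_deriv_eq_foldr smooth_foldr_partial)

lemma foldr_partial_sum:
  fixes f :: "'j \<Rightarrow> real^'n::finite \<Rightarrow> 'b::real_normed_algebra"
  assumes "finite J" "\<And>j. j \<in> J \<Longrightarrow> smooth (f j)"
  shows "foldr partial is (\<lambda>y. \<Sum>j\<in>J. c j * f j y) = (\<lambda>y. \<Sum>j\<in>J. c j * foldr partial is (f j) y)"
proof (induction "is")
  case (Cons i "is")
  have d: "foldr partial is (f j) differentiable (at y)" if "j \<in> J" for j y
    using smooth_differentiable[OF smooth_foldr_partial[OF assms(2)[OF that]]] .
  have "partial i (\<lambda>y. \<Sum>j\<in>K. c j * foldr partial is (f j) y) y = (\<Sum>j\<in>K. c j * partial i (foldr partial is (f j)) y)"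
    if "K \<subseteq> J" for K y
  proof -
    have "finite K" using that assms(1) finite_subset by blast
    then show ?thesis using that
    proof (induction K)
      case (insert j K)
      have "partial i (\<lambda>y. c j * foldr partial is (f j) y + (\<Sum>j\<in>K. c j * foldr partial is (f j) y)) y
        = partial i (\<lambda>y. c j * foldr partial is (f j) y) y + partial i (\<lambda>y. \<Sum>j\<in>K. c j * foldr partial is (f j) y) y"
        by (rule partial_add) (use insert d in \<open>auto intro!: differentiable_sum differentiable_mult\<close>)
      moreover have "partial i (\<lambda>y. c j * foldr partial is (f j) y) y = c j * partial i (foldr partial is (f j)) y"
        by (rule partial_bounded_linear[OF bounded_linear_mult_right]) (use insert d in auto)
      ultimately show ?case using insert by simp
    qed simp
  qed
  then show ?case using Cons by auto
qed simp

lemma mi_deriv_sum: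
  fixes f :: "'j \<Rightarrow> real^'n::finite \<Rightarrow> 'b::real_normed_algebra"
  assumes "finite J" "\<And>j. j \<in> J \<Longrightarrow> smooth (f j)"
  shows "mi_deriv \<alpha> (\<lambda>y. \<Sum>j\<in>J. c j * f j y) x = (\<Sum>j\<in>J. c j * mi_deriv \<alpha> (f j) x)"
  using foldr_partial_sum[OF assms] by (simp add: mi_deriv_eq_foldr)

lemma mi_deriv_lincomb2:
  fixes f g :: "real^'n::finite \<Rightarrow> 'b::real_normed_algebra"
  assumes "smooth f" "smooth g"
  shows "mi_deriv \<alpha> (\<lambda>y. c * f y + d * g y) x = c * mi_deriv \<alpha> f x + d * mi_deriv \<alpha> g x"
  using mi_deriv_sum[of "{True,False}" "\<lambda>b. if b then f else g" \<alpha> "\<lambda>b. if b then c else d" x] assms by simp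

lemma mi_deriv_add:
  fixes f g :: "real^'n::finite \<Rightarrow> 'b::real_normed_algebra_1"
  shows "smooth f \<Longrightarrow> smooth g \<Longrightarrow> mi_deriv \<alpha> (\<lambda>y. f y + g y) x = mi_deriv \<alpha> f x + mi_deriv \<alpha> g x"
  using mi_deriv_lincomb2[of f g \<alpha> 1 1 x] by simp

section \<open>Derivatives of monomials and of Taylor polynomials\<close>

lemma smooth_const: "smooth (\<lambda>y. c)"
  unfolding smooth_iff_sfam by (intro sfam_intros continuous_intros)

lemma smooth_monomial: "smooth (\<lambda>y. complex_of_real (mi_power (y - x) \<beta>))"
  unfolding smooth_iff_sfam by (intro sfam_of_real sfam_mi_power continuous_intros)

lemma smooth_taylor_poly: "smooth (taylor_poly m c x)"
  unfolding smooth_iff_sfam by (intro sfam_taylor_poly[of _ "\<lambda>_. x" m "\<lambda>_. c"] continuous_intros)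

lemma partial_monomial:
  "partial i (\<lambda>y. complex_of_real (mi_power (y - x) \<beta>))
    = (\<lambda>y. of_nat (\<beta> i) * of_real (mi_power (y - x) (\<beta>(i := \<beta> i - 1))))"
proof
  fix y :: "real^'a"
  define P where "P = (\<Prod>j\<in>UNIV - {i}. ((y - x) $ j) ^ \<beta> j)"
  have "mi_power (y + h *\<^sub>R axis i 1 - x) \<beta> = ((y - x) $ i + h) ^ \<beta> i * P" for h
    unfolding mi_power_def P_def
    by (subst prod.remove[of _ i]) (auto intro!: arg_cong2[where f="(*)"] prod.cong simp: axis_def algebra_simps)
  then have 1: "(\<lambda>h. complex_of_real (mi_power (y + h *\<^sub>R axis i 1 - x) \<beta>))
    = (\<lambda>h. of_real (((y - x) $ i + h) ^ \<beta> i * P))" by simp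
  have 2: "((\<lambda>h. complex_of_real (((y - x) $ i + h) ^ \<beta> i * P)) has_vector_derivative
    of_real (of_nat (\<beta> i) * ((y - x) $ i) ^ (\<beta> i - 1) * P)) (at 0)"
    by (intro has_vector_derivative_of_real)
      (auto intro!: derivative_eq_intros simp: has_real_derivative_iff_has_vector_derivative[symmetric])
  have 3: "mi_power (y - x) (\<beta>(i := \<beta> i - 1)) = ((y - x) $ i) ^ (\<beta> i - 1) * P"
    unfolding mi_power_def P_def
    by (subst prod.remove[of _ i]) (auto intro!: arg_cong2[where f="(*)"] prod.cong)
  show "partial i (\<lambda>y. complex_of_real (mi_power (y - x) \<beta>)) y
    = of_nat (\<beta> i) * of_real (mi_power (y - x) (\<beta>(i := \<beta> i - 1)))"
    unfolding partial_def 1 vector_derivative_at[OF 2] 3 by simp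
qed

lemma partial_cmult_monomial:
  "partial i (\<lambda>y. K * complex_of_real (mi_power (y - x) \<beta>))
    = (\<lambda>y. K * of_nat (\<beta> i) * of_real (mi_power (y - x) (\<beta>(i := \<beta> i - 1))))"
proof
  fix y
  show "partial i (\<lambda>y. K * complex_of_real (mi_power (y - x) \<beta>)) y
    = K * of_nat (\<beta> i) * of_real (mi_power (y - x) (\<beta>(i := \<beta> i - 1)))"
    by (subst partial_bounded_linear[OF bounded_linear_mult_right smooth_differentiable[OF smooth_monomial]])
      (simp add: partial_monomial)
qed

text \<open>Truncated subtraction is harmless for \<open>m > \<beta> i\<close>: the product then
  contains the factor with \<open>j = \<beta> i\<close>, which is zero.\<close>

lemma partial_pow_monomial:
  "(partial i ^^ m) (\<lambda>y. K * complex_of_real (mi_power (y - x) \<beta>))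
    = (\<lambda>y. K * (\<Prod>j<m. of_nat (\<beta> i - j)) * of_real (mi_power (y - x) (\<beta>(i := \<beta> i - m))))"
proof (induction m)
  case (Suc m)
  show ?case unfolding funpow.simps o_def Suc partial_cmult_monomial by (simp add: mult_ac fun_upd_def cong: if_cong)
qed simp

lemma foldr_partial_monomial:
  "distinct is \<Longrightarrow> foldr (\<lambda>i. partial i ^^ \<alpha> i) is (\<lambda>y. complex_of_real (mi_power (y - x) \<beta>))
    = (\<lambda>y. (\<Prod>i\<in>set is. \<Prod>j<\<alpha> i. of_nat (\<beta> i - j)) *
        of_real (mi_power (y - x) (\<lambda>i. if i \<in> set is then \<beta> i - \<alpha> i else \<beta> i)))"
proof (induction "is")
  case (Cons i "is")
  have *: "(\<lambda>j. if j \<in> set is then \<beta> j - \<alpha> j else \<beta> j)(i := \<beta> i - \<alpha> i)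
     = (\<lambda>j. if j \<in> set (i # is) then \<beta> j - \<alpha> j else \<beta> j)"
    using Cons.prems by auto
  have IH: "foldr (\<lambda>i. partial i ^^ \<alpha> i) is (\<lambda>y. complex_of_real (mi_power (y - x) \<beta>))
    = (\<lambda>y. (\<Prod>i\<in>set is. \<Prod>j<\<alpha> i. of_nat (\<beta> i - j)) *
        of_real (mi_power (y - x) (\<lambda>i. if i \<in> set is then \<beta> i - \<alpha> i else \<beta> i)))"
    using Cons by simp
  have i: "i \<notin> set is" using Cons.prems by simp
  show ?case
    unfolding foldr.simps o_def IH partial_pow_monomial
    using i by (simp add: mult_ac *[unfolded fun_upd_def] fun_upd_def cong: if_cong)
qed simp

lemma mi_power_0: "mi_power 0 \<gamma> = (if \<forall>i. \<gamma> i = 0 then 1 else 0)"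
  by (auto simp: mi_power_def power_0_left)

lemma prod_falling_zero: "b < a \<Longrightarrow> (\<Prod>j<a. of_nat (b - j)) = (0::complex)"
  by (rule prod_zero) (auto intro!: bexI[of _ b])

lemma prod_falling_fact: "(\<Prod>j<a. of_nat (a - j)) = (of_nat (fact a) :: complex)"
proof -
  have "(\<Prod>j<a. of_nat (a - j)) = (of_nat (\<Prod>j<a. a - j) :: complex)" by simp
  also have "(\<Prod>j<a. a - j) = fact a"
    unfolding fact_prod_rev by (simp add: lessThan_atLeast0)
  finally show ?thesis .
qed

text \<open>If some \<open>\<alpha> i\<close> exceeds \<open>\<beta> i\<close>, a falling product
  has a zero factor; if \<alpha> is smaller in some coordinate and nowhere larger, a positive power
  of zero remains at the centre.\<close>

lemma mi_deriv_monomial: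
  "mi_deriv \<alpha> (\<lambda>y. complex_of_real (mi_power (y - x) \<beta>)) x = (if \<alpha> = \<beta> then of_nat (mi_fact \<alpha>) else 0)"
proof -
  have *: "mi_deriv \<alpha> (\<lambda>y. complex_of_real (mi_power (y - x) \<beta>)) x =
    (\<Prod>i\<in>UNIV. \<Prod>j<\<alpha> i. of_nat (\<beta> i - j)) * of_real (mi_power 0 (\<lambda>i. \<beta> i - \<alpha> i))"
    unfolding mi_deriv_def by (subst foldr_partial_monomial) (simp_all add: coords)
  show ?thesis
  proof (cases "\<forall>i. \<alpha> i \<le> \<beta> i")
    case True
    show ?thesis
    proof (cases "\<alpha> = \<beta>")
      case False
      then obtain i where "\<alpha> i \<noteq> \<beta> i" by blast
      then have "\<beta> i - \<alpha> i \<noteq> 0" using True by (metis diff_is_0_eq le_antisym)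
      then show ?thesis using False by (auto simp: * mi_power_0)
    next
      case True
      show ?thesis using * unfolding True prod_falling_fact by (simp add: mi_power_0 mi_fact_def)
    qed
  next
    case False
    then obtain i where i: "\<beta> i < \<alpha> i" by (meson not_le)
    have "(\<Prod>i\<in>UNIV. \<Prod>j<\<alpha> i. of_nat (\<beta> i - j)) = (0::complex)"
      by (rule prod_zero) (use prod_falling_zero[OF i] in auto)
    then show ?thesis using i by (auto simp: *)
  qed
qed

lemma mi_fact_nonzero [simp]: "mi_fact \<alpha> \<noteq> 0"
  by (simp add: mi_fact_def)

text \<open>Coefficients are read off as derivatives at the centre. This is how conditions on
  derivatives at the centre become equations for the coefficients.\<close>

lemma mi_deriv_taylor_poly:
  "mi_deriv \<alpha> (taylor_poly m c x) x = (if mi_size \<alpha> \<le> m then c \<alpha> else 0)"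
proof -
  have "mi_deriv \<alpha> (taylor_poly m c x) x = (\<Sum>\<beta> | mi_size \<beta> \<le> m. c \<beta> / of_nat (mi_fact \<beta>) *
    mi_deriv \<alpha> (\<lambda>y. complex_of_real (mi_power (y - x) \<beta>)) x)"
    unfolding taylor_poly_def[abs_def] by (rule mi_deriv_sum) (auto intro: smooth_monomial finite_mi_size_le)
  also have "\<dots> = (\<Sum>\<beta> | mi_size \<beta> \<le> m. if \<alpha> = \<beta> then c \<beta> else 0)"
    by (intro sum.cong) (auto simp: mi_deriv_monomial)
  also have "\<dots> = (if mi_size \<alpha> \<le> m then c \<alpha> else 0)"
    by (subst sum.delta') (auto simp: finite_mi_size_le)
  finally show ?thesis .
qed

text \<open>By induction on the order, with the mean value inequality on the segment from the centre.\<close>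

lemma sfam_vanish_bound:
  fixes f :: "'p::topological_space \<Rightarrow> real^'n::finite \<Rightarrow> 'b::real_normed_vector"
  assumes "compact P" "continuous_on P \<xi>" "sfam P f"
    and "\<And>p is. p \<in> P \<Longrightarrow> length is < N \<Longrightarrow> foldr partial is (f p) (\<xi> p) = 0"
  shows "\<exists>C\<ge>0. \<forall>p\<in>P. \<forall>y. norm (y - \<xi> p) \<le> R \<longrightarrow> norm (f p y) \<le> C * norm (y - \<xi> p) ^ N"
  using assms(3,4)
proof (induction N arbitrary: f)
  case 0
  have "continuous_on (P \<times> cball 0 R) (\<lambda>z. f (fst z) (\<xi> (fst z) + snd z))"
    by (rule sfam_continuous_comp[OF 0(1)])
      (auto intro!: continuous_intros continuous_on_compose2[OF assms(2)])
  then have "bounded ((\<lambda>z. f (fst z) (\<xi> (fst z) + snd z)) ` (P \<times> cball 0 R))"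
    by (intro compact_imp_bounded compact_continuous_image compact_Times assms(1) compact_cball)
  then obtain B where B: "\<And>z. z \<in> P \<times> cball 0 R \<Longrightarrow> norm (f (fst z) (\<xi> (fst z) + snd z)) \<le> B"
    unfolding bounded_iff by blast
  have "norm (f p y) \<le> \<bar>B\<bar>" if "p \<in> P" "norm (y - \<xi> p) \<le> R" for p y
    using B[of "(p, y - \<xi> p)"] that by simp
  then show ?case by (intro exI[of _ "\<bar>B\<bar>"]) auto
next
  case (Suc N)
  have "\<exists>C\<ge>0. \<forall>p\<in>P. \<forall>y. norm (y - \<xi> p) \<le> R \<longrightarrow> norm (partial i (f p) y) \<le> C * norm (y - \<xi> p) ^ N" for i
  proof (rule Suc.IH)
    show "sfam P (\<lambda>p. partial i (f p))" by (intro sfam_intros Suc.prems)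
    \<comment> \<open>The last letter of a word acts first, so the word \<open>is @ [i]\<close>, of
      length below \<open>Suc N\<close>, differentiates in direction i before the rest.\<close>
    show "foldr partial is (partial i (f p)) (\<xi> p) = 0" if "p \<in> P" "length is < N" for p "is"
      using Suc.prems(2)[of p "is @ [i]"] that by simp
  qed
  then have "\<exists>C. \<forall>i. C i \<ge> 0 \<and> (\<forall>p\<in>P. \<forall>y. norm (y - \<xi> p) \<le> R \<longrightarrow>
      norm (partial i (f p) y) \<le> C i * norm (y - \<xi> p) ^ N)"
    by (intro choice allI)
  then obtain C where Cc: "\<forall>i. C i \<ge> 0 \<and> (\<forall>p\<in>P. \<forall>y. norm (y - \<xi> p) \<le> R \<longrightarrow>
      norm (partial i (f p) y) \<le> C i * norm (y - \<xi> p) ^ N)"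
    by (elim exE)
  have C: "\<And>i. C i \<ge> 0"
    "\<And>i p y. p \<in> P \<Longrightarrow> norm (y - \<xi> p) \<le> R \<Longrightarrow> norm (partial i (f p) y) \<le> C i * norm (y - \<xi> p) ^ N"
    using Cc by simp_all
  have "norm (f p y) \<le> (\<Sum>i\<in>UNIV. C i) * norm (y - \<xi> p) ^ Suc N" if p: "p \<in> P" and y: "norm (y - \<xi> p) \<le> R" for p y
  proof -
    let ?r = "norm (y - \<xi> p)"
    have "norm (f p y - f p (\<xi> p)) \<le> ((\<Sum>i\<in>UNIV. C i) * ?r ^ N) * norm (y - \<xi> p)"
    proof (rule differentiable_bound[of "closed_segment (\<xi> p) y" "f p" "\<lambda>x h. \<Sum>i\<in>UNIV. h $ i *\<^sub>R partial i (f p) x"])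
      show "(f p has_derivative (\<lambda>h. \<Sum>i\<in>UNIV. h $ i *\<^sub>R partial i (f p) x)) (at x within closed_segment (\<xi> p) y)" for x
        by (rule has_derivative_at_withinI[OF has_derivative_partials[OF sfam_differentiable[OF Suc.prems(1) p]]])
      fix x assume x: "x \<in> closed_segment (\<xi> p) y"
      have xr: "norm (x - \<xi> p) \<le> ?r"
        using segment_bound(1)[OF x] by simp
      show "onorm (\<lambda>h. \<Sum>i\<in>UNIV. h $ i *\<^sub>R partial i (f p) x) \<le> (\<Sum>i\<in>UNIV. C i) * ?r ^ N"
      proof (rule onorm_le)
        fix h :: "real^'n"
        have "norm (\<Sum>i\<in>UNIV. h $ i *\<^sub>R partial i (f p) x) \<le> (\<Sum>i\<in>UNIV. norm h * (C i * ?r ^ N))"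
        proof (rule sum_norm_le)
          fix i
          have "norm (partial i (f p) x) \<le> C i * norm (x - \<xi> p) ^ N"
            by (rule C(2)[OF p]) (use xr y in linarith)
          also have "\<dots> \<le> C i * ?r ^ N" by (intro mult_left_mono power_mono xr C(1) norm_ge_zero)
          finally have "norm (partial i (f p) x) \<le> C i * ?r ^ N" .
          then show "norm (h $ i *\<^sub>R partial i (f p) x) \<le> norm h * (C i * ?r ^ N)"
            unfolding norm_scaleR real_norm_def
            by (intro mult_mono component_le_norm_cart norm_ge_zero)
        qed
        also have "\<dots> = (\<Sum>i\<in>UNIV. C i) * ?r ^ N * norm h"
          by (simp add: sum_distrib_left[symmetric] sum_distrib_right[symmetric])
        finally show "norm (\<Sum>i\<in>UNIV. h $ i *\<^sub>R partial i (f p) x) \<le> (\<Sum>i\<in>UNIV. C i) * ?r ^ N * norm h" .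
      qed
    qed simp_all
    moreover have "f p (\<xi> p) = 0" using Suc.prems(2)[of p "[]"] p by simp
    ultimately show ?thesis by (simp add: mult_ac)
  qed
  then show ?case by (intro exI[of _ "\<Sum>i\<in>UNIV. C i"] conjI sum_nonneg C(1)) blast
qed

section \<open>Ordinary differential equations\<close>

lemma nonincreasing_within:
  fixes g :: "real \<Rightarrow> real"
  assumes "\<And>s. s \<in> {0..T} \<Longrightarrow> (g has_real_derivative g' s) (at s within {0..T})"
    and "\<And>s. s \<in> {0..T} \<Longrightarrow> g' s \<le> 0" and "t \<in> {0..T}"
  shows "g t \<le> g 0"
proof -
  have "\<exists>x\<in>{0..t}. g t - g 0 = (\<lambda>h. g' x * h) (t - 0)"
  proof (rule mvt_very_simple)
    fix x assume "0 \<le> x" "x \<le> t"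
    then show "(g has_derivative (\<lambda>h. g' x * h)) (at x within {0..t})"
      using has_derivative_subset[of g _ x "{0..T}" "{0..t}"] assms(1)[of x] assms(3)
      unfolding has_field_derivative_def by auto
  qed (use assms in auto)
  then obtain x where x: "x \<in> {0..t}" "g t - g 0 = g' x * t" by auto
  have "g' x * t \<le> 0" using assms(2)[of x] x(1) assms(3) by (intro mult_nonpos_nonneg) auto
  then show ?thesis using x(2) by linarith
qed

lemma exp_cancel:
  fixes a b x :: real
  shows "exp (- a * b) * (exp (a * b) * x) = x" "exp (a * b) * (exp (- a * b) * x) = x"
  by (simp_all only: mult.assoc[symmetric] exp_add[symmetric]) simp_all

lemma gronwall:
  fixes D :: "real \<Rightarrow> real"
  assumes D: "\<And>s. s \<in> {0..T} \<Longrightarrow> (D has_real_derivative D' s) (at s within {0..T})"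
    and le: "\<And>s. s \<in> {0..T} \<Longrightarrow> D' s \<le> C * D s + \<eta>"
    and "C \<ge> 0" "\<eta> \<ge> 0" "t \<in> {0..T}"
  shows "D t \<le> (D 0 + \<eta> * t) * exp (C * t)"
proof -
  \<comment> \<open>The exponential factor absorbs the linear term, and \<open>\<eta> * s\<close>
    the inhomogeneity, because \<open>exp (- C * s)\<close> is at most 1.\<close>
  define g where "g s = exp (- C * s) * D s - \<eta> * s" for s
  have "g t \<le> g 0"
  proof (rule nonincreasing_within)
    fix s assume s: "s \<in> {0..T}"
    show "(g has_real_derivative (exp (- C * s) * (D' s - C * D s) - \<eta>)) (at s within {0..T})"
      unfolding g_def by (rule derivative_eq_intros D[OF s] refl | simp add: algebra_simps)+
    have "exp (- C * s) * (D' s - C * D s) \<le> exp (- C * s) * \<eta>"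
      using le[OF s] by (intro mult_left_mono) auto
    also have "\<dots> \<le> 1 * \<eta>" using s assms by (intro mult_right_mono) auto
    finally show "exp (- C * s) * (D' s - C * D s) - \<eta> \<le> 0" by simp
  qed (use assms in auto)
  then have "exp (- C * t) * D t \<le> D 0 + \<eta> * t" by (simp add: g_def)
  then have "exp (C * t) * (exp (- C * t) * D t) \<le> exp (C * t) * (D 0 + \<eta> * t)"
    by (intro mult_left_mono) auto
  then show ?thesis by (simp only: exp_cancel mult.commute[of "exp (C * t)"])
qed

text \<open>Bounds how fast D can shrink. It serves to show that trajectories which meet at time t
  started at the same point.\<close>

lemma gronwall_backward:
  fixes D :: "real \<Rightarrow> real"
  assumes D: "\<And>s. s \<in> {0..T} \<Longrightarrow> (D has_real_derivative D' s) (at s within {0..T})"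
    and le: "\<And>s. s \<in> {0..T} \<Longrightarrow> D' s \<ge> - C * D s"
    and "t \<in> {0..T}"
  shows "D 0 \<le> exp (C * t) * D t"
proof -
  define g where "g s = - exp (C * s) * D s" for s
  have "g t \<le> g 0"
  proof (rule nonincreasing_within)
    fix s assume s: "s \<in> {0..T}"
    show "(g has_real_derivative - (exp (C * s) * (D' s + C * D s))) (at s within {0..T})"
      unfolding g_def by (rule derivative_eq_intros D[OF s] refl | simp add: algebra_simps)+
    show "- (exp (C * s) * (D' s + C * D s)) \<le> 0"
      using le[OF s] by simp
  qed (use assms in auto)
  then show ?thesis by (simp add: g_def)
qed

section \<open>Comparison of solutions and continuous dependence on parameters\<close>

lemma sum_square_le_card:
  fixes f :: "'j \<Rightarrow> real"
  shows "(\<Sum>j\<in>J. f j)\<^sup>2 \<le> real (card J) * (\<Sum>j\<in>J. (f j)\<^sup>2)"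
  using Cauchy_Schwarz_ineq_sum[of f "\<lambda>_. 1" J] by (simp add: mult.commute)

text \<open>A bootstrap argument: as long as the two solutions stay within distance 1 the local
  Lipschitz bound applies, and Gronwall's inequality keeps them there.\<close>

lemma ode_compare:
  fixes u v :: "'j \<Rightarrow> real \<Rightarrow> 'b::real_inner"
  assumes fin: "finite J" and T: "0 \<le> T" and L: "L \<ge> 0" and \<eta>: "\<eta> \<ge> 0"
    and u: "\<And>j t. j \<in> J \<Longrightarrow> t \<in> {0..T} \<Longrightarrow> (u j has_vector_derivative u' j t) (at t within {0..T})"
    and v: "\<And>j t. j \<in> J \<Longrightarrow> t \<in> {0..T} \<Longrightarrow> (v j has_vector_derivative v' j t) (at t within {0..T})"
    and lip: "\<And>j t. j \<in> J \<Longrightarrow> t \<in> {0..T} \<Longrightarrow> (\<And>i. i \<in> J \<Longrightarrow> norm (u i t - v i t) \<le> 1) \<Longrightarrow>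
      norm (u' j t - v' j t) \<le> L * (\<Sum>i\<in>J. norm (u i t - v i t)) + \<eta>"
    and small: "((\<Sum>j\<in>J. (norm (u j 0 - v j 0))\<^sup>2) + real (card J) * \<eta>\<^sup>2 * T) * exp ((2 * L * real (card J) + 1) * T) < 1"
    and t: "t \<in> {0..T}"
  shows "(\<Sum>j\<in>J. (norm (u j t - v j t))\<^sup>2) \<le>
    ((\<Sum>j\<in>J. (norm (u j 0 - v j 0))\<^sup>2) + real (card J) * \<eta>\<^sup>2 * T) * exp ((2 * L * real (card J) + 1) * T)"
proof -
  \<comment> \<open>The sum of squares is differentiable even where components of the two solutions
    coincide, unlike the sum of norms in the Lipschitz bound.\<close>
  define D where "D t = (\<Sum>j\<in>J. (norm (u j t - v j t))\<^sup>2)" for t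
  define D' where "D' t = (\<Sum>j\<in>J. 2 * ((u j t - v j t) \<bullet> (u' j t - v' j t)))" for t
  \<comment> \<open>The first summand comes from Cauchy-Schwarz for the square of the sum of the
    distances, the second from \<open>2 d \<eta> \<le> d^2 + \<eta>^2\<close>.\<close>
  define C where "C = 2 * L * real (card J) + 1"
  have C: "C \<ge> 0" using L by (simp add: C_def)
  define \<theta> where "\<theta> = real (card J) * \<eta>\<^sup>2"
  have \<theta>: "\<theta> \<ge> 0" by (simp add: \<theta>_def)
  define b where "b = (D 0 + \<theta> * T) * exp (C * T)"
  have b: "b < 1" using small by (simp add: b_def C_def \<theta>_def D_def)
  have D0: "D t \<ge> 0" for t by (auto simp: D_def intro: sum_nonneg)
  have deriv: "(D has_real_derivative D' t) (at t within {0..T})" if "t \<in> {0..T}" for t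
    unfolding D_def D'_def power2_norm_eq_inner
  proof (intro DERIV_sum)
    fix j assume j: "j \<in> J"
    have "((\<lambda>t. u j t - v j t) has_vector_derivative u' j t - v' j t) (at t within {0..T})"
      by (intro derivative_intros u v j that)
    then have "((\<lambda>t. (u j t - v j t) \<bullet> (u j t - v j t)) has_derivative
       (\<lambda>h. (u j t - v j t) \<bullet> (h *\<^sub>R (u' j t - v' j t)) + (h *\<^sub>R (u' j t - v' j t)) \<bullet> (u j t - v j t))) (at t within {0..T})"
      unfolding has_vector_derivative_def by (intro has_derivative_inner)
    then show "((\<lambda>t. (u j t - v j t) \<bullet> (u j t - v j t)) has_real_derivative 2 * ((u j t - v j t) \<bullet> (u' j t - v' j t))) (at t within {0..T})"
      unfolding has_field_derivative_def
      by (rule back_subst[where P="\<lambda>f. (_ has_derivative f) _"]) (auto simp: inner_commute)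
  qed
  have bound: "D' t \<le> C * D t + \<theta>" if t: "t \<in> {0..T}" and D1: "D t \<le> 1" for t
  proof -
    define d where "d j = norm (u j t - v j t)" for j
    have d1: "d i \<le> 1" if "i \<in> J" for i
    proof -
      have "(d i)\<^sup>2 \<le> D t" unfolding D_def d_def by (rule member_le_sum) (use that fin in auto)
      then have "(d i)\<^sup>2 \<le> 1\<^sup>2" using D1 by simp
      then show ?thesis by (rule power2_le_imp_le) simp
    qed
    have "D' t \<le> (\<Sum>j\<in>J. 2 * (d j * (L * (\<Sum>i\<in>J. d i) + \<eta>)))"
      unfolding D'_def
    proof (intro sum_mono mult_left_mono)
      fix j assume j: "j \<in> J"
      have "(u j t - v j t) \<bullet> (u' j t - v' j t) \<le> d j * norm (u' j t - v' j t)"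
        unfolding d_def by (rule norm_cauchy_schwarz)
      also have "\<dots> \<le> d j * (L * (\<Sum>i\<in>J. d i) + \<eta>)"
        unfolding d_def by (intro mult_left_mono lip j t) (use d1 in \<open>auto simp: d_def\<close>)
      finally show "(u j t - v j t) \<bullet> (u' j t - v' j t) \<le> d j * (L * (\<Sum>i\<in>J. d i) + \<eta>)" .
    qed auto
    also have "\<dots> = 2 * L * (\<Sum>i\<in>J. d i)\<^sup>2 + (\<Sum>j\<in>J. 2 * d j * \<eta>)"
    proof -
      have "(\<Sum>j\<in>J. 2 * (d j * (L * S + \<eta>))) = (\<Sum>j\<in>J. 2 * L * S * d j + 2 * d j * \<eta>)" for S
        by (intro sum.cong) (auto simp: algebra_simps)
      then show ?thesis by (simp only: sum.distrib sum_distrib_left[symmetric] power2_eq_square mult.assoc)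
    qed
    also have "(\<Sum>j\<in>J. 2 * d j * \<eta>) \<le> (\<Sum>j\<in>J. (d j)\<^sup>2 + \<eta>\<^sup>2)"
      by (intro sum_mono sum_squares_bound)
    also have "\<dots> = D t + \<theta>" by (simp add: sum.distrib D_def d_def \<theta>_def)
    also have "2 * L * (\<Sum>i\<in>J. d i)\<^sup>2 \<le> 2 * L * (real (card J) * (\<Sum>j\<in>J. (d j)\<^sup>2))"
      using L by (intro mult_left_mono sum_square_le_card) auto
    also have "(\<Sum>j\<in>J. (d j)\<^sup>2) = D t" by (simp add: D_def d_def)
    finally show ?thesis by (simp add: C_def algebra_simps)
  qed
  \<comment> \<open>The bound b is the same for all s and lies below 1, while the assumption only
    asks for \<open>D r \<le> 1\<close>. This gap is what the bootstrap lives on.\<close>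
  have gron: "D s \<le> b" if s: "s \<in> {0..T}" and le: "\<And>r. r \<in> {0..s} \<Longrightarrow> D r \<le> 1" for s
  proof -
    have "D s \<le> (D 0 + \<theta> * s) * exp (C * s)"
    proof (rule gronwall[where T=s and D'=D'])
      show "(D has_real_derivative D' r) (at r within {0..s})" if "r \<in> {0..s}" for r
        by (rule DERIV_subset[OF deriv]) (use that s in auto)
      show "D' r \<le> C * D r + \<theta>" if "r \<in> {0..s}" for r
        by (rule bound) (use that s le in auto)
    qed (use C \<theta> s in auto)
    also have "\<dots> \<le> b"
      unfolding b_def
    proof (rule mult_mono)
      show "D 0 + \<theta> * s \<le> D 0 + \<theta> * T" using s \<theta> by (simp add: mult_left_mono)
      show "exp (C * s) \<le> exp (C * T)" using s C by (simp add: mult_left_mono)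
      show "0 \<le> D 0 + \<theta> * T" using D0 \<theta> T by simp
    qed simp
    finally show ?thesis .
  qed
  have contD: "continuous_on {0..T} D"
    by (rule DERIV_continuous_on[OF deriv])
  have D00: "D 0 \<le> b"
  proof -
    have "D 0 * 1 \<le> (D 0 + \<theta> * T) * exp (C * T)"
      using D0 \<theta> T C by (intro mult_mono) simp_all
    then show ?thesis by (simp add: b_def)
  qed
  have "D s < 1" if s: "s \<in> {0..T}" for s
  proof (rule ccontr)
    assume "\<not> D s < 1"
    \<comment> \<open>The times up to s at which D has reached 1. At the earliest of them D equals 1
      by the intermediate value theorem, whereas Gronwall's bound up to that time gives at most
      b.\<close>
    define S where "S = {0..s} \<inter> D -` {1..}"
    have "compact S"
    proof -
      have "continuous_on {0..s} D" using contD s by (auto elim: continuous_on_subset)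
      then have "closed S" unfolding S_def by (rule continuous_closed_preimage) simp_all
      moreover have "bounded S" by (rule bounded_subset[of "{0..s}"]) (auto simp: S_def)
      ultimately show ?thesis by (simp add: compact_eq_bounded_closed)
    qed
    moreover have "s \<in> S" using \<open>\<not> D s < 1\<close> s by (auto simp: S_def)
    ultimately obtain r where r: "r \<in> S" "\<And>q. q \<in> S \<Longrightarrow> r \<le> q"
      using compact_attains_inf[of S] by blast
    have rT: "r \<in> {0..T}" using r(1) s by (auto simp: S_def)
    have "\<exists>q\<ge>0. q \<le> r \<and> D q = 1"
    proof (rule IVT')
      show "continuous_on {0..r} D" using contD rT by (auto elim: continuous_on_subset)
    qed (use r(1) rT D00 b in \<open>auto simp: S_def\<close>)
    then obtain q where q: "0 \<le> q" "q \<le> r" "D q = 1" by blast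
    then have "q \<in> S" using rT r(1) by (auto simp: S_def)
    then have qr: "q = r" using r(2) q(2) by force
    have "D r \<le> b"
    proof (rule gron[OF rT])
      fix p assume p: "p \<in> {0..r}"
      show "D p \<le> 1"
      proof (cases "p = r")
        case False
        then have "p \<notin> S" using r(2)[of p] p by auto
        then show ?thesis using p r(1) by (auto simp: S_def)
      qed (use q qr in auto)
    qed
    then show False using b q(3) qr by simp
  qed
  then have "D t \<le> b" by (intro gron[OF t]) (use t in \<open>auto intro: less_imp_le\<close>)
  then show ?thesis by (simp add: b_def C_def \<theta>_def D_def)
qed

text \<open>No bound on the solutions that start near z0 is known beforehand. They are compared with
  the solution for z0: along that one the defect of the right-hand side is small by uniform
  continuity, a Lipschitz constant is taken on a ball one unit larger than its range, and
  \<open>ode_compare\<close> keeps the neighbours inside. Continuity in z, uniform in t, then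
  combines with continuity in t at z0.\<close>

lemma ode_continuous_dependence:
  fixes u :: "'j \<Rightarrow> real \<Rightarrow> 'z::metric_space \<Rightarrow> 'b::real_inner"
  assumes fin: "finite J" and T: "0 \<le> T" and Z: "compact Z"
    and ode: "\<And>j t z. j \<in> J \<Longrightarrow> t \<in> {0..T} \<Longrightarrow> z \<in> Z \<Longrightarrow>
      ((\<lambda>s. u j s z) has_vector_derivative G j t z (\<lambda>i. u i t z)) (at t within {0..T})"
    and lip: "\<And>R. \<exists>L\<ge>0. \<forall>j\<in>J. \<forall>t\<in>{0..T}. \<forall>z\<in>Z. \<forall>v w.
      (\<forall>i\<in>J. norm (v i) \<le> R \<and> norm (w i) \<le> R) \<longrightarrow> norm (G j t z v - G j t z w) \<le> L * (\<Sum>i\<in>J. norm (v i - w i))"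
    and cont: "\<And>z0 j. z0 \<in> Z \<Longrightarrow> j \<in> J \<Longrightarrow> continuous_on ({0..T} \<times> Z) (\<lambda>p. G j (fst p) (snd p) (\<lambda>i. u i (fst p) z0))"
    and init: "\<And>j. j \<in> J \<Longrightarrow> continuous_on Z (\<lambda>z. u j 0 z)"
    and j: "j \<in> J"
  shows "continuous_on ({0..T} \<times> Z) (\<lambda>p. u j (fst p) (snd p))"
proof -
  have ct: "continuous_on {0..T} (\<lambda>t. u i t z)" if "i \<in> J" "z \<in> Z" for i z
    by (rule continuous_on_vector_derivative[OF ode[OF that(1) _ that(2)]])
  have unif: "eventually (\<lambda>z. \<forall>t\<in>{0..T}. \<forall>j\<in>J. norm (u j t z - u j t z0) < \<epsilon>) (at z0 within Z)"
    if z0: "z0 \<in> Z" and \<epsilon>: "\<epsilon> > 0" for z0 \<epsilon>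
  proof -
    have "bounded (\<Union>i\<in>J. (\<lambda>t. u i t z0) ` {0..T})"
      by (intro bounded_UN fin ballI compact_imp_bounded compact_continuous_image ct z0 compact_Icc)
    then obtain R0 where "\<forall>x\<in>(\<Union>i\<in>J. (\<lambda>t. u i t z0) ` {0..T}). norm x \<le> R0"
      unfolding bounded_iff by blast
    then have R0: "norm (u i t z0) \<le> R0" if "i \<in> J" "t \<in> {0..T}" for i t using that by blast
    obtain L where L: "L \<ge> 0" and Llip: "\<forall>j\<in>J. \<forall>t\<in>{0..T}. \<forall>z\<in>Z. \<forall>v w.
      (\<forall>i\<in>J. norm (v i) \<le> R0 + 1 \<and> norm (w i) \<le> R0 + 1) \<longrightarrow> norm (G j t z v - G j t z w) \<le> L * (\<Sum>i\<in>J. norm (v i - w i))"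
      using lip[of "R0 + 1"] by blast
    define n where "n = real (card J)"
    define E where "E = exp ((2 * L * n + 1) * T)"
    \<comment> \<open>The 1 meets the smallness hypothesis of \<open>ode_compare\<close>, the square
      of \<epsilon> the desired bound. The number e below is such that an initial deviation and a
      defect of size e keep the Gronwall bound under m.\<close>
    define m where "m = min 1 (\<epsilon>\<^sup>2)"
    have m: "m > 0" using \<epsilon> by (simp add: m_def)
    define Q where "Q = 2 * (n + 1) * (1 + T) * E"
    have pos: "Q > 0" using T by (simp add: Q_def n_def E_def add_nonneg_pos)
    define e where "e = sqrt (m / Q)"
    have e: "e > 0" using m pos by (simp add: e_def)
    have e2: "e\<^sup>2 * Q = m" using m pos by (simp add: e_def)
    have "n * ((1 + T) * E) < 2 * (n + 1) * ((1 + T) * E)"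
      using T by (intro mult_strict_right_mono) (auto simp: n_def E_def)
    then have "e\<^sup>2 * (n * ((1 + T) * E)) < e\<^sup>2 * Q"
      using e by (intro mult_strict_left_mono) (auto simp: Q_def mult.assoc)
    also have "e\<^sup>2 * (n * ((1 + T) * E)) = (n * e\<^sup>2 + n * e\<^sup>2 * T) * E" by (simp add: algebra_simps)
    finally have small: "(n * e\<^sup>2 + n * e\<^sup>2 * T) * E < m" using e2 by simp
    have ev1: "eventually (\<lambda>z. \<forall>j\<in>J. norm (u j 0 z - u j 0 z0) < e) (at z0 within Z)"
      using init[unfolded continuous_on_def] z0 e
      by (intro eventually_ball_finite fin ballI) (auto simp: tendsto_iff dist_norm)
    \<comment> \<open>Only the solution for z0 is inserted here, so the function is known to be
      continuous on a compact set before anything is known about its neighbours.\<close>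
    have ev2: "eventually (\<lambda>z. \<forall>j\<in>J. \<forall>t\<in>{0..T}. norm (G j t z (\<lambda>i. u i t z0) - G j t z0 (\<lambda>i. u i t z0)) < e) (at z0 within Z)"
    proof (rule eventually_ball_finite[OF fin], rule ballI)
      fix j assume j: "j \<in> J"
      have "uniformly_continuous_on ({0..T} \<times> Z) (\<lambda>p. G j (fst p) (snd p) (\<lambda>i. u i (fst p) z0))"
        by (intro compact_uniformly_continuous cont z0 j compact_Times Z) auto
      then obtain d where d: "d > 0" "\<And>p q. p \<in> {0..T} \<times> Z \<Longrightarrow> q \<in> {0..T} \<times> Z \<Longrightarrow> dist q p < d \<Longrightarrow>
         dist (G j (fst q) (snd q) (\<lambda>i. u i (fst q) z0)) (G j (fst p) (snd p) (\<lambda>i. u i (fst p) z0)) < e"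
        unfolding uniformly_continuous_on_def using e by blast
      have "\<forall>t\<in>{0..T}. norm (G j t z (\<lambda>i. u i t z0) - G j t z0 (\<lambda>i. u i t z0)) < e" if "z \<in> Z" "dist z z0 < d" for z
      proof
        fix t assume t: "t \<in> {0..T}"
        then show "norm (G j t z (\<lambda>i. u i t z0) - G j t z0 (\<lambda>i. u i t z0)) < e"
          using d(2)[of "(t, z0)" "(t, z)"] that z0 by (simp add: dist_Pair_Pair dist_norm)
      qed
      then show "eventually (\<lambda>z. \<forall>t\<in>{0..T}. norm (G j t z (\<lambda>i. u i t z0) - G j t z0 (\<lambda>i. u i t z0)) < e) (at z0 within Z)"
        unfolding eventually_at by (intro exI[of _ d]) (simp add: d(1))
    qed
    have ev3: "eventually (\<lambda>z. z \<in> Z) (at z0 within Z)" by (auto simp: eventually_at_filter)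
    from ev1 ev2 ev3 show ?thesis
    proof eventually_elim
      case (elim z)
      have base: "(\<Sum>j\<in>J. (norm (u j 0 z - u j 0 z0))\<^sup>2) \<le> n * e\<^sup>2"
      proof -
        have "(\<Sum>j\<in>J. (norm (u j 0 z - u j 0 z0))\<^sup>2) \<le> (\<Sum>j\<in>J. e\<^sup>2)"
          by (intro sum_mono power_mono) (use elim in \<open>auto intro: less_imp_le\<close>)
        then show ?thesis by (simp add: n_def)
      qed
      have le: "((\<Sum>j\<in>J. (norm (u j 0 z - u j 0 z0))\<^sup>2) + n * e\<^sup>2 * T) * E \<le> (n * e\<^sup>2 + n * e\<^sup>2 * T) * E"
        using base by (intro mult_right_mono) (auto simp: E_def)
      have main: "(\<Sum>j\<in>J. (norm (u j t z - u j t z0))\<^sup>2) \<le>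
         ((\<Sum>j\<in>J. (norm (u j 0 z - u j 0 z0))\<^sup>2) + n * e\<^sup>2 * T) * E" if t: "t \<in> {0..T}" for t
        unfolding n_def E_def
      proof (rule ode_compare[where u="\<lambda>j t. u j t z" and v="\<lambda>j t. u j t z0" and u'="\<lambda>j t. G j t z (\<lambda>i. u i t z)" and v'="\<lambda>j t. G j t z0 (\<lambda>i. u i t z0)"])
        show "((\<lambda>t. u j t z) has_vector_derivative G j t z (\<lambda>i. u i t z)) (at t within {0..T})"
          if "j \<in> J" "t \<in> {0..T}" for j t by (rule ode) (use that elim in auto)
        show "((\<lambda>t. u j t z0) has_vector_derivative G j t z0 (\<lambda>i. u i t z0)) (at t within {0..T})"
          if "j \<in> J" "t \<in> {0..T}" for j t by (rule ode) (use that z0 in auto)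
        show "((\<Sum>j\<in>J. (norm (u j 0 z - u j 0 z0))\<^sup>2) + real (card J) * e\<^sup>2 * T) * exp ((2 * L * real (card J) + 1) * T) < 1"
          using le small unfolding n_def E_def m_def by linarith
        fix j t assume jt: "j \<in> J" "t \<in> {0..T}" and near: "\<And>i. i \<in> J \<Longrightarrow> norm (u i t z - u i t z0) \<le> 1"
        have "norm (u i t z) \<le> R0 + 1" if "i \<in> J" for i
        proof -
          have "norm (u i t z) \<le> norm (u i t z0) + norm (u i t z - u i t z0)"
            by (metis add.commute diff_add_cancel norm_triangle_ineq)
          then show ?thesis using near[OF that] R0[OF that jt(2)] by linarith
        qed
        moreover have "norm (u i t z0) \<le> R0 + 1" if "i \<in> J" for i using R0[OF that jt(2)] by linarith
        ultimately have "norm (G j t z (\<lambda>i. u i t z) - G j t z (\<lambda>i. u i t z0)) \<le> L * (\<Sum>i\<in>J. norm (u i t z - u i t z0))"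
          using Llip jt elim(3) by simp
        moreover have "norm (G j t z (\<lambda>i. u i t z0) - G j t z0 (\<lambda>i. u i t z0)) \<le> e"
          using elim(2) jt by (auto intro: less_imp_le)
        ultimately show "norm (G j t z (\<lambda>i. u i t z) - G j t z0 (\<lambda>i. u i t z0))
            \<le> L * (\<Sum>i\<in>J. norm (u i t z - u i t z0)) + e"
          using norm_triangle_ineq[of "G j t z (\<lambda>i. u i t z) - G j t z (\<lambda>i. u i t z0)"
            "G j t z (\<lambda>i. u i t z0) - G j t z0 (\<lambda>i. u i t z0)"] by simp
      qed (use fin T L e t in auto)
      show ?case
      proof (intro ballI)
        fix t j assume t: "t \<in> {0..T}" and j: "j \<in> J"
        have "(norm (u j t z - u j t z0))\<^sup>2 \<le> (\<Sum>j\<in>J. (norm (u j t z - u j t z0))\<^sup>2)"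
          by (rule member_le_sum) (use j fin in auto)
        also have "\<dots> < m" using main[OF t] le small by linarith
        also have "m \<le> \<epsilon>\<^sup>2" by (simp add: m_def)
        finally show "norm (u j t z - u j t z0) < \<epsilon>"
          using \<epsilon> by (intro power_less_imp_less_base[of _ 2 \<epsilon>]) auto
      qed
    qed
  qed
  show ?thesis
    unfolding continuous_on_iff
  proof (intro ballI allI impI)
    fix p \<epsilon> assume p: "p \<in> {0..T} \<times> Z" and \<epsilon>: "(\<epsilon>::real) > 0"
    obtain t0 z0 where tz: "p = (t0, z0)" "t0 \<in> {0..T}" "z0 \<in> Z" using p by auto
    from unif[OF tz(3), of "\<epsilon>/2"] \<epsilon> obtain d1 where d1: "d1 > 0"
      "\<And>z. z \<in> Z \<Longrightarrow> z \<noteq> z0 \<Longrightarrow> dist z z0 < d1 \<Longrightarrow> \<forall>t\<in>{0..T}. \<forall>j\<in>J. norm (u j t z - u j t z0) < \<epsilon>/2"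
      unfolding eventually_at by auto
    from ct[OF j tz(3)] tz(2) \<epsilon> obtain d2 where d2: "d2 > 0"
      "\<And>t. t \<in> {0..T} \<Longrightarrow> dist t t0 < d2 \<Longrightarrow> dist (u j t z0) (u j t0 z0) < \<epsilon>/2"
      unfolding continuous_on_iff using half_gt_zero[OF \<epsilon>] by blast
    have "dist (u j (fst q) (snd q)) (u j (fst p) (snd p)) < \<epsilon>"
      if q: "q \<in> {0..T} \<times> Z" "dist q p < min d1 d2" for q
    proof -
      have *: "dist (fst q) t0 < d2" "dist (snd q) z0 < d1"
        using q(2) dist_fst_le[of q p] dist_snd_le[of q p] tz(1) by auto
      have "fst q \<in> {0..T}" "snd q \<in> Z" using q(1) by auto
      have 1: "dist (u j (fst q) z0) (u j t0 z0) < \<epsilon>/2"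
        by (rule d2(2)[OF \<open>fst q \<in> {0..T}\<close> *(1)])
      have 2: "norm (u j (fst q) (snd q) - u j (fst q) z0) < \<epsilon>/2"
      proof (cases "snd q = z0")
        case True
        then show ?thesis using \<epsilon> by simp
      next
        case False
        from d1(2)[OF \<open>snd q \<in> Z\<close> this *(2)] \<open>fst q \<in> {0..T}\<close> j
        show ?thesis by blast
      qed
      from 1 2 show ?thesis
        using dist_triangle[of "u j (fst q) (snd q)" "u j t0 z0" "u j (fst q) z0"] tz(1)
        by (simp add: dist_norm)
    qed
    then show "\<exists>d>0. \<forall>q\<in>{0..T} \<times> Z. dist q p < d \<longrightarrow> dist (u j (fst q) (snd q)) (u j (fst p) (snd p)) < \<epsilon>"
      using d1(1) d2(1) by (intro exI[of _ "min d1 d2"]) auto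
  qed
qed

text \<open>The form shared by the phase coefficients, whose system is quadratic, and the amplitude
  coefficients, whose system is linear. A right-hand side that is polynomial in the unknowns with
  bounded coefficients is Lipschitz on balls.\<close>

lemma quadratic_ode_continuous:
  fixes u :: "'j \<Rightarrow> real \<Rightarrow> 'z::metric_space \<Rightarrow> complex"
  assumes fin: "finite J" and T: "0 \<le> T" and Z: "compact Z"
    and ode: "\<And>j t z. j \<in> J \<Longrightarrow> t \<in> {0..T} \<Longrightarrow> z \<in> Z \<Longrightarrow>
      ((\<lambda>s. u j s z) has_vector_derivative ((\<Sum>b\<in>J. \<Sum>c\<in>J. K j b c (t, z) * (u b t z * u c t z))
        + (\<Sum>b\<in>J. L j b (t, z) * u b t z) + F j (t, z))) (at t within {0..T})"
    and K: "\<And>j b c. j \<in> J \<Longrightarrow> b \<in> J \<Longrightarrow> c \<in> J \<Longrightarrow> continuous_on ({0..T} \<times> Z) (K j b c)"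
    and L: "\<And>j b. j \<in> J \<Longrightarrow> b \<in> J \<Longrightarrow> continuous_on ({0..T} \<times> Z) (L j b)"
    and F: "\<And>j. j \<in> J \<Longrightarrow> continuous_on ({0..T} \<times> Z) (F j)"
    and init: "\<And>j. j \<in> J \<Longrightarrow> continuous_on Z (\<lambda>z. u j 0 z)"
    and j: "j \<in> J"
  shows "continuous_on ({0..T} \<times> Z) (\<lambda>p. u j (fst p) (snd p))"
proof -
  define G where "G j t z v = (\<Sum>b\<in>J. \<Sum>c\<in>J. K j b c (t, z) * (v b * v c)) + (\<Sum>b\<in>J. L j b (t, z) * v b) + F j (t, z)"
    for j t z and v :: "'j \<Rightarrow> complex"
  have ct: "continuous_on {0..T} (\<lambda>t. u i t z)" if "i \<in> J" "z \<in> Z" for i z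
    by (rule continuous_on_vector_derivative[OF ode[OF that(1) _ that(2)]])
  have cpt: "compact ({0..T} \<times> Z)" by (intro compact_Times Z) auto
  have "bounded ((\<Union>j\<in>J. \<Union>b\<in>J. \<Union>c\<in>J. K j b c ` ({0..T} \<times> Z)) \<union> (\<Union>j\<in>J. \<Union>b\<in>J. L j b ` ({0..T} \<times> Z)))"
    by (intro bounded_Un[THEN iffD2] conjI bounded_UN fin ballI compact_imp_bounded compact_continuous_image cpt K L)
  then obtain M where M: "\<forall>x\<in>((\<Union>j\<in>J. \<Union>b\<in>J. \<Union>c\<in>J. K j b c ` ({0..T} \<times> Z)) \<union> (\<Union>j\<in>J. \<Union>b\<in>J. L j b ` ({0..T} \<times> Z))). norm x \<le> M"
    unfolding bounded_iff by blast
  have boundK: "norm (K j b c (t, z)) \<le> \<bar>M\<bar>" if "j \<in> J" "b \<in> J" "c \<in> J" "t \<in> {0..T}" "z \<in> Z" for j b c t z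
    by (rule order.trans[OF M[rule_format] abs_ge_self]) (use that in blast)
  have boundL: "norm (L j b (t, z)) \<le> \<bar>M\<bar>" if "j \<in> J" "b \<in> J" "t \<in> {0..T}" "z \<in> Z" for j b t z
    by (rule order.trans[OF M[rule_format] abs_ge_self]) (use that in blast)
  show ?thesis
  proof (rule ode_continuous_dependence[OF fin T Z, where G=G])
    fix R :: real
    define n where "n = real (card J)"
    have "norm (G j t z v - G j t z w) \<le> (2 * n * \<bar>M\<bar> * \<bar>R\<bar> + \<bar>M\<bar>) * (\<Sum>i\<in>J. norm (v i - w i))"
      if jt: "j \<in> J" "t \<in> {0..T}" "z \<in> Z" and R: "\<forall>i\<in>J. norm (v i) \<le> R \<and> norm (w i) \<le> R" for j t z v w
    proof -
      have "G j t z v - G j t z w = (\<Sum>b\<in>J. \<Sum>c\<in>J. K j b c (t, z) * (v b * v c - w b * w c))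
        + (\<Sum>b\<in>J. L j b (t, z) * (v b - w b))"
        by (simp add: G_def algebra_simps sum_subtractf)
      also have "norm \<dots> \<le> (\<Sum>b\<in>J. \<Sum>c\<in>J. \<bar>M\<bar> * (\<bar>R\<bar> * (norm (v b - w b) + norm (v c - w c)))) + (\<Sum>b\<in>J. \<bar>M\<bar> * norm (v b - w b))"
      proof (rule order.trans[OF norm_triangle_ineq add_mono])
        show "norm (\<Sum>b\<in>J. L j b (t, z) * (v b - w b)) \<le> (\<Sum>b\<in>J. \<bar>M\<bar> * norm (v b - w b))"
          by (intro sum_norm_le) (auto simp: norm_mult intro!: mult_right_mono boundL jt)
        show "norm (\<Sum>b\<in>J. \<Sum>c\<in>J. K j b c (t, z) * (v b * v c - w b * w c)) \<le> (\<Sum>b\<in>J. \<Sum>c\<in>J. \<bar>M\<bar> * (\<bar>R\<bar> * (norm (v b - w b) + norm (v c - w c))))"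
        proof (intro sum_norm_le)
          fix b c assume bc: "b \<in> J" "c \<in> J"
          have "norm (v b * v c - w b * w c) = norm (v b * (v c - w c) + (v b - w b) * w c)"
            by (simp add: algebra_simps)
          also have "\<dots> \<le> norm (v b) * norm (v c - w c) + norm (v b - w b) * norm (w c)"
            by (rule order.trans[OF norm_triangle_ineq]) (simp add: norm_mult)
          also have "\<dots> \<le> \<bar>R\<bar> * norm (v c - w c) + norm (v b - w b) * \<bar>R\<bar>"
            using R bc by (intro add_mono mult_right_mono mult_left_mono) (auto intro: order.trans[OF _ abs_ge_self])
          finally have "norm (v b * v c - w b * w c) \<le> \<bar>R\<bar> * (norm (v b - w b) + norm (v c - w c))"
            by (simp add: algebra_simps)
          then show "norm (K j b c (t, z) * (v b * v c - w b * w c)) \<le> \<bar>M\<bar> * (\<bar>R\<bar> * (norm (v b - w b) + norm (v c - w c)))"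
            unfolding norm_mult by (intro mult_mono boundK bc jt) auto
        qed
      qed
      also have "(\<Sum>b\<in>J. \<Sum>c\<in>J. \<bar>M\<bar> * (\<bar>R\<bar> * (norm (v b - w b) + norm (v c - w c))))
          = \<bar>M\<bar> * (\<bar>R\<bar> * (\<Sum>b\<in>J. \<Sum>c\<in>J. norm (v b - w b) + norm (v c - w c)))"
        by (simp only: sum_distrib_left)
      also have "(\<Sum>b\<in>J. \<Sum>c\<in>J. norm (v b - w b) + norm (v c - w c)) = 2 * n * (\<Sum>i\<in>J. norm (v i - w i))"
        by (simp add: sum.distrib sum_distrib_left[symmetric] n_def)
      also have "\<bar>M\<bar> * (\<bar>R\<bar> * (2 * n * (\<Sum>i\<in>J. norm (v i - w i)))) + (\<Sum>b\<in>J. \<bar>M\<bar> * norm (v b - w b))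
          = (2 * n * \<bar>M\<bar> * \<bar>R\<bar> + \<bar>M\<bar>) * (\<Sum>i\<in>J. norm (v i - w i))"
        by (simp add: sum_distrib_left[symmetric] algebra_simps)
      finally show ?thesis .
    qed
    then show "\<exists>L\<ge>0. \<forall>j\<in>J. \<forall>t\<in>{0..T}. \<forall>z\<in>Z. \<forall>v w. (\<forall>i\<in>J. norm (v i) \<le> R \<and> norm (w i) \<le> R) \<longrightarrow>
        norm (G j t z v - G j t z w) \<le> L * (\<Sum>i\<in>J. norm (v i - w i))"
      by (intro exI[of _ "2 * n * \<bar>M\<bar> * \<bar>R\<bar> + \<bar>M\<bar>"]) (auto simp: n_def)
  next
    fix z0 j assume z0: "z0 \<in> Z" and j: "j \<in> J"
    have c: "continuous_on ({0..T} \<times> Z) (\<lambda>p. u i (fst p) z0)" if "i \<in> J" for i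
      by (rule continuous_on_compose2[OF ct[OF that z0]]) (auto intro!: continuous_intros)
    show "continuous_on ({0..T} \<times> Z) (\<lambda>p. G j (fst p) (snd p) (\<lambda>i. u i (fst p) z0))"
      unfolding G_def prod.collapse by (intro continuous_intros c K L F j)
  next
    show "((\<lambda>s. u j s z) has_vector_derivative G j t z (\<lambda>i. u i t z)) (at t within {0..T})"
      if "j \<in> J" "t \<in> {0..T}" "z \<in> Z" for j t z
      unfolding G_def by (rule ode[OF that])
  qed (use init j in auto)
qed

section \<open>Positivity for the Riccati equation\<close>

text \<open>The first-order condition at a minimum: for small s of sign opposite to b the linear
  term dominates, and dividing by \<open>\<bar>c\<bar> + 1\<close> makes s small enough.\<close>

lemma quadratic_nonneg_imp_zero:
  fixes b c :: real
  assumes "\<And>s. 0 \<le> 2 * s * b + s\<^sup>2 * c"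
  shows "b = 0"
proof (rule ccontr)
  assume b: "b \<noteq> 0"
  define q where "q = \<bar>c\<bar> + 1"
  define s where "s = - b / q"
  have p: "q > 0" "c < q" by (auto simp: q_def)
  have "2 * s * b + s\<^sup>2 * c = b\<^sup>2 / q * (c / q - 2)"
    by (simp add: s_def power2_eq_square right_diff_distrib divide_inverse algebra_simps)
  also have "\<dots> < 0"
  proof (rule mult_pos_neg)
    show "0 < b\<^sup>2 / q" using b p by simp
    have "c / q < 1" using p by simp
    then show "c / q - 2 < 0" by linarith
  qed
  finally show False using assms[of s] by simp
qed

text \<open>The imaginary part \<open>N\<close> of a Riccati solution satisfies the linear equation
  \<open>N' = -(R N + N R)\<close>. At the first time at which \<open>exp (K t) N\<close> loses positivity the
  minimising vector is an eigenvector of \<open>N\<close>, which makes the time derivative there positive.\<close>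

lemma riccati_positive:
  fixes N R :: "real \<Rightarrow> real^'n::finite^'n"
  assumes sym: "\<And>t. t \<in> {0..T} \<Longrightarrow> transpose (N t) = N t" "\<And>t. t \<in> {0..T} \<Longrightarrow> transpose (R t) = R t"
    and deriv: "\<And>t i j. t \<in> {0..T} \<Longrightarrow>
      ((\<lambda>s. N s $ i $ j) has_real_derivative - (R t ** N t + N t ** R t) $ i $ j) (at t within {0..T})"
    and init: "N 0 = mat 1"
    and B: "\<And>t v. t \<in> {0..T} \<Longrightarrow> norm v = 1 \<Longrightarrow> v \<bullet> (R t *v v) \<le> B" and B0: "B \<ge> 0"
    and t: "t \<in> {0..T}"
  shows "exp (- (2 * B + 1) * t) * (norm v)\<^sup>2 \<le> v \<bullet> (N t *v v)"
proof -
  \<comment> \<open>The excess of K over \<open>2 * B\<close> makes the weighted form strictly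
    increasing at the critical point found below.\<close>
  define K where "K = 2 * B + 1"
  define g where "g p = exp (K * fst p) * (snd p \<bullet> (N (fst p) *v snd p))" for p
  have cN: "continuous_on {0..T} (\<lambda>s. N s $ i $ j)" for i j
    by (rule DERIV_continuous_on[OF deriv])
  have gexp: "v \<bullet> (N s *v v) = (\<Sum>i\<in>UNIV. v $ i * (\<Sum>j\<in>UNIV. N s $ i $ j * v $ j))" for v s
    by (simp add: inner_vec_def matrix_vector_mult_def)
  have cg: "continuous_on ({0..T} \<times> sphere 0 1) g"
    unfolding g_def gexp
    by (intro continuous_intros continuous_on_compose2[OF cN]) auto
  have dg: "((\<lambda>s. g (s, v)) has_real_derivative exp (K * s) * (K * (v \<bullet> (N s *v v)) - 2 * ((N s *v v) \<bullet> (R s *v v)))) (at s within {0..T})"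
    if s: "s \<in> {0..T}" for s v
  proof -
    have "((\<lambda>s. v \<bullet> (N s *v v)) has_real_derivative (\<Sum>i\<in>UNIV. v $ i * (\<Sum>j\<in>UNIV. (- (R s ** N s + N s ** R s) $ i $ j) * v $ j))) (at s within {0..T})"
      unfolding gexp by (auto intro!: derivative_eq_intros deriv[OF s] simp: sum_distrib_left mult_ac)
    also have "(\<Sum>i\<in>UNIV. v $ i * (\<Sum>j\<in>UNIV. (- (R s ** N s + N s ** R s) $ i $ j) * v $ j))
       = - (v \<bullet> ((R s ** N s + N s ** R s) *v v))"
      unfolding inner_vec_def matrix_vector_mult_def inner_real_def vec_lambda_beta sum_negf[symmetric]
        sum_distrib_left
      by (intro sum.cong) (auto simp: algebra_simps)
    also have "v \<bullet> ((R s ** N s + N s ** R s) *v v) = v \<bullet> (R s *v (N s *v v)) + v \<bullet> (N s *v (R s *v v))"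
      by (simp add: matrix_vector_mult_add_rdistrib matrix_vector_mul_assoc inner_add_right)
    \<comment> \<open>By symmetry of R and N both terms equal the inner product of N v and R v,
      which at an eigenvector of N reduces to the quadratic form of R.\<close>
    also have "v \<bullet> (R s *v (N s *v v)) = (R s *v v) \<bullet> (N s *v v)"
      by (metis dot_lmul_matrix sym(2)[OF s] vector_transpose_matrix)
    also have "v \<bullet> (N s *v (R s *v v)) = (N s *v v) \<bullet> (R s *v v)"
      by (metis dot_lmul_matrix sym(1)[OF s] vector_transpose_matrix)
    finally have 1: "((\<lambda>s. v \<bullet> (N s *v v)) has_real_derivative - ((R s *v v) \<bullet> (N s *v v) + (N s *v v) \<bullet> (R s *v v))) (at s within {0..T})" .
    show ?thesis
      unfolding g_def fst_conv snd_conv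
      by (rule derivative_eq_intros 1 refl | simp add: algebra_simps inner_commute)+
  qed
  have unit: "1 \<le> g (s, w)" if s: "s \<in> {0..T}" and w: "norm w = 1" for s w
  proof (rule ccontr)
    assume "\<not> 1 \<le> g (s, w)"
    \<comment> \<open>A level strictly below the initial value 1 and not below the value at
      \<open>(s, w)\<close>, so that some time reaches it; the 1/2 keeps it positive.\<close>
    define \<theta> where "\<theta> = max (1/2) (g (s, w))"
    have \<theta>: "0 < \<theta>" "\<theta> < 1" using \<open>\<not> 1 \<le> g (s, w)\<close> by (auto simp: \<theta>_def)
    define S where "S = ({0..T} \<times> sphere 0 1) \<inter> g -` {..\<theta>}"
    have "compact ({0..T} \<times> sphere 0 (1::real) :: (real \<times> (real^'n)) set)" by (intro compact_Times) auto
    then have "closed S" "bounded S"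
      using continuous_closed_preimage[OF cg compact_imp_closed closed_atMost] unfolding S_def
      by (blast, metis compact_imp_bounded bounded_Int)
    then have "compact S" by (simp add: compact_eq_bounded_closed)
    moreover have "(s, w) \<in> S" using s w by (auto simp: S_def \<theta>_def)
    moreover have "continuous_on S fst" by (intro continuous_intros)
    ultimately obtain p where p: "p \<in> S" "\<And>q. q \<in> S \<Longrightarrow> fst p \<le> fst q"
      using continuous_attains_inf[of S fst] by blast
    obtain t1 v1 where tv: "p = (t1, v1)" by (cases p)
    have t1: "t1 \<in> {0..T}" and v1: "norm v1 = 1" and gv1: "g (t1, v1) \<le> \<theta>" using p(1) by (auto simp: S_def tv)
    have g0: "g (0, v) = 1" if "norm v = 1" for v
      using that by (simp add: g_def init power2_norm_eq_inner[symmetric])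
    have ge: "g (t1, v) \<ge> \<theta>" if v: "norm v = 1" for v
    proof (rule ccontr)
      assume less: "\<not> g (t1, v) \<ge> \<theta>"
      have c: "continuous_on {0..t1} (\<lambda>s. g (s, v))"
        by (rule continuous_on_compose2[OF cg]) (use t1 v in \<open>auto intro!: continuous_intros\<close>)
      obtain q where q: "0 \<le> q" "q \<le> t1" "g (q, v) = \<theta>"
        using IVT2'[of "\<lambda>s. g (s, v)" t1 \<theta> 0] less g0[OF v] \<theta> t1 c by auto
      then have "(q, v) \<in> S" using v t1 by (auto simp: S_def)
      then have "t1 \<le> q" using p(2) tv by fastforce
      then show False using q less by auto
    qed
    have g1: "g (t1, v1) = \<theta>" using ge[OF v1] gv1 by simp
    define m where "m = \<theta> * exp (- K * t1)"
    have m: "m > 0" using \<theta> by (simp add: m_def)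
    have Qm: "m * (norm v)\<^sup>2 \<le> v \<bullet> (N t1 *v v)" for v
    proof (cases "v = 0")
      case False
      define v' where "v' = (1 / norm v) *\<^sub>R v"
      have v': "norm v' = 1" "v = norm v *\<^sub>R v'" using False by (auto simp: v'_def)
      have "exp (- K * t1) * \<theta> \<le> exp (- K * t1) * g (t1, v')" by (intro mult_left_mono ge v') auto
      also have "\<dots> = v' \<bullet> (N t1 *v v')" by (simp only: g_def fst_conv snd_conv exp_cancel)
      finally have "m \<le> v' \<bullet> (N t1 *v v')" by (simp add: m_def mult.commute)
      then have "(norm v)\<^sup>2 * m \<le> (norm v)\<^sup>2 * (v' \<bullet> (N t1 *v v'))" by (intro mult_left_mono) auto
      also have "\<dots> = (norm v *\<^sub>R v') \<bullet> (N t1 *v (norm v *\<^sub>R v'))"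
        by (simp add: matrix_vector_mult_scaleR power2_eq_square)
      finally show ?thesis using v'(2) by (simp add: mult.commute)
    qed simp
    have eqm: "v1 \<bullet> (N t1 *v v1) = m"
    proof -
      have "v1 \<bullet> (N t1 *v v1) = exp (- K * t1) * g (t1, v1)"
        by (simp only: g_def fst_conv snd_conv exp_cancel)
      then show ?thesis using g1 by (simp add: m_def)
    qed
    \<comment> \<open>The form minus m times the squared norm is nonnegative and vanishes at v1, so
      its first variation there is zero.\<close>
    have eig: "(N t1 *v v1 - m *\<^sub>R v1) \<bullet> h = 0" for h
    proof (rule quadratic_nonneg_imp_zero)
      fix s :: real
      let ?w = "v1 + s *\<^sub>R h"
      have "v1 \<bullet> (N t1 *v h) = (N t1 *v v1) \<bullet> h"
        by (metis dot_lmul_matrix sym(1)[OF t1] vector_transpose_matrix)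
      then have "?w \<bullet> (N t1 *v ?w) = m + 2 * s * ((N t1 *v v1) \<bullet> h) + s\<^sup>2 * (h \<bullet> (N t1 *v h))"
        by (simp add: matrix_vector_right_distrib matrix_vector_mult_scaleR inner_add_left inner_add_right eqm
            power2_eq_square inner_commute algebra_simps)
      moreover have "(norm ?w)\<^sup>2 = 1 + 2 * s * (v1 \<bullet> h) + s\<^sup>2 * (h \<bullet> h)"
        using v1 unfolding power2_norm_eq_inner norm_eq_1
        by (simp add: inner_add_left inner_add_right power2_eq_square inner_commute algebra_simps)
      ultimately show "0 \<le> 2 * s * ((N t1 *v v1 - m *\<^sub>R v1) \<bullet> h) + s\<^sup>2 * (h \<bullet> (N t1 *v h) - m * (h \<bullet> h))"
        using Qm[of ?w] by (simp add: inner_diff_left algebra_simps)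
    qed
    have Nv: "N t1 *v v1 = m *\<^sub>R v1"
      using eig[of "N t1 *v v1 - m *\<^sub>R v1"] by simp
    have "0 < exp (K * t1) * (K * (v1 \<bullet> (N t1 *v v1)) - 2 * ((N t1 *v v1) \<bullet> (R t1 *v v1)))"
    proof -
      have "K * (v1 \<bullet> (N t1 *v v1)) - 2 * ((N t1 *v v1) \<bullet> (R t1 *v v1)) = m * (K - 2 * (v1 \<bullet> (R t1 *v v1)))"
        unfolding eqm unfolding Nv by (simp add: algebra_simps)
      also have "\<dots> > 0" using m B[OF t1 v1] by (intro mult_pos_pos) (auto simp: K_def)
      finally show ?thesis by simp
    qed
    \<comment> \<open>A strictly positive derivative puts the values just before t1 below \<theta>,
      against the choice of t1 as the first such time.\<close>
    from has_real_derivative_pos_inc_left[OF dg[OF t1] this]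
    obtain d where d: "d > 0" "\<And>h. 0 < h \<Longrightarrow> t1 - h \<in> {0..T} \<Longrightarrow> h < d \<Longrightarrow> g (t1 - h, v1) < g (t1, v1)" by blast
    have "t1 \<noteq> 0" using g0[OF v1] g1 \<theta> by auto
    then have t1p: "t1 > 0" using t1 by auto
    define h where "h = min (d/2) t1"
    have h: "0 < h" "h < d" "t1 - h \<in> {0..T}" using d(1) t1p t1 by (auto simp: h_def)
    have "(t1 - h, v1) \<in> S" using d(2)[OF h(1,3,2)] g1 h v1 by (auto simp: S_def)
    then show False using p(2) tv h(1) by fastforce
  qed
  show ?thesis
  proof (cases "v = 0")
    case False
    define v' where "v' = (1 / norm v) *\<^sub>R v"
    have v': "norm v' = 1" "v = norm v *\<^sub>R v'" using False by (auto simp: v'_def)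
    have "exp (- K * t) * 1 \<le> exp (- K * t) * g (t, v')" by (intro mult_left_mono unit t v') auto
    also have "\<dots> = v' \<bullet> (N t *v v')" by (simp only: g_def fst_conv snd_conv exp_cancel)
    finally have "exp (- K * t) \<le> v' \<bullet> (N t *v v')" by simp
    then have "(norm v)\<^sup>2 * exp (- K * t) \<le> (norm v)\<^sup>2 * (v' \<bullet> (N t *v v'))" by (intro mult_left_mono) auto
    also have "\<dots> = (norm v *\<^sub>R v') \<bullet> (N t *v (norm v *\<^sub>R v'))"
      by (simp add: matrix_vector_mult_scaleR power2_eq_square)
    finally show ?thesis using v'(2) by (simp add: mult.commute K_def)
  qed simp
qed

section \<open>Integrals with parameters\<close>

lemma integrable_continuous_compact:
  fixes g :: "'a::euclidean_space \<Rightarrow> 'b::{banach, second_countable_topology}"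
  shows "compact K \<Longrightarrow> continuous_on K g \<Longrightarrow> set_integrable lborel K g"
  unfolding set_integrable_def by (rule borel_integrable_compact)

lemma emeasure_lborel_compact_finite: "compact K \<Longrightarrow> emeasure lborel (K :: 'a::euclidean_space set) < \<infinity>"
  by (rule emeasure_bounded_finite[OF compact_imp_bounded])

lemma norm_set_integral_le:
  fixes g :: "'a::euclidean_space \<Rightarrow> 'b::{banach, second_countable_topology}"
  assumes K: "compact K" and g: "continuous_on K g" and B: "\<And>x. x \<in> K \<Longrightarrow> norm (g x) \<le> B"
  shows "norm (LINT x:K|lborel. g x) \<le> B * measure lborel K"
proof -
  have "norm (LINT x:K|lborel. g x) \<le> (LINT x:K|lborel. norm (g x))"
    by (rule set_integral_norm_bound[OF integrable_continuous_compact[OF K g]])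
  also have "\<dots> \<le> (LINT x:K|lborel. B)"
    by (intro set_integral_mono integrable_continuous_compact K continuous_on_const continuous_on_norm g B)
  also have "\<dots> = B * measure lborel K"
    using emeasure_lborel_compact_finite[OF K]
    by (simp add: set_lebesgue_integral_def mult.commute)
  finally show ?thesis .
qed

lemma set_integral_diff_compact:
  fixes f g :: "'a::euclidean_space \<Rightarrow> 'b::{banach, second_countable_topology}"
  assumes "compact K" "continuous_on K f" "continuous_on K g"
  shows "(LINT x:K|lborel. f x) - (LINT x:K|lborel. g x) = (LINT x:K|lborel. f x - g x)"
  by (subst set_integral_diff) (auto intro: integrable_continuous_compact assms)

lemma continuous_on_set_integral:
  fixes f :: "'a::euclidean_space \<Rightarrow> 'w::metric_space \<Rightarrow> 'b::{banach, second_countable_topology}"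
  assumes K: "compact K" and W: "compact W" and f: "continuous_on (K \<times> W) (\<lambda>p. f (fst p) (snd p))"
  shows "continuous_on W (\<lambda>w. LINT x:K|lborel. f x w)"
  unfolding continuous_on_iff
proof (intro ballI allI impI)
  fix w \<epsilon> assume w: "w \<in> W" and \<epsilon>: "(\<epsilon>::real) > 0"
  have c: "continuous_on K (\<lambda>x. f x v)" if "v \<in> W" for v
  proof -
    have "continuous_on K (\<lambda>x. (x, v))" by (intro continuous_intros)
    moreover have "(\<lambda>x. (x, v)) ` K \<subseteq> K \<times> W" using that by auto
    ultimately show ?thesis using continuous_on_compose2[OF f, of K "\<lambda>x. (x, v)"] by simp
  qed
  \<comment> \<open>The summand 1 keeps the divisor positive when K is a null set.\<close>
  define m where "m = measure lborel K + 1"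
  have m: "m > 0" "measure lborel K < m" by (simp_all add: m_def add_nonneg_pos)
  have "uniformly_continuous_on (K \<times> W) (\<lambda>p. f (fst p) (snd p))"
    by (intro compact_uniformly_continuous f compact_Times K W)
  then obtain d where d: "d > 0" "\<forall>p\<in>K \<times> W. \<forall>q\<in>K \<times> W. dist q p < d \<longrightarrow>
      dist (f (fst q) (snd q)) (f (fst p) (snd p)) < \<epsilon> / m"
    unfolding uniformly_continuous_on_def using divide_pos_pos[OF \<epsilon> m(1)] by meson
  have "dist (LINT x:K|lborel. f x v) (LINT x:K|lborel. f x w) < \<epsilon>" if v: "v \<in> W" "dist v w < d" for v
  proof -
    have "norm (LINT x:K|lborel. f x v - f x w) \<le> (\<epsilon> / m) * measure lborel K"
    proof (rule norm_set_integral_le[OF K])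
      show "continuous_on K (\<lambda>x. f x v - f x w)" by (intro continuous_intros c v w)
      fix x assume x: "x \<in> K"
      show "norm (f x v - f x w) \<le> \<epsilon> / m"
        using d(2)[rule_format, of "(x, w)" "(x, v)"] x v w by (simp add: dist_Pair_Pair dist_norm)
    qed
    also have "\<dots> < (\<epsilon> / m) * m" using \<epsilon> m by (intro mult_strict_left_mono) auto
    also have "\<dots> = \<epsilon>" using m by simp
    finally show ?thesis
      using set_integral_diff_compact[OF K c[OF v(1)] c[OF w]] by (simp add: dist_norm)
  qed
  then show "\<exists>d>0. \<forall>v\<in>W. dist v w < d \<longrightarrow> dist (LINT x:K|lborel. f x v) (LINT x:K|lborel. f x w) < \<epsilon>"
    using d(1) by blast
qed

text \<open>Uniform continuity of the derivative on the compact product makes the difference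
  quotients converge uniformly in x. Derivatives within the interval are used so that the endpoints
  of the time interval are covered.\<close>

lemma has_vector_derivative_set_integral:
  fixes f :: "'a::euclidean_space \<Rightarrow> real \<Rightarrow> 'b::{banach, second_countable_topology}"
  assumes K: "compact K"
    and f: "\<And>s. s \<in> {a..b} \<Longrightarrow> continuous_on K (\<lambda>x. f x s)"
    and d: "\<And>x s. x \<in> K \<Longrightarrow> s \<in> {a..b} \<Longrightarrow> (f x has_vector_derivative f' x s) (at s within {a..b})"
    and f': "continuous_on (K \<times> {a..b}) (\<lambda>p. f' (fst p) (snd p))"
    and s: "s \<in> {a..b}"
  shows "((\<lambda>s. LINT x:K|lborel. f x s) has_vector_derivative (LINT x:K|lborel. f' x s)) (at s within {a..b})"
  unfolding has_vector_derivative_def has_derivative_within_alt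
proof (intro conjI allI impI bounded_linear_scaleR_left)
  fix \<epsilon> :: real assume \<epsilon>: "\<epsilon> > 0"
  have c: "continuous_on K (\<lambda>x. f' x s)"
  proof -
    have "continuous_on K (\<lambda>x. (x, s))" by (intro continuous_intros)
    moreover have "(\<lambda>x. (x, s)) ` K \<subseteq> K \<times> {a..b}" using s by auto
    ultimately show ?thesis using continuous_on_compose2[OF f', of K "\<lambda>x. (x, s)"] by simp
  qed
  define m where "m = measure lborel K + 1"
  have m: "m > 0" "measure lborel K \<le> m" by (simp_all add: m_def add_nonneg_pos)
  have "uniformly_continuous_on (K \<times> {a..b}) (\<lambda>p. f' (fst p) (snd p))"
    by (intro compact_uniformly_continuous f' compact_Times K compact_Icc)
  then obtain d' where d': "d' > 0" "\<forall>p\<in>K \<times> {a..b}. \<forall>q\<in>K \<times> {a..b}. dist q p < d' \<longrightarrow>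
      dist (f' (fst q) (snd q)) (f' (fst p) (snd p)) < \<epsilon> / m"
    unfolding uniformly_continuous_on_def using divide_pos_pos[OF \<epsilon> m(1)] by meson
  have "norm ((LINT x:K|lborel. f x r) - (LINT x:K|lborel. f x s) - (r - s) *\<^sub>R (LINT x:K|lborel. f' x s)) \<le> \<epsilon> * norm (r - s)"
    if r: "r \<in> {a..b}" "norm (r - s) < d'" for r
  proof -
    have near: "norm (f x r - f x s - (r - s) *\<^sub>R f' x s) \<le> (\<epsilon> / m) * norm (r - s)" if x: "x \<in> K" for x
    proof -
      let ?S = "closed_segment s r"
      have sub: "?S \<subseteq> {a..b}" using s r(1) by (auto simp: closed_segment_eq_real_ivl split: if_splits)
      have "norm ((f x r - r *\<^sub>R f' x s) - (f x s - s *\<^sub>R f' x s)) \<le> (\<epsilon> / m) * norm (r - s)"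
      proof (rule differentiable_bound[of ?S "\<lambda>q. f x q - q *\<^sub>R f' x s" "\<lambda>q h. h *\<^sub>R (f' x q - f' x s)"])
        fix q assume q: "q \<in> ?S"
        have "(f x has_vector_derivative f' x q) (at q within ?S)"
          using has_vector_derivative_within_subset[OF d[OF x] sub] q sub by auto
        then have "((\<lambda>q. f x q - q *\<^sub>R f' x s) has_vector_derivative f' x q - f' x s) (at q within ?S)"
          by (auto intro!: derivative_eq_intros)
        then show "((\<lambda>q. f x q - q *\<^sub>R f' x s) has_derivative (\<lambda>h. h *\<^sub>R (f' x q - f' x s))) (at q within ?S)"
          by (simp add: has_vector_derivative_def)
        have "norm (q - s) \<le> norm (r - s)" using segment_bound(1)[OF q] by (simp add: norm_minus_commute)
        then have "dist (x, q) (x, s) < d'" using r(2) by (simp add: dist_Pair_Pair dist_norm)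
        then have "norm (f' x q - f' x s) \<le> \<epsilon> / m"
          using d'(2)[rule_format, of "(x, s)" "(x, q)"] x s q sub by (auto simp: dist_norm)
        then show "onorm (\<lambda>h. h *\<^sub>R (f' x q - f' x s)) \<le> \<epsilon> / m"
          by (intro onorm_le) (simp add: mult.commute[of "\<epsilon> / m"] mult_left_mono del: times_divide_eq_right times_divide_eq_left)
      qed auto
      then show ?thesis by (simp add: algebra_simps)
    qed
    have "(LINT x:K|lborel. f x r) - (LINT x:K|lborel. f x s) - (r - s) *\<^sub>R (LINT x:K|lborel. f' x s)
      = (LINT x:K|lborel. f x r - f x s - (r - s) *\<^sub>R f' x s)"
      unfolding set_integral_scaleR_right[symmetric]
      by (subst set_integral_diff_compact, (intro K continuous_intros f r s c)+)+ simp
    also have "norm \<dots> \<le> ((\<epsilon> / m) * norm (r - s)) * measure lborel K"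
      by (rule norm_set_integral_le[OF K _ near]) (intro continuous_intros f r s c)
    also have "\<dots> \<le> ((\<epsilon> / m) * norm (r - s)) * m"
      using \<epsilon> m by (intro mult_left_mono) auto
    also have "\<dots> = \<epsilon> * norm (r - s)" using m by simp
    finally show ?thesis .
  qed
  then show "\<exists>d>0. \<forall>r\<in>{a..b}. norm (r - s) < d \<longrightarrow>
     norm ((LINT x:K|lborel. f x r) - (LINT x:K|lborel. f x s) - (r - s) *\<^sub>R (LINT x:K|lborel. f' x s)) \<le> \<epsilon> * norm (r - s)"
    using d'(1) by blast
qed

section \<open>Translation invariance and integration by parts\<close>

lemma integral_translate_lborel:
  fixes w :: "'a::euclidean_space \<Rightarrow> 'b::{banach, second_countable_topology}"
  assumes "w \<in> borel_measurable borel"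
  shows "(LINT y|lborel. w (c + y)) = (LINT y|lborel. w y)"
proof -
  have "(LINT y|lborel. w y) = (LINT y|distr lborel borel ((+) c). w y)" by (simp add: lborel_distr_plus)
  also have "\<dots> = (LINT y|lborel. w (c + y))" by (rule integral_distr) (use assms in auto)
  finally show ?thesis by simp
qed

text \<open>Translation invariance makes the integral of \<open>w (y + h e\<^sub>i)\<close> independent of \<open>h\<close>;
  differentiating in \<open>h\<close> gives the divergence theorem without iterated integrals.\<close>

lemma set_integral_partial_zero:
  fixes w :: "real^'n::finite \<Rightarrow> complex"
  assumes d: "\<And>y. ((\<lambda>h. w (y + h *\<^sub>R axis i 1)) has_vector_derivative w' y) (at 0)"
    and w: "continuous_on UNIV w" and w': "continuous_on UNIV w'"
    and supp: "\<And>y. norm y > r \<Longrightarrow> w y = 0"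
  shows "(LINT y:cball 0 (r + 1)|lborel. w' y) = 0"
proof -
  let ?e = "axis i 1 :: real^'n"
  let ?B = "cball 0 (r + 1) :: (real^'n) set"
  \<comment> \<open>The margin 1 in the radius ensures that for \<open>h\<close> in
    \<open>{-1..1}\<close> the shifted function is still supported in the ball, so that g is the
    integral over the whole space.\<close>
  define g where "g h = (LINT y:?B|lborel. w (y + h *\<^sub>R ?e))" for h
  have "(g has_vector_derivative (LINT y:?B|lborel. w' (y + 0 *\<^sub>R ?e))) (at 0 within {-1..1})"
    unfolding g_def
  proof (rule has_vector_derivative_set_integral)
    show "continuous_on ?B (\<lambda>y. w (y + s *\<^sub>R ?e))" for s
      by (rule continuous_on_compose2[OF w]) (auto intro!: continuous_intros)
    show "continuous_on (?B \<times> {-1..1}) (\<lambda>p. w' (fst p + snd p *\<^sub>R ?e))"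
      by (rule continuous_on_compose2[OF w']) (auto intro!: continuous_intros)
    fix y and s :: real
    have "((\<lambda>h. h - s) has_vector_derivative 1) (at s within {-1..1})"
      by (auto intro!: derivative_eq_intros)
    moreover have "((\<lambda>h. w ((y + s *\<^sub>R ?e) + h *\<^sub>R ?e)) has_vector_derivative w' (y + s *\<^sub>R ?e)) (at (s - s) within (\<lambda>h. h - s) ` {-1..1})"
      using d[of "y + s *\<^sub>R ?e"] by (simp add: has_vector_derivative_at_within)
    ultimately have "((\<lambda>h. w ((y + s *\<^sub>R ?e) + h *\<^sub>R ?e)) \<circ> (\<lambda>h. h - s) has_vector_derivative 1 *\<^sub>R w' (y + s *\<^sub>R ?e)) (at s within {-1..1})"
      by (rule vector_diff_chain_within)
    then show "((\<lambda>h. w (y + h *\<^sub>R ?e)) has_vector_derivative w' (y + s *\<^sub>R ?e)) (at s within {-1..1})"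
      by (simp add: o_def algebra_simps)
  qed auto
  moreover have "g h = (LINT y|lborel. w y)" if h: "h \<in> {-1..1}" for h
  proof -
    have "indicator ?B y *\<^sub>R w (y + h *\<^sub>R ?e) = w (h *\<^sub>R ?e + y)" for y
    proof (cases "y \<in> ?B")
      case False
      have "norm (h *\<^sub>R ?e) \<le> 1" using h by (auto simp: norm_axis_1)
      moreover have "norm y \<le> norm (h *\<^sub>R ?e + y) + norm (h *\<^sub>R ?e)"
        by (metis add.commute add_diff_cancel_left' norm_triangle_sub norm_minus_commute norm_triangle_ineq4 add_diff_cancel_right')
      ultimately have "norm (h *\<^sub>R ?e + y) > r" using False by auto
      then show ?thesis using False supp by simp
    qed (simp add: add.commute)
    then have "g h = (LINT y|lborel. w (h *\<^sub>R ?e + y))" by (simp add: g_def set_lebesgue_integral_def)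
    also have "\<dots> = (LINT y|lborel. w y)"
      by (rule integral_translate_lborel) (use w in \<open>simp add: borel_measurable_continuous_onI\<close>)
    finally show ?thesis .
  qed
  then have "(g has_vector_derivative 0) (at 0 within {-1..1})"
    by (intro has_vector_derivative_transform[OF _ _ has_vector_derivative_const[of "LINT y|lborel. w y"]]) auto
  ultimately show ?thesis
    using vector_derivative_unique_within_closed_interval[of "-1" 1 0 g] by (simp add: cbox_interval)
qed

section \<open>The energy estimate\<close>

text \<open>The hypothesis for all \<open>\<mu>\<close> encodes \<open>E' \<le> 2 c sqrt E\<close>,
  because the minimum of \<open>\<mu> E + 1 / \<mu>\<close> is \<open>2 sqrt E\<close>. In this form
  Young's inequality can be applied under the integral and optimised afterwards. Adding
  \<open>\<delta>\<close> to E keeps the root differentiable where E vanishes.\<close>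

lemma sqrt_growth:
  fixes E :: "real \<Rightarrow> real"
  assumes E: "\<And>t. t \<in> {0..T} \<Longrightarrow> (E has_real_derivative E' t) (at t within {0..T})"
    and nonneg: "\<And>t. E t \<ge> 0" and c: "c \<ge> 0"
    and le: "\<And>t \<mu>. t \<in> {0..T} \<Longrightarrow> \<mu> > 0 \<Longrightarrow> E' t \<le> c * (\<mu> * E t + 1 / \<mu>)"
    and t: "t \<in> {0..T}"
  shows "sqrt (E t) \<le> sqrt (E 0) + c * t"
proof -
  have "sqrt (E t) \<le> sqrt (E 0) + c * t + e" if e: "e > 0" for e
  proof -
    define \<delta> where "\<delta> = e\<^sup>2"
    have \<delta>: "\<delta> > 0" using e by (simp add: \<delta>_def)
    define g where "g s = sqrt (E s + \<delta>) - c * s" for s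
    have "g t \<le> g 0"
    proof (rule nonincreasing_within[OF _ _ t])
      fix s assume s: "s \<in> {0..T}"
      have p: "E s + \<delta> > 0" using nonneg[of s] \<delta> by linarith
      define q where "q = sqrt (E s + \<delta>)"
      have q: "q > 0" "q * q = E s + \<delta>" using p by (auto simp: q_def)
      show "(g has_real_derivative (E' s / (2 * q) - c)) (at s within {0..T})"
        unfolding g_def q_def
        by (rule derivative_eq_intros E[OF s] refl | use p in \<open>simp add: field_simps\<close>)+
      have "E' s \<le> c * ((1 / q) * E s + 1 / (1 / q))" by (rule le[OF s]) (use q in simp)
      also have "\<dots> \<le> c * (2 * q)"
      proof (rule mult_left_mono[OF _ c])
        have "E s \<le> q * q" using q \<delta> by simp
        then have "E s / q \<le> q" using q by (simp add: divide_le_eq)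
        then show "(1 / q) * E s + 1 / (1 / q) \<le> 2 * q" by simp
      qed
      finally show "E' s / (2 * q) - c \<le> 0" using q by (simp add: divide_le_eq)
    qed
    then have "sqrt (E t + \<delta>) \<le> sqrt (E 0 + \<delta>) + c * t" by (simp add: g_def)
    moreover have "sqrt (E t) \<le> sqrt (E t + \<delta>)" using \<delta> by (intro real_sqrt_le_mono) simp
    moreover have "sqrt \<delta> = e" using e by (simp add: \<delta>_def)
    moreover have "sqrt (E 0 + \<delta>) \<le> sqrt (E 0) + sqrt \<delta>"
      using nonneg \<delta> by (intro sqrt_add_le_add_sqrt) auto
    ultimately show ?thesis by linarith
  qed
  then show ?thesis by (rule field_le_epsilon)
qed

lemma schrodinger_derivatives:
  assumes "schrodinger_solution V uin \<epsilon> T u" "t \<in> {0..T}"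
  shows "((\<lambda>h. u t (y + h *\<^sub>R axis i 1)) has_vector_derivative partial i (u t) y) (at 0)"
    and "((\<lambda>h. partial i (u t) (y + h *\<^sub>R axis i 1)) has_vector_derivative partial i (partial i (u t)) y) (at 0)"
proof -
  have d: "foldr partial is (u t) differentiable (at y)" if "length is \<le> 1" for "is"
    using assms that unfolding schrodinger_solution_def by blast
  show "((\<lambda>h. u t (y + h *\<^sub>R axis i 1)) has_vector_derivative partial i (u t) y) (at 0)"
    using differentiable_imp_partial[of "u t" y 0 i] d[of "[]"] by simp
  show "((\<lambda>h. partial i (u t) (y + h *\<^sub>R axis i 1)) has_vector_derivative partial i (partial i (u t)) y) (at 0)"
    using differentiable_imp_partial[of "partial i (u t)" y 0 i] d[of "[i]"] by simp
qed

lemma schrodinger_continuous: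
  assumes "schrodinger_solution V uin \<epsilon> T u"
  shows "continuous_on ({0..T} \<times> UNIV) (\<lambda>p. u (fst p) (snd p))"
    and "continuous_on ({0..T} \<times> UNIV) (\<lambda>p. partial i (u (fst p)) (snd p))"
    and "continuous_on ({0..T} \<times> UNIV) (\<lambda>p. partial i (partial i (u (fst p))) (snd p))"
    and "continuous_on ({0..T} \<times> UNIV) (\<lambda>p. vector_derivative (\<lambda>s. u s (snd p)) (at (fst p) within {0..T}))"
proof -
  have d: "continuous_on ({0..T} \<times> UNIV) (\<lambda>p. foldr partial is (u (fst p)) (snd p))" if "length is \<le> 2" for "is"
    using assms that unfolding schrodinger_solution_def split_beta by blast
  show "continuous_on ({0..T} \<times> UNIV) (\<lambda>p. u (fst p) (snd p))" using d[of "[]"] by simp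
  show "continuous_on ({0..T} \<times> UNIV) (\<lambda>p. partial i (u (fst p)) (snd p))" using d[of "[i]"] by simp
  show "continuous_on ({0..T} \<times> UNIV) (\<lambda>p. partial i (partial i (u (fst p))) (snd p))" using d[of "[i,i]"] by simp
  show "continuous_on ({0..T} \<times> UNIV) (\<lambda>p. vector_derivative (\<lambda>s. u s (snd p)) (at (fst p) within {0..T}))"
    using assms unfolding schrodinger_solution_def split_beta by blast
qed

text \<open>Once both time derivatives are expressed through the equations, the potential terms
  cancel because V is real. What is left is the residual tested against the error, and second-order
  terms which, summed over the coordinates, form a divergence up to a real quantity.\<close>

lemma energy_pointwise:
  fixes u ut ps pt R lu lp :: complex and V \<epsilon> :: real
  assumes \<epsilon>: "\<epsilon> > 0"
    and u: "- \<i> * of_real \<epsilon> * ut - of_real (\<epsilon>\<^sup>2 / 2) * lu + of_real V * u = R"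
    and ps: "- \<i> * of_real \<epsilon> * pt - of_real (\<epsilon>\<^sup>2 / 2) * lp + of_real V * ps = 0"
  shows "2 * Re (cnj u * ut) - 2 * Re (cnj ut * ps + cnj u * pt) =
    (2 / \<epsilon>) * Re (\<i> * cnj (u - ps) * R) - \<epsilon> * Im (cnj u * lu - cnj ps * lu + u * cnj lp)"
proof -
  define \<kappa> where "\<kappa> = 1 / \<epsilon>"
  have inv: "\<i> * of_real \<kappa> * (- \<i> * of_real \<epsilon> * w) = w" for w :: complex
    using \<epsilon> by (simp add: \<kappa>_def)
  have half: "of_real \<kappa> * of_real (\<epsilon>\<^sup>2 / 2) = (of_real (\<epsilon> / 2) :: complex)"
    unfolding of_real_mult[symmetric] using \<epsilon> by (simp add: \<kappa>_def power2_eq_square)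
  have expand: "\<i> * of_real \<kappa> * (R' + of_real (\<epsilon>\<^sup>2 / 2) * l - of_real V * w)
      = \<i> * of_real \<kappa> * R' + \<i> * of_real (\<epsilon> / 2) * l - \<i> * of_real (\<kappa> * V) * w" for R' l w :: complex
    unfolding half[symmetric] by (simp add: algebra_simps)
  have "- \<i> * of_real \<epsilon> * ut = R + of_real (\<epsilon>\<^sup>2 / 2) * lu - of_real V * u" using u by (simp add: algebra_simps)
  then have ut: "ut = \<i> * of_real \<kappa> * R + \<i> * of_real (\<epsilon> / 2) * lu - \<i> * of_real (\<kappa> * V) * u"
    using inv[of ut] expand[of R lu u] by simp
  have "- \<i> * of_real \<epsilon> * pt = 0 + of_real (\<epsilon>\<^sup>2 / 2) * lp - of_real V * ps" using ps by (simp add: algebra_simps)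
  then have pt: "pt = \<i> * of_real (\<epsilon> / 2) * lp - \<i> * of_real (\<kappa> * V) * ps"
    using inv[of pt] expand[of 0 lp ps] by simp
  have "2 / \<epsilon> = 2 * \<kappa>" by (simp add: \<kappa>_def)
  then show ?thesis unfolding ut pt by (simp add: algebra_simps) (simp add: field_simps)
qed

lemma norm_diff_square: "(norm (a - b :: complex))\<^sup>2 = (norm b)\<^sup>2 + ((norm a)\<^sup>2 - 2 * Re (cnj a * b))"
  unfolding cmod_power2 by (simp add: power2_eq_square algebra_simps)

lemma power_norm_hvd:
  fixes u p :: "real \<Rightarrow> complex"
  assumes "(u has_vector_derivative u') (at t within S)" "(p has_vector_derivative p') (at t within S)"
  shows "((\<lambda>s. (norm (u s))\<^sup>2 - 2 * Re (cnj (u s) * p s)) has_vector_derivative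
    2 * Re (cnj (u t) * u') - 2 * Re (cnj u' * p t + cnj (u t) * p')) (at t within S)"
proof -
  have c: "((\<lambda>s. cnj (u s)) has_vector_derivative cnj u') (at t within S)"
    by (rule bounded_linear.has_vector_derivative[OF bounded_linear_cnj assms(1)])
  have "((\<lambda>s. Re (cnj (u s) * u s)) has_vector_derivative Re (cnj (u t) * u' + cnj u' * u t)) (at t within S)"
    by (rule bounded_linear.has_vector_derivative[OF bounded_linear_Re has_vector_derivative_mult[OF c assms(1)]])
  moreover have "((\<lambda>s. Re (cnj (u s) * p s)) has_vector_derivative Re (cnj (u t) * p' + cnj u' * p t)) (at t within S)"
    by (rule bounded_linear.has_vector_derivative[OF bounded_linear_Re has_vector_derivative_mult[OF c assms(2)]])
  ultimately have 3: "((\<lambda>s. Re (cnj (u s) * u s) - 2 * Re (cnj (u s) * p s)) has_vector_derivative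
     Re (cnj (u t) * u' + cnj u' * u t) - 2 * Re (cnj (u t) * p' + cnj u' * p t)) (at t within S)"
    by (intro has_vector_derivative_diff bounded_linear.has_vector_derivative[OF bounded_linear_mult_right])
  have eq: "(\<lambda>s. (norm (u s))\<^sup>2 - 2 * Re (cnj (u s) * p s)) = (\<lambda>s. Re (cnj (u s) * u s) - 2 * Re (cnj (u s) * p s))"
    unfolding cmod_power2 by (simp add: power2_eq_square)
  show ?thesis unfolding eq by (rule has_vector_derivative_eq_rhs[OF 3]) (simp add: algebra_simps)
qed

text \<open>Nothing is known about the derivatives of \<open>\<psi>\<close> at infinity, so the
  square of the error is expanded: the norm of \<open>\<psi>\<close> is conserved, and the rest,
  \<open>G\<close>, vanishes outside the support of u. Only \<open>G\<close> is differentiated under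
  the integral, and every integration by parts has a compactly supported factor.\<close>

lemma energy_estimate:
  fixes u ut R :: "real \<Rightarrow> real^'n::finite \<Rightarrow> complex" and ui uii :: "'n \<Rightarrow> real \<Rightarrow> real^'n \<Rightarrow> complex"
  assumes T: "T > 0" and \<epsilon>: "\<epsilon> > 0" and r: "r \<ge> 0"
    and sol: "schrodinger_solution V uin \<epsilon> T \<psi>"
    and supp: "\<And>t y. t \<in> {0..T} \<Longrightarrow> norm y > r \<Longrightarrow> u t y = 0"
    and ut: "\<And>t y. t \<in> {0..T} \<Longrightarrow> ((\<lambda>s. u s y) has_vector_derivative ut t y) (at t within {0..T})"
    and ui: "\<And>t y i. t \<in> {0..T} \<Longrightarrow> ((\<lambda>h. u t (y + h *\<^sub>R axis i 1)) has_vector_derivative ui i t y) (at 0)"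
    and uii: "\<And>t y i. t \<in> {0..T} \<Longrightarrow> ((\<lambda>h. ui i t (y + h *\<^sub>R axis i 1)) has_vector_derivative uii i t y) (at 0)"
    and cu: "continuous_on ({0..T} \<times> UNIV) (\<lambda>p. u (fst p) (snd p))"
    and cut: "continuous_on ({0..T} \<times> UNIV) (\<lambda>p. ut (fst p) (snd p))"
    and cui: "\<And>i. continuous_on ({0..T} \<times> UNIV) (\<lambda>p. ui i (fst p) (snd p))"
    and cuii: "\<And>i. continuous_on ({0..T} \<times> UNIV) (\<lambda>p. uii i (fst p) (snd p))"
    and residual: "\<And>t y. t \<in> {0..T} \<Longrightarrow> - \<i> * of_real \<epsilon> * ut t y - of_real (\<epsilon>\<^sup>2 / 2) * (\<Sum>i\<in>UNIV. uii i t y)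
      + of_real (V y) * u t y = R t y"
    and cR: "continuous_on ({0..T} \<times> UNIV) (\<lambda>p. R (fst p) (snd p))"
    and q: "q > 0" and bound: "\<And>t. t \<in> {0..T} \<Longrightarrow> (LINT y:cball 0 (r + 1)|lborel. (norm (R t y))\<^sup>2) \<le> q\<^sup>2"
    and t: "t \<in> {0..T}"
  shows "square_integrable (\<lambda>y. u t y - \<psi> t y)"
    and "L2_norm (\<lambda>y. u t y - \<psi> t y) \<le> L2_norm (\<lambda>y. u 0 y - \<psi> 0 y) + q / \<epsilon> * t"
proof -
  let ?B = "cball 0 (r + 1) :: (real^'n) set"
  define pt where "pt t y = vector_derivative (\<lambda>s. \<psi> s y) (at t within {0..T})" for t y
  define G where "G t y = (norm (u t y))\<^sup>2 - 2 * Re (cnj (u t y) * \<psi> t y)" for t y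
  define G' where "G' t y = 2 * Re (cnj (u t y) * ut t y) - 2 * Re (cnj (ut t y) * \<psi> t y + cnj (u t y) * pt t y)" for t y
  define n0 where "n0 = (L2_norm uin)\<^sup>2"
  have slice: "continuous_on S (\<lambda>y. f t y)" if "continuous_on ({0..T} \<times> UNIV) (\<lambda>p. f (fst p) (snd p))" "t \<in> {0..T}"
    for f :: "real \<Rightarrow> real^'n \<Rightarrow> 'c::topological_space" and t S
  proof -
    have "continuous_on S (\<lambda>y. (t, y))" by (intro continuous_intros)
    moreover have "(\<lambda>y. (t, y)) ` S \<subseteq> {0..T} \<times> UNIV" using that(2) by auto
    ultimately show ?thesis using continuous_on_compose2[OF that(1), of S "\<lambda>y. (t, y)"] by simp
  qed
  note cps = schrodinger_continuous[OF sol]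
  have cpt: "continuous_on ({0..T} \<times> UNIV) (\<lambda>p. pt (fst p) (snd p))" unfolding pt_def by (rule cps)
  have cG: "continuous_on ({0..T} \<times> UNIV) (\<lambda>p. G (fst p) (snd p))"
    unfolding G_def by (intro continuous_intros cu cps(1))
  have cG': "continuous_on ({0..T} \<times> UNIV) (\<lambda>p. G' (fst p) (snd p))"
    unfolding G'_def by (intro continuous_intros cu cps(1) cpt cut)
  have dps: "((\<lambda>s. \<psi> s y) has_vector_derivative pt t y) (at t within {0..T})" if "t \<in> {0..T}" for t y
  proof -
    have "(\<lambda>s. \<psi> s y) differentiable (at t within {0..T})"
      using sol that unfolding schrodinger_solution_def by blast
    then show ?thesis unfolding pt_def by (simp add: vector_derivative_works)
  qed
  have sq: "integrable lborel (\<lambda>y. (norm (\<psi> t y))\<^sup>2)" "(LINT y|lborel. (norm (\<psi> t y))\<^sup>2) = n0"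
    "\<psi> t \<in> borel_measurable lborel" if "t \<in> {0..T}" for t
  proof -
    have *: "square_integrable (\<psi> t)" "L2_norm (\<psi> t) = L2_norm uin"
      using sol that unfolding schrodinger_solution_def by blast+
    then show 1: "integrable lborel (\<lambda>y. (norm (\<psi> t y))\<^sup>2)" and "\<psi> t \<in> borel_measurable lborel"
      unfolding square_integrable_def by blast+
    have "(L2_norm (\<psi> t))\<^sup>2 = (LINT y|lborel. (norm (\<psi> t y))\<^sup>2)"
      unfolding L2_norm_def by (rule real_sqrt_pow2) (auto intro: integral_nonneg_AE)
    then show "(LINT y|lborel. (norm (\<psi> t y))\<^sup>2) = n0" using *(2) by (simp add: n0_def)
  qed
  have split: "(norm (u t y - \<psi> t y))\<^sup>2 = (norm (\<psi> t y))\<^sup>2 + indicator ?B y *\<^sub>R G t y" if "t \<in> {0..T}" for t y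
  proof (cases "y \<in> ?B")
    case True
    then show ?thesis using norm_diff_square[of "u t y" "\<psi> t y"] by (simp add: G_def)
  next
    case False
    then have "u t y = 0" using supp[OF that, of y] by simp
    then show ?thesis using False by simp
  qed
  have Gint: "set_integrable lborel ?B (G t)" if "t \<in> {0..T}" for t
    by (rule integrable_continuous_compact[OF compact_cball slice[OF cG that]])
  have int: "integrable lborel (\<lambda>y. (norm (u t y - \<psi> t y))\<^sup>2)" if "t \<in> {0..T}" for t
    unfolding split[OF that] using sq(1)[OF that] Gint[OF that] by (auto simp: set_integrable_def)
  have umeas: "u t \<in> borel_measurable lborel" if "t \<in> {0..T}" for t
    using borel_measurable_continuous_onI[OF slice[OF cu that]] by simp
  show "square_integrable (\<lambda>y. u t y - \<psi> t y)"
    unfolding square_integrable_def using int[OF t] umeas[OF t] sq(3)[OF t] by auto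
  define E where "E t = (if t \<in> {0..T} then LINT y|lborel. (norm (u t y - \<psi> t y))\<^sup>2 else 0)" for t
  have Eeq: "E t = n0 + (LINT y:?B|lborel. G t y)" if "t \<in> {0..T}" for t
    unfolding E_def split[OF that] using that sq[OF that] Gint[OF that]
    by (simp add: set_lebesgue_integral_def set_integrable_def)
  have Enn: "E t \<ge> 0" for t unfolding E_def by (auto intro: integral_nonneg_AE)
  have dE: "(E has_real_derivative (LINT y:?B|lborel. G' t y)) (at t within {0..T})" if t: "t \<in> {0..T}" for t
  proof -
    have "((\<lambda>s. LINT y:?B|lborel. G s y) has_vector_derivative (LINT y:?B|lborel. G' t y)) (at t within {0..T})"
    proof (rule has_vector_derivative_set_integral)
      show "continuous_on ?B (\<lambda>y. G s y)" if "s \<in> {0..T}" for s by (rule slice[OF cG that])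
      show "((\<lambda>s. G s y) has_vector_derivative G' s y) (at s within {0..T})" if "s \<in> {0..T}" for y s
        unfolding G_def G'_def by (rule power_norm_hvd[OF ut[OF that] dps[OF that]])
      show "continuous_on (?B \<times> {0..T}) (\<lambda>p. G' (snd p) (fst p))"
      proof -
        have "continuous_on (?B \<times> {0..T}) (\<lambda>p. (snd p, fst p))" by (intro continuous_intros)
        moreover have "(\<lambda>p. (snd p, fst p)) ` (?B \<times> {0..T}) \<subseteq> {0..T} \<times> UNIV" by auto
        ultimately show ?thesis using continuous_on_compose2[OF cG', of _ "\<lambda>p. (snd p, fst p)"] by simp
      qed
    qed (use t in auto)
    then have "((\<lambda>s. n0 + (LINT y:?B|lborel. G s y)) has_vector_derivative (LINT y:?B|lborel. G' t y)) (at t within {0..T})"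
      by (auto intro!: derivative_eq_intros)
    then have "(E has_vector_derivative (LINT y:?B|lborel. G' t y)) (at t within {0..T})"
      by (rule has_vector_derivative_transform[OF t, rotated]) (simp add: Eeq)
    then show ?thesis by (simp add: has_real_derivative_iff_has_vector_derivative)
  qed
  have le: "(LINT y:?B|lborel. G' t y) \<le> (q / \<epsilon>) * (\<mu> * E t + 1 / \<mu>)" if t: "t \<in> {0..T}" and \<mu>: "\<mu> > 0" for t \<mu>
  proof -
    \<comment> \<open>The derivative in direction i of the flux \<open>?w\<close> below; the
      products of first derivatives of u and \<open>\<psi>\<close> cancel in it. The summand
      \<open>cnj (ui i t y) * ui i t y\<close> is real, so that the imaginary part, summed over i,
      is the second-order term of \<open>energy_pointwise\<close>.\<close>
    define D where "D i y = cnj (ui i t y) * ui i t y + cnj (u t y) * uii i t y - cnj (\<psi> t y) * uii i t y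
        + u t y * cnj (partial i (partial i (\<psi> t)) y)" for i y
    have c: "continuous_on S (u t)" "continuous_on S (ut t)" "continuous_on S (ui i t)" "continuous_on S (uii i t)"
      "continuous_on S (\<psi> t)" "continuous_on S (partial i (\<psi> t))" "continuous_on S (partial i (partial i (\<psi> t)))"
      "continuous_on S (R t)" "continuous_on S (G' t)" for S i
      using slice[OF cu t] slice[OF cut t] slice[OF cui t] slice[OF cuii t] slice[OF cps(1) t]
        slice[of "\<lambda>t. partial i (\<psi> t)", OF cps(2) t] slice[of "\<lambda>t. partial i (partial i (\<psi> t))", OF cps(3) t]
        slice[OF cR t] slice[OF cG' t] by auto
    have cD: "continuous_on S (D i)" for S i
      unfolding D_def by (intro continuous_intros c)
    have D0: "(LINT y:?B|lborel. D i y) = 0" for i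
    proof (rule set_integral_partial_zero)
      let ?w = "\<lambda>y. cnj (u t y) * ui i t y - cnj (\<psi> t y) * ui i t y + u t y * cnj (partial i (\<psi> t) y)"
      show "continuous_on UNIV ?w" by (intro continuous_intros c)
      show "continuous_on UNIV (D i)" by (rule cD)
      fix y
      note d = ui[OF t, of y i] uii[OF t, of i y] schrodinger_derivatives(1)[OF sol t, of y i] schrodinger_derivatives(2)[OF sol t, of i y]
      note dc = bounded_linear.has_vector_derivative[OF bounded_linear_cnj]
      show "((\<lambda>h. ?w (y + h *\<^sub>R axis i 1)) has_vector_derivative D i y) (at 0)"
        unfolding D_def
        by (rule has_vector_derivative_eq_rhs[OF has_vector_derivative_add[OF has_vector_derivative_diff[OF
           has_vector_derivative_mult[OF dc[OF d(1)] d(2)] has_vector_derivative_mult[OF dc[OF d(3)] d(2)]]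
           has_vector_derivative_mult[OF d(1) dc[OF d(4)]]]]) (simp add: algebra_simps)
      assume y: "norm y > r"
      have u0: "u t y = 0" by (rule supp[OF t y])
      \<comment> \<open>Beyond radius r the function u vanishes along a whole piece of the line, so
        its derivative vanishes too and the flux has bounded support.\<close>
      have ev: "eventually (\<lambda>h. u t (y + h *\<^sub>R axis i 1) = 0) (nhds 0)"
      proof -
        have "((\<lambda>h. norm (y + h *\<^sub>R axis i (1::real))) \<longlongrightarrow> norm y) (nhds 0)"
          by (intro tendsto_eq_intros) (auto intro!: tendsto_eq_intros filterlim_ident)
        from order_tendstoD(1)[OF this y] show ?thesis
          by eventually_elim (rule supp[OF t])
      qed
      have "((\<lambda>h. 0) has_vector_derivative ui i t y) (at 0)"
        using ui[OF t, of y i] ev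
        by (subst (asm) has_vector_derivative_cong_ev[where g="\<lambda>_. 0"]) (auto elim: eventually_mono simp: u0)
      then have "ui i t y = 0" using vector_derivative_unique_at has_vector_derivative_const by blast
      then show "?w y = 0" using u0 by simp
    qed
    have G'eq: "G' t y = (2 / \<epsilon>) * Re (\<i> * cnj (u t y - \<psi> t y) * R t y) - \<epsilon> * (\<Sum>i\<in>UNIV. Im (D i y))" for y
    proof -
      have ps: "- \<i> * of_real \<epsilon> * pt t y - of_real (\<epsilon>\<^sup>2 / 2) * (\<Sum>i\<in>UNIV. partial i (partial i (\<psi> t)) y) + of_real (V y) * \<psi> t y = 0"
        using sol t unfolding schrodinger_solution_def pt_def laplacian_def by blast
      have "(\<Sum>i\<in>UNIV. D i y) = (\<Sum>i\<in>UNIV. cnj (ui i t y) * ui i t y) + (cnj (u t y) * (\<Sum>i\<in>UNIV. uii i t y)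
         - cnj (\<psi> t y) * (\<Sum>i\<in>UNIV. uii i t y) + u t y * cnj (\<Sum>i\<in>UNIV. partial i (partial i (\<psi> t)) y))"
        unfolding D_def sum.distrib sum_subtractf sum_distrib_left cnj_sum by simp
      moreover have "Im (\<Sum>i\<in>UNIV. cnj (ui i t y) * ui i t y) = 0" by (simp add: Im_sum)
      ultimately have "Im (\<Sum>i\<in>UNIV. D i y) = Im (cnj (u t y) * (\<Sum>i\<in>UNIV. uii i t y) - cnj (\<psi> t y) * (\<Sum>i\<in>UNIV. uii i t y)
         + u t y * cnj (\<Sum>i\<in>UNIV. partial i (partial i (\<psi> t)) y))"
        by (simp only: plus_complex.sel add_0)
      then show ?thesis
        unfolding G'_def using energy_pointwise[OF \<epsilon> residual[OF t] ps] by (simp only: Im_sum)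
    qed
    have "(LINT y:?B|lborel. G' t y) = (LINT y:?B|lborel. (2 / \<epsilon>) * Re (\<i> * cnj (u t y - \<psi> t y) * R t y))
       - (LINT y:?B|lborel. \<epsilon> * (\<Sum>i\<in>UNIV. Im (D i y)))"
      unfolding G'eq by (rule set_integral_diff_compact[symmetric]) (intro continuous_intros c cD compact_cball)+
    also have "(LINT y:?B|lborel. \<epsilon> * (\<Sum>i\<in>UNIV. Im (D i y))) = 0"
    proof -
      have "(LINT y:?B|lborel. Im (D i y)) = 0" for i
      proof -
        have "set_integrable lborel ?B (D i)" by (rule integrable_continuous_compact[OF compact_cball cD])
        then have "(LINT y:?B|lborel. Im (D i y)) = Im (LINT y:?B|lborel. D i y)"
          unfolding set_lebesgue_integral_def set_integrable_def
          using integral_bounded_linear[OF bounded_linear_Im, of lborel "\<lambda>y. indicat_real ?B y *\<^sub>R D i y"] by simp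
        then show ?thesis using D0 by simp
      qed
      moreover have "(LINT y:?B|lborel. (\<Sum>i\<in>UNIV. Im (D i y))) = (\<Sum>i\<in>UNIV. LINT y:?B|lborel. Im (D i y))"
        unfolding set_lebesgue_integral_def scaleR_sum_right
        by (rule Bochner_Integration.integral_sum)
          (use integrable_continuous_compact[OF compact_cball continuous_on_Im[OF cD]] in \<open>simp add: set_integrable_def\<close>)
      ultimately show ?thesis by simp
    qed
    also have "(LINT y:?B|lborel. (2 / \<epsilon>) * Re (\<i> * cnj (u t y - \<psi> t y) * R t y)) - 0
       \<le> (LINT y:?B|lborel. (q / \<epsilon>) * (\<mu> * (norm (u t y - \<psi> t y))\<^sup>2) + (1 / (q * \<epsilon> * \<mu>)) * (norm (R t y))\<^sup>2)"
      unfolding diff_0_right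
    proof (rule set_integral_mono)
      fix y
      define a b where "a = norm (u t y - \<psi> t y)" and "b = norm (R t y)"
      have "Re (\<i> * cnj (u t y - \<psi> t y) * R t y) \<le> a * b"
        unfolding a_def b_def by (rule order.trans[OF complex_Re_le_cmod]) (simp add: norm_mult del: complex_cnj_diff)
      \<comment> \<open>Young's inequality with weight \<open>q * \<mu>\<close>: after integration
        the bound by the square of q for the residual makes both terms proportional to q.\<close>
      moreover have "2 * (a * b) \<le> q * \<mu> * a\<^sup>2 + b\<^sup>2 / (q * \<mu>)"
      proof -
        have "0 \<le> (q * \<mu> * a - b)\<^sup>2 / (q * \<mu>)" using q \<mu> by simp
        also have "\<dots> = q * \<mu> * a\<^sup>2 + b\<^sup>2 / (q * \<mu>) - 2 * (a * b)"
          using q \<mu> by (simp add: power2_eq_square field_simps)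
        finally show ?thesis by simp
      qed
      ultimately have "2 * Re (\<i> * cnj (u t y - \<psi> t y) * R t y) / \<epsilon> \<le> (q * \<mu> * a\<^sup>2 + b\<^sup>2 / (q * \<mu>)) / \<epsilon>"
        using \<epsilon> by (intro divide_right_mono) auto
      then show "(2 / \<epsilon>) * Re (\<i> * cnj (u t y - \<psi> t y) * R t y) \<le> (q / \<epsilon>) * (\<mu> * (norm (u t y - \<psi> t y))\<^sup>2) + (1 / (q * \<epsilon> * \<mu>)) * (norm (R t y))\<^sup>2"
        unfolding a_def[symmetric] b_def[symmetric] by (simp add: add_divide_distrib mult_ac)
    qed (intro integrable_continuous_compact continuous_intros c compact_cball)+
    also have "\<dots> = (q / \<epsilon>) * (\<mu> * (LINT y:?B|lborel. (norm (u t y - \<psi> t y))\<^sup>2)) + (1 / (q * \<epsilon> * \<mu>)) * (LINT y:?B|lborel. (norm (R t y))\<^sup>2)"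
      by (subst set_integral_add(2)) (use q \<epsilon> \<mu> in \<open>auto intro!: integrable_continuous_compact continuous_intros c\<close>)
    also have "\<dots> \<le> (q / \<epsilon>) * (\<mu> * E t) + (1 / (q * \<epsilon> * \<mu>)) * q\<^sup>2"
    proof (intro add_mono mult_left_mono bound t)
      show "(LINT y:?B|lborel. (norm (u t y - \<psi> t y))\<^sup>2) \<le> E t"
        unfolding E_def using t int[OF t]
        by (auto simp: set_lebesgue_integral_def indicator_def intro!: integral_mono' )
    qed (use q \<epsilon> \<mu> in auto)
    also have "\<dots> = (q / \<epsilon>) * (\<mu> * E t + 1 / \<mu>)"
      using q \<epsilon> \<mu> by (simp add: power2_eq_square field_simps)
    finally show ?thesis .
  qed
  have "sqrt (E t) \<le> sqrt (E 0) + (q / \<epsilon>) * t"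
    by (rule sqrt_growth[OF dE Enn _ le t]) (use q \<epsilon> in auto)
  then show "L2_norm (\<lambda>y. u t y - \<psi> t y) \<le> L2_norm (\<lambda>y. u 0 y - \<psi> 0 y) + q / \<epsilon> * t"
    using t T by (simp add: E_def L2_norm_def)
qed

section \<open>Gaussian integrals\<close>

text \<open>Equal to \<open>(pi / c) powr (n / 2)\<close> in dimension n for positive c; the type
  token carries the dimension.\<close>

definition gauss_int :: "'a::euclidean_space itself \<Rightarrow> real \<Rightarrow> real" where
  "gauss_int _ c = (LINT y::'a|lborel. exp (- c * (norm y)\<^sup>2))"

text \<open>A multiple of the normal density with variance \<open>1 / (2 * c)\<close>.\<close>

lemma gauss_1d_finite:
  assumes "c > 0"
  shows "(\<integral>\<^sup>+ x. ennreal (exp (- c * (x::real)\<^sup>2)) \<partial>lborel) < \<infinity>"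
proof -
  define \<sigma> where "\<sigma> = sqrt (1 / (2 * c))"
  have \<sigma>: "\<sigma> > 0" "2 * \<sigma>\<^sup>2 = 1 / c" using assms by (auto simp: \<sigma>_def)
  have "exp (- c * x\<^sup>2) = sqrt (2 * pi * \<sigma>\<^sup>2) * normal_density 0 \<sigma> x" for x
    using \<sigma> assms by (simp add: normal_density_def)
  then have "integrable lborel (\<lambda>x. exp (- c * x\<^sup>2))" by (simp add: integrable_normal_density[OF \<sigma>(1)])
  then show ?thesis unfolding integrable_iff_bounded by simp
qed

text \<open>The Gaussian is the product of its one-dimensional factors along the basis, and the
  integral of such a product factorises.\<close>

lemma integrable_gauss:
  assumes c: "c > 0"
  shows "integrable lborel (\<lambda>y::'a::euclidean_space. exp (- c * (norm y)\<^sup>2))"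
proof (rule integrableI_bounded)
  have "(norm y)\<^sup>2 = (\<Sum>b\<in>Basis. (y \<bullet> b)\<^sup>2)" for y :: 'a
    unfolding power2_norm_eq_inner by (subst euclidean_inner) (simp add: power2_eq_square)
  then have "exp (- c * (norm y)\<^sup>2) = (\<Prod>b\<in>Basis. exp (- c * (y \<bullet> b)\<^sup>2))" for y :: 'a
    by (simp only: sum_distrib_left exp_sum[OF finite_Basis])
  then have "ennreal (norm (exp (- c * (norm y)\<^sup>2))) = (\<Prod>b\<in>Basis. ennreal (exp (- c * (y \<bullet> b)\<^sup>2)))" for y :: 'a
    unfolding real_norm_def abs_exp_cancel by (simp only: prod_ennreal exp_ge_zero)
  then have "(\<integral>\<^sup>+ y. ennreal (norm (exp (- c * (norm (y::'a))\<^sup>2))) \<partial>lborel)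
      = (\<integral>\<^sup>+ y. (\<Prod>b\<in>Basis. ennreal (exp (- c * ((y::'a) \<bullet> b)\<^sup>2))) \<partial>lborel)"
    by (simp only:)
  also have "\<dots> = (\<Prod>b\<in>(Basis::'a set). (\<integral>\<^sup>+ x. ennreal (exp (- c * x\<^sup>2)) \<partial>lborel))"
    by (rule nn_integral_lborel_prod) auto
  also have "\<dots> < \<infinity>"
    using gauss_1d_finite[OF c] by (simp add: power_less_top_ennreal)
  finally show "(\<integral>\<^sup>+ y. ennreal (norm (exp (- c * (norm (y::'a))\<^sup>2))) \<partial>lborel) < \<infinity>" .
qed simp

lemma gauss_int_pos:
  assumes "c > 0"
  shows "gauss_int TYPE('a::euclidean_space) c > 0"
proof -
  have "(LINT y:cball (0::'a) 1|lborel. exp (- c)) \<le> (LINT y::'a|lborel. exp (- c * (norm y)\<^sup>2))"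
    unfolding set_lebesgue_integral_def
  proof (rule Bochner_Integration.integral_mono)
    show "integrable lborel (\<lambda>y::'a. indicat_real (cball 0 1) y *\<^sub>R exp (- c))"
      using integrable_continuous_compact[OF compact_cball continuous_on_const] unfolding set_integrable_def .
    show "indicat_real (cball 0 1) y *\<^sub>R exp (- c) \<le> exp (- c * (norm y)\<^sup>2)" for y :: 'a
      using assms by (auto simp: indicator_def power_le_one)
  qed (rule integrable_gauss[OF assms])
  moreover have "(LINT y:cball (0::'a) 1|lborel. exp (- c)) = exp (- c) * measure lborel (cball (0::'a) 1)"
    using emeasure_lborel_compact_finite[OF compact_cball, of "0::'a" 1] by (simp add: set_lebesgue_integral_def)
  moreover have "measure lborel (cball (0::'a) 1) > 0"
    using content_cball_pos[of 1 "0::'a"] by simp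
  ultimately show ?thesis unfolding gauss_int_def
    by (metis exp_gt_zero less_le_trans mult_pos_pos)
qed

text \<open>The substitution of \<open>x + sqrt \<epsilon> *\<^sub>R y\<close> for y. Its Jacobian
  is the origin of every exponent that depends on the dimension.\<close>

lemma has_bochner_integral_gauss_scaled:
  fixes x :: "'a::euclidean_space"
  assumes c: "c > 0" and \<epsilon>: "\<epsilon> > 0"
  shows "has_bochner_integral lborel (\<lambda>y. exp (- c * (norm (y - x))\<^sup>2 / \<epsilon>)) (sqrt \<epsilon> ^ DIM('a) * gauss_int TYPE('a) c)"
proof -
  let ?s = "sqrt \<epsilon>"
  have s: "?s > 0" using \<epsilon> by simp
  let ?f = "\<lambda>y::'a. exp (- c * (norm (y - x))\<^sup>2 / \<epsilon>)"
  have eq: "?f (x + ?s *\<^sub>R y) = exp (- c * (norm y)\<^sup>2)" for y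
    using \<epsilon> by (simp add: power_mult_distrib)
  have m: "?f \<in> borel_measurable borel" by measurable
  \<comment> \<open>Lebesgue measure as the image under the affine map, with the Jacobian as
    density.\<close>
  have L: "(lborel :: 'a measure) = density (distr lborel borel (\<lambda>y. x + ?s *\<^sub>R y)) (\<lambda>_. ennreal (?s ^ DIM('a)))"
    using lborel_affine[of ?s x] s by simp
  have "has_bochner_integral lborel (\<lambda>y::'a. exp (- c * (norm y)\<^sup>2)) (gauss_int TYPE('a) c)"
    unfolding gauss_int_def by (rule has_bochner_integral_integrable[OF integrable_gauss[OF c]])
  then have "has_bochner_integral (distr lborel borel (\<lambda>y. x + ?s *\<^sub>R y)) ?f (gauss_int TYPE('a) c)"
    by (intro has_bochner_integral_distr[OF m]) (simp_all only: eq, measurable)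
  then have "has_bochner_integral (distr lborel borel (\<lambda>y. x + ?s *\<^sub>R y)) (\<lambda>y. ?s ^ DIM('a) *\<^sub>R ?f y) (?s ^ DIM('a) *\<^sub>R gauss_int TYPE('a) c)"
    by (rule has_bochner_integral_scaleR_right)
  then have "has_bochner_integral (density (distr lborel borel (\<lambda>y. x + ?s *\<^sub>R y)) (\<lambda>_. ennreal (?s ^ DIM('a)))) ?f (?s ^ DIM('a) *\<^sub>R gauss_int TYPE('a) c)"
    by (intro has_bochner_integral_density) (use m s in auto)
  then show ?thesis using L by simp
qed

text \<open>Cauchy-Schwarz against the constant 1, from the nonnegative integral of the square of
  \<open>m * g x - superpose\<close>. The expansion gives m times the claim, so null sets are
  treated separately.\<close>

lemma set_integral_square_le:
  fixes g :: "'a::euclidean_space \<Rightarrow> real"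
  assumes K: "compact K" and g: "continuous_on K g"
  shows "(LINT x:K|lborel. g x)\<^sup>2 \<le> measure lborel K * (LINT x:K|lborel. (g x)\<^sup>2)"
proof -
  define m superpose J where "m = measure lborel K" and "superpose = (LINT x:K|lborel. g x)" and "J = (LINT x:K|lborel. (g x)\<^sup>2)"
  have m0: "m \<ge> 0" by (simp add: m_def)
  have const: "(LINT x:K|lborel. c) = c * m" for c :: real
    using emeasure_lborel_compact_finite[OF K] by (simp add: set_lebesgue_integral_def m_def mult.commute)
  have i: "set_integrable lborel K (\<lambda>x. h x)" if "continuous_on K h" for h :: "'a \<Rightarrow> real"
    by (rule integrable_continuous_compact[OF K that])
  have "0 \<le> (LINT x:K|lborel. (m * g x - superpose)\<^sup>2)"
    unfolding set_lebesgue_integral_def by (intro integral_nonneg_AE) auto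
  also have "\<dots> = (LINT x:K|lborel. m\<^sup>2 * (g x)\<^sup>2 - (2 * m * superpose) * g x + superpose\<^sup>2)"
    by (intro set_lebesgue_integral_cong) (use borel_closed[OF compact_imp_closed[OF K]] in \<open>auto simp: power2_eq_square algebra_simps\<close>)
  also have "\<dots> = m\<^sup>2 * J - (2 * m * superpose) * superpose + superpose\<^sup>2 * m"
    unfolding J_def
    by (subst set_integral_add(2) set_integral_diff(2), (intro i continuous_intros g)+)+ (simp add: const superpose_def)
  finally have "0 \<le> m * (m * J - superpose\<^sup>2)" by (simp add: power2_eq_square algebra_simps)
  moreover have "superpose = 0" if "m = 0"
  proof -
    obtain B where "\<And>x. x \<in> K \<Longrightarrow> norm (g x) \<le> B"
      using compact_imp_bounded[OF compact_continuous_image[OF g K]] unfolding bounded_iff by blast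
    then show ?thesis using norm_set_integral_le[OF K g, of B] that by (simp add: superpose_def m_def)
  qed
  ultimately have "superpose\<^sup>2 \<le> m * J" using m0 by (cases "m = 0") (auto simp: zero_le_mult_iff)
  then show ?thesis by (simp add: superpose_def J_def m_def)
qed

text \<open>Cauchy-Schwarz in z moves the square onto the single Gaussian and doubles its rate.
  After the integrals are exchanged, every z has the same bound, wherever its centre lies.\<close>

lemma gauss_superposition:
  fixes x :: "'z::euclidean_space \<Rightarrow> 'a::euclidean_space"
  assumes K: "compact K" and x: "continuous_on K x" and c: "c > 0" and \<epsilon>: "\<epsilon> > 0" and B: "compact B"
  shows "(LINT y:B|lborel. (LINT z:K|lborel. exp (- c * (norm (y - x z))\<^sup>2 / \<epsilon>))\<^sup>2)
    \<le> (measure lborel K)\<^sup>2 * (sqrt \<epsilon> ^ DIM('a) * gauss_int TYPE('a) (2 * c))"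
proof -
  let ?g = "\<lambda>y z. exp (- c * (norm (y - x z))\<^sup>2 / \<epsilon>)"
  let ?h = "\<lambda>y z. exp (- (2 * c) * (norm (y - x z))\<^sup>2 / \<epsilon>)"
  let ?G = "sqrt \<epsilon> ^ DIM('a) * gauss_int TYPE('a) (2 * c)"
  let ?m = "measure lborel K"
  have gh: "(?g y z)\<^sup>2 = ?h y z" for y z by (simp add: power2_eq_square exp_add[symmetric])
  have cg: "continuous_on (K \<times> B) (\<lambda>p. ?g (snd p) (fst p))" "continuous_on (K \<times> B) (\<lambda>p. ?h (snd p) (fst p))"
    using \<epsilon> by (auto intro!: continuous_intros continuous_on_compose2[OF x])
  have cgz: "continuous_on K (\<lambda>z. ?g y z)" "continuous_on K (\<lambda>z. ?h y z)" for y
    using \<epsilon> by (auto intro!: continuous_intros x)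
  have G0: "?G \<ge> 0" using gauss_int_pos[of "2 * c", where 'a='a] c \<epsilon> by simp
  have "(LINT y:B|lborel. (LINT z:K|lborel. ?g y z)\<^sup>2) \<le> (LINT y:B|lborel. ?m * (LINT z:K|lborel. ?h y z))"
  proof (rule set_integral_mono)
    show "set_integrable lborel B (\<lambda>y. (LINT z:K|lborel. ?g y z)\<^sup>2)"
      by (intro integrable_continuous_compact B continuous_intros continuous_on_set_integral K cg)
    show "set_integrable lborel B (\<lambda>y. ?m * (LINT z:K|lborel. ?h y z))"
      by (intro integrable_continuous_compact B continuous_intros continuous_on_set_integral K cg)
    show "(LINT z:K|lborel. ?g y z)\<^sup>2 \<le> ?m * (LINT z:K|lborel. ?h y z)" for y
      using set_integral_square_le[OF K cgz(1), of y] by (simp only: gh)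
  qed
  also have "\<dots> = ?m * (LINT y:B|lborel. (LINT z:K|lborel. ?h y z))" by simp
  also have "(LINT y:B|lborel. (LINT z:K|lborel. ?h y z)) \<le> ?m * ?G"
  proof -
    \<comment> \<open>Extending the centres by zero makes them Borel on the whole space, as the
      exchange of integrals requires.\<close>
    define x' where "x' z = indicator K z *\<^sub>R x z" for z
    have [measurable]: "x' \<in> borel_measurable borel"
      unfolding x'_def by (rule borel_measurable_continuous_on_indicator[OF borel_closed[OF compact_imp_closed[OF K]] x])
    have [measurable]: "K \<in> sets borel" "B \<in> sets borel"
      using borel_closed[OF compact_imp_closed[OF K]] borel_closed[OF compact_imp_closed[OF B]] .
    let ?F = "\<lambda>y z. indicator B y * (indicator K z * exp (- (2 * c) * (norm (y - x' z))\<^sup>2 / \<epsilon>)) :: real"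
    have F: "indicator B y * (indicator K z * ?h y z) = ?F y z" for y z
      by (auto simp: x'_def indicator_def)
    \<comment> \<open>The exchange takes place between nonnegative extended integrals, where joint
      measurability is enough; this conversion and the next one lead there from the real
      integrals.\<close>
    have inner: "(\<integral>\<^sup>+ z. ennreal (?F y z) \<partial>lborel) = ennreal (indicator B y * (LINT z:K|lborel. ?h y z))" for y
    proof -
      have "integrable lborel (\<lambda>z. indicator K z *\<^sub>R ?h y z)"
        by (rule borel_integrable_compact[OF K cgz(2)])
      then have "integrable lborel (\<lambda>z. indicator B y * (indicator K z * ?h y z))" by simp
      then have "(\<integral>\<^sup>+ z. ennreal (indicator B y * (indicator K z * ?h y z)) \<partial>lborel) =
        ennreal (LINT z|lborel. indicator B y * (indicator K z * ?h y z))"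
        by (rule nn_integral_eq_integral) auto
      moreover have "(LINT z|lborel. indicator B y * (indicator K z * ?h y z)) = indicator B y * (LINT z:K|lborel. ?h y z)"
        by (simp add: set_lebesgue_integral_def)
      ultimately show ?thesis by (simp only: F)
    qed
    have "ennreal (LINT y:B|lborel. (LINT z:K|lborel. ?h y z)) = (\<integral>\<^sup>+ y. ennreal (indicator B y * (LINT z:K|lborel. ?h y z)) \<partial>lborel)"
    proof -
      have "set_integrable lborel B (\<lambda>y. LINT z:K|lborel. ?h y z)"
        by (intro integrable_continuous_compact B continuous_intros continuous_on_set_integral K cg)
      moreover have "0 \<le> (LINT z:K|lborel. ?h y z)" for y
        unfolding set_lebesgue_integral_def by (intro integral_nonneg_AE) auto
      ultimately show ?thesis
        unfolding set_lebesgue_integral_def[of lborel B] set_integrable_def real_scaleR_def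
        by (intro nn_integral_eq_integral[symmetric]) auto
    qed
    also have "\<dots> = (\<integral>\<^sup>+ y. \<integral>\<^sup>+ z. ennreal (?F y z) \<partial>lborel \<partial>lborel)" by (simp only: inner)
    also have "\<dots> = (\<integral>\<^sup>+ z. \<integral>\<^sup>+ y. ennreal (?F y z) \<partial>lborel \<partial>lborel)"
      by (rule lborel_pair.Fubini') measurable
    also have "\<dots> \<le> (\<integral>\<^sup>+ z. ennreal ?G * indicator K z \<partial>lborel)"
    proof (rule nn_integral_mono)
      fix z
      have hb: "has_bochner_integral lborel (\<lambda>y. exp (- (2 * c) * (norm (y - x' z))\<^sup>2 / \<epsilon>)) ?G"
        by (rule has_bochner_integral_gauss_scaled) (use c \<epsilon> in auto)
      have "(\<integral>\<^sup>+ y. ennreal (?F y z) \<partial>lborel) \<le> (\<integral>\<^sup>+ y. ennreal (exp (- (2 * c) * (norm (y - x' z))\<^sup>2 / \<epsilon>)) * indicator K z \<partial>lborel)"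
        by (intro nn_integral_mono) (auto simp: indicator_def)
      also have "\<dots> = (\<integral>\<^sup>+ y. ennreal (exp (- (2 * c) * (norm (y - x' z))\<^sup>2 / \<epsilon>)) \<partial>lborel) * indicator K z"
        by (rule nn_integral_multc) measurable
      also have "(\<integral>\<^sup>+ y. ennreal (exp (- (2 * c) * (norm (y - x' z))\<^sup>2 / \<epsilon>)) \<partial>lborel) = ennreal ?G"
        using hb by (subst nn_integral_eq_integral) (auto simp: has_bochner_integral_iff)
      finally show "(\<integral>\<^sup>+ y. ennreal (?F y z) \<partial>lborel) \<le> ennreal ?G * indicator K z" .
    qed
    also have "\<dots> = ennreal ?G * emeasure lborel K" by (rule nn_integral_cmult_indicator) simp
    also have "\<dots> = ennreal (?m * ?G)"
      using emeasure_lborel_compact_finite[OF K] G0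
      by (simp add: emeasure_eq_ennreal_measure less_top ennreal_mult mult.commute)
    finally show ?thesis using G0 by (subst (asm) ennreal_le_iff) auto
  qed
  then have "?m * (LINT y:B|lborel. (LINT z:K|lborel. ?h y z)) \<le> ?m * (?m * ?G)"
    by (intro mult_left_mono) auto
  finally show ?thesis by (simp add: power2_eq_square mult.assoc)
qed

section \<open>Coefficients of the beams\<close>

lemma has_vector_derivative_moving:
  fixes g :: "real^'n::finite \<Rightarrow> 'b::real_normed_vector"
  assumes "g differentiable (at (y - \<xi> t))" "(\<xi> has_vector_derivative \<xi>') (at t within U)"
  shows "((\<lambda>s. g (y - \<xi> s)) has_vector_derivative - (\<Sum>i\<in>UNIV. (\<xi>' $ i) *\<^sub>R partial i g (y - \<xi> t))) (at t within U)"
proof -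
  have "((\<lambda>s. y - \<xi> s) has_derivative (\<lambda>h. 0 - h *\<^sub>R \<xi>')) (at t within U)"
    using assms(2) unfolding has_vector_derivative_def by (intro has_derivative_diff has_derivative_const)
  from has_derivative_compose[OF this has_derivative_partials[OF assms(1)]]
  show ?thesis
    unfolding has_vector_derivative_def
    by (rule has_derivative_eq_rhs) (auto simp: scaleR_sum_right sum_negf)
qed

lemma partial_taylor_poly:
  "partial i (taylor_poly m c x) y =
    (\<Sum>\<beta> | mi_size \<beta> \<le> m. c \<beta> / of_nat (mi_fact \<beta>) * partial i (\<lambda>y. complex_of_real (mi_power (y - x) \<beta>)) y)"
proof -
  have "foldr partial [i] (\<lambda>y. \<Sum>\<beta> | mi_size \<beta> \<le> m. c \<beta> / of_nat (mi_fact \<beta>) * complex_of_real (mi_power (y - x) \<beta>))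
    = (\<lambda>y. \<Sum>\<beta> | mi_size \<beta> \<le> m. c \<beta> / of_nat (mi_fact \<beta>) * foldr partial [i] (\<lambda>y. complex_of_real (mi_power (y - x) \<beta>)) y)"
    by (rule foldr_partial_sum) (auto intro: finite_mi_size_le smooth_monomial)
  then show ?thesis unfolding taylor_poly_def[abs_def] by (simp add: fun_eq_iff)
qed

text \<open>The point y is fixed while the centre moves: besides the derivatives of the coefficients
  there is a convective term with the velocity of the centre.\<close>

lemma has_vector_derivative_taylor_poly:
  assumes c: "\<And>\<alpha>. mi_size \<alpha> \<le> m \<Longrightarrow> ((\<lambda>s. c s \<alpha>) has_vector_derivative c' \<alpha>) (at t within U)"
    and \<xi>: "(\<xi> has_vector_derivative \<xi>') (at t within U)"
  shows "((\<lambda>s. taylor_poly m (c s) (\<xi> s) y) has_vector_derivative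
     taylor_poly m c' (\<xi> t) y - (\<Sum>i\<in>UNIV. of_real (\<xi>' $ i) * partial i (taylor_poly m (c t) (\<xi> t)) y)) (at t within U)"
proof -
  let ?J = "{\<beta>. mi_size \<beta> \<le> m}"
  let ?g = "\<lambda>\<beta> w. complex_of_real (mi_power w \<beta>)"
  have mono: "((\<lambda>s. ?g \<beta> (y - \<xi> s)) has_vector_derivative - (\<Sum>i\<in>UNIV. (\<xi>' $ i) *\<^sub>R partial i (\<lambda>y. ?g \<beta> (y - \<xi> t)) y)) (at t within U)" for \<beta>
    using has_vector_derivative_moving[of "?g \<beta>" y \<xi> t \<xi>' U] smooth_differentiable[OF smooth_monomial[of 0 \<beta>]] \<xi>
    by (simp add: partial_translate[of i "?g \<beta>" for i])
  have "((\<lambda>s. \<Sum>\<beta>\<in>?J. c s \<beta> / of_nat (mi_fact \<beta>) * ?g \<beta> (y - \<xi> s)) has_vector_derivative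
     (\<Sum>\<beta>\<in>?J. c t \<beta> / of_nat (mi_fact \<beta>) * - (\<Sum>i\<in>UNIV. (\<xi>' $ i) *\<^sub>R partial i (\<lambda>y. ?g \<beta> (y - \<xi> t)) y)
       + c' \<beta> / of_nat (mi_fact \<beta>) * ?g \<beta> (y - \<xi> t))) (at t within U)"
    by (intro has_vector_derivative_sum has_vector_derivative_mult has_vector_derivative_divide mono c) auto
  moreover have "(\<Sum>\<beta>\<in>?J. c t \<beta> / of_nat (mi_fact \<beta>) * - (\<Sum>i\<in>UNIV. (\<xi>' $ i) *\<^sub>R partial i (\<lambda>y. ?g \<beta> (y - \<xi> t)) y)
       + c' \<beta> / of_nat (mi_fact \<beta>) * ?g \<beta> (y - \<xi> t))
    = taylor_poly m c' (\<xi> t) y - (\<Sum>i\<in>UNIV. of_real (\<xi>' $ i) * partial i (taylor_poly m (c t) (\<xi> t)) y)"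
  proof -
    have "(\<Sum>i\<in>UNIV. of_real (\<xi>' $ i) * partial i (taylor_poly m (c t) (\<xi> t)) y)
      = (\<Sum>\<beta>\<in>?J. \<Sum>i\<in>UNIV. of_real (\<xi>' $ i) * (c t \<beta> / of_nat (mi_fact \<beta>) * partial i (\<lambda>y. ?g \<beta> (y - \<xi> t)) y))"
      unfolding partial_taylor_poly sum_distrib_left by (rule sum.swap)
    also have "\<dots> = (\<Sum>\<beta>\<in>?J. c t \<beta> / of_nat (mi_fact \<beta>) * (\<Sum>i\<in>UNIV. (\<xi>' $ i) *\<^sub>R partial i (\<lambda>y. ?g \<beta> (y - \<xi> t)) y))"
      by (intro sum.cong refl) (simp add: sum_distrib_left scaleR_conv_of_real mult_ac)
    finally show ?thesis by (simp add: sum.distrib sum_negf sum_subtractf taylor_poly_def)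
  qed
  ultimately show ?thesis unfolding taylor_poly_def[of m "c _"] by simp
qed

section \<open>Lipschitz bounds and injectivity of the flow\<close>

lemma smooth_locally_lipschitz:
  fixes f :: "real^'n::finite \<Rightarrow> 'b::real_normed_vector"
  assumes "smooth f"
  shows "\<exists>L\<ge>0. \<forall>x\<in>cball 0 R. \<forall>y\<in>cball 0 R. norm (f x - f y) \<le> L * norm (x - y)"
proof -
  have "\<exists>B. \<forall>x\<in>cball 0 R. norm (partial i f x) \<le> B" for i
    using compact_imp_bounded[OF compact_continuous_image[OF smooth_continuous[OF smooth_partial[OF assms]] compact_cball]]
    unfolding bounded_iff by blast
  then have "\<exists>B. \<forall>i. \<forall>x\<in>cball 0 R. norm (partial i f x) \<le> B i" by (intro choice allI)
  then obtain B where B: "\<forall>i. \<forall>x\<in>cball 0 R. norm (partial i f x) \<le> B i" by (elim exE)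
  have "norm (f x - f y) \<le> (\<Sum>i\<in>UNIV. \<bar>B i\<bar>) * norm (x - y)" if xy: "x \<in> cball 0 R" "y \<in> cball 0 R" for x y
  proof (rule differentiable_bound[OF convex_cball _ _ xy])
    fix w :: "real^'n" assume w: "w \<in> cball 0 R"
    show "(f has_derivative (\<lambda>h. \<Sum>i\<in>UNIV. h $ i *\<^sub>R partial i f w)) (at w within cball 0 R)"
      by (rule has_derivative_at_withinI[OF has_derivative_partials[OF smooth_differentiable[OF assms]]])
    show "onorm (\<lambda>h. \<Sum>i\<in>UNIV. h $ i *\<^sub>R partial i f w) \<le> (\<Sum>i\<in>UNIV. \<bar>B i\<bar>)"
    proof (rule onorm_le)
      fix h :: "real^'n"
      have "norm (\<Sum>i\<in>UNIV. h $ i *\<^sub>R partial i f w) \<le> (\<Sum>i\<in>UNIV. \<bar>B i\<bar> * norm h)"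
      proof (rule sum_norm_le)
        fix i
        have "norm (partial i f w) \<le> \<bar>B i\<bar>" using B w by (meson abs_ge_self order.trans)
        then have "\<bar>h $ i\<bar> * norm (partial i f w) \<le> norm h * \<bar>B i\<bar>"
          by (intro mult_mono component_le_norm_cart) auto
        then show "norm (h $ i *\<^sub>R partial i f w) \<le> \<bar>B i\<bar> * norm h" by (simp add: mult.commute)
      qed
      then show "norm (\<Sum>i\<in>UNIV. h $ i *\<^sub>R partial i f w) \<le> (\<Sum>i\<in>UNIV. \<bar>B i\<bar>) * norm h"
        by (simp add: sum_distrib_right)
    qed
  qed
  then show ?thesis by (intro exI[of _ "\<Sum>i\<in>UNIV. \<bar>B i\<bar>"]) (auto intro: sum_nonneg)
qed

lemma grad_locally_lipschitz:
  fixes V :: "real^'n::finite \<Rightarrow> real"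
  assumes "smooth V"
  shows "\<exists>L\<ge>0. \<forall>x\<in>cball 0 R. \<forall>y\<in>cball 0 R. norm (grad V x - grad V y) \<le> L * norm (x - y)"
proof -
  have "\<forall>i. \<exists>L. L \<ge> 0 \<and> (\<forall>x\<in>cball 0 R. \<forall>y\<in>cball 0 R. norm (partial i V x - partial i V y) \<le> L * norm (x - y))"
    using smooth_locally_lipschitz[OF smooth_partial[OF assms]] by blast
  then have "\<exists>L. \<forall>i. L i \<ge> 0 \<and> (\<forall>x\<in>cball 0 R. \<forall>y\<in>cball 0 R. norm (partial i V x - partial i V y) \<le> L i * norm (x - y))"
    by (rule choice)
  then obtain L where L: "\<forall>i. L i \<ge> 0 \<and> (\<forall>x\<in>cball 0 R. \<forall>y\<in>cball 0 R. norm (partial i V x - partial i V y) \<le> L i * norm (x - y))"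
    by (elim exE)
  have "norm (grad V x - grad V y) \<le> (\<Sum>i\<in>UNIV. L i) * norm (x - y)" if "x \<in> cball 0 R" "y \<in> cball 0 R" for x y
  proof -
    have "norm (grad V x - grad V y) \<le> (\<Sum>i\<in>UNIV. \<bar>(grad V x - grad V y) $ i\<bar>)" by (rule norm_le_l1_cart)
    also have "\<dots> \<le> (\<Sum>i\<in>UNIV. L i * norm (x - y))"
      by (rule sum_mono) (use L that in \<open>auto simp: grad_def\<close>)
    finally show ?thesis by (simp add: sum_distrib_right)
  qed
  then show ?thesis using L by (intro exI[of _ "\<Sum>i\<in>UNIV. L i"]) (auto intro: sum_nonneg)
qed

lemma continuous_on_grad: "smooth V \<Longrightarrow> continuous_on S (grad V)"
  unfolding grad_def by (intro continuous_intros smooth_continuous smooth_partial)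

lemma flow_lipschitz:
  fixes V :: "real^'n::finite \<Rightarrow> real"
  assumes "smooth V"
  shows "\<exists>L\<ge>0. \<forall>v w :: 'n phase. norm v \<le> R \<and> norm w \<le> R \<longrightarrow>
    norm ((snd v, - grad V (fst v)) - (snd w, - grad V (fst w))) \<le> L * norm (v - w)"
proof -
  obtain L where L: "L \<ge> 0" "\<forall>x\<in>cball 0 R. \<forall>y\<in>cball 0 R. norm (grad V x - grad V y) \<le> L * norm (x - y)"
    using grad_locally_lipschitz[OF assms] by blast
  have main: "norm ((snd v, - grad V (fst v)) - (snd w, - grad V (fst w))) \<le> (1 + L) * norm (v - w)"
    if "norm v \<le> R \<and> norm w \<le> R" for v w :: "(real^'n) \<times> (real^'n)"
  proof -
    have "fst v \<in> cball 0 R" "fst w \<in> cball 0 R"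
      using that norm_fst_le[of "fst v" "snd v"] norm_fst_le[of "fst w" "snd w"] by auto
    then have "norm (grad V (fst v) - grad V (fst w)) \<le> L * norm (fst v - fst w)" using L by blast
    also have "\<dots> \<le> L * norm (v - w)"
      using norm_fst_le[of "fst v - fst w" "snd v - snd w"] L(1) by (intro mult_left_mono) (auto simp: minus_prod_def)
    finally have 1: "norm (- grad V (fst v) - (- grad V (fst w))) \<le> L * norm (v - w)"
      by (simp add: norm_minus_commute)
    have 2: "norm (snd v - snd w) \<le> norm (v - w)"
      using norm_snd_le[of "snd v - snd w" "fst v - fst w"] by (simp add: minus_prod_def)
    have "norm ((snd v, - grad V (fst v)) - (snd w, - grad V (fst w))) \<le>
       norm (snd v - snd w) + norm (- grad V (fst v) - (- grad V (fst w)))"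
      using norm_Pair_le[of "snd v - snd w" "- grad V (fst v) - (- grad V (fst w))"] by simp
    also have "\<dots> \<le> norm (v - w) + L * norm (v - w)" using 1 2 by linarith
    finally show ?thesis by (simp add: algebra_simps)
  qed
  show ?thesis
  proof (intro exI[of _ "1 + L"] conjI allI impI)
    show "0 \<le> 1 + L" using L(1) by simp
    fix v w :: "'n phase" assume "norm v \<le> R \<and> norm w \<le> R"
    then show "norm ((snd v, - grad V (fst v)) - (snd w, - grad V (fst w))) \<le> (1 + L) * norm (v - w)" by (rule main)
  qed
qed

text \<open>The squared distance of two trajectories shrinks at most exponentially, so it cannot
  reach zero. This makes \<open>inv (X t)\<close> in the phase space beam return the starting
  point.\<close>

lemma flow_inj:
  fixes V :: "real^'n::finite \<Rightarrow> real"
  assumes V: "smooth V" and flow: "hamiltonian_flow V T X" and t: "t \<in> {0..T}"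
  shows "inj (X t)"
proof (rule injI)
  fix v w assume eq: "X t v = X t w"
  define G where "G y = (snd y, - grad V (fst y))" for y :: "(real^'n) \<times> (real^'n)"
  have d: "((\<lambda>s. X s v) has_vector_derivative G (X s v)) (at s within {0..T})" if "s \<in> {0..T}" for s v
    using flow that unfolding hamiltonian_flow_def G_def by blast
  have b: "bounded ((\<lambda>s. X s u) ` {0..T})" for u
    by (intro compact_imp_bounded compact_continuous_image continuous_on_vector_derivative[OF d] compact_Icc)
  have "bounded ((\<lambda>s. X s v) ` {0..T} \<union> (\<lambda>s. X s w) ` {0..T})" using b by simp
  then obtain R where R: "\<forall>x\<in>(\<lambda>s. X s v) ` {0..T} \<union> (\<lambda>s. X s w) ` {0..T}. norm x \<le> R"
    unfolding bounded_iff by blast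
  obtain L where L: "L \<ge> 0" "\<forall>v w :: 'n phase. norm v \<le> R \<and> norm w \<le> R \<longrightarrow> norm (G v - G w) \<le> L * norm (v - w)"
    using flow_lipschitz[OF V, of R] unfolding G_def by blast
  define D where "D s = (X s v - X s w) \<bullet> (X s v - X s w)" for s
  have "D 0 \<le> exp ((2 * L) * t) * D t"
  proof (rule gronwall_backward[OF _ _ t])
    fix s assume s: "s \<in> {0..T}"
    have "((\<lambda>s. X s v - X s w) has_derivative (\<lambda>h. h *\<^sub>R (G (X s v) - G (X s w)))) (at s within {0..T})"
      using has_vector_derivative_diff[OF d[OF s] d[OF s], of v w] by (simp add: has_vector_derivative_def)
    from has_derivative_inner[OF this this]
    show "(D has_real_derivative 2 * ((X s v - X s w) \<bullet> (G (X s v) - G (X s w)))) (at s within {0..T})"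
      unfolding D_def has_field_derivative_def
      by (rule has_derivative_eq_rhs) (auto simp: inner_commute)
    have "\<bar>(X s v - X s w) \<bullet> (G (X s v) - G (X s w))\<bar> \<le> norm (X s v - X s w) * norm (G (X s v) - G (X s w))"
      by (rule Cauchy_Schwarz_ineq2)
    also have "\<dots> \<le> norm (X s v - X s w) * (L * norm (X s v - X s w))"
    proof (rule mult_left_mono)
      have "norm (X s v) \<le> R" "norm (X s w) \<le> R" using R s by blast+
      then show "norm (G (X s v) - G (X s w)) \<le> L * norm (X s v - X s w)" using L(2) by blast
    qed simp
    also have "\<dots> = L * D s" by (simp add: D_def power2_norm_eq_inner[symmetric] power2_eq_square)
    finally show "- (2 * L) * D s \<le> 2 * ((X s v - X s w) \<bullet> (G (X s v) - G (X s w)))" by linarith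
  qed
  then have "D 0 \<le> 0" using eq by (simp add: D_def)
  then have "X 0 v = X 0 w" unfolding D_def by (metis inner_gt_zero_iff leD right_minus_eq)
  then show "v = w" using flow unfolding hamiltonian_flow_def by simp
qed

section \<open>The phase of a beam: its coefficients and their regularity\<close>

locale gaussian_beams =
  fixes V S \<rho> :: "real^'n::finite \<Rightarrow> real"
    and A :: "real^'n \<Rightarrow> complex"
    and T :: real
    and k :: nat
    and X :: "real \<Rightarrow> 'n phase \<Rightarrow> 'n phase"
    and \<phi> :: "('n \<Rightarrow> nat) \<Rightarrow> real \<Rightarrow> 'n phase \<Rightarrow> complex"
    and a :: "nat \<Rightarrow> ('n \<Rightarrow> nat) \<Rightarrow> real \<Rightarrow> 'n phase \<Rightarrow> complex"
  assumes T: "T > 0" and k: "k \<ge> 1"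
    and V: "smooth V" and S: "smooth S" and A: "test_function A"
    and flow: "hamiltonian_flow V T X"
    and phase: "\<And>X0. X0 \<in> Omega0 A S \<Longrightarrow> phase_system V S T k X \<phi> X0"
    and amplitude: "\<And>X0. X0 \<in> Omega0 A S \<Longrightarrow> amplitude_system A T k X \<phi> a X0"
    and cut: "cutoff A S T k X \<phi> \<rho>"
begin

text \<open>A pair \<open>p = (t, z)\<close> stands for time \<open>t\<close> on the beam started at position \<open>z\<close>;
  \<open>coef'\<close>, \<open>Phase_t\<close>, \<open>acoef'\<close>, \<open>Amp_t\<close> are derivatives in \<open>t\<close> for fixed \<open>z\<close>.\<close>

definition K :: "(real^'n) set" where "K = supp A"
definition P :: "(real \<times> (real^'n)) set" where "P = {0..T} \<times> K"
definition ini :: "real^'n \<Rightarrow> 'n phase" where "ini z = (z, grad S z)"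
definition xc :: "real \<times> (real^'n) \<Rightarrow> real^'n" where "xc p = fst (X (fst p) (ini (snd p)))"
definition mom :: "real \<times> (real^'n) \<Rightarrow> real^'n" where "mom p = snd (X (fst p) (ini (snd p)))"
definition coef :: "('n \<Rightarrow> nat) \<Rightarrow> real \<times> (real^'n) \<Rightarrow> complex" where
  "coef \<alpha> p = \<phi> \<alpha> (fst p) (ini (snd p))"
definition coef' :: "('n \<Rightarrow> nat) \<Rightarrow> real \<times> (real^'n) \<Rightarrow> complex" where
  "coef' \<alpha> p = vector_derivative (\<lambda>s. \<phi> \<alpha> s (ini (snd p))) (at (fst p) within {0..T})"
definition Phase :: "real \<times> (real^'n) \<Rightarrow> real^'n \<Rightarrow> complex" where
  "Phase p = taylor_poly (k + 1) (\<lambda>\<alpha>. coef \<alpha> p) (xc p)"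
definition mono :: "('n \<Rightarrow> nat) \<Rightarrow> real \<times> (real^'n) \<Rightarrow> real^'n \<Rightarrow> complex" where
  "mono \<beta> p y = of_real (mi_power (y - xc p) \<beta>)"
text \<open>The eikonal expression without the time derivatives of the coefficients. The term with
  the momentum stems from the motion of the expansion point.\<close>

definition eikonal_static :: "real \<times> (real^'n) \<Rightarrow> real^'n \<Rightarrow> complex" where
  "eikonal_static p y = 1/2 * (\<Sum>i\<in>UNIV. (partial i (Phase p) y)\<^sup>2) - (\<Sum>i\<in>UNIV. of_real (mom p $ i) * partial i (Phase p) y) + of_real (V y)"

lemma compact_K: "compact K" and smooth_A: "smooth A"
  using A by (auto simp: test_function_def K_def)

lemma compact_P: "compact P"
  unfolding P_def by (intro compact_Times compact_K compact_Icc)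

lemma P_I: "t \<in> {0..T} \<Longrightarrow> z \<in> K \<Longrightarrow> (t, z) \<in> P"
  by (simp add: P_def)

lemma ini_Omega: "z \<in> K \<Longrightarrow> ini z \<in> Omega0 A S"
  by (auto simp: ini_def Omega0_def K_def)

lemma flow_deriv:
  assumes "t \<in> {0..T}"
  shows "((\<lambda>s. X s Y) has_vector_derivative (snd (X t Y), - grad V (fst (X t Y)))) (at t within {0..T})"
  using flow assms unfolding hamiltonian_flow_def by blast

lemma flow_0 [simp]: "X 0 Y = Y"
  using flow unfolding hamiltonian_flow_def by blast

lemma xc_deriv:
  assumes "t \<in> {0..T}"
  shows "((\<lambda>s. xc (s, z)) has_vector_derivative mom (t, z)) (at t within {0..T})"
  using bounded_linear.has_vector_derivative[OF bounded_linear_fst flow_deriv[OF assms, of "ini z"]]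
  by (simp add: xc_def mom_def)

lemma mom_deriv:
  assumes "t \<in> {0..T}"
  shows "((\<lambda>s. mom (s, z)) has_vector_derivative - grad V (xc (t, z))) (at t within {0..T})"
  using bounded_linear.has_vector_derivative[OF bounded_linear_snd flow_deriv[OF assms, of "ini z"]]
  by (simp add: xc_def mom_def)

lemma xc_0 [simp]: "xc (0, z) = z" and mom_0 [simp]: "mom (0, z) = grad S z"
  by (simp_all add: xc_def mom_def ini_def)

lemma continuous_flow: "continuous_on P (\<lambda>p. X (fst p) (ini (snd p)))"
proof -
  have "continuous_on ({0..T} \<times> K) (\<lambda>p. (\<lambda>_::unit. \<lambda>t z. X t (ini z)) () (fst p) (snd p))"
  \<comment> \<open>A single unknown with values in phase space, hence the unit type as index
    set.\<close>
  proof (rule ode_continuous_dependence[where J="{()}" and G="\<lambda>_ _ _ v. (snd (v ()), - grad V (fst (v ())))"])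
    show "((\<lambda>s. X s (ini z)) has_vector_derivative (snd (X t (ini z)), - grad V (fst (X t (ini z))))) (at t within {0..T})"
      if "t \<in> {0..T}" for t z by (rule flow_deriv[OF that])
    show "\<exists>L\<ge>0. \<forall>j\<in>{()}. \<forall>t\<in>{0..T}. \<forall>z\<in>K. \<forall>v w :: unit \<Rightarrow> 'n phase. (\<forall>i\<in>{()}. norm (v i) \<le> R \<and> norm (w i) \<le> R) \<longrightarrow>
      norm ((snd (v ()), - grad V (fst (v ()))) - (snd (w ()), - grad V (fst (w ())))) \<le> L * (\<Sum>i\<in>{()}. norm (v i - w i))" for R
    proof -
      obtain L where L: "L \<ge> 0" "\<forall>v w :: 'n phase. norm v \<le> R \<and> norm w \<le> R \<longrightarrow>
          norm ((snd v, - grad V (fst v)) - (snd w, - grad V (fst w))) \<le> L * norm (v - w)"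
        using flow_lipschitz[OF V, of R] by blast
      show ?thesis
      proof (intro exI[of _ L] conjI ballI allI impI L(1))
        fix v w :: "unit \<Rightarrow> 'n phase" assume R: "\<forall>i\<in>{()}. norm (v i) \<le> R \<and> norm (w i) \<le> R"
        have s: "(\<Sum>i\<in>{()}. norm (v i - w i)) = norm (v () - w ())" by simp
        show "norm ((snd (v ()), - grad V (fst (v ()))) - (snd (w ()), - grad V (fst (w ())))) \<le> L * (\<Sum>i\<in>{()}. norm (v i - w i))"
          unfolding s by (rule L(2)[rule_format]) (use R in blast)
      qed
    qed
    fix z0 j
    have c: "continuous_on {0..T} (\<lambda>t. X t (ini z0))" by (rule continuous_on_vector_derivative[OF flow_deriv])
    have c': "continuous_on ({0..T} \<times> K) (\<lambda>p. X (fst p) (ini z0))"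
      by (rule continuous_on_compose2[OF c]) (auto intro!: continuous_intros)
    show "continuous_on ({0..T} \<times> K) (\<lambda>p. (snd (X (fst p) (ini z0)), - grad V (fst (X (fst p) (ini z0)))))"
      by (intro continuous_intros c' continuous_on_compose2[OF continuous_on_grad[OF V, of UNIV]]) auto
    show "continuous_on K (\<lambda>z. X 0 (ini z))"
      unfolding flow_0 ini_def by (intro continuous_intros continuous_on_grad S)
  qed (use T compact_K in auto)
  then show ?thesis by (simp add: P_def)
qed

lemma continuous_xc: "continuous_on P xc" and continuous_mom: "continuous_on P mom"
  unfolding xc_def mom_def by (intro continuous_intros continuous_flow)+

lemma sfam_mono [sfam_intros]: "continuous_on Q xc \<Longrightarrow> sfam Q (mono \<beta>)"
  unfolding mono_def by (intro sfam_of_real sfam_mi_power)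

lemma smooth_Ph: "smooth (Phase p)"
  unfolding Phase_def by (rule smooth_taylor_poly)

lemma sfam_rest:
  assumes "sfam Q Phase" "continuous_on Q mom"
  shows "sfam Q eikonal_static"
proof -
  have "sfam Q (\<lambda>p y. eikonal_static p y)"
    unfolding eikonal_static_def
    by (intro sfam_intros assms V continuous_intros bounded_linear.continuous_on[OF bounded_linear_vec_nth])
  then show ?thesis .
qed

lemma smooth_rest: "smooth (eikonal_static p)"
proof -
  have "sfam {p} Phase" using sfam_smooth[OF smooth_Ph, of "{p}" p] sfam_cong[of "{p}" Phase "\<lambda>_. Phase p"] by simp
  then show ?thesis using sfam_imp_smooth[OF sfam_rest] by auto
qed

lemma smooth_V: "smooth (\<lambda>y. complex_of_real (V y))"
  unfolding smooth_iff_sfam by (intro sfam_intros V)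

lemma beam_phase_eq: "beam_phase k X \<phi> (ini z) t = Phase (t, z)"
  by (rule ext) (simp add: beam_phase_def Phase_def coef_def xc_def)

lemma phase_facts:
  assumes "p \<in> P" "mi_size \<alpha> \<le> k + 1"
  shows "(\<lambda>s. \<phi> \<alpha> s (ini (snd p))) differentiable (at (fst p) within {0..T})"
    and "mi_deriv \<alpha> (eikonal V T (beam_phase k X \<phi> (ini (snd p))) (fst p)) (xc p) = 0"
  using phase[OF ini_Omega, of "snd p"] assms unfolding phase_system_def P_def xc_def Let_def by auto

lemma coef_deriv:
  assumes "t \<in> {0..T}" "z \<in> K" "mi_size \<alpha> \<le> k + 1"
  shows "((\<lambda>s. coef \<alpha> (s, z)) has_vector_derivative coef' \<alpha> (t, z)) (at t within {0..T})"
  using phase_facts(1)[OF P_I[OF assms(1,2)] assms(3)] unfolding coef_def coef'_def fst_conv snd_conv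
  by (rule vector_derivative_works[THEN iffD1])

lemma vector_derivative_within_T:
  "t \<in> {0..T} \<Longrightarrow> (f has_vector_derivative d) (at t within {0..T}) \<Longrightarrow> vector_derivative f (at t within {0..T}) = d"
  using vector_derivative_within_cbox[of 0 T t f d] T by (simp add: cbox_interval)

definition Phase_t :: "real \<times> (real^'n) \<Rightarrow> real^'n \<Rightarrow> complex" where
  "Phase_t p y = taylor_poly (k + 1) (\<lambda>\<alpha>. coef' \<alpha> p) (xc p) y - (\<Sum>i\<in>UNIV. of_real (mom p $ i) * partial i (Phase p) y)"

lemma Phase_time_deriv:
  assumes "t \<in> {0..T}" "z \<in> K"
  shows "((\<lambda>s. Phase (s, z) y) has_vector_derivative Phase_t (t, z) y) (at t within {0..T})"
  unfolding Phase_def Phase_t_def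
  by (rule has_vector_derivative_taylor_poly[where c="\<lambda>s \<alpha>. coef \<alpha> (s, z)" and \<xi>="\<lambda>s. xc (s, z)"])
    (use coef_deriv xc_deriv assms in auto)

definition eikonal_residual :: "real \<times> (real^'n) \<Rightarrow> real^'n \<Rightarrow> complex" where
  "eikonal_residual p y = Phase_t p y + 1/2 * (\<Sum>i\<in>UNIV. (partial i (Phase p) y)\<^sup>2) + of_real (V y)"

lemma eikonal_residual_split: "eikonal_residual p = (\<lambda>y. taylor_poly (k + 1) (\<lambda>\<alpha>. coef' \<alpha> p) (xc p) y + eikonal_static p y)"
  by (rule ext) (simp add: eikonal_residual_def Phase_t_def eikonal_static_def)

lemma eikonal_eq:
  assumes "p \<in> P"
  shows "eikonal V T (beam_phase k X \<phi> (ini (snd p))) (fst p) = eikonal_residual p"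
proof
  fix y
  have "fst p \<in> {0..T}" "snd p \<in> K" using assms by (auto simp: P_def)
  from vector_derivative_within_T[OF this(1) Phase_time_deriv[OF this]]
  show "eikonal V T (beam_phase k X \<phi> (ini (snd p))) (fst p) y = eikonal_residual p y"
    unfolding eikonal_def eikonal_residual_def beam_phase_eq prod.collapse by simp
qed

text \<open>At the centre the Taylor polynomial with coefficients \<open>coef'\<close> contributes
  exactly \<open>coef' \<alpha>\<close>, so the vanishing of the derivatives of the eikonal
  expression becomes an explicit differential equation.\<close>

lemma coef'_eq:
  assumes "p \<in> P" "mi_size \<alpha> \<le> k + 1"
  shows "coef' \<alpha> p = - mi_deriv \<alpha> (eikonal_static p) (xc p)"
proof -
  have "0 = mi_deriv \<alpha> (eikonal_residual p) (xc p)" using phase_facts(2)[OF assms] eikonal_eq[OF assms(1)] by simp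
  also have "\<dots> = mi_deriv \<alpha> (taylor_poly (k + 1) (\<lambda>\<alpha>. coef' \<alpha> p) (xc p)) (xc p) + mi_deriv \<alpha> (eikonal_static p) (xc p)"
    unfolding eikonal_residual_split by (rule mi_deriv_add[OF smooth_taylor_poly smooth_rest])
  also have "mi_deriv \<alpha> (taylor_poly (k + 1) (\<lambda>\<alpha>. coef' \<alpha> p) (xc p)) (xc p) = coef' \<alpha> p"
    using assms(2) by (simp only: mi_deriv_taylor_poly if_True)
  finally show ?thesis by (simp add: eq_neg_iff_add_eq_0)
qed

lemma partial_Ph: "partial i (Phase p) y = (\<Sum>\<beta> | mi_size \<beta> \<le> k + 1. coef \<beta> p / of_nat (mi_fact \<beta>) * partial i (mono \<beta> p) y)"
  unfolding Phase_def partial_taylor_poly mono_def[abs_def] ..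

text \<open>\<open>eikonal_static\<close> is a quadratic polynomial in the coefficients of the phase, with the
  following functions as its coefficients; this turns the phase system into an ODE system.\<close>

definition phase_quad :: "('n \<Rightarrow> nat) \<times> ('n \<Rightarrow> nat) \<Rightarrow> real \<times> (real^'n) \<Rightarrow> real^'n \<Rightarrow> complex" where
  "phase_quad bc p y = 1 / (of_nat (mi_fact (fst bc)) * of_nat (mi_fact (snd bc))) *
     (1/2 * (\<Sum>i\<in>UNIV. partial i (mono (fst bc) p) y * partial i (mono (snd bc) p) y))"
definition phase_lin :: "('n \<Rightarrow> nat) \<Rightarrow> real \<times> (real^'n) \<Rightarrow> real^'n \<Rightarrow> complex" where
  "phase_lin b p y = - 1 / of_nat (mi_fact b) * (\<Sum>i\<in>UNIV. of_real (mom p $ i) * partial i (mono b p) y)"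

lemma sfam_Qf: "continuous_on Q xc \<Longrightarrow> sfam Q (phase_quad bc)"
proof -
  assume "continuous_on Q xc"
  then have "sfam Q (\<lambda>p y. phase_quad bc p y)" unfolding phase_quad_def by (intro sfam_intros continuous_intros)
  then show ?thesis .
qed

lemma sfam_Lf: "continuous_on Q xc \<Longrightarrow> continuous_on Q mom \<Longrightarrow> sfam Q (phase_lin b)"
proof -
  assume "continuous_on Q xc" "continuous_on Q mom"
  then have "sfam Q (\<lambda>p y. phase_lin b p y)" unfolding phase_lin_def
    by (intro sfam_intros continuous_intros bounded_linear.continuous_on[OF bounded_linear_vec_nth])
  then show ?thesis .
qed

lemma smooth_Qf: "smooth (phase_quad bc p)" and smooth_Lf: "smooth (phase_lin b p)"
  using sfam_imp_smooth[OF sfam_Qf[of "{p}"]] sfam_imp_smooth[OF sfam_Lf[of "{p}"]] by auto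

lemma eikonal_static_eq:
  "eikonal_static p = (\<lambda>y. (\<Sum>bc\<in>{\<beta>. mi_size \<beta> \<le> k + 1} \<times> {\<beta>. mi_size \<beta> \<le> k + 1}. (coef (fst bc) p * coef (snd bc) p) * phase_quad bc p y)
     + (\<Sum>b | mi_size b \<le> k + 1. coef b p * phase_lin b p y) + of_real (V y))"
proof
  fix y
  let ?J = "{\<beta> :: 'n \<Rightarrow> nat. mi_size \<beta> \<le> k + 1}"
  let ?g = "\<lambda>i b. partial i (mono b p) y"
  let ?c = "\<lambda>b. coef b p / of_nat (mi_fact b)"
  have "1/2 * (\<Sum>i\<in>UNIV. (partial i (Phase p) y)\<^sup>2) = 1/2 * (\<Sum>i\<in>UNIV. \<Sum>b\<in>?J. \<Sum>c\<in>?J. (?c b * ?g i b) * (?c c * ?g i c))"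
    by (simp add: partial_Ph power2_eq_square sum_product)
  also have "(\<Sum>i\<in>UNIV. \<Sum>b\<in>?J. \<Sum>c\<in>?J. (?c b * ?g i b) * (?c c * ?g i c))
     = (\<Sum>i\<in>UNIV. \<Sum>bc\<in>?J \<times> ?J. (?c (fst bc) * ?g i (fst bc)) * (?c (snd bc) * ?g i (snd bc)))"
    by (simp add: sum.cartesian_product split_beta)
  also have "\<dots> = (\<Sum>bc\<in>?J \<times> ?J. \<Sum>i\<in>UNIV. (?c (fst bc) * ?g i (fst bc)) * (?c (snd bc) * ?g i (snd bc)))"
    by (rule sum.swap)
  also have "1/2 * \<dots> = (\<Sum>bc\<in>?J \<times> ?J. (coef (fst bc) p * coef (snd bc) p) * phase_quad bc p y)"
    unfolding sum_distrib_left[of "1/2"]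
    by (intro sum.cong refl) (simp add: phase_quad_def sum_distrib_left mult_ac)
  finally have 1: "1/2 * (\<Sum>i\<in>UNIV. (partial i (Phase p) y)\<^sup>2) = (\<Sum>bc\<in>?J \<times> ?J. (coef (fst bc) p * coef (snd bc) p) * phase_quad bc p y)" .
  have "(\<Sum>i\<in>UNIV. of_real (mom p $ i) * partial i (Phase p) y) = (\<Sum>b\<in>?J. \<Sum>i\<in>UNIV. of_real (mom p $ i) * (?c b * ?g i b))"
    unfolding partial_Ph sum_distrib_left by (rule sum.swap)
  also have "\<dots> = - (\<Sum>b\<in>?J. coef b p * phase_lin b p y)"
    unfolding sum_negf[symmetric] by (intro sum.cong refl) (simp add: phase_lin_def sum_distrib_left sum_negf mult_ac)
  finally have 2: "- (\<Sum>i\<in>UNIV. of_real (mom p $ i) * partial i (Phase p) y) = (\<Sum>b\<in>?J. coef b p * phase_lin b p y)" by simp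
  show "eikonal_static p y = (\<Sum>bc\<in>?J \<times> ?J. (coef (fst bc) p * coef (snd bc) p) * phase_quad bc p y)
     + (\<Sum>b | mi_size b \<le> k + 1. coef b p * phase_lin b p y) + of_real (V y)"
    unfolding eikonal_static_def 1[symmetric] 2[symmetric] by simp
qed

lemma mi_deriv_rest:
  "mi_deriv \<alpha> (eikonal_static p) x = (\<Sum>b | mi_size b \<le> k + 1. \<Sum>c | mi_size c \<le> k + 1. mi_deriv \<alpha> (phase_quad (b, c) p) x * (coef b p * coef c p))
     + (\<Sum>b | mi_size b \<le> k + 1. mi_deriv \<alpha> (phase_lin b p) x * coef b p) + mi_deriv \<alpha> (\<lambda>y. of_real (V y)) x"
proof -
  let ?J = "{\<beta> :: 'n \<Rightarrow> nat. mi_size \<beta> \<le> k + 1}"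
  have fin: "finite (?J \<times> ?J)" "finite ?J" by (auto intro: finite_mi_size_le)
  have s: "smooth (\<lambda>y. \<Sum>bc\<in>?J \<times> ?J. (coef (fst bc) p * coef (snd bc) p) * phase_quad bc p y)"
    "smooth (\<lambda>y. \<Sum>b\<in>?J. coef b p * phase_lin b p y)"
    unfolding smooth_iff_sfam
    by (intro sfam_intros continuous_intros smooth_Qf smooth_Lf)+
  have s': "smooth (\<lambda>y. (\<Sum>bc\<in>?J \<times> ?J. (coef (fst bc) p * coef (snd bc) p) * phase_quad bc p y) + (\<Sum>b\<in>?J. coef b p * phase_lin b p y))"
    using s unfolding smooth_iff_sfam by (rule sfam_add)
  show ?thesis
    unfolding eikonal_static_eq mi_deriv_add[OF s' smooth_V] mi_deriv_add[OF s]
      mi_deriv_sum[OF fin(1) smooth_Qf] mi_deriv_sum[OF fin(2) smooth_Lf]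
    by (simp add: sum.cartesian_product split_beta mult.commute)
qed

lemma continuous_mi_deriv:
  assumes "sfam Q f" "continuous_on Q xc"
  shows "continuous_on Q (\<lambda>p. mi_deriv \<alpha> (f p) (xc p))"
  unfolding mi_deriv_eq_foldr
  by (rule sfam_continuous_comp[OF sfam_foldr_partial[OF assms(1)] continuous_on_id assms(2)]) auto

lemma coef_list: "mi_size \<alpha> \<le> k + 1 \<Longrightarrow> coef \<alpha> p = foldr partial (mi_list \<alpha>) (Phase p) (xc p)"
  using mi_deriv_taylor_poly[of \<alpha> "k + 1" "\<lambda>\<alpha>. coef \<alpha> p" "xc p"] by (simp add: mi_deriv_eq_foldr Phase_def)

lemma phase_init:
  assumes "z \<in> K"
  shows "Phase (0, z) z = of_real (S z)"
    and "partial i (Phase (0, z)) z = of_real (grad S z $ i)"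
    and "partial i (partial j (Phase (0, z))) z = of_real (partial i (partial j S) z) + (if i = j then \<i> else 0)"
    and "3 \<le> mi_size \<alpha> \<Longrightarrow> mi_size \<alpha> \<le> k + 1 \<Longrightarrow> coef \<alpha> (0, z) = of_real (mi_deriv \<alpha> S z)"
proof -
  note ps = phase[OF ini_Omega[OF assms], unfolded phase_system_def Let_def beam_phase_eq]
  have "mi_list (\<lambda>_::'n. 0) = []" using size_mi_list[of "\<lambda>_::'n. 0"] by (simp add: mi_size_def)
  then have "coef (\<lambda>_. 0) (0, z) = Phase (0, z) z" using coef_list[of "\<lambda>_. 0" "(0, z)"] by (simp add: mi_size_def)
  then show "Phase (0, z) z = of_real (S z)" using ps by (simp add: coef_def ini_def)
  show "partial i (Phase (0, z)) z = of_real (grad S z $ i)"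
    "partial i (partial j (Phase (0, z))) z = of_real (partial i (partial j S) z) + (if i = j then \<i> else 0)"
    "3 \<le> mi_size \<alpha> \<Longrightarrow> mi_size \<alpha> \<le> k + 1 \<Longrightarrow> coef \<alpha> (0, z) = of_real (mi_deriv \<alpha> S z)"
    using ps by (auto simp: coef_def ini_def)
qed

text \<open>The initial data come in two forms: orders one and two are prescribed as derivatives of
  the beam phase, order zero and orders from three on as coefficients. The case split on the word of
  \<alpha> follows this.\<close>

lemma continuous_coef_0:
  assumes \<alpha>: "mi_size \<alpha> \<le> k + 1"
  shows "continuous_on K (\<lambda>z. coef \<alpha> (0, z))"
proof -
  have eq: "coef \<alpha> (0, z) = foldr partial (mi_list \<alpha>) (Phase (0, z)) z" for z
    using coef_list[OF \<alpha>, of "(0, z)"] by simp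
  have len: "length (mi_list \<alpha>) = mi_size \<alpha>" by (rule size_mi_list)
  consider "mi_list \<alpha> = []" | i where "mi_list \<alpha> = [i]" | i j where "mi_list \<alpha> = [i, j]" | "3 \<le> mi_size \<alpha>"
    using len by (cases "mi_list \<alpha>"; cases "tl (mi_list \<alpha>)"; cases "tl (tl (mi_list \<alpha>))") auto
  then show ?thesis
  proof cases
    case 1
    have "continuous_on K (\<lambda>z. complex_of_real (S z))" by (intro continuous_intros smooth_continuous S)
    then show ?thesis by (rule continuous_on_cong[THEN iffD1, OF refl, rotated]) (simp add: eq 1 phase_init)
  next
    case 2
    have "continuous_on K (\<lambda>z. complex_of_real (partial i S z))" by (intro continuous_intros smooth_continuous smooth_partial S)
    then show ?thesis by (rule continuous_on_cong[THEN iffD1, OF refl, rotated]) (simp add: eq 2 phase_init grad_def)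
  next
    case 3
    have "continuous_on K (\<lambda>z. complex_of_real (partial i (partial j S) z) + (if i = j then \<i> else 0))"
      by (intro continuous_intros smooth_continuous smooth_partial S)
    then show ?thesis by (rule continuous_on_cong[THEN iffD1, OF refl, rotated]) (simp add: eq 3 phase_init)
  next
    case 4
    have "continuous_on K (\<lambda>z. complex_of_real (mi_deriv \<alpha> S z))"
      by (intro continuous_intros smooth_continuous smooth_mi_deriv S)
    then show ?thesis by (rule continuous_on_cong[THEN iffD1, OF refl, rotated]) (rule phase_init(4)[OF _ 4 \<alpha>, symmetric])
  qed
qed

text \<open>The truncated phase is a polynomial in y, so its system is closed: only coefficients of
  order at most \<open>k + 1\<close> occur, and they occur at most quadratically.\<close>

lemma continuous_coef:
  assumes \<alpha>: "mi_size \<alpha> \<le> k + 1"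
  shows "continuous_on P (coef \<alpha>)"
proof -
  let ?J = "{\<beta> :: 'n \<Rightarrow> nat. mi_size \<beta> \<le> k + 1}"
  have "continuous_on ({0..T} \<times> K) (\<lambda>p. (\<lambda>j t z. coef j (t, z)) \<alpha> (fst p) (snd p))"
  proof (rule quadratic_ode_continuous[where J="?J" and K="\<lambda>j b c p. - mi_deriv j (phase_quad (b, c) p) (xc p)"
        and L="\<lambda>j b p. - mi_deriv j (phase_lin b p) (xc p)" and F="\<lambda>j p. - mi_deriv j (\<lambda>y. complex_of_real (V y)) (xc p)"])
    fix j :: "'n \<Rightarrow> nat" and t z assume j: "j \<in> ?J" and tz: "t \<in> {0..T}" "z \<in> K"
    have "coef' j (t, z) = (\<Sum>b\<in>?J. \<Sum>c\<in>?J. - mi_deriv j (phase_quad (b, c) (t, z)) (xc (t, z)) * (coef b (t, z) * coef c (t, z)))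
        + (\<Sum>b\<in>?J. - mi_deriv j (phase_lin b (t, z)) (xc (t, z)) * coef b (t, z)) + - mi_deriv j (\<lambda>y. complex_of_real (V y)) (xc (t, z))"
      using coef'_eq[OF P_I[OF tz], of j] j by (simp add: mi_deriv_rest sum_negf)
    then show "((\<lambda>s. coef j (s, z)) has_vector_derivative (\<Sum>b\<in>?J. \<Sum>c\<in>?J. - mi_deriv j (phase_quad (b, c) (t, z)) (xc (t, z)) * (coef b (t, z) * coef c (t, z)))
        + (\<Sum>b\<in>?J. - mi_deriv j (phase_lin b (t, z)) (xc (t, z)) * coef b (t, z)) + - mi_deriv j (\<lambda>y. complex_of_real (V y)) (xc (t, z))) (at t within {0..T})"
      using coef_deriv[OF tz, of j] j by simp
  next
    fix j b c :: "'n \<Rightarrow> nat"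
    show "continuous_on ({0..T} \<times> K) (\<lambda>p. - mi_deriv j (phase_quad (b, c) p) (xc p))"
      unfolding P_def[symmetric] by (intro continuous_intros continuous_mi_deriv sfam_Qf continuous_xc)
    show "continuous_on ({0..T} \<times> K) (\<lambda>p. - mi_deriv j (phase_lin b p) (xc p))"
      unfolding P_def[symmetric] by (intro continuous_intros continuous_mi_deriv sfam_Lf continuous_xc continuous_mom)
    show "continuous_on ({0..T} \<times> K) (\<lambda>p. - mi_deriv j (\<lambda>y. complex_of_real (V y)) (xc p))"
      unfolding P_def[symmetric] by (intro continuous_intros continuous_mi_deriv sfam_intros V continuous_xc)
    show "continuous_on K (\<lambda>z. coef j (0, z))" if "j \<in> ?J" by (rule continuous_coef_0) (use that in simp)
  qed (use T compact_K \<alpha> in \<open>auto intro: finite_mi_size_le\<close>)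
  then show ?thesis by (simp add: P_def)
qed

lemma sfam_Ph [sfam_intros]: "sfam P Phase"
proof -
  have "sfam P (\<lambda>p y. Phase p y)"
    unfolding Phase_def by (rule sfam_taylor_poly[OF continuous_xc continuous_coef])
  then show ?thesis .
qed

lemma continuous_coef':
  assumes \<alpha>: "mi_size \<alpha> \<le> k + 1"
  shows "continuous_on P (coef' \<alpha>)"
proof -
  have "continuous_on P (\<lambda>p. - mi_deriv \<alpha> (eikonal_static p) (xc p))"
    by (intro continuous_intros continuous_mi_deriv sfam_rest sfam_Ph continuous_mom continuous_xc)
  then show ?thesis by (rule continuous_on_cong[THEN iffD1, OF refl, rotated]) (rule coef'_eq[OF _ \<alpha>, symmetric])
qed

lemma continuous_mom_i: "continuous_on P (\<lambda>p. complex_of_real (mom p $ i))"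
  by (intro continuous_intros bounded_linear.continuous_on[OF bounded_linear_vec_nth] continuous_mom)

lemma sfam_Pht [sfam_intros]: "sfam P Phase_t"
proof -
  have "sfam P (\<lambda>p y. Phase_t p y)"
    unfolding Phase_t_def by (intro sfam_intros continuous_xc continuous_coef' continuous_mom_i)
  then show ?thesis .
qed

lemma sfam_eik [sfam_intros]: "sfam P eikonal_residual"
proof -
  have "sfam P (\<lambda>p y. eikonal_residual p y)" unfolding eikonal_residual_def by (intro sfam_intros V continuous_intros)
  then show ?thesis .
qed

text \<open>The equations cover all orders up to \<open>k + 1\<close>, that is all words shorter
  than \<open>k + 2\<close>. This order of contact is what \<open>sfam_vanish_bound\<close> turns
  into a power of the distance.\<close>

lemma eikonal_residual_vanish:
  assumes "p \<in> P" "length is < k + 2"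
  shows "foldr partial is (eikonal_residual p) (xc p) = 0"
proof -
  have "smooth (eikonal_residual p)" by (rule sfam_imp_smooth[OF sfam_eik assms(1)])
  then have "foldr partial is (eikonal_residual p) (xc p) = mi_deriv (count (mset is)) (eikonal_residual p) (xc p)"
    using foldr_partial_eq_mi_deriv by metis
  also have "\<dots> = 0"
    using phase_facts(2)[OF assms(1), of "count (mset is)"] assms eikonal_eq[OF assms(1)] mi_size_count[of "is"] by simp
  finally show ?thesis .
qed

subsection \<open>Amplitudes\<close>

definition acoef :: "nat \<Rightarrow> ('n \<Rightarrow> nat) \<Rightarrow> real \<times> (real^'n) \<Rightarrow> complex" where
  "acoef l \<alpha> p = a l \<alpha> (fst p) (ini (snd p))"
definition acoef' :: "nat \<Rightarrow> ('n \<Rightarrow> nat) \<Rightarrow> real \<times> (real^'n) \<Rightarrow> complex" where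
  "acoef' l \<alpha> p = vector_derivative (\<lambda>s. a l \<alpha> s (ini (snd p))) (at (fst p) within {0..T})"
definition Amp :: "nat \<Rightarrow> real \<times> (real^'n) \<Rightarrow> real^'n \<Rightarrow> complex" where
  "Amp l p = taylor_poly (k - 1 - 2 * l) (\<lambda>\<alpha>. acoef l \<alpha> p) (xc p)"
definition Amp_t :: "nat \<Rightarrow> real \<times> (real^'n) \<Rightarrow> real^'n \<Rightarrow> complex" where
  "Amp_t l p y = taylor_poly (k - 1 - 2 * l) (\<lambda>\<alpha>. acoef' l \<alpha> p) (xc p) y - (\<Sum>i\<in>UNIV. of_real (mom p $ i) * partial i (Amp l p) y)"
text \<open>The factor of one amplitude coefficient in the transport expression. The momentum is
  subtracted because the expansion point moves, so the transporting field is only the deviation of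
  the phase gradient from the momentum.\<close>

definition amp_lin :: "('n \<Rightarrow> nat) \<Rightarrow> real \<times> (real^'n) \<Rightarrow> real^'n \<Rightarrow> complex" where
  "amp_lin b p y = 1 / of_nat (mi_fact b) * ((\<Sum>i\<in>UNIV. (partial i (Phase p) y - of_real (mom p $ i)) * partial i (mono b p) y)
     + 1/2 * laplacian (Phase p) y * mono b p y)"
definition amp_source :: "nat \<Rightarrow> real \<times> (real^'n) \<Rightarrow> real^'n \<Rightarrow> complex" where
  "amp_source l p y = - \<i>/2 * (if l = 0 then 0 else laplacian (Amp (l - 1) p) y)"
definition transport_residual :: "nat \<Rightarrow> real \<times> (real^'n) \<Rightarrow> real^'n \<Rightarrow> complex" where
  "transport_residual l p y = Amp_t l p y + (\<Sum>i\<in>UNIV. partial i (Phase p) y * partial i (Amp l p) y) + 1/2 * laplacian (Phase p) y * Amp l p y + amp_source l p y"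

lemma beam_amplitude_eq: "beam_amplitude k X a (ini z) l t = Amp l (t, z)"
  by (rule ext) (simp add: beam_amplitude_def Amp_def acoef_def xc_def)

lemma smooth_Am: "smooth (Amp l p)"
  unfolding Amp_def by (rule smooth_taylor_poly)

lemma amplitude_facts:
  assumes "p \<in> P" "l \<le> (k - 1) div 2" "mi_size \<alpha> \<le> k - 1 - 2 * l"
  shows "(\<lambda>s. a l \<alpha> s (ini (snd p))) differentiable (at (fst p) within {0..T})"
    and "mi_deriv \<alpha> (\<lambda>y. transport T (beam_phase k X \<phi> (ini (snd p))) (beam_amplitude k X a (ini (snd p)) l) (fst p) y
                - \<i>/2 * (if l = 0 then 0 else laplacian (beam_amplitude k X a (ini (snd p)) (l - 1) (fst p)) y)) (xc p) = 0"
proof -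
  have "fst p \<in> {0..T}" "snd p \<in> K" using assms by (auto simp: P_def)
  then show "(\<lambda>s. a l \<alpha> s (ini (snd p))) differentiable (at (fst p) within {0..T})"
    "mi_deriv \<alpha> (\<lambda>y. transport T (beam_phase k X \<phi> (ini (snd p))) (beam_amplitude k X a (ini (snd p)) l) (fst p) y
                - \<i>/2 * (if l = 0 then 0 else laplacian (beam_amplitude k X a (ini (snd p)) (l - 1) (fst p)) y)) (xc p) = 0"
    using amplitude[OF ini_Omega, of "snd p"] assms(2,3) unfolding amplitude_system_def xc_def Let_def by blast+
qed

lemma amplitude_init:
  assumes "z \<in> K" "l \<le> (k - 1) div 2" "mi_size \<alpha> \<le> k - 1 - 2 * l"
  shows "acoef l \<alpha> (0, z) = (if l = 0 then mi_deriv \<alpha> A z else 0)"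
  using amplitude[OF ini_Omega[OF assms(1)]] assms unfolding amplitude_system_def Let_def acoef_def by (simp add: ini_def)

lemma acoef_deriv:
  assumes "t \<in> {0..T}" "z \<in> K" "l \<le> (k - 1) div 2" "mi_size \<alpha> \<le> k - 1 - 2 * l"
  shows "((\<lambda>s. acoef l \<alpha> (s, z)) has_vector_derivative acoef' l \<alpha> (t, z)) (at t within {0..T})"
  using amplitude_facts(1)[OF P_I[OF assms(1,2)] assms(3,4)] unfolding acoef_def acoef'_def fst_conv snd_conv
  by (rule vector_derivative_works[THEN iffD1])

lemma Amp_time_deriv:
  assumes "t \<in> {0..T}" "z \<in> K" "l \<le> (k - 1) div 2"
  shows "((\<lambda>s. Amp l (s, z) y) has_vector_derivative Amp_t l (t, z) y) (at t within {0..T})"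
  unfolding Amp_def Amp_t_def
  by (rule has_vector_derivative_taylor_poly[where c="\<lambda>s \<alpha>. acoef l \<alpha> (s, z)" and \<xi>="\<lambda>s. xc (s, z)"])
    (use acoef_deriv xc_deriv assms in auto)

lemma transport_eq:
  assumes "p \<in> P" "l \<le> (k - 1) div 2"
  shows "(\<lambda>y. transport T (beam_phase k X \<phi> (ini (snd p))) (beam_amplitude k X a (ini (snd p)) l) (fst p) y
                - \<i>/2 * (if l = 0 then 0 else laplacian (beam_amplitude k X a (ini (snd p)) (l - 1) (fst p)) y)) = transport_residual l p"
proof
  fix y
  have "fst p \<in> {0..T}" "snd p \<in> K" using assms by (auto simp: P_def)
  from vector_derivative_within_T[OF this(1) Amp_time_deriv[OF this assms(2)]]
  show "transport T (beam_phase k X \<phi> (ini (snd p))) (beam_amplitude k X a (ini (snd p)) l) (fst p) y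
                - \<i>/2 * (if l = 0 then 0 else laplacian (beam_amplitude k X a (ini (snd p)) (l - 1) (fst p)) y) = transport_residual l p y"
    unfolding transport_def transport_residual_def amp_source_def beam_phase_eq beam_amplitude_eq prod.collapse by simp
qed

text \<open>Isolates the time derivatives of the coefficients in a Taylor polynomial about the
  centre, as \<open>eikonal_residual_split\<close> does for the phase; what remains is affine in the
  amplitude coefficients of the same level.\<close>

lemma transport_residual_split:
  "transport_residual l p = (\<lambda>y. taylor_poly (k - 1 - 2 * l) (\<lambda>\<alpha>. acoef' l \<alpha> p) (xc p) y +
     ((\<Sum>b | mi_size b \<le> k - 1 - 2 * l. acoef l b p * amp_lin b p y) + amp_source l p y))"
proof
  fix y
  let ?J = "{b :: 'n \<Rightarrow> nat. mi_size b \<le> k - 1 - 2 * l}"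
  have pA: "partial i (Amp l p) y = (\<Sum>b\<in>?J. acoef l b p / of_nat (mi_fact b) * partial i (mono b p) y)" for i
    unfolding Amp_def partial_taylor_poly mono_def[abs_def] ..
  have "(\<Sum>i\<in>UNIV. partial i (Phase p) y * partial i (Amp l p) y) - (\<Sum>i\<in>UNIV. of_real (mom p $ i) * partial i (Amp l p) y)
    = (\<Sum>i\<in>UNIV. (partial i (Phase p) y - of_real (mom p $ i)) * partial i (Amp l p) y)"
    by (simp add: sum_subtractf algebra_simps)
  also have "\<dots> = (\<Sum>b\<in>?J. \<Sum>i\<in>UNIV. (partial i (Phase p) y - of_real (mom p $ i)) * (acoef l b p / of_nat (mi_fact b) * partial i (mono b p) y))"
    unfolding pA sum_distrib_left by (rule sum.swap)
  finally have 1: "(\<Sum>i\<in>UNIV. partial i (Phase p) y * partial i (Amp l p) y) - (\<Sum>i\<in>UNIV. of_real (mom p $ i) * partial i (Amp l p) y)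
    = (\<Sum>b\<in>?J. \<Sum>i\<in>UNIV. (partial i (Phase p) y - of_real (mom p $ i)) * (acoef l b p / of_nat (mi_fact b) * partial i (mono b p) y))" .
  have 2: "1/2 * laplacian (Phase p) y * Amp l p y = (\<Sum>b\<in>?J. 1/2 * laplacian (Phase p) y * (acoef l b p / of_nat (mi_fact b) * mono b p y))"
    unfolding Amp_def taylor_poly_def mono_def sum_distrib_left ..
  have "(\<Sum>b\<in>?J. acoef l b p * amp_lin b p y) = (\<Sum>i\<in>UNIV. partial i (Phase p) y * partial i (Amp l p) y)
     - (\<Sum>i\<in>UNIV. of_real (mom p $ i) * partial i (Amp l p) y) + 1/2 * laplacian (Phase p) y * Amp l p y"
    unfolding 1 2 sum.distrib[symmetric]
    by (intro sum.cong refl) (simp add: amp_lin_def distrib_left sum_distrib_left mult_ac)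
  then show "transport_residual l p y = taylor_poly (k - 1 - 2 * l) (\<lambda>\<alpha>. acoef' l \<alpha> p) (xc p) y +
     ((\<Sum>b\<in>?J. acoef l b p * amp_lin b p y) + amp_source l p y)"
    by (simp add: transport_residual_def Amp_t_def)
qed

lemma sfam_Lg [sfam_intros]: "sfam P (amp_lin b)"
proof -
  have "sfam P (\<lambda>p y. amp_lin b p y)" unfolding amp_lin_def
    by (intro sfam_intros continuous_intros continuous_mom_i continuous_xc)
  then show ?thesis .
qed

lemma sfam_Fg:
  assumes "l > 0 \<Longrightarrow> sfam P (Amp (l - 1))"
  shows "sfam P (amp_source l)"
proof -
  have "sfam P (\<lambda>p y. amp_source l p y)"
  proof (cases "l = 0")
    case False
    then show ?thesis unfolding amp_source_def using assms by (simp only: if_False) (intro sfam_intros continuous_intros, simp)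
  qed (auto simp: amp_source_def intro!: sfam_const continuous_intros)
  then show ?thesis .
qed

lemma acoef'_eq:
  assumes p: "p \<in> P" and l: "l \<le> (k - 1) div 2" and \<alpha>: "mi_size \<alpha> \<le> k - 1 - 2 * l"
    and F: "sfam P (amp_source l)"
  shows "acoef' l \<alpha> p = (\<Sum>b | mi_size b \<le> k - 1 - 2 * l. - mi_deriv \<alpha> (amp_lin b p) (xc p) * acoef l b p) - mi_deriv \<alpha> (amp_source l p) (xc p)"
proof -
  let ?J = "{b :: 'n \<Rightarrow> nat. mi_size b \<le> k - 1 - 2 * l}"
  have sL: "smooth (amp_lin b p)" for b by (rule sfam_imp_smooth[OF sfam_Lg p])
  have sF: "smooth (amp_source l p)" by (rule sfam_imp_smooth[OF F p])
  have sS: "smooth (\<lambda>y. \<Sum>b\<in>?J. acoef l b p * amp_lin b p y)"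
    unfolding smooth_iff_sfam by (intro sfam_intros continuous_intros sL)
  have sLF: "smooth (\<lambda>y. (\<Sum>b\<in>?J. acoef l b p * amp_lin b p y) + amp_source l p y)"
    using sS sF unfolding smooth_iff_sfam by (rule sfam_add)
  have "0 = mi_deriv \<alpha> (transport_residual l p) (xc p)" using amplitude_facts(2)[OF p l \<alpha>] transport_eq[OF p l] by simp
  also have "\<dots> = mi_deriv \<alpha> (taylor_poly (k - 1 - 2 * l) (\<lambda>\<alpha>. acoef' l \<alpha> p) (xc p)) (xc p)
      + ((\<Sum>b\<in>?J. acoef l b p * mi_deriv \<alpha> (amp_lin b p) (xc p)) + mi_deriv \<alpha> (amp_source l p) (xc p))"
    unfolding transport_residual_split mi_deriv_add[OF smooth_taylor_poly sLF] mi_deriv_add[OF sS sF] mi_deriv_sum[OF finite_mi_size_le sL] ..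
  also have "mi_deriv \<alpha> (taylor_poly (k - 1 - 2 * l) (\<lambda>\<alpha>. acoef' l \<alpha> p) (xc p)) (xc p) = acoef' l \<alpha> p"
    using \<alpha> by (simp only: mi_deriv_taylor_poly if_True)
  finally have "acoef' l \<alpha> p = - (\<Sum>b\<in>?J. acoef l b p * mi_deriv \<alpha> (amp_lin b p) (xc p)) - mi_deriv \<alpha> (amp_source l p) (xc p)"
    by (simp add: algebra_simps eq_neg_iff_add_eq_0)
  then show ?thesis by (simp add: sum_negf mult.commute)
qed

lemma continuous_acoef:
  assumes l: "l \<le> (k - 1) div 2" and \<alpha>: "mi_size \<alpha> \<le> k - 1 - 2 * l" and F: "sfam P (amp_source l)"
  shows "continuous_on P (acoef l \<alpha>)"
proof -
  let ?J = "{b :: 'n \<Rightarrow> nat. mi_size b \<le> k - 1 - 2 * l}"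
  have "continuous_on ({0..T} \<times> K) (\<lambda>p. (\<lambda>j t z. acoef l j (t, z)) \<alpha> (fst p) (snd p))"
  proof (rule quadratic_ode_continuous[where J="?J" and K="\<lambda>j b c p. 0"
        and L="\<lambda>j b p. - mi_deriv j (amp_lin b p) (xc p)" and F="\<lambda>j p. - mi_deriv j (amp_source l p) (xc p)"])
    fix j :: "'n \<Rightarrow> nat" and t z assume j: "j \<in> ?J" and tz: "t \<in> {0..T}" "z \<in> K"
    show "((\<lambda>s. acoef l j (s, z)) has_vector_derivative (\<Sum>b\<in>?J. \<Sum>c\<in>?J. 0 * (acoef l b (t, z) * acoef l c (t, z)))
        + (\<Sum>b\<in>?J. - mi_deriv j (amp_lin b (t, z)) (xc (t, z)) * acoef l b (t, z)) + - mi_deriv j (amp_source l (t, z)) (xc (t, z))) (at t within {0..T})"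
      using acoef_deriv[OF tz l, of j] j acoef'_eq[OF P_I[OF tz] l _ F, of j] by simp
  next
    fix j b c :: "'n \<Rightarrow> nat"
    show "continuous_on ({0..T} \<times> K) (\<lambda>p. 0 :: complex)" by (rule continuous_on_const)
    show "continuous_on ({0..T} \<times> K) (\<lambda>p. - mi_deriv j (amp_lin b p) (xc p))"
      unfolding P_def[symmetric] by (intro continuous_intros continuous_mi_deriv sfam_Lg continuous_xc)
    show "continuous_on ({0..T} \<times> K) (\<lambda>p. - mi_deriv j (amp_source l p) (xc p))"
      unfolding P_def[symmetric] by (intro continuous_intros continuous_mi_deriv F continuous_xc)
    show "continuous_on K (\<lambda>z. acoef l j (0, z))" if "j \<in> ?J"
    proof -
      have "continuous_on K (\<lambda>z. if l = 0 then mi_deriv j A z else 0)"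
        by (cases "l = 0") (auto intro!: smooth_continuous smooth_mi_deriv smooth_A)
      then show ?thesis
        by (rule continuous_on_cong[THEN iffD1, OF refl, rotated]) (use that l in \<open>simp add: amplitude_init\<close>)
    qed
  qed (use T compact_K \<alpha> in \<open>auto intro: finite_mi_size_le\<close>)
  then show ?thesis by (simp add: P_def)
qed

text \<open>The source at level l is the Laplacian of the amplitude at level \<open>l - 1\<close>,
  so regularity has to be obtained level by level.\<close>

lemma sfam_Am: "l \<le> (k - 1) div 2 \<Longrightarrow> sfam P (Amp l)"
proof (induction l)
  case 0
  have "sfam P (\<lambda>p y. Amp 0 p y)"
    unfolding Amp_def by (rule sfam_taylor_poly[OF continuous_xc continuous_acoef]) (auto intro: sfam_Fg)
  then show ?case .
next
  case (Suc l)
  then have "sfam P (amp_source (Suc l))" by (intro sfam_Fg) auto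
  then have "sfam P (\<lambda>p y. Amp (Suc l) p y)"
    unfolding Amp_def by (intro sfam_taylor_poly[OF continuous_xc continuous_acoef[OF Suc.prems]]) auto
  then show ?case .
qed

lemma sfam_Fg': "l \<le> (k - 1) div 2 \<Longrightarrow> sfam P (amp_source l)"
  by (rule sfam_Fg) (auto intro: sfam_Am)

lemma sfam_Amt: "l \<le> (k - 1) div 2 \<Longrightarrow> sfam P (Amp_t l)"
proof -
  assume l: "l \<le> (k - 1) div 2"
  have c: "continuous_on P (acoef' l \<alpha>)" if \<alpha>: "mi_size \<alpha> \<le> k - 1 - 2 * l" for \<alpha>
  proof -
    have "continuous_on P (\<lambda>p. (\<Sum>b | mi_size b \<le> k - 1 - 2 * l. - mi_deriv \<alpha> (amp_lin b p) (xc p) * acoef l b p) - mi_deriv \<alpha> (amp_source l p) (xc p))"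
      by (intro continuous_intros continuous_mi_deriv sfam_Lg sfam_Fg' l continuous_xc continuous_acoef) auto
    then show ?thesis
      by (rule continuous_on_cong[THEN iffD1, OF refl, rotated]) (rule acoef'_eq[symmetric, OF _ l \<alpha> sfam_Fg'[OF l]])
  qed
  have "sfam P (\<lambda>p y. Amp_t l p y)"
    unfolding Amp_t_def by (intro sfam_intros continuous_xc c continuous_mom_i sfam_Am l)
  then show ?thesis .
qed

lemma sfam_trn: "l \<le> (k - 1) div 2 \<Longrightarrow> sfam P (transport_residual l)"
proof -
  assume l: "l \<le> (k - 1) div 2"
  have "sfam P (\<lambda>p y. transport_residual l p y)"
    unfolding transport_residual_def by (intro sfam_intros sfam_Amt sfam_Am sfam_Fg' l continuous_intros)
  then show ?thesis .
qed

lemma transport_residual_vanish: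
  assumes "p \<in> P" "l \<le> (k - 1) div 2" "length is < k - 2 * l"
  shows "foldr partial is (transport_residual l p) (xc p) = 0"
proof -
  have "smooth (transport_residual l p)" by (rule sfam_imp_smooth[OF sfam_trn[OF assms(2)] assms(1)])
  then have "foldr partial is (transport_residual l p) (xc p) = mi_deriv (count (mset is)) (transport_residual l p) (xc p)"
    using foldr_partial_eq_mi_deriv by metis
  also have "\<dots> = 0"
    using amplitude_facts(2)[OF assms(1,2), of "count (mset is)"] assms transport_eq[OF assms(1,2)] mi_size_count[of "is"] by simp
  finally show ?thesis .
qed

end

section \<open>Quadratic forms and WKB functions\<close>

lemma hvd_coordinate:
  "((\<lambda>h. complex_of_real ((y + h *\<^sub>R axis l 1 - c) $ i)) has_vector_derivative (if i = l then 1 else 0)) (at 0)"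
proof -
  have 1: "((\<lambda>h. complex_of_real ((y - c) $ i + h * (axis l 1 $ i))) has_vector_derivative of_real (axis l 1 $ i)) (at 0)"
    by (intro has_vector_derivative_of_real) (auto intro!: derivative_eq_intros)
  have 2: "(\<lambda>h. complex_of_real ((y + h *\<^sub>R axis l 1 - c) $ i)) = (\<lambda>h. complex_of_real ((y - c) $ i + h * (axis l 1 $ i)))"
    by (rule ext) simp
  have 3: "(if i = l then 1 else 0) = complex_of_real (axis l 1 $ i)" by (simp add: axis_def)
  show ?thesis unfolding 2 3 by (rule 1)
qed

lemma partial_linear_form:
  "partial l (\<lambda>y. \<Sum>j\<in>UNIV. b j * complex_of_real ((y - c) $ j)) = (\<lambda>y. b l)"
proof
  fix y
  have "((\<lambda>h. \<Sum>j\<in>UNIV. b j * complex_of_real ((y + h *\<^sub>R axis l 1 - c) $ j)) has_vector_derivative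
     (\<Sum>j\<in>UNIV. b j * (if j = l then 1 else 0))) (at 0)"
    by (intro has_vector_derivative_sum has_vector_derivative_mult_right hvd_coordinate)
  also have "(\<Sum>j\<in>UNIV. b j * (if j = l then 1 else 0)) = b l"
    by (simp add: if_distrib[of "\<lambda>x. _ * x"] sum.delta cong: if_cong)
  finally show "partial l (\<lambda>y. \<Sum>j\<in>UNIV. b j * complex_of_real ((y - c) $ j)) y = b l"
    unfolding partial_def by (rule vector_derivative_at)
qed

definition quad :: "('n::finite \<Rightarrow> 'n \<Rightarrow> complex) \<Rightarrow> real^'n \<Rightarrow> real^'n \<Rightarrow> complex" where
  "quad m c y = 1/2 * (\<Sum>i\<in>UNIV. \<Sum>j\<in>UNIV. m i j * (of_real ((y - c) $ i) * of_real ((y - c) $ j)))"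

lemma partial_quad:
  assumes sym: "\<And>i j. m i j = m j i"
  shows "partial l (quad m c) = (\<lambda>y. \<Sum>j\<in>UNIV. m l j * of_real ((y - c) $ j))"
proof
  fix y
  let ?z = "\<lambda>j. complex_of_real ((y - c) $ j)"
  have h: "((\<lambda>h. complex_of_real ((y + h *\<^sub>R axis l 1 - c) $ i) * complex_of_real ((y + h *\<^sub>R axis l 1 - c) $ j)) has_vector_derivative
     (?z i * (if j = l then 1 else 0) + (if i = l then 1 else 0) * ?z j)) (at 0)" for i j
    using has_vector_derivative_mult[OF hvd_coordinate[of y l c i] hvd_coordinate[of y l c j]] by simp
  have "((\<lambda>h. quad m c (y + h *\<^sub>R axis l 1)) has_vector_derivative
     1/2 * (\<Sum>i\<in>UNIV. \<Sum>j\<in>UNIV. m i j * (?z i * (if j = l then 1 else 0) + (if i = l then 1 else 0) * ?z j))) (at 0)"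
    unfolding quad_def by (intro has_vector_derivative_mult_right has_vector_derivative_sum h)
  also have "(\<Sum>i\<in>UNIV. \<Sum>j\<in>UNIV. m i j * (?z i * (if j = l then 1 else 0) + (if i = l then 1 else 0) * ?z j))
    = (\<Sum>i\<in>UNIV. \<Sum>j\<in>UNIV. if j = l then m i j * ?z i else 0) + (\<Sum>i\<in>UNIV. \<Sum>j\<in>UNIV. if i = l then m i j * ?z j else 0)"
    unfolding sum.distrib[symmetric] by (intro sum.cong refl) (simp add: distrib_left)
  also have "(\<Sum>i\<in>UNIV. \<Sum>j\<in>UNIV. if j = l then m i j * ?z i else 0) = (\<Sum>i\<in>UNIV. m l i * ?z i)"
    by (simp add: sum.delta sym[of _ l])
  also have "(\<Sum>i\<in>UNIV. \<Sum>j\<in>UNIV. if i = l then m i j * ?z j else 0) = (\<Sum>j\<in>UNIV. m l j * ?z j)"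
    by (subst sum.swap) (simp add: sum.delta)
  also have "1/2 * ((\<Sum>i\<in>UNIV. m l i * ?z i) + (\<Sum>j\<in>UNIV. m l j * ?z j)) = (\<Sum>j\<in>UNIV. m l j * ?z j)"
    by simp
  finally show "partial l (quad m c) y = (\<Sum>j\<in>UNIV. m l j * ?z j)"
    unfolding partial_def by (rule vector_derivative_at)
qed

lemma foldr_partial_append_const: "is \<noteq> [] \<Longrightarrow> foldr partial is (\<lambda>y. c) = (\<lambda>y. 0)"
proof (induction "is")
  case (Cons i "is")
  then show ?case by (cases "is = []") auto
qed simp

text \<open>The last two letters of a word act first and leave a constant, which every further
  derivative annihilates; at the centre the form and its gradient vanish.\<close>

lemma foldr_partial_quad:
  assumes sym: "\<And>i j. m i j = m j i"
  shows "foldr partial is (quad m c) c = (case is of [i, j] \<Rightarrow> m i j | _ \<Rightarrow> 0)"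
proof -
  consider "is = []" | i where "is = [i]" | i j where "is = [i, j]" | js i j where "is = js @ [i, j]" "js \<noteq> []"
  proof (cases "is" rule: rev_cases)
    case (snoc ys j)
    show ?thesis
    proof (cases ys rule: rev_cases)
      case Nil
      then show ?thesis using that(2)[of j] snoc by simp
    next
      case (snoc zs i)
      then show ?thesis using that(3)[of i j] that(4)[of zs i j] \<open>is = ys @ [j]\<close> by (cases "zs = []") simp_all
    qed
  qed (use that in auto)
  then show ?thesis
  proof cases
    case (4 js i j)
    then obtain b bs where js: "js = b # bs" by (cases js) auto
    have "foldr partial is (quad m c) = foldr partial js (\<lambda>y. m j i)"
      by (simp add: 4 partial_quad[OF sym] partial_linear_form del: vector_minus_component)
    then have "foldr partial is (quad m c) c = 0" using foldr_partial_append_const[OF 4(2), of "m j i"] by simp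
    moreover have "(case is of [i, j] \<Rightarrow> m i j | _ \<Rightarrow> 0) = 0" by (cases bs) (simp_all add: 4 js split: list.split)
    ultimately show ?thesis by simp
  next
    case 1
    then show ?thesis by (simp add: quad_def)
  next
    case (2 i)
    then show ?thesis by (simp add: partial_quad[OF sym])
  next
    case (3 i j)
    then show ?thesis using sym[of i j] by (simp add: partial_quad[OF sym] partial_linear_form del: vector_minus_component)
  qed
qed

lemma sfam_linear_form:
  assumes "continuous_on P \<xi>" "\<And>j. continuous_on P (b j)"
  shows "sfam P (\<lambda>p y. \<Sum>j\<in>UNIV. b j p * complex_of_real ((y - \<xi> p) $ j))"
  by (intro sfam_intros sfam_coordinate assms)

lemma sfam_quad:
  assumes "continuous_on P \<xi>" "\<And>i j. continuous_on P (m i j)"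
  shows "sfam P (\<lambda>p y. quad (\<lambda>i j. m i j p) (\<xi> p) y)"
  unfolding quad_def by (intro sfam_intros sfam_coordinate assms continuous_intros)

section \<open>Leibniz rules and the Schroedinger operator on WKB functions\<close>

lemma foldr_partial_add:
  "smooth f \<Longrightarrow> smooth g \<Longrightarrow> foldr partial is (\<lambda>y. f y + g y) = (\<lambda>y. foldr partial is f y + foldr partial is (g :: real^'n::finite \<Rightarrow> complex) y)"
  using foldr_partial_sum[of "{True,False}" "\<lambda>b. if b then f else g" "is" "\<lambda>_. 1"] by simp

lemma foldr_partial_diff:
  "smooth f \<Longrightarrow> smooth g \<Longrightarrow> foldr partial is (\<lambda>y. f y - g y) = (\<lambda>y. foldr partial is f y - foldr partial is (g :: real^'n::finite \<Rightarrow> complex) y)"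
  using foldr_partial_sum[of "{True,False}" "\<lambda>b. if b then f else g" "is" "\<lambda>b. if b then 1 else -1"] by simp

lemma partial_mult_fun:
  fixes f g :: "real^'n::finite \<Rightarrow> complex"
  shows "smooth f \<Longrightarrow> smooth g \<Longrightarrow> partial i (\<lambda>y. f y * g y) = (\<lambda>y. f y * partial i g y + partial i f y * g y)"
  by (rule ext) (simp add: partial_mult smooth_differentiable)

lemma partial_add_fun:
  fixes f g :: "real^'n::finite \<Rightarrow> complex"
  shows "smooth f \<Longrightarrow> smooth g \<Longrightarrow> partial i (\<lambda>y. f y + g y) = (\<lambda>y. partial i f y + partial i g y)"
  by (rule ext) (simp add: partial_add smooth_differentiable)

lemma smooth_mult:
  fixes f g :: "real^'n::finite \<Rightarrow> complex"
  shows "smooth f \<Longrightarrow> smooth g \<Longrightarrow> smooth (\<lambda>y. f y * g y)"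
  unfolding smooth_iff_sfam by (rule sfam_mult)

lemma smooth_add:
  fixes f g :: "real^'n::finite \<Rightarrow> complex"
  shows "smooth f \<Longrightarrow> smooth g \<Longrightarrow> smooth (\<lambda>y. f y + g y)"
  unfolding smooth_iff_sfam by (rule sfam_add)

lemma partial_sum_fun:
  fixes f :: "'j \<Rightarrow> real^'n::finite \<Rightarrow> complex"
  assumes "finite J" "\<And>j. j \<in> J \<Longrightarrow> smooth (f j)"
  shows "partial i (\<lambda>y. \<Sum>j\<in>J. c j * f j y) = (\<lambda>y. \<Sum>j\<in>J. c j * partial i (f j) y)"
proof -
  have "foldr partial [i] (\<lambda>y. \<Sum>j\<in>J. c j * f j y) = (\<lambda>y. \<Sum>j\<in>J. c j * foldr partial [i] (f j) y)"
    by (rule foldr_partial_sum[OF assms])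
  then show ?thesis by simp
qed

lemma laplacian_sum:
  fixes f :: "'j \<Rightarrow> real^'n::finite \<Rightarrow> complex"
  assumes "finite J" "\<And>j. j \<in> J \<Longrightarrow> smooth (f j)"
  shows "laplacian (\<lambda>y. \<Sum>j\<in>J. c j * f j y) y = (\<Sum>j\<in>J. c j * laplacian (f j) y)"
proof -
  have "partial i (partial i (\<lambda>y. \<Sum>j\<in>J. c j * f j y)) y = (\<Sum>j\<in>J. c j * partial i (partial i (f j)) y)" for i
  proof -
    have "foldr partial [i, i] (\<lambda>y. \<Sum>j\<in>J. c j * f j y) = (\<lambda>y. \<Sum>j\<in>J. c j * foldr partial [i, i] (f j) y)"
      by (rule foldr_partial_sum[OF assms])
    then show ?thesis by (simp add: fun_eq_iff)
  qed
  then show ?thesis unfolding laplacian_def sum_distrib_left by (simp add: sum.swap[of _ J])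
qed

lemma laplacian_mult:
  fixes f g :: "real^'n::finite \<Rightarrow> complex"
  assumes "smooth f" "smooth g"
  shows "laplacian (\<lambda>y. f y * g y) y = f y * laplacian g y + 2 * (\<Sum>i\<in>UNIV. partial i f y * partial i g y) + laplacian f y * g y"
proof -
  have "partial i (partial i (\<lambda>y. f y * g y)) y = f y * partial i (partial i g) y + 2 * (partial i f y * partial i g y) + partial i (partial i f) y * g y" for i
    using assms by (simp add: partial_mult_fun partial_add_fun smooth_mult smooth_partial algebra_simps)
  then show ?thesis by (simp add: laplacian_def sum.distrib sum_distrib_left sum_distrib_right)
qed

lemma laplacian_exp:
  fixes F :: "real^'n::finite \<Rightarrow> complex"
  assumes "smooth F"
  shows "laplacian (\<lambda>y. exp (c * F y)) y = (c * laplacian F y + c\<^sup>2 * (\<Sum>i\<in>UNIV. (partial i F y)\<^sup>2)) * exp (c * F y)"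
    and "partial i (\<lambda>y. exp (c * F y)) y = c * partial i F y * exp (c * F y)"
    and "smooth (\<lambda>y. exp (c * F y))"
proof -
  have s: "smooth (\<lambda>y. c * F y)" by (intro smooth_mult smooth_const assms)
  show se: "smooth (\<lambda>y. exp (c * F y))" using s unfolding smooth_iff_sfam by (rule sfam_exp)
  have 1: "partial i (\<lambda>y. exp (c * F y)) = (\<lambda>y. c * (partial i F y * exp (c * F y)))" for i
    by (rule ext) (simp add: partial_exp[OF smooth_differentiable[OF s]]
      partial_bounded_linear[OF bounded_linear_mult_right smooth_differentiable[OF assms]])
  show "partial i (\<lambda>y. exp (c * F y)) y = c * partial i F y * exp (c * F y)" by (simp add: 1)
  have "partial i (partial i (\<lambda>y. exp (c * F y))) y = (c * partial i (partial i F) y + c\<^sup>2 * (partial i F y)\<^sup>2) * exp (c * F y)" for i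
    unfolding 1
    by (subst partial_bounded_linear[OF bounded_linear_mult_right smooth_differentiable[OF smooth_mult[OF smooth_partial[OF assms] se]]])
      (simp add: partial_mult_fun[OF smooth_partial[OF assms] se] 1 power2_eq_square algebra_simps)
  then show "laplacian (\<lambda>y. exp (c * F y)) y = (c * laplacian F y + c\<^sup>2 * (\<Sum>i\<in>UNIV. (partial i F y)\<^sup>2)) * exp (c * F y)"
    by (simp add: laplacian_def sum.distrib sum_distrib_left sum_distrib_right[symmetric])
qed

text \<open>Sorted by powers of \<epsilon>: the eikonal expression without a factor, the transport
  expression with one factor, and the Laplacian of the amplitude with two. This last one feeds the
  next level of the amplitude hierarchy.\<close>

lemma wkb_residual:
  fixes B F :: "real^'n::finite \<Rightarrow> complex" and Bt Ft W :: complex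
  assumes B: "smooth B" and F: "smooth F" and \<epsilon>: "\<epsilon> \<noteq> (0::real)"
  shows "- \<i> * of_real \<epsilon> * ((Bt + B y * (\<i> / of_real \<epsilon> * Ft)) * exp (\<i> / of_real \<epsilon> * F y))
      - of_real (\<epsilon>\<^sup>2 / 2) * laplacian (\<lambda>y. B y * exp (\<i> / of_real \<epsilon> * F y)) y + W * (B y * exp (\<i> / of_real \<epsilon> * F y))
    = exp (\<i> / of_real \<epsilon> * F y) * (B y * (Ft + 1/2 * (\<Sum>i\<in>UNIV. (partial i F y)\<^sup>2) + W)
      - \<i> * of_real \<epsilon> * (Bt + (\<Sum>i\<in>UNIV. partial i B y * partial i F y) + 1/2 * laplacian F y * B y)
      - of_real (\<epsilon>\<^sup>2 / 2) * laplacian B y)"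
proof -
  define e where "e = complex_of_real \<epsilon>"
  define c where "c = \<i> / e"
  have e: "e \<noteq> 0" "e * c = \<i>" "e * e * c * c = -1" using \<epsilon> by (auto simp: e_def c_def)
  have e2: "of_real (\<epsilon>\<^sup>2 / 2) = e * e / 2" by (simp add: e_def power2_eq_square)
  let ?E = "exp (c * F y)"
  define X Y L Q where "X = (\<Sum>i\<in>UNIV. partial i B y * partial i F y)" and "Y = (\<Sum>i\<in>UNIV. (partial i F y)\<^sup>2)"
    and "L = laplacian F y" and "Q = laplacian B y"
  have "(\<Sum>i\<in>UNIV. partial i B y * partial i (\<lambda>y. exp (c * F y)) y) = c * X * ?E"
    unfolding X_def sum_distrib_left sum_distrib_right laplacian_exp(2)[OF F]
    by (intro sum.cong refl) (simp add: mult_ac)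
  then have lap: "laplacian (\<lambda>y. B y * exp (c * F y)) y = (B y * (c * L + c * c * Y) + 2 * c * X + Q) * ?E"
    unfolding laplacian_mult[OF B laplacian_exp(3)[OF F]] laplacian_exp(1)[OF F]
    by (simp add: L_def Y_def Q_def power2_eq_square algebra_simps)
  have 1: "e * ((Bt + B y * (c * Ft)) * ?E) = ?E * (e * Bt + (e * c) * (B y * Ft))" by (simp add: algebra_simps)
  have 2: "e * e / 2 * ((B y * (c * L + c * c * Y) + 2 * c * X + Q) * ?E)
      = ?E * (B y * ((e * c) * e * L / 2 + (e * e * c * c) * Y / 2) + (e * c) * e * X + e * e / 2 * Q)" by (simp add: algebra_simps)
  show ?thesis
    unfolding e2 e_def[symmetric]
    unfolding c_def[symmetric]
    unfolding lap 2 X_def[symmetric] Y_def[symmetric] L_def[symmetric] Q_def[symmetric]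
    unfolding e(2,3) mult.assoc[of "- \<i>" e] 1 by (simp add: e(2) algebra_simps)
qed

text \<open>Meant for the top amplitude, whose degree is the parity of \<open>k - 1\<close>; it ends
  the hierarchy without a leftover Laplacian.\<close>

lemma laplacian_taylor_poly_linear: "m \<le> 1 \<Longrightarrow> laplacian (taylor_poly m c x) y = 0"
proof -
  assume m: "m \<le> 1"
  have "partial i (partial i (taylor_poly m c x)) y = 0" for i
  proof -
    have "foldr partial [i, i] (taylor_poly m c x) y =
      (\<Sum>\<beta> | mi_size \<beta> \<le> m. c \<beta> / of_nat (mi_fact \<beta>) * foldr partial [i, i] (\<lambda>y. complex_of_real (mi_power (y - x) \<beta>)) y)"
      unfolding taylor_poly_def[abs_def] by (subst foldr_partial_sum) (auto intro: finite_mi_size_le smooth_monomial)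
    also have "\<dots> = 0"
    proof (rule sum.neutral, rule ballI)
      fix \<beta> :: "'a \<Rightarrow> nat" assume "\<beta> \<in> {\<beta>. mi_size \<beta> \<le> m}"
      moreover have "\<beta> i \<le> mi_size \<beta>" unfolding mi_size_def by (rule member_le_sum) auto
      ultimately have "\<beta> i = 0 \<or> \<beta> i - 1 = 0" using m by auto
      then show "c \<beta> / of_nat (mi_fact \<beta>) * foldr partial [i, i] (\<lambda>y. complex_of_real (mi_power (y - x) \<beta>)) y = 0"
        by (auto simp: partial_monomial partial_cmult_monomial)
    qed
    finally show ?thesis by simp
  qed
  then show ?thesis by (simp add: laplacian_def)
qed

section \<open>Estimates for Gaussians and exponentials\<close>

lemma power_le_exp:
  fixes x :: real
  assumes "x \<ge> 0"
  shows "x ^ j \<le> fact j * exp x"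
proof -
  have "(\<lambda>n. x ^ n /\<^sub>R fact n) sums exp x" by (rule exp_converges)
  then have "x ^ j /\<^sub>R fact j \<le> exp x"
    using sum_le_suminf[of "\<lambda>n. x ^ n /\<^sub>R fact n" "{j}"] assms by (auto simp: sums_iff)
  then show ?thesis by (simp add: divide_inverse_commute[symmetric] field_simps)
qed

text \<open>In the rescaled distance \<open>s / sqrt \<epsilon>\<close> a Gaussian beats every
  power. Half of its rate is spent on this, and each power of the distance becomes one factor
  \<open>sqrt \<epsilon>\<close>.\<close>

lemma power_gauss_bound:
  fixes c :: real
  assumes c: "c > 0"
  shows "\<exists>C\<ge>0. \<forall>s\<ge>0. \<forall>\<epsilon>>0. s ^ j * exp (- c * s\<^sup>2 / \<epsilon>) \<le> C * sqrt \<epsilon> ^ j * exp (- (c/2) * s\<^sup>2 / \<epsilon>)"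
proof -
  define C where "C = 1 + fact j * (2 / c) ^ j"
  have C: "C \<ge> 0" using c by (simp add: C_def)
  have "s ^ j * exp (- c * s\<^sup>2 / \<epsilon>) \<le> C * sqrt \<epsilon> ^ j * exp (- (c/2) * s\<^sup>2 / \<epsilon>)" if s: "s \<ge> 0" and \<epsilon>: "\<epsilon> > 0" for s \<epsilon> :: real
  proof -
    define \<tau> where "\<tau> = s / sqrt \<epsilon>"
    have \<tau>: "\<tau> \<ge> 0" "s = \<tau> * sqrt \<epsilon>" "s\<^sup>2 / \<epsilon> = \<tau>\<^sup>2" using s \<epsilon> by (auto simp: \<tau>_def power_divide)
    define x where "x = (c/2) * \<tau>\<^sup>2"
    have x: "x \<ge> 0" using c by (simp add: x_def)
    \<comment> \<open>Doubling the exponent gives a power of the squared distance, to which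
      \<open>power_le_exp\<close> applies; the 1 covers small distances.\<close>
    have "\<tau> ^ j \<le> 1 + (\<tau>\<^sup>2) ^ j"
    proof (cases "\<tau> \<le> 1")
      case True
      then have "\<tau> ^ j \<le> 1" using \<tau>(1) by (simp add: power_le_one)
      moreover have "0 \<le> (\<tau>\<^sup>2) ^ j" by simp
      ultimately show ?thesis by linarith
    next
      case False
      then have "\<tau> ^ j \<le> \<tau> ^ (2 * j)" by (intro power_increasing) auto
      then show ?thesis by (simp add: power_mult)
    qed
    also have "\<tau>\<^sup>2 = (2 / c) * x" using c by (simp add: x_def)
    also have "((2 / c) * x) ^ j = (2 / c) ^ j * x ^ j" by (rule power_mult_distrib)
    also have "\<dots> \<le> (2 / c) ^ j * (fact j * exp x)" using c by (intro mult_left_mono power_le_exp x) auto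
    also have "1 + \<dots> \<le> exp x + (2 / c) ^ j * (fact j * exp x)" using x by simp
    also have "\<dots> = C * exp x" by (simp add: C_def algebra_simps)
    finally have "\<tau> ^ j * exp (- 2 * x) \<le> C * exp x * exp (- 2 * x)" by (intro mult_right_mono) auto
    also have "\<dots> = C * exp (- x)" by (simp add: mult.assoc exp_add[symmetric])
    finally have "sqrt \<epsilon> ^ j * (\<tau> ^ j * exp (- 2 * x)) \<le> sqrt \<epsilon> ^ j * (C * exp (- x))" using \<epsilon> by (intro mult_left_mono) auto
    moreover have "- c * s\<^sup>2 / \<epsilon> = - 2 * x" "- (c/2) * s\<^sup>2 / \<epsilon> = - x"
      by (simp_all add: x_def \<tau>(3)[symmetric])
    ultimately show ?thesis using \<tau>(2) by (simp add: power_mult_distrib mult_ac)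
  qed
  then show ?thesis using C by blast
qed

text \<open>The mean value inequality on a half-plane, where the derivative has modulus at most
  \<open>exp M\<close>. It keeps the Gaussian decay when two oscillating factors are
  compared.\<close>

lemma exp_diff_bound:
  fixes a b :: complex
  assumes "Re a \<le> M" "Re b \<le> M"
  shows "norm (exp a - exp b) \<le> exp M * norm (a - b)"
proof (rule differentiable_bound[of "{z. Re z \<le> M}" exp "\<lambda>z h. exp z * h"])
  show "convex {z. Re z \<le> M}" by (rule convex_halfspace_Re_le)
  show "(exp has_derivative (*) (exp z)) (at z within {z. Re z \<le> M})" for z :: complex
    using DERIV_exp[of z] unfolding has_field_derivative_def by (rule has_derivative_at_withinI)
  show "onorm ((*) (exp z)) \<le> exp M" if "z \<in> {z. Re z \<le> M}" for z :: complex
    by (rule onorm_le) (use that in \<open>simp add: norm_mult mult_right_mono\<close>)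
qed (use assms in auto)

lemma compact_norm_bound:
  assumes "compact Q" "continuous_on Q f"
  shows "\<exists>B\<ge>0. \<forall>p\<in>Q. norm (f p) \<le> B"
proof -
  obtain B where B: "\<forall>x\<in>f ` Q. norm x \<le> B"
    using compact_imp_bounded[OF compact_continuous_image[OF assms(2,1)]] unfolding bounded_iff by blast
  have "\<forall>p\<in>Q. norm (f p) \<le> \<bar>B\<bar>" using B by force
  then show ?thesis by (intro exI[of _ "\<bar>B\<bar>"]) auto
qed

section \<open>The phase along the trajectories\<close>

context gaussian_beams
begin

definition M :: "'n \<Rightarrow> 'n \<Rightarrow> real \<times> (real^'n) \<Rightarrow> complex" where
  "M i j p = partial i (partial j (Phase p)) (xc p)"

abbreviation Vc :: "real^'n \<Rightarrow> complex" where "Vc \<equiv> \<lambda>y. of_real (V y)"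

lemma M_sym: "M i j p = M j i p"
  unfolding M_def using partial_commute[OF smooth_Ph] by metis

lemma partial_Vc: "partial i Vc = (\<lambda>y. of_real (partial i V y))"
  by (rule ext) (rule partial_bounded_linear[OF bounded_linear_of_real smooth_differentiable[OF V]])

lemma partial_partial_Vc: "partial i (partial j Vc) = (\<lambda>y. of_real (partial i (partial j V) y))"
  unfolding partial_Vc
  by (rule ext) (rule partial_bounded_linear[OF bounded_linear_of_real smooth_differentiable[OF smooth_partial[OF V]]])

text \<open>At the moving centre a derivative of the phase is one of its coefficients, so its rate
  of change along the trajectory is the right-hand side of the coefficient system, which already
  contains the convective term.\<close>

lemma phase_list_deriv:
  assumes tz: "t \<in> {0..T}" "z \<in> K" and len: "length is \<le> k + 1"
  shows "((\<lambda>s. foldr partial is (Phase (s, z)) (xc (s, z))) has_vector_derivative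
    - foldr partial is (eikonal_static (t, z)) (xc (t, z))) (at t within {0..T})"
proof -
  let ?\<alpha> = "count (mset is)"
  have s: "mi_size ?\<alpha> \<le> k + 1" using len by (simp add: mi_size_count)
  have "foldr partial is (Phase p) (xc p) = coef ?\<alpha> p" for p
  proof -
    have "foldr partial is (Phase p) (xc p) = mi_deriv ?\<alpha> (Phase p) (xc p)"
      by (simp only: foldr_partial_eq_mi_deriv[OF smooth_Ph])
    also have "\<dots> = coef ?\<alpha> p" by (simp only: Phase_def mi_deriv_taylor_poly s if_True)
    finally show ?thesis .
  qed
  moreover have "foldr partial is (eikonal_static p) = mi_deriv ?\<alpha> (eikonal_static p)" for p
    by (rule foldr_partial_eq_mi_deriv[OF smooth_rest])
  ultimately show ?thesis using coef_deriv[OF tz s] coef'_eq[OF P_I[OF tz] s] by simp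
qed

lemma line_deriv_Ph:
  "((\<lambda>h. foldr partial is (Phase p) (y + h *\<^sub>R axis j 1)) has_vector_derivative partial j (foldr partial is (Phase p)) y) (at 0)"
  using differentiable_imp_partial[of "foldr partial is (Phase p)" y 0 j] smooth_differentiable[OF smooth_foldr_partial[OF smooth_Ph]] by simp

lemma partial_rest:
  "partial j (eikonal_static p) = (\<lambda>y. (\<Sum>l\<in>UNIV. (partial l (Phase p) y - of_real (mom p $ l)) * partial j (partial l (Phase p)) y) + partial j Vc y)"
proof
  fix y
  note d = line_deriv_Ph[of "[l]" for l, simplified]
  have dV: "((\<lambda>h. Vc (y + h *\<^sub>R axis j 1)) has_vector_derivative partial j Vc y) (at 0)"
    using differentiable_imp_partial[of Vc y 0 j] smooth_differentiable[OF smooth_V] by simp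
  have "((\<lambda>h. eikonal_static p (y + h *\<^sub>R axis j 1)) has_vector_derivative
     1/2 * (\<Sum>l\<in>UNIV. partial l (Phase p) (y + 0 *\<^sub>R axis j 1) * partial j (partial l (Phase p)) y + partial j (partial l (Phase p)) y * partial l (Phase p) (y + 0 *\<^sub>R axis j 1))
     - (\<Sum>l\<in>UNIV. of_real (mom p $ l) * partial j (partial l (Phase p)) y) + partial j Vc y) (at 0)"
    unfolding eikonal_static_def power2_eq_square
    by (intro has_vector_derivative_add has_vector_derivative_diff has_vector_derivative_mult_right has_vector_derivative_sum
        has_vector_derivative_mult d dV)
  then have "partial j (eikonal_static p) y = 1/2 * (\<Sum>l\<in>UNIV. partial l (Phase p) y * partial j (partial l (Phase p)) y + partial j (partial l (Phase p)) y * partial l (Phase p) y)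
     - (\<Sum>l\<in>UNIV. of_real (mom p $ l) * partial j (partial l (Phase p)) y) + partial j Vc y"
    unfolding partial_def[of j "eikonal_static p"] by (intro vector_derivative_at) simp
  also have "\<dots> = (\<Sum>l\<in>UNIV. (partial l (Phase p) y - of_real (mom p $ l)) * partial j (partial l (Phase p)) y) + partial j Vc y"
  proof -
    have "(\<Sum>l\<in>UNIV. partial l (Phase p) y * partial j (partial l (Phase p)) y + partial j (partial l (Phase p)) y * partial l (Phase p) y)
      = 2 * (\<Sum>l\<in>UNIV. partial l (Phase p) y * partial j (partial l (Phase p)) y)"
      unfolding sum_distrib_left by (intro sum.cong refl) simp
    then show ?thesis by (simp add: left_diff_distrib sum_subtractf)
  qed
  finally show "partial j (eikonal_static p) y = (\<Sum>l\<in>UNIV. (partial l (Phase p) y - of_real (mom p $ l)) * partial j (partial l (Phase p)) y) + partial j Vc y" .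
qed

lemma partial_partial_rest:
  "partial i (partial j (eikonal_static p)) y = (\<Sum>l\<in>UNIV. (partial l (Phase p) y - of_real (mom p $ l)) * partial i (partial j (partial l (Phase p))) y
     + partial i (partial l (Phase p)) y * partial j (partial l (Phase p)) y) + partial i (partial j Vc) y"
proof -
  note d = line_deriv_Ph[of "[l]" for l, simplified] and dd = line_deriv_Ph[of "[j, l]" for l, simplified]
  have dV: "((\<lambda>h. partial j Vc (y + h *\<^sub>R axis i 1)) has_vector_derivative partial i (partial j Vc) y) (at 0)"
    using differentiable_imp_partial[of "partial j Vc" y 0 i] smooth_differentiable[OF smooth_partial[OF smooth_V]] by simp
  have "((\<lambda>h. partial j (eikonal_static p) (y + h *\<^sub>R axis i 1)) has_vector_derivative
     (\<Sum>l\<in>UNIV. (partial l (Phase p) (y + 0 *\<^sub>R axis i 1) - of_real (mom p $ l)) * partial i (partial j (partial l (Phase p))) y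
     + (partial i (partial l (Phase p)) y - 0) * partial j (partial l (Phase p)) (y + 0 *\<^sub>R axis i 1)) + partial i (partial j Vc) y) (at 0)"
    unfolding partial_rest
    by (intro has_vector_derivative_add has_vector_derivative_sum
        has_vector_derivative_mult has_vector_derivative_diff has_vector_derivative_const d dd dV)
  then show ?thesis
    unfolding partial_def[of i "partial j (eikonal_static p)"] by (intro vector_derivative_at) simp
qed

lemma continuous_M: "continuous_on P (M i j)"
  unfolding M_def
  by (rule sfam_continuous_comp[of P "\<lambda>p. partial i (partial j (Phase p))" P "\<lambda>p. p" xc])
    (auto intro!: sfam_intros continuous_xc continuous_on_id)

lemma M_bound: "\<exists>B\<ge>0. \<forall>p\<in>P. \<forall>i j. norm (M i j p) \<le> B"
proof -
  have "\<forall>i j. \<exists>B\<ge>0. \<forall>p\<in>P. norm (M i j p) \<le> B"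
    using compact_norm_bound[OF compact_P continuous_M] by blast
  then obtain B where B: "\<And>i j. 0 \<le> B i j" "\<And>i j p. p \<in> P \<Longrightarrow> norm (M i j p) \<le> B i j" by metis
  have "norm (M i j p) \<le> (\<Sum>i\<in>UNIV. \<Sum>j\<in>UNIV. B i j)" if "p \<in> P" for p i j
  proof -
    have "B i j \<le> (\<Sum>j\<in>UNIV. B i j)" by (rule member_le_sum) (auto simp: B)
    also have "\<dots> \<le> (\<Sum>i\<in>UNIV. \<Sum>j\<in>UNIV. B i j)" by (rule member_le_sum[of i UNIV "\<lambda>i. \<Sum>j\<in>UNIV. B i j"]) (auto simp: B sum_nonneg)
    finally show ?thesis using B(2)[OF that, of i j] by linarith
  qed
  then show ?thesis by (intro exI[of _ "\<Sum>i\<in>UNIV. \<Sum>j\<in>UNIV. B i j"]) (auto simp: B sum_nonneg)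
qed

text \<open>The deviation of the gradient from the momentum starts at zero and solves a linear
  homogeneous system with matrix M: the forces in the phase equation and in Hamilton's equation
  cancel. Comparison with the zero solution shows that it stays zero.\<close>

lemma gradient_Ph:
  assumes p: "p \<in> P"
  shows "partial i (Phase p) (xc p) = of_real (mom p $ i)"
proof -
  obtain t z where tz: "p = (t, z)" "t \<in> {0..T}" "z \<in> K" using p by (auto simp: P_def)
  obtain B where B: "B \<ge> 0" "\<forall>p\<in>P. \<forall>i j. norm (M i j p) \<le> B" using M_bound by blast
  define u where "u i t = partial i (Phase (t, z)) (xc (t, z)) - of_real (mom (t, z) $ i)" for i t
  define u' where "u' i t = - (\<Sum>l\<in>UNIV. u l t * M i l (t, z))" for i t
  have u: "(u i has_vector_derivative u' i s) (at s within {0..T})" if s: "s \<in> {0..T}" for i s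
  proof -
    have "((\<lambda>s. partial i (Phase (s, z)) (xc (s, z))) has_vector_derivative - partial i (eikonal_static (s, z)) (xc (s, z))) (at s within {0..T})"
      using phase_list_deriv[OF s tz(3), of "[i]"] k by simp
    moreover have "((\<lambda>s. complex_of_real (mom (s, z) $ i)) has_vector_derivative of_real (- grad V (xc (s, z)) $ i)) (at s within {0..T})"
      using bounded_linear.has_vector_derivative[OF bounded_linear_vec_nth mom_deriv[OF s, of z]]
      by (intro has_vector_derivative_of_real) (simp add: has_real_derivative_iff_has_vector_derivative)
    ultimately have "(u i has_vector_derivative - partial i (eikonal_static (s, z)) (xc (s, z)) - of_real (- grad V (xc (s, z)) $ i)) (at s within {0..T})"
      unfolding u_def by (rule has_vector_derivative_diff)
    moreover have "- partial i (eikonal_static (s, z)) (xc (s, z)) - of_real (- grad V (xc (s, z)) $ i) = u' i s"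
      by (simp add: partial_rest u'_def u_def M_def partial_Vc grad_def)
    ultimately show ?thesis by simp
  qed
  have init: "u i 0 = 0" for i using phase_init(2)[OF tz(3), of i] by (simp add: u_def)
  \<comment> \<open>With initial distance and defect both zero, the smallness hypothesis of
    \<open>ode_compare\<close> is trivial and its bound is zero.\<close>
  have "(\<Sum>j\<in>UNIV. (norm (u j t - 0))\<^sup>2) \<le> ((\<Sum>j\<in>(UNIV :: 'n set). (norm (u j 0 - (0::complex)))\<^sup>2) + real (card (UNIV :: 'n set)) * 0\<^sup>2 * T) * exp ((2 * B * real (card (UNIV :: 'n set)) + 1) * T)"
  proof (rule ode_compare[where u'=u' and v'="\<lambda>_ _. 0" and v="\<lambda>_ _. 0"])
    fix j s assume s: "s \<in> {0..T}"
    show "norm (u' j s - 0) \<le> B * (\<Sum>i\<in>UNIV. norm (u i s - 0)) + 0"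
    proof -
      have "norm (u' j s) \<le> (\<Sum>l\<in>UNIV. B * norm (u l s))"
        unfolding u'_def norm_minus_cancel
      proof (rule sum_norm_le)
        fix l
        have "norm (M j l (s, z)) \<le> B" using B(2) P_I[OF s tz(3)] by blast
        then show "norm (u l s * M j l (s, z)) \<le> B * norm (u l s)"
          unfolding norm_mult mult.commute[of B] by (rule mult_left_mono) simp
      qed
      then show ?thesis by (simp add: sum_distrib_left)
    qed
  qed (use T B u init tz in auto)
  then have "(\<Sum>j\<in>UNIV. (norm (u j t))\<^sup>2) \<le> 0" by (simp add: init)
  moreover have "(norm (u i t))\<^sup>2 \<le> (\<Sum>j\<in>UNIV. (norm (u j t))\<^sup>2)" by (rule member_le_sum) auto
  ultimately have "(norm (u i t))\<^sup>2 \<le> 0" by linarith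
  then have "u i t = 0" by simp
  then show ?thesis by (simp add: u_def tz(1))
qed

text \<open>At the centre the gradient of the phase is the real momentum, so
  \<open>eikonal_static\<close> is real there and the imaginary part keeps its initial
  value.\<close>

lemma Im_Ph_centre:
  assumes p: "p \<in> P"
  shows "Im (Phase p (xc p)) = 0"
proof -
  obtain t z where tz: "p = (t, z)" "t \<in> {0..T}" "z \<in> K" using p by (auto simp: P_def)
  define u where "u t = Im (Phase (t, z) (xc (t, z)))" for t
  have u: "(u has_vector_derivative 0) (at s within {0..T})" if s: "s \<in> {0..T}" for s
  proof -
    have "(u has_vector_derivative Im (- eikonal_static (s, z) (xc (s, z)))) (at s within {0..T})"
      unfolding u_def using phase_list_deriv[OF s tz(3), of "[]"]
      by (intro bounded_linear.has_vector_derivative[OF bounded_linear_Im]) simp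
    moreover have "Im (eikonal_static (s, z) (xc (s, z))) = 0"
      by (simp add: eikonal_static_def gradient_Ph[OF P_I[OF s tz(3)]] Im_sum power2_eq_square)
    ultimately show ?thesis by simp
  qed
  have "u t = u 0"
  proof (rule has_derivative_zero_unique[of "{0..T}" u, OF _ _ tz(2)])
    show "(u has_derivative (\<lambda>h. 0)) (at s within {0..T})" if "s \<in> {0..T}" for s
      using u[OF that] by (simp add: has_vector_derivative_def)
  qed (use T in auto)
  moreover have "u 0 = 0" using phase_init(1)[OF tz(3)] by (simp add: u_def)
  ultimately show ?thesis by (simp add: u_def tz(1))
qed

text \<open>Since the gradient at the centre is the momentum, the third derivatives in
  \<open>partial_partial_rest\<close> carry a zero factor and the equation for the Hessian closes.
  Order two belongs to the phase system because \<open>k \<ge> 1\<close>.\<close>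

lemma M_deriv:
  assumes tz: "t \<in> {0..T}" "z \<in> K"
  shows "((\<lambda>s. M i j (s, z)) has_vector_derivative - ((\<Sum>l\<in>UNIV. M i l (t, z) * M j l (t, z)) + of_real (partial i (partial j V) (xc (t, z))))) (at t within {0..T})"
  using phase_list_deriv[OF tz, of "[i, j]"] k gradient_Ph[OF P_I[OF tz]]
  by (simp add: M_def partial_partial_rest partial_partial_Vc)

text \<open>In the imaginary part of the Riccati equation the real potential drops out; what remains
  is linear in \<open>Im M\<close> with coefficient \<open>Re M\<close> and starts from the
  identity. The constant c is the bound of \<open>riccati_positive\<close> at the final
  time.\<close>

lemma Im_M_positive: "\<exists>c>0. \<forall>p\<in>P. \<forall>v. c * (norm v)\<^sup>2 \<le> (\<Sum>i\<in>UNIV. \<Sum>j\<in>UNIV. v $ i * v $ j * Im (M i j p))"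
proof -
  obtain B where B: "B \<ge> 0" "\<forall>p\<in>P. \<forall>i j. norm (M i j p) \<le> B" using M_bound by blast
  \<comment> \<open>On unit vectors the form of \<open>Re M\<close> is a sum over all pairs of
    coordinates, with each term at most B.\<close>
  define B' where "B' = real (CARD('n)) * real (CARD('n)) * B"
  define c where "c = exp (- (2 * B' + 1) * T)"
  have B': "B' \<ge> 0" using B by (simp add: B'_def)
  have "c * (norm v)\<^sup>2 \<le> (\<Sum>i\<in>UNIV. \<Sum>j\<in>UNIV. v $ i * v $ j * Im (M i j p))" if p: "p \<in> P" for p v
  proof -
    obtain t z where tz: "p = (t, z)" "t \<in> {0..T}" "z \<in> K" using p by (auto simp: P_def)
    define N where "N t = (\<chi> i j. Im (M i j (t, z)))" for t
    define R where "R t = (\<chi> i j. Re (M i j (t, z)))" for t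
    have "exp (- (2 * B' + 1) * t) * (norm v)\<^sup>2 \<le> v \<bullet> (N t *v v)"
    proof (rule riccati_positive[where R=R and T=T])
      show "transpose (N s) = N s" "transpose (R s) = R s" for s
        using M_sym by (simp_all add: N_def R_def transpose_def)
      show "N 0 = mat 1"
        using phase_init(3)[OF tz(3)] by (simp add: N_def M_def mat_def vec_eq_iff)
      show "((\<lambda>s. N s $ i $ j) has_real_derivative - (R s ** N s + N s ** R s) $ i $ j) (at s within {0..T})" if s: "s \<in> {0..T}" for s i j
      proof -
        have "((\<lambda>s. Im (M i j (s, z))) has_vector_derivative Im (- ((\<Sum>l\<in>UNIV. M i l (s, z) * M j l (s, z)) + of_real (partial i (partial j V) (xc (s, z)))))) (at s within {0..T})"
          by (rule bounded_linear.has_vector_derivative[OF bounded_linear_Im M_deriv[OF s tz(3)]])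
        moreover have "Im (- ((\<Sum>l\<in>UNIV. M i l (s, z) * M j l (s, z)) + of_real (partial i (partial j V) (xc (s, z))))) = - (R s ** N s + N s ** R s) $ i $ j"
          by (simp add: Im_sum matrix_matrix_mult_def R_def N_def sum.distrib M_sym[of j])
        ultimately show ?thesis by (simp add: N_def has_real_derivative_iff_has_vector_derivative)
      qed
      show "w \<bullet> (R s *v w) \<le> B'" if s: "s \<in> {0..T}" and w: "norm w = 1" for s w
      proof -
        have "w \<bullet> (R s *v w) = (\<Sum>i\<in>UNIV. \<Sum>j\<in>UNIV. w $ i * (Re (M i j (s, z)) * w $ j))"
          by (simp add: inner_vec_def matrix_vector_mult_def R_def sum_distrib_left)
        also have "\<dots> \<le> (\<Sum>i\<in>(UNIV::'n set). \<Sum>j\<in>(UNIV::'n set). 1 * (B * 1))"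
        proof (intro sum_mono)
          fix i j
          have "\<bar>Re (M i j (s, z))\<bar> \<le> B" using B(2) P_I[OF s tz(3)] abs_Re_le_cmod order.trans by blast
          then have "\<bar>w $ i\<bar> * (\<bar>Re (M i j (s, z))\<bar> * \<bar>w $ j\<bar>) \<le> 1 * (B * 1)"
            using component_le_norm_cart[of w i] component_le_norm_cart[of w j] w B(1) by (intro mult_mono) auto
          then have "\<bar>w $ i * (Re (M i j (s, z)) * w $ j)\<bar> \<le> 1 * (B * 1)" by (simp add: abs_mult)
          then show "w $ i * (Re (M i j (s, z)) * w $ j) \<le> 1 * (B * 1)" by linarith
        qed
        also have "\<dots> = B'" by (simp add: B'_def)
        finally show ?thesis .
      qed
    qed (use B' tz in auto)
    moreover have "c \<le> exp (- (2 * B' + 1) * t)" using tz(2) B' by (simp add: c_def mult_left_mono)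
    then have "c * (norm v)\<^sup>2 \<le> exp (- (2 * B' + 1) * t) * (norm v)\<^sup>2" by (rule mult_right_mono) simp
    moreover have "v \<bullet> (N t *v v) = (\<Sum>i\<in>UNIV. \<Sum>j\<in>UNIV. v $ i * v $ j * Im (M i j p))"
      by (simp add: inner_vec_def matrix_vector_mult_def N_def sum_distrib_left mult_ac tz(1))
    ultimately show ?thesis by linarith
  qed
  then show ?thesis by (intro exI[of _ c]) (auto simp: c_def)
qed

section \<open>Lower bound for the imaginary part of the phase\<close>

lemma supp_rho: "compact (supp \<rho>)" and smooth_rho: "smooth \<rho>" and cut_at_one: "\<exists>r>0. \<forall>z\<in>ball 0 r. \<rho> z = 1"
  using cut by (auto simp: cutoff_def test_function_def)

lemma Phase_positive: "p \<in> P \<Longrightarrow> w \<in> supp \<rho> \<Longrightarrow> w \<noteq> 0 \<Longrightarrow> Im (Phase p (xc p + w)) > 0"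
proof -
  assume p: "p \<in> P" and w: "w \<in> supp \<rho>" "w \<noteq> 0"
  obtain t z where tz: "p = (t, z)" "t \<in> {0..T}" "z \<in> K" using p by (auto simp: P_def)
  have "let X0 = ini z in (xc p + w) - fst (X t X0) \<in> supp \<rho> \<and> (xc p + w) - fst (X t X0) \<noteq> 0 \<longrightarrow> 0 < Im (beam_phase k X \<phi> X0 t (xc p + w))"
    using cut tz(2,3) unfolding cutoff_def K_def ini_def by blast
  moreover have "(xc p + w) - fst (X t (ini z)) = w" by (simp add: xc_def tz(1))
  ultimately show ?thesis using w by (simp add: Let_def beam_phase_eq tz(1))
qed

text \<open>Near the centre the lower bound comes from the Hessian, away from it from compactness.\<close>

lemma Im_Ph_lower: "\<exists>c>0. \<forall>p\<in>P. \<forall>y. y - xc p \<in> supp \<rho> \<longrightarrow> c * (norm (y - xc p))\<^sup>2 \<le> Im (Phase p y)"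
proof -
  obtain c0 where c0: "c0 > 0" "\<forall>p\<in>P. \<forall>v. c0 * (norm v)\<^sup>2 \<le> (\<Sum>i\<in>UNIV. \<Sum>j\<in>UNIV. v $ i * v $ j * Im (M i j p))"
    using Im_M_positive by blast
  \<comment> \<open>The second-order Taylor polynomial of the phase at the centre. Its constant and
    linear parts are real there, so the imaginary part sits in the quadratic part and in the
    remainder f.\<close>
  define lin where "lin p y = (\<Sum>j\<in>UNIV. of_real (mom p $ j) * complex_of_real ((y - xc p) $ j))" for p y
  define qd where "qd p = quad (\<lambda>i j. M i j p) (xc p)" for p
  define f where "f p y = Phase p y - (Phase p (xc p) + lin p y + qd p y)" for p y
  have cPh: "continuous_on P (\<lambda>p. Phase p (xc p))"
    by (rule sfam_continuous_comp[OF sfam_Ph]) (auto intro: continuous_xc)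
  have slin: "sfam P (\<lambda>p y. lin p y)" unfolding lin_def by (intro sfam_linear_form continuous_xc continuous_mom_i)
  have sqd: "sfam P (\<lambda>p y. qd p y)" unfolding qd_def by (intro sfam_quad continuous_xc continuous_M)
  have sf: "sfam P f"
  proof -
    have "sfam P (\<lambda>p y. f p y)" unfolding f_def by (intro sfam_intros sfam_Ph cPh slin sqd)
    then show ?thesis .
  qed
  have "foldr partial is (f p) (xc p) = 0" if p: "p \<in> P" and len: "length is < 3" for p "is"
  proof -
    have sl: "smooth (lin p)" "smooth (qd p)" using sfam_imp_smooth[OF slin p] sfam_imp_smooth[OF sqd p] by auto
    have s1: "smooth (\<lambda>y. Phase p (xc p) + lin p y)" by (intro smooth_add smooth_const sl)
    have s2: "smooth (\<lambda>y. Phase p (xc p) + lin p y + qd p y)" by (intro smooth_add s1 sl)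
    have eq: "foldr partial is (f p) (xc p) = foldr partial is (Phase p) (xc p) - (foldr partial is (\<lambda>y. Phase p (xc p)) (xc p)
        + foldr partial is (lin p) (xc p) + foldr partial is (qd p) (xc p))"
      unfolding f_def[abs_def] foldr_partial_diff[OF smooth_Ph s2] foldr_partial_add[OF s1 sl(2)] foldr_partial_add[OF smooth_const sl(1)] ..
    have pl: "partial i (lin p) = (\<lambda>y. of_real (mom p $ i))" for i unfolding lin_def[abs_def] by (rule partial_linear_form)
    have q: "foldr partial is (qd p) (xc p) = (case is of [i, j] \<Rightarrow> M i j p | _ \<Rightarrow> 0)"
      unfolding qd_def by (rule foldr_partial_quad) (rule M_sym)
    consider "is = []" | i where "is = [i]" | i j where "is = [i, j]"
      using len by (cases "is"; cases "tl is"; cases "tl (tl is)") auto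
    then show ?thesis
    proof cases
      case 1
      then show ?thesis unfolding eq q by (simp add: lin_def)
    next
      case 2
      then show ?thesis unfolding eq q by (simp add: pl gradient_Ph[OF p])
    next
      case 3
      then show ?thesis unfolding eq q by (simp add: pl M_def)
    qed
  qed
  then have "\<exists>C\<ge>0. \<forall>p\<in>P. \<forall>y. norm (y - xc p) \<le> 1 \<longrightarrow> norm (f p y) \<le> C * norm (y - xc p) ^ 3"
    by (rule sfam_vanish_bound[OF compact_P continuous_xc sf])
  then obtain C where "C \<ge> 0 \<and> (\<forall>p\<in>P. \<forall>y. norm (y - xc p) \<le> 1 \<longrightarrow> norm (f p y) \<le> C * norm (y - xc p) ^ 3)"
    by (elim exE)
  then have C: "C \<ge> 0" "\<And>p y. p \<in> P \<Longrightarrow> norm (y - xc p) \<le> 1 \<Longrightarrow> norm (f p y) \<le> C * norm (y - xc p) ^ 3"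
    by simp_all
  \<comment> \<open>Within r0 the cubic remainder uses up at most c0/4 of the c0/2 that the Hessian
    provides; \<open>C + 1\<close> avoids a division by zero.\<close>
  define r0 where "r0 = min 1 (c0 / (4 * (C + 1)))"
  have r0: "r0 > 0" "r0 \<le> 1" "C * r0 \<le> c0 / 4"
  proof -
    show "r0 > 0" "r0 \<le> 1" using c0 C by (auto simp: r0_def)
    have "C * r0 \<le> (C + 1) * (c0 / (4 * (C + 1)))" using C c0 by (intro mult_mono) (auto simp: r0_def)
    also have "\<dots> = c0 / 4" using C by (simp add: field_simps)
    finally show "C * r0 \<le> c0 / 4" .
  qed
  have near: "c0 / 4 * (norm (y - xc p))\<^sup>2 \<le> Im (Phase p y)" if p: "p \<in> P" and y: "norm (y - xc p) \<le> r0" for p y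
  proof -
    let ?v = "y - xc p" and ?n = "norm (y - xc p)"
    have "Im (qd p y) = 1/2 * (\<Sum>i\<in>UNIV. \<Sum>j\<in>UNIV. ?v $ i * ?v $ j * Im (M i j p))"
    proof -
      have half: "Im (1/2 * w) = 1/2 * Im w" for w by simp
      have t: "Im (M i j p * (complex_of_real a * complex_of_real b)) = a * b * Im (M i j p)" for i j a b
        unfolding of_real_mult[symmetric] by (simp del: of_real_mult)
      show ?thesis unfolding qd_def quad_def half Im_sum t ..
    qed
    moreover have "c0 * ?n\<^sup>2 \<le> (\<Sum>i\<in>UNIV. \<Sum>j\<in>UNIV. ?v $ i * ?v $ j * Im (M i j p))" using c0(2) p by blast
    ultimately have 1: "Im (qd p y) \<ge> c0 / 2 * ?n\<^sup>2" by linarith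
    have 2: "Im (lin p y) = 0" by (simp add: lin_def Im_sum)
    have "\<bar>Im (f p y)\<bar> \<le> C * ?n ^ 3" using C(2)[OF p, of y] y r0(2) abs_Im_le_cmod[of "f p y"] by linarith
    also have "C * ?n ^ 3 = (C * ?n) * ?n\<^sup>2" by (simp add: power3_eq_cube power2_eq_square)
    also have "\<dots> \<le> (C * r0) * ?n\<^sup>2" using y C(1) by (intro mult_right_mono mult_left_mono) auto
    also have "\<dots> \<le> c0 / 4 * ?n\<^sup>2" by (rule mult_right_mono[OF r0(3)]) simp
    finally have 3: "\<bar>Im (f p y)\<bar> \<le> c0 / 4 * ?n\<^sup>2" .
    have "Im (Phase p y) = Im (f p y) + Im (qd p y)" using 2 Im_Ph_centre[OF p] by (simp add: f_def)
    then show ?thesis using 1 3 by linarith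
  qed
  \<comment> \<open>On the part of the support away from the centre the imaginary part is positive
    by the choice of the cutoff, and compactness provides a positive minimum.\<close>
  define Q where "Q = P \<times> (supp \<rho> - ball 0 r0)"
  have cQ: "compact Q" unfolding Q_def by (intro compact_Times compact_P compact_diff supp_rho open_ball)
  have cg: "continuous_on Q (\<lambda>q. Im (Phase (fst q) (xc (fst q) + snd q)))"
    by (intro continuous_intros sfam_continuous_comp[OF sfam_Ph] continuous_on_compose2[OF continuous_xc]) (auto simp: Q_def)
  obtain R where R: "R > 0" "\<And>w. w \<in> supp \<rho> \<Longrightarrow> norm w \<le> R"
    using compact_imp_bounded[OF supp_rho] unfolding bounded_pos by blast
  have "\<exists>m>0. \<forall>q\<in>Q. m \<le> Im (Phase (fst q) (xc (fst q) + snd q))"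
  proof (cases "Q = {}")
    case False
    from continuous_attains_inf[OF cQ this cg] obtain q where
      q: "q \<in> Q" "\<forall>q'\<in>Q. Im (Phase (fst q) (xc (fst q) + snd q)) \<le> Im (Phase (fst q') (xc (fst q') + snd q'))" by blast
    have "Im (Phase (fst q) (xc (fst q) + snd q)) > 0"
      by (rule Phase_positive) (use q(1) r0(1) in \<open>auto simp: Q_def\<close>)
    then show ?thesis using q(2) by blast
  qed (auto intro: exI[of _ 1])
  then obtain m where m: "m > 0" "\<And>q. q \<in> Q \<Longrightarrow> m \<le> Im (Phase (fst q) (xc (fst q) + snd q))" by blast
  \<comment> \<open>On the support the distance is at most R, so dividing the minimum m by the
    square of R turns it into a quadratic lower bound.\<close>
  define c where "c = min (c0 / 4) (m / R\<^sup>2)"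
  have c: "c > 0" using c0 m R by (simp add: c_def)
  have "c * (norm (y - xc p))\<^sup>2 \<le> Im (Phase p y)" if p: "p \<in> P" and y: "y - xc p \<in> supp \<rho>" for p y
  proof (cases "norm (y - xc p) \<le> r0")
    case True
    have "c * (norm (y - xc p))\<^sup>2 \<le> c0 / 4 * (norm (y - xc p))\<^sup>2" unfolding c_def by (intro mult_right_mono min.cobounded1) simp
    then show ?thesis using near[OF p True] by linarith
  next
    case False
    have "c * (norm (y - xc p))\<^sup>2 \<le> (m / R\<^sup>2) * R\<^sup>2"
    proof (rule mult_mono)
      show "c \<le> m / R\<^sup>2" unfolding c_def by (rule min.cobounded2)
      show "(norm (y - xc p))\<^sup>2 \<le> R\<^sup>2" by (intro power_mono R(2)[OF y] norm_ge_zero)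
    qed (use m R in auto)
    also have "\<dots> = m" using R by simp
    also have "m \<le> Im (Phase p y)" using m(2)[of "(p, y - xc p)"] False p y by (simp add: Q_def)
    finally show ?thesis .
  qed
  then show ?thesis using c by blast
qed

end

section \<open>Residual and initial error of a single beam\<close>

lemma bounded_choice:
  fixes N :: nat
  assumes "\<And>l. l \<le> N \<Longrightarrow> \<exists>c. Q l c"
  shows "\<exists>C. \<forall>l. l \<le> N \<longrightarrow> Q l (C l)"
  by (rule choice) (use assms in blast)

context gaussian_beams
begin

section \<open>The residual of a single beam\<close>

definition lmax :: nat where "lmax = (k - 1) div 2"
definition cut_at :: "real \<times> (real^'n) \<Rightarrow> real^'n \<Rightarrow> complex" where "cut_at p y = of_real (\<rho> (y - xc p))"
definition cut_at_t :: "real \<times> (real^'n) \<Rightarrow> real^'n \<Rightarrow> complex" where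
  "cut_at_t p y = - (\<Sum>i\<in>UNIV. of_real (mom p $ i) * partial i (cut_at p) y)"
definition Amps :: "real \<Rightarrow> real \<times> (real^'n) \<Rightarrow> real^'n \<Rightarrow> complex" where
  "Amps \<epsilon> p y = (\<Sum>l\<le>lmax. of_real (\<epsilon> ^ l) * Amp l p y)"
definition Amps_t :: "real \<Rightarrow> real \<times> (real^'n) \<Rightarrow> real^'n \<Rightarrow> complex" where
  "Amps_t \<epsilon> p y = (\<Sum>l\<le>lmax. of_real (\<epsilon> ^ l) * Amp_t l p y)"
definition osc :: "real \<Rightarrow> real \<times> (real^'n) \<Rightarrow> real^'n \<Rightarrow> complex" where
  "osc \<epsilon> p y = exp (\<i> / of_real \<epsilon> * Phase p y)"
definition beam_at :: "real \<Rightarrow> real \<times> (real^'n) \<Rightarrow> real^'n \<Rightarrow> complex" where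
  "beam_at \<epsilon> p y = cut_at p y * Amps \<epsilon> p y * osc \<epsilon> p y"
definition beam_t :: "real \<Rightarrow> real \<times> (real^'n) \<Rightarrow> real^'n \<Rightarrow> complex" where
  "beam_t \<epsilon> p y = (cut_at_t p y * Amps \<epsilon> p y + cut_at p y * Amps_t \<epsilon> p y + cut_at p y * Amps \<epsilon> p y * (\<i> / of_real \<epsilon> * Phase_t p y)) * osc \<epsilon> p y"
definition residual :: "real \<Rightarrow> real \<times> (real^'n) \<Rightarrow> real^'n \<Rightarrow> complex" where
  "residual \<epsilon> p y = - \<i> * of_real \<epsilon> * beam_t \<epsilon> p y - of_real (\<epsilon>\<^sup>2 / 2) * laplacian (beam_at \<epsilon> p) y + of_real (V y) * beam_at \<epsilon> p y"
text \<open>All terms of level l in which a derivative falls on the cutoff, with one factor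
  \<epsilon> taken out. The time derivative counts as well, because the cutoff travels with the
  centre.\<close>

definition cutoff_error :: "nat \<Rightarrow> real \<Rightarrow> real \<times> (real^'n) \<Rightarrow> real^'n \<Rightarrow> complex" where
  "cutoff_error l \<epsilon> p y = - \<i> * ((cut_at_t p y + (\<Sum>i\<in>UNIV. partial i (cut_at p) y * partial i (Phase p) y)) * Amp l p y)
     - of_real \<epsilon> * (1/2 * laplacian (cut_at p) y * Amp l p y + (\<Sum>i\<in>UNIV. partial i (cut_at p) y * partial i (Amp l p) y))"

lemma gaussian_beam_eq: "gaussian_beam k X \<rho> \<phi> a \<epsilon> t y (ini z) = beam_at \<epsilon> (t, z) y"
  by (simp add: gaussian_beam_def beam_at_def cut_at_def Amps_def osc_def lmax_def beam_amplitude_eq beam_phase_eq xc_def)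

lemma smooth_rho_c: "smooth (\<lambda>w. complex_of_real (\<rho> w))"
  unfolding smooth_iff_sfam by (intro sfam_intros smooth_rho)

lemma sfam_rho [sfam_intros]: "sfam P cut_at"
proof -
  have "sfam P (\<lambda>p y. cut_at p y)" unfolding cut_at_def by (intro sfam_intros smooth_rho continuous_xc)
  then show ?thesis .
qed

lemma sfam_rhot [sfam_intros]: "sfam P cut_at_t"
proof -
  have "sfam P (\<lambda>p y. cut_at_t p y)" unfolding cut_at_t_def by (intro sfam_intros sfam_rho continuous_mom_i)
  then show ?thesis .
qed

lemma sfam_As [sfam_intros]: "sfam P (Amps \<epsilon>)"
proof -
  have "sfam P (\<lambda>p y. Amps \<epsilon> p y)" unfolding Amps_def by (intro sfam_intros sfam_Am continuous_intros) (auto simp: lmax_def)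
  then show ?thesis .
qed

lemma sfam_Ast [sfam_intros]: "sfam P (Amps_t \<epsilon>)"
proof -
  have "sfam P (\<lambda>p y. Amps_t \<epsilon> p y)" unfolding Amps_t_def by (intro sfam_intros sfam_Amt continuous_intros) (auto simp: lmax_def)
  then show ?thesis .
qed

lemma sfam_Ex [sfam_intros]: "sfam P (osc \<epsilon>)"
proof -
  have "sfam P (\<lambda>p y. osc \<epsilon> p y)" unfolding osc_def by (intro sfam_exp sfam_mult sfam_const continuous_on_const sfam_Ph)
  then show ?thesis .
qed

lemma sfam_bm [sfam_intros]: "sfam P (beam_at \<epsilon>)"
proof -
  have "sfam P (\<lambda>p y. beam_at \<epsilon> p y)" unfolding beam_at_def by (intro sfam_mult sfam_rho sfam_As sfam_Ex)
  then show ?thesis .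
qed

lemma sfam_bt [sfam_intros]: "sfam P (beam_t \<epsilon>)"
proof -
  have "sfam P (\<lambda>p y. beam_t \<epsilon> p y)" unfolding beam_t_def
    by (intro sfam_mult sfam_add sfam_rho sfam_rhot sfam_As sfam_Ast sfam_Ex sfam_Pht sfam_const continuous_on_const)
  then show ?thesis .
qed

lemma sfam_res: "sfam P (residual \<epsilon>)"
proof -
  have "sfam P (\<lambda>p y. residual \<epsilon> p y)" unfolding residual_def
    by (intro sfam_mult sfam_add sfam_diff sfam_bm sfam_bt sfam_laplacian sfam_of_real sfam_smooth V sfam_const continuous_on_const)
  then show ?thesis .
qed

lemma smooth_rho_p: "smooth (cut_at p)"
proof -
  have "sfam {0::real} (\<lambda>_ y. cut_at p y)" unfolding cut_at_def by (intro sfam_of_real sfam_translate smooth_rho continuous_on_const)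
  then show ?thesis by (simp add: smooth_iff_sfam)
qed

lemma smooth_As: "smooth (Amps \<epsilon> p)"
proof -
  have "sfam {0::real} (\<lambda>_ y. Amps \<epsilon> p y)" unfolding Amps_def
    by (intro sfam_sum sfam_mult sfam_const continuous_on_const sfam_smooth smooth_Am)
  then show ?thesis by (simp add: smooth_iff_sfam)
qed

lemma beam_at_time_deriv:
  assumes tz: "t \<in> {0..T}" "z \<in> K"
  shows "((\<lambda>s. beam_at \<epsilon> (s, z) y) has_vector_derivative beam_t \<epsilon> (t, z) y) (at t within {0..T})"
proof -
  have 1: "((\<lambda>s. cut_at (s, z) y) has_vector_derivative cut_at_t (t, z) y) (at t within {0..T})"
    unfolding cut_at_def cut_at_t_def
    by (rule has_vector_derivative_eq_rhs[OF has_vector_derivative_moving[OF smooth_differentiable[OF smooth_rho_c] xc_deriv[OF tz(1)]]])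
      (simp add: cut_at_def[abs_def] partial_translate[of _ "\<lambda>w. complex_of_real (\<rho> w)"] scaleR_conv_of_real)
  have 2: "((\<lambda>s. Amps \<epsilon> (s, z) y) has_vector_derivative Amps_t \<epsilon> (t, z) y) (at t within {0..T})"
    unfolding Amps_def Amps_t_def
    by (intro has_vector_derivative_sum has_vector_derivative_mult_right Amp_time_deriv tz) (simp add: lmax_def)
  have "((\<lambda>s. \<i> / of_real \<epsilon> * Phase (s, z) y) has_vector_derivative \<i> / of_real \<epsilon> * Phase_t (t, z) y) (at t within {0..T})"
    by (intro has_vector_derivative_mult_right Phase_time_deriv tz)
  from field_vector_diff_chain_within[OF this DERIV_subset[OF DERIV_exp subset_UNIV]]
  have 3: "((\<lambda>s. osc \<epsilon> (s, z) y) has_vector_derivative \<i> / of_real \<epsilon> * Phase_t (t, z) y * osc \<epsilon> (t, z) y) (at t within {0..T})"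
    by (simp add: osc_def o_def)
  show ?thesis
    unfolding beam_at_def
    by (rule has_vector_derivative_eq_rhs[OF has_vector_derivative_mult[OF has_vector_derivative_mult[OF 1 2] 3]])
      (simp add: beam_t_def algebra_simps)
qed

text \<open>The Laplacian of level \<open>l - 1\<close>, which appears with the square of
  \<epsilon>, is exactly what the source of level l absorbs, and the top amplitude has none. Every
  remaining term contains a factor that vanishes to high order at the centre, or a derivative of the
  cutoff.\<close>

lemma residual_eq:
  assumes \<epsilon>: "\<epsilon> > 0"
  shows "residual \<epsilon> p y = osc \<epsilon> p y * (cut_at p y * Amps \<epsilon> p y * eikonal_residual p y
    - \<i> * of_real \<epsilon> * cut_at p y * (\<Sum>l\<le>lmax. of_real (\<epsilon> ^ l) * transport_residual l p y)
    + of_real \<epsilon> * (\<Sum>l\<le>lmax. of_real (\<epsilon> ^ l) * cutoff_error l \<epsilon> p y))"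
proof -
  define e where "e = complex_of_real \<epsilon>"
  define F where "F = Phase p"
  define B where "B y = cut_at p y * Amps \<epsilon> p y" for y
  define Y where "Y = (\<Sum>i\<in>UNIV. (partial i F y)\<^sup>2)"
  define L where "L = laplacian F y"
  define Z where "Z = (\<Sum>i\<in>UNIV. partial i (cut_at p) y * partial i F y)"
  define X where "X = (\<Sum>i\<in>UNIV. partial i (Amps \<epsilon> p) y * partial i F y)"
  define W where "W = (\<Sum>i\<in>UNIV. partial i (cut_at p) y * partial i (Amps \<epsilon> p) y)"
  define LA where "LA = laplacian (Amps \<epsilon> p) y"
  define Lr where "Lr = laplacian (cut_at p) y"
  have sB: "smooth B" unfolding B_def by (rule smooth_mult[OF smooth_rho_p smooth_As])
  have ep: "complex_of_real (\<epsilon> ^ l) = e ^ l" for l by (simp add: e_def)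
  have pAs: "partial i (Amps \<epsilon> p) y = (\<Sum>l\<le>lmax. e ^ l * partial i (Amp l p) y)" for i
    unfolding Amps_def[abs_def] ep by (subst partial_sum_fun) (auto intro: smooth_Am)
  have LAs: "LA = (\<Sum>l\<le>lmax. e ^ l * laplacian (Amp l p) y)"
    unfolding LA_def Amps_def[abs_def] ep by (subst laplacian_sum) (auto intro: smooth_Am)
  have amp_source: "(\<Sum>l\<le>lmax. e ^ l * amp_source l p y) = - \<i> / 2 * e * LA"
  proof -
    \<comment> \<open>The degree of the top amplitude is the parity of \<open>k - 1\<close>, so this
      amplitude is affine.\<close>
    have "k - 1 - 2 * lmax = (k - 1) mod 2" unfolding lmax_def by (rule minus_mult_div_eq_mod)
    then have "k - 1 - 2 * lmax \<le> 1" using mod_less_divisor[of 2 "k - 1"] by linarith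
    then have lmax0: "laplacian (Amp lmax p) y = 0" unfolding Amp_def by (rule laplacian_taylor_poly_linear)
    \<comment> \<open>A shift of the index: level 0 has no source, and level \<open>Suc l\<close>
      takes its source from level l.\<close>
    have "(\<Sum>l\<le>lmax. e ^ l * amp_source l p y) = (\<Sum>l<lmax. e ^ Suc l * (- \<i> / 2 * laplacian (Amp l p) y))"
      by (subst sum.atMost_shift) (simp add: amp_source_def)
    also have "\<dots> = - \<i> / 2 * e * (\<Sum>l<lmax. e ^ l * laplacian (Amp l p) y)"
      unfolding sum_distrib_left by (intro sum.cong refl) (simp add: mult_ac)
    also have "(\<Sum>l<lmax. e ^ l * laplacian (Amp l p) y) = LA"
      unfolding LAs lessThan_Suc_atMost[symmetric] by (simp add: lmax0)
    finally show ?thesis .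
  qed
  have tr: "Amps_t \<epsilon> p y + X + 1/2 * L * Amps \<epsilon> p y = (\<Sum>l\<le>lmax. e ^ l * transport_residual l p y) + \<i> / 2 * e * LA"
  proof -
    have "X = (\<Sum>l\<le>lmax. \<Sum>i\<in>UNIV. e ^ l * (partial i F y * partial i (Amp l p) y))"
      unfolding X_def pAs sum_distrib_right by (subst sum.swap) (simp add: mult_ac)
    then have X: "X = (\<Sum>l\<le>lmax. e ^ l * (\<Sum>i\<in>UNIV. partial i F y * partial i (Amp l p) y))"
      by (simp only: sum_distrib_left)
    have "(\<Sum>l\<le>lmax. e ^ l * transport_residual l p y) = Amps_t \<epsilon> p y + X + 1/2 * L * Amps \<epsilon> p y + (\<Sum>l\<le>lmax. e ^ l * amp_source l p y)"
      unfolding X Amps_t_def Amps_def ep transport_residual_def distrib_left sum.distrib sum_distrib_left[of "1/2 * L"]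
      by (simp add: F_def L_def mult_ac)
    then show ?thesis unfolding amp_source by simp
  qed
  have errs: "(\<Sum>l\<le>lmax. e ^ l * cutoff_error l \<epsilon> p y) = - \<i> * ((cut_at_t p y + Z) * Amps \<epsilon> p y) - e * (1/2 * Lr * Amps \<epsilon> p y + W)"
  proof -
    have "W = (\<Sum>l\<le>lmax. \<Sum>i\<in>UNIV. e ^ l * (partial i (cut_at p) y * partial i (Amp l p) y))"
      unfolding W_def pAs sum_distrib_left by (subst sum.swap) (simp add: mult_ac)
    then have W: "W = (\<Sum>l\<le>lmax. e ^ l * (\<Sum>i\<in>UNIV. partial i (cut_at p) y * partial i (Amp l p) y))"
      by (simp only: sum_distrib_left)
    have "e ^ l * cutoff_error l \<epsilon> p y = (- \<i> * (cut_at_t p y + Z) - e * (1/2 * Lr)) * (e ^ l * Amp l p y)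
      - e * (e ^ l * (\<Sum>i\<in>UNIV. partial i (cut_at p) y * partial i (Amp l p) y))" for l
      by (simp add: cutoff_error_def Z_def F_def Lr_def e_def algebra_simps)
    then have "(\<Sum>l\<le>lmax. e ^ l * cutoff_error l \<epsilon> p y) = (- \<i> * (cut_at_t p y + Z) - e * (1/2 * Lr)) * Amps \<epsilon> p y - e * W"
      by (simp only: sum_subtractf sum_distrib_left[symmetric] W Amps_def ep)
    then show ?thesis by (simp add: algebra_simps)
  qed
  have gB: "(\<Sum>i\<in>UNIV. partial i B y * partial i F y) = cut_at p y * X + Z * Amps \<epsilon> p y"
    unfolding B_def[abs_def] partial_mult_fun[OF smooth_rho_p smooth_As] X_def Z_def sum_distrib_left sum_distrib_right sum.distrib[symmetric]
    by (intro sum.cong refl) (simp add: algebra_simps)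
  have LB: "laplacian B y = cut_at p y * LA + 2 * W + Lr * Amps \<epsilon> p y"
    unfolding B_def[abs_def] laplacian_mult[OF smooth_rho_p smooth_As] LA_def W_def Lr_def ..
  have "residual \<epsilon> p y = osc \<epsilon> p y * (B y * eikonal_residual p y
      - \<i> * e * ((cut_at_t p y * Amps \<epsilon> p y + cut_at p y * Amps_t \<epsilon> p y) + (cut_at p y * X + Z * Amps \<epsilon> p y) + 1/2 * L * B y)
      - e * e / 2 * (cut_at p y * LA + 2 * W + Lr * Amps \<epsilon> p y))"
    using wkb_residual[OF sB smooth_Ph[of p], of \<epsilon> "cut_at_t p y * Amps \<epsilon> p y + cut_at p y * Amps_t \<epsilon> p y" y "Phase_t p y" "of_real (V y)"] \<epsilon>
    unfolding F_def[symmetric] gB LB L_def[symmetric]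
    by (simp add: residual_def beam_t_def beam_at_def[abs_def] osc_def eikonal_residual_def B_def[abs_def] F_def e_def power2_eq_square mult.assoc)
  also have "\<dots> = osc \<epsilon> p y * (B y * eikonal_residual p y - \<i> * e * cut_at p y * (Amps_t \<epsilon> p y + X + 1/2 * L * Amps \<epsilon> p y)
      - e * e / 2 * (cut_at p y * LA) + e * (- \<i> * ((cut_at_t p y + Z) * Amps \<epsilon> p y) - e * (1/2 * Lr * Amps \<epsilon> p y + W)))"
    by (simp add: B_def algebra_simps)
  also have "\<dots> = osc \<epsilon> p y * (B y * eikonal_residual p y - \<i> * e * cut_at p y * (\<Sum>l\<le>lmax. e ^ l * transport_residual l p y) + e * (\<Sum>l\<le>lmax. e ^ l * cutoff_error l \<epsilon> p y))"
    unfolding tr errs[symmetric] by (simp add: algebra_simps)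
  finally show ?thesis by (simp only: B_def e_def ep)
qed

lemma supp_zero: "w \<notin> supp \<rho> \<Longrightarrow> \<rho> w = 0"
  using closure_subset[of "{x. \<rho> x \<noteq> 0}"] unfolding supp_def by blast

text \<open>The support is closed, so outside it the cutoff vanishes on a neighbourhood, together
  with all derivatives.\<close>

lemma beam_at_outside:
  assumes "y - xc p \<notin> supp \<rho>"
  shows "beam_at \<epsilon> p y = 0" "beam_t \<epsilon> p y = 0" "laplacian (beam_at \<epsilon> p) y = 0" "residual \<epsilon> p y = 0"
proof -
  define U where "U = {y. y - xc p \<notin> supp \<rho>}"
  have "closed (supp \<rho>)" unfolding supp_def by simp
  then have "open ((\<lambda>y. y - xc p) -` (- supp \<rho>))"
    by (intro open_vimage) (auto intro!: continuous_intros)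
  then have U: "open U" by (simp add: U_def vimage_def)
  have rz: "cut_at p y = 0" if "y \<in> U" for y using that by (simp add: U_def cut_at_def supp_zero)
  have y: "y \<in> U" using assms by (simp add: U_def)
  have pz: "partial i f y = 0" if "y \<in> U" "\<And>y. y \<in> U \<Longrightarrow> f y = 0" for f :: "real^'n \<Rightarrow> complex" and i y
    using partial_cong_open[OF U that(1), of f "\<lambda>_. 0" i] that(2) by simp
  have bz: "beam_at \<epsilon> p y = 0" if "y \<in> U" for y using rz[OF that] by (simp add: beam_at_def)
  show 1: "beam_at \<epsilon> p y = 0" by (rule bz[OF y])
  have "partial i (partial i (beam_at \<epsilon> p)) y = 0" for i by (rule pz[OF y]) (rule pz, auto intro: bz)
  then show 2: "laplacian (beam_at \<epsilon> p) y = 0" by (simp add: laplacian_def)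
  have "cut_at_t p y = 0" unfolding cut_at_t_def using pz[OF y, of "cut_at p"] rz by simp
  then show 3: "beam_t \<epsilon> p y = 0" using rz[OF y] by (simp add: beam_t_def)
  show "residual \<epsilon> p y = 0" by (simp add: residual_def 1 2 3)
qed

lemma cut_at_deriv_near:
  assumes r: "\<forall>z\<in>ball 0 r. \<rho> z = 1" and y: "norm (y - xc p) < r"
  shows "partial i (cut_at p) y = 0" "laplacian (cut_at p) y = 0"
proof -
  define U where "U = ball (xc p) r"
  have yU: "y \<in> U" using y by (simp add: U_def dist_norm norm_minus_commute)
  have one: "cut_at p y = 1" if "y \<in> U" for y
    using r that by (simp add: cut_at_def U_def dist_norm norm_minus_commute)
  have p1: "partial i (cut_at p) y = 0" if "y \<in> U" for i y
    using partial_cong_open[OF _ that, of "cut_at p" "\<lambda>_. 1" i] one by (simp add: U_def)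
  show "partial i (cut_at p) y = 0" by (rule p1[OF yU])
  have "partial i (partial i (cut_at p)) y = 0" for i
    using partial_cong_open[OF _ yU, of "partial i (cut_at p)" "\<lambda>_. 0" i] p1 by (simp add: U_def)
  then show "laplacian (cut_at p) y = 0" by (simp add: laplacian_def)
qed

lemma norm_Ex_le:
  assumes "\<epsilon> > 0" "c * s \<le> Im (Phase p y)"
  shows "norm (osc \<epsilon> p y) \<le> exp (- c * s / \<epsilon>)"
proof -
  have "Re (\<i> / of_real \<epsilon> * Phase p y) = - Im (Phase p y) / \<epsilon>" by (simp add: Re_divide_of_real)
  moreover have "- Im (Phase p y) / \<epsilon> \<le> - (c * s) / \<epsilon>" using assms by (intro divide_right_mono) auto
  ultimately show ?thesis by (simp add: osc_def norm_exp_eq_Re)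
qed

lemma family_bound:
  fixes f :: "real \<times> (real^'n) \<Rightarrow> real^'n \<Rightarrow> complex"
  assumes "sfam P f"
  shows "\<exists>C\<ge>0. \<forall>p\<in>P. \<forall>y. norm (y - xc p) \<le> R \<longrightarrow> norm (f p y) \<le> C"
  using sfam_vanish_bound[OF compact_P continuous_xc assms, of 0 R] by simp

text \<open>The cutoff is constant up to distance r, so the error vanishes there; beyond r a
  constant is at most itself times the power k of the distance over r. The power k suffices because
  of the prefactor \<epsilon> in \<open>residual_eq\<close>, which is worth two more.\<close>

lemma cutoff_error_bound:
  assumes l: "l \<le> lmax" and r: "r > 0" "\<forall>z\<in>ball 0 r. \<rho> z = 1"
  shows "\<exists>C\<ge>0. \<forall>\<epsilon>\<in>{0<..1}. \<forall>p\<in>P. \<forall>y. norm (y - xc p) \<le> R \<longrightarrow> norm (cutoff_error l \<epsilon> p y) \<le> C * norm (y - xc p) ^ k"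
proof -
  define f where "f p y = (cut_at_t p y + (\<Sum>i\<in>UNIV. partial i (cut_at p) y * partial i (Phase p) y)) * Amp l p y" for p y
  define g where "g p y = 1/2 * laplacian (cut_at p) y * Amp l p y + (\<Sum>i\<in>UNIV. partial i (cut_at p) y * partial i (Amp l p) y)" for p y
  have l': "l \<le> (k - 1) div 2" using l by (simp add: lmax_def)
  have "sfam P (\<lambda>p y. f p y)" unfolding f_def
    by (intro sfam_mult sfam_add sfam_sum sfam_rhot sfam_partial sfam_rho sfam_Ph sfam_Am l')
  from family_bound[OF this] obtain Cf where Cf: "Cf \<ge> 0" "\<And>p y. p \<in> P \<Longrightarrow> norm (y - xc p) \<le> R \<Longrightarrow> norm (f p y) \<le> Cf" by blast
  have "sfam P (\<lambda>p y. g p y)" unfolding g_def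
    by (intro sfam_mult sfam_add sfam_sum sfam_laplacian sfam_partial sfam_rho sfam_Am l' sfam_const continuous_on_const)
  from family_bound[OF this] obtain Cg where Cg: "Cg \<ge> 0" "\<And>p y. p \<in> P \<Longrightarrow> norm (y - xc p) \<le> R \<Longrightarrow> norm (g p y) \<le> Cg" by blast
  have "norm (cutoff_error l \<epsilon> p y) \<le> (Cf + Cg) / r ^ k * norm (y - xc p) ^ k"
    if \<epsilon>: "\<epsilon> \<in> {0<..1}" and p: "p \<in> P" and y: "norm (y - xc p) \<le> R" for \<epsilon> p y
  proof (cases "norm (y - xc p) < r")
    case True
    then have "cutoff_error l \<epsilon> p y = 0" using cut_at_deriv_near[OF r(2) True] by (simp add: cutoff_error_def cut_at_t_def)
    then show ?thesis using Cf Cg r by simp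
  next
    case False
    have "norm (cutoff_error l \<epsilon> p y) \<le> norm (f p y) + \<epsilon> * norm (g p y)"
      using norm_triangle_ineq4[of "- \<i> * f p y" "of_real \<epsilon> * g p y"] \<epsilon> by (simp add: cutoff_error_def f_def g_def norm_mult)
    also have "\<epsilon> * norm (g p y) \<le> 1 * norm (g p y)" using \<epsilon> by (intro mult_right_mono) auto
    finally have "norm (cutoff_error l \<epsilon> p y) \<le> Cf + Cg" using Cf(2)[OF p y] Cg(2)[OF p y] by linarith
    also have "\<dots> = (Cf + Cg) / r ^ k * r ^ k" using r by simp
    also have "\<dots> \<le> (Cf + Cg) / r ^ k * norm (y - xc p) ^ k"
      using False r Cf Cg by (intro mult_left_mono power_mono) auto
    finally show ?thesis .
  qed
  then show ?thesis using Cf(1) Cg(1) r(1) by (intro exI[of _ "(Cf + Cg) / r ^ k"]) auto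
qed

text \<open>Under the Gaussian each power of the distance is worth \<open>sqrt \<epsilon>\<close>.
  The eikonal term has the power \<open>k + 2\<close>, the transport terms
  \<open>\<epsilon> ^ (l + 1)\<close> with the power \<open>k - 2 * l\<close>, the cutoff terms
  \<epsilon> with the power k: each amounts to \<open>sqrt \<epsilon> ^ (k + 2)\<close>.\<close>

lemma residual_bound:
  "\<exists>C\<ge>0. \<exists>c>0. \<forall>\<epsilon>\<in>{0<..1}. \<forall>p\<in>P. \<forall>y. norm (residual \<epsilon> p y) \<le> C * sqrt \<epsilon> ^ (k + 2) * exp (- c * (norm (y - xc p))\<^sup>2 / \<epsilon>)"
proof -
  obtain c where c: "c > 0" "\<And>p y. p \<in> P \<Longrightarrow> y - xc p \<in> supp \<rho> \<Longrightarrow> c * (norm (y - xc p))\<^sup>2 \<le> Im (Phase p y)"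
    using Im_Ph_lower by blast
  obtain r where r: "r > 0" "\<forall>z\<in>ball 0 r. \<rho> z = 1" using cut_at_one by blast
  obtain R where R: "\<And>w. w \<in> supp \<rho> \<Longrightarrow> norm w \<le> R"
    using compact_imp_bounded[OF supp_rho] unfolding bounded_iff by blast
  have Amp: "sfam P (Amp l)" "sfam P (transport_residual l)" if "l \<le> lmax" for l
    using that sfam_Am sfam_trn by (auto simp: lmax_def)
  obtain Cr where Cr: "Cr \<ge> 0" "\<And>p y. p \<in> P \<Longrightarrow> norm (y - xc p) \<le> R \<Longrightarrow> norm (cut_at p y) \<le> Cr"
    using family_bound[OF sfam_rho] by blast
  have "\<exists>C\<ge>0. \<forall>p\<in>P. \<forall>y. norm (y - xc p) \<le> R \<longrightarrow> norm (eikonal_residual p y) \<le> C * norm (y - xc p) ^ (k + 2)"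
    by (rule sfam_vanish_bound[OF compact_P continuous_xc sfam_eik eikonal_residual_vanish])
  then obtain Ce where Ce': "Ce \<ge> 0 \<and> (\<forall>p\<in>P. \<forall>y. norm (y - xc p) \<le> R \<longrightarrow> norm (eikonal_residual p y) \<le> Ce * norm (y - xc p) ^ (k + 2))"
    by (elim exE)
  then have Ce: "Ce \<ge> 0" "\<And>p y. p \<in> P \<Longrightarrow> norm (y - xc p) \<le> R \<Longrightarrow> norm (eikonal_residual p y) \<le> Ce * norm (y - xc p) ^ (k + 2)"
    by simp_all
  have "\<exists>C. \<forall>l. l \<le> lmax \<longrightarrow> C l \<ge> 0 \<and> (\<forall>p\<in>P. \<forall>y. norm (y - xc p) \<le> R \<longrightarrow> norm (Amp l p y) \<le> C l)"
    by (rule bounded_choice) (rule family_bound[OF Amp(1)])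
  then obtain Ca where Ca: "\<forall>l. l \<le> lmax \<longrightarrow> Ca l \<ge> 0 \<and> (\<forall>p\<in>P. \<forall>y. norm (y - xc p) \<le> R \<longrightarrow> norm (Amp l p y) \<le> Ca l)"
    by (elim exE)
  have "\<exists>C\<ge>0. \<forall>p\<in>P. \<forall>y. norm (y - xc p) \<le> R \<longrightarrow> norm (transport_residual l p y) \<le> C * norm (y - xc p) ^ (k - 2 * l)" if "l \<le> lmax" for l
    by (rule sfam_vanish_bound[OF compact_P continuous_xc Amp(2)[OF that] transport_residual_vanish]) (use that in \<open>auto simp: lmax_def\<close>)
  then have "\<exists>C. \<forall>l. l \<le> lmax \<longrightarrow> C l \<ge> 0 \<and> (\<forall>p\<in>P. \<forall>y. norm (y - xc p) \<le> R \<longrightarrow> norm (transport_residual l p y) \<le> C l * norm (y - xc p) ^ (k - 2 * l))"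
    by (rule bounded_choice)
  then obtain Ct where Ct: "\<forall>l. l \<le> lmax \<longrightarrow> Ct l \<ge> 0 \<and> (\<forall>p\<in>P. \<forall>y. norm (y - xc p) \<le> R \<longrightarrow> norm (transport_residual l p y) \<le> Ct l * norm (y - xc p) ^ (k - 2 * l))"
    by (elim exE)
  have "\<exists>C. \<forall>l. l \<le> lmax \<longrightarrow> C l \<ge> 0 \<and> (\<forall>\<epsilon>\<in>{0<..1}. \<forall>p\<in>P. \<forall>y. norm (y - xc p) \<le> R \<longrightarrow> norm (cutoff_error l \<epsilon> p y) \<le> C l * norm (y - xc p) ^ k)"
    by (rule bounded_choice) (rule cutoff_error_bound[OF _ r])
  then obtain Cx where Cx: "\<forall>l. l \<le> lmax \<longrightarrow> Cx l \<ge> 0 \<and> (\<forall>\<epsilon>\<in>{0<..1}. \<forall>p\<in>P. \<forall>y. norm (y - xc p) \<le> R \<longrightarrow> norm (cutoff_error l \<epsilon> p y) \<le> Cx l * norm (y - xc p) ^ k)"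
    by (elim exE)
  have "\<exists>G. \<forall>j. G j \<ge> 0 \<and> (\<forall>s\<ge>0. \<forall>\<epsilon>>0. s ^ j * exp (- c * s\<^sup>2 / \<epsilon>) \<le> G j * sqrt \<epsilon> ^ j * exp (- (c/2) * s\<^sup>2 / \<epsilon>))"
    by (rule choice, rule allI, rule power_gauss_bound[OF c(1)])
  then obtain G where G: "\<forall>j. G j \<ge> 0 \<and> (\<forall>s\<ge>0. \<forall>\<epsilon>>0. s ^ j * exp (- c * s\<^sup>2 / \<epsilon>) \<le> G j * sqrt \<epsilon> ^ j * exp (- (c/2) * s\<^sup>2 / \<epsilon>))"
    by (elim exE)
  define CA where "CA = (\<Sum>l\<le>lmax. Ca l)"
  define C where "C = Cr * CA * Ce * G (k + 2) + (\<Sum>l\<le>lmax. Cr * Ct l * G (k - 2 * l)) + (\<Sum>l\<le>lmax. Cx l * G k)"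
  have CA: "CA \<ge> 0" unfolding CA_def using Ca by (intro sum_nonneg) auto
  have C0: "C \<ge> 0" unfolding C_def using Cr CA Ce G Ct Cx by (intro add_nonneg_nonneg mult_nonneg_nonneg sum_nonneg) auto
  have "norm (residual \<epsilon> p y) \<le> C * sqrt \<epsilon> ^ (k + 2) * exp (- (c/2) * (norm (y - xc p))\<^sup>2 / \<epsilon>)"
    if \<epsilon>: "\<epsilon> \<in> {0<..1}" and p: "p \<in> P" for \<epsilon> p y
  proof (cases "y - xc p \<in> supp \<rho>")
    case False
    then show ?thesis using beam_at_outside(4) C0 \<epsilon> by simp
  next
    case True
    define n where "n = norm (y - xc p)"
    define s where "s = sqrt \<epsilon>"
    define E where "E = exp (- c * n\<^sup>2 / \<epsilon>)"
    define E' where "E' = exp (- (c/2) * n\<^sup>2 / \<epsilon>)"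
    have e: "\<epsilon> > 0" "\<epsilon> \<le> 1" using \<epsilon> by auto
    have s: "s \<ge> 0" "\<epsilon> = s\<^sup>2" using e by (auto simp: s_def)
    have nR: "norm (y - xc p) \<le> R" by (rule R[OF True])
    have n0: "n \<ge> 0" by (simp add: n_def)
    have osc: "norm (osc \<epsilon> p y) \<le> E" unfolding E_def n_def by (rule norm_Ex_le[OF e(1) c(2)[OF p True]])
    have gb: "n ^ j * E \<le> G j * s ^ j * E'" for j using G n0 e(1) unfolding E_def E'_def s_def by blast
    have el: "\<epsilon> ^ l \<le> 1" "\<epsilon> ^ l \<ge> 0" for l using e by (auto simp: power_le_one)
    have Amps: "norm (Amps \<epsilon> p y) \<le> CA"
      unfolding Amps_def CA_def
    proof (rule sum_norm_le)
      fix l assume "l \<in> {..lmax}"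
      then have "norm (Amp l p y) \<le> Ca l" using Ca p nR by auto
      then have "\<epsilon> ^ l * norm (Amp l p y) \<le> 1 * Ca l" using el[of l] by (intro mult_mono) auto
      then show "norm (complex_of_real (\<epsilon> ^ l) * Amp l p y) \<le> Ca l" using e(1) by (simp add: norm_mult norm_power)
    qed
    have t1: "norm (cut_at p y * Amps \<epsilon> p y * eikonal_residual p y) * E \<le> (Cr * CA * Ce * G (k + 2)) * (s ^ (k + 2) * E')"
    proof -
      have "norm (cut_at p y * Amps \<epsilon> p y * eikonal_residual p y) \<le> (Cr * CA) * (Ce * n ^ (k + 2))"
        unfolding norm_mult n_def using Cr Ce CA Amps p nR by (intro mult_mono) auto
      then have "norm (cut_at p y * Amps \<epsilon> p y * eikonal_residual p y) * E \<le> (Cr * CA) * (Ce * n ^ (k + 2)) * E"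
        by (rule mult_right_mono) (simp add: E_def)
      also have "\<dots> = (Cr * CA * Ce) * (n ^ (k + 2) * E)" by (simp add: mult_ac)
      also have "\<dots> \<le> (Cr * CA * Ce) * (G (k + 2) * s ^ (k + 2) * E')" using Cr CA Ce by (intro mult_left_mono gb) auto
      finally show ?thesis by (simp add: mult_ac)
    qed
    have t2: "norm (\<i> * of_real \<epsilon> * cut_at p y * (\<Sum>l\<le>lmax. of_real (\<epsilon> ^ l) * transport_residual l p y)) * E \<le> (\<Sum>l\<le>lmax. Cr * Ct l * G (k - 2 * l)) * (s ^ (k + 2) * E')"
    proof -
      have "norm (\<Sum>l\<le>lmax. of_real (\<epsilon> ^ l) * transport_residual l p y) \<le> (\<Sum>l\<le>lmax. \<epsilon> ^ l * (Ct l * n ^ (k - 2 * l)))"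
      proof (rule sum_norm_le)
        fix l assume l: "l \<in> {..lmax}"
        then have "norm (transport_residual l p y) \<le> Ct l * n ^ (k - 2 * l)" using Ct p nR unfolding n_def by auto
        then have "\<epsilon> ^ l * norm (transport_residual l p y) \<le> \<epsilon> ^ l * (Ct l * n ^ (k - 2 * l))" using el by (intro mult_left_mono) auto
        then show "norm (complex_of_real (\<epsilon> ^ l) * transport_residual l p y) \<le> \<epsilon> ^ l * (Ct l * n ^ (k - 2 * l))"
          using e(1) by (simp add: norm_mult norm_power)
      qed
      then have "norm (\<i> * of_real \<epsilon> * cut_at p y * (\<Sum>l\<le>lmax. of_real (\<epsilon> ^ l) * transport_residual l p y)) \<le> \<epsilon> * Cr * (\<Sum>l\<le>lmax. \<epsilon> ^ l * (Ct l * n ^ (k - 2 * l)))"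
        unfolding norm_mult using Cr p nR e by (intro mult_mono) auto
      then have "norm (\<i> * of_real \<epsilon> * cut_at p y * (\<Sum>l\<le>lmax. of_real (\<epsilon> ^ l) * transport_residual l p y)) * E \<le> \<epsilon> * Cr * (\<Sum>l\<le>lmax. \<epsilon> ^ l * (Ct l * n ^ (k - 2 * l))) * E"
        by (rule mult_right_mono) (simp add: E_def)
      also have "\<dots> = (\<Sum>l\<le>lmax. (Cr * Ct l) * (\<epsilon> ^ Suc l * (n ^ (k - 2 * l) * E)))"
        unfolding sum_distrib_left sum_distrib_right by (intro sum.cong refl) (simp add: mult_ac)
      also have "\<dots> \<le> (\<Sum>l\<le>lmax. (Cr * Ct l) * (\<epsilon> ^ Suc l * (G (k - 2 * l) * s ^ (k - 2 * l) * E')))"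
        using Cr Ct e by (intro sum_mono mult_left_mono gb) auto
      also have "\<dots> = (\<Sum>l\<le>lmax. Cr * Ct l * G (k - 2 * l)) * (s ^ (k + 2) * E')"
        unfolding sum_distrib_right
      proof (intro sum.cong refl)
        fix l assume "l \<in> {..lmax}"
        \<comment> \<open>The bound on l gives \<open>2 * l \<le> k\<close>, so the subtraction is
          not truncated and the powers match exactly.\<close>
        then have "2 * Suc l + (k - 2 * l) = k + 2" using k by (auto simp: lmax_def)
        then have eq: "\<epsilon> ^ Suc l * s ^ (k - 2 * l) = s ^ (k + 2)"
          unfolding s(2) power_mult[symmetric] power_add[symmetric] by simp
        show "(Cr * Ct l) * (\<epsilon> ^ Suc l * (G (k - 2 * l) * s ^ (k - 2 * l) * E')) = Cr * Ct l * G (k - 2 * l) * (s ^ (k + 2) * E')"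
          unfolding eq[symmetric] by (simp only: mult_ac)
      qed
      finally show ?thesis .
    qed
    have t3: "norm (of_real \<epsilon> * (\<Sum>l\<le>lmax. of_real (\<epsilon> ^ l) * cutoff_error l \<epsilon> p y)) * E \<le> (\<Sum>l\<le>lmax. Cx l * G k) * (s ^ (k + 2) * E')"
    proof -
      have "norm (\<Sum>l\<le>lmax. of_real (\<epsilon> ^ l) * cutoff_error l \<epsilon> p y) \<le> (\<Sum>l\<le>lmax. Cx l * n ^ k)"
      proof (rule sum_norm_le)
        fix l assume l: "l \<in> {..lmax}"
        then have "norm (cutoff_error l \<epsilon> p y) \<le> Cx l * n ^ k" using Cx p nR \<epsilon> unfolding n_def by auto
        then have "\<epsilon> ^ l * norm (cutoff_error l \<epsilon> p y) \<le> 1 * (Cx l * n ^ k)" using el[of l] by (intro mult_mono) auto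
        then show "norm (complex_of_real (\<epsilon> ^ l) * cutoff_error l \<epsilon> p y) \<le> Cx l * n ^ k"
          using e(1) by (simp add: norm_mult norm_power)
      qed
      then have "norm (of_real \<epsilon> * (\<Sum>l\<le>lmax. of_real (\<epsilon> ^ l) * cutoff_error l \<epsilon> p y)) \<le> \<epsilon> * (\<Sum>l\<le>lmax. Cx l * n ^ k)"
        unfolding norm_mult using e by (intro mult_mono) auto
      then have "norm (of_real \<epsilon> * (\<Sum>l\<le>lmax. of_real (\<epsilon> ^ l) * cutoff_error l \<epsilon> p y)) * E \<le> \<epsilon> * (\<Sum>l\<le>lmax. Cx l * n ^ k) * E"
        by (rule mult_right_mono) (simp add: E_def)
      also have "\<dots> = (\<epsilon> * (\<Sum>l\<le>lmax. Cx l)) * (n ^ k * E)" by (simp add: sum_distrib_right[symmetric])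
      also have "\<dots> \<le> (\<epsilon> * (\<Sum>l\<le>lmax. Cx l)) * (G k * s ^ k * E')"
        using e Cx by (intro mult_left_mono gb mult_nonneg_nonneg sum_nonneg) auto
      also have "\<dots> = (\<Sum>l\<le>lmax. Cx l * G k) * (s ^ (k + 2) * E')"
        by (simp add: s(2) sum_distrib_right[symmetric] power_add power2_eq_square mult_ac)
      finally show ?thesis .
    qed
    let ?a = "cut_at p y * Amps \<epsilon> p y * eikonal_residual p y" and ?b = "\<i> * of_real \<epsilon> * cut_at p y * (\<Sum>l\<le>lmax. of_real (\<epsilon> ^ l) * transport_residual l p y)"
      and ?c = "of_real \<epsilon> * (\<Sum>l\<le>lmax. of_real (\<epsilon> ^ l) * cutoff_error l \<epsilon> p y)"
    have "norm (residual \<epsilon> p y) = norm (osc \<epsilon> p y) * norm (?a - ?b + ?c)" unfolding residual_eq[OF e(1)] norm_mult ..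
    also have "\<dots> \<le> E * (norm ?a + norm ?b + norm ?c)"
      using norm_triangle_ineq[of "?a - ?b" ?c] norm_triangle_ineq4[of ?a ?b] osc by (intro mult_mono) (auto simp: E_def)
    also have "\<dots> = norm ?a * E + norm ?b * E + norm ?c * E" by (simp add: algebra_simps)
    also have "\<dots> \<le> C * (s ^ (k + 2) * E')" using t1 t2 t3 unfolding C_def distrib_right by linarith
    finally show ?thesis by (simp add: s_def E'_def n_def mult_ac)
  qed
  then show ?thesis using C0 c(1) by (intro exI[of _ C] conjI exI[of _ "c/2"]) auto
qed

text \<open>All derivatives of A vanish at z, so a Taylor bound of any order holds there; k is the
  order of the initial error. Points outside K do not form a compact set, so the uniform constant
  comes from the compact set Q below; for y farther than 1 from z the boundedness of A is
  enough.\<close>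

lemma A_flat: "\<exists>C\<ge>0. \<forall>z y. z \<notin> K \<longrightarrow> norm (A y) \<le> C * norm (y - z) ^ k"
proof -
  obtain RK where RK: "\<And>x. x \<in> K \<Longrightarrow> norm x \<le> RK" using compact_imp_bounded[OF compact_K] unfolding bounded_iff by blast
  have A0: "A y = 0" if "y \<notin> K" for y
    using that closure_subset[of "{x. A x \<noteq> 0}"] unfolding K_def supp_def by blast
  have oK: "open (- K)" using compact_imp_closed[OF compact_K] by (simp add: open_Compl)
  have flat: "foldr partial is A z = 0" if "z \<notin> K" for "is" z
    using that
  proof (induction "is" arbitrary: z)
    case (Cons i "is")
    then show ?case using partial_cong_open[OF oK, of z "foldr partial is A" "\<lambda>_. 0" i] by simp
  qed (simp add: A0)
  \<comment> \<open>Closed by continuity of the derivatives, so it also contains limits of points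
    outside K. The radius covers every z within distance 1 of K.\<close>
  define Q where "Q = cball 0 (RK + 1) \<inter> (\<Inter>is. {x. foldr partial is A x = 0})"
  have "closed {x. foldr partial is A x = 0}" for "is"
    by (rule closed_Collect_eq[OF smooth_continuous[OF smooth_foldr_partial[OF smooth_A]] continuous_on_const])
  then have cQ: "compact Q" unfolding Q_def by (intro compact_Int_closed compact_cball closed_INT) auto
  have "\<exists>C\<ge>0. \<forall>p\<in>Q. \<forall>y. norm (y - p) \<le> 1 \<longrightarrow> norm (A y) \<le> C * norm (y - p) ^ k"
    by (rule sfam_vanish_bound[OF cQ continuous_on_id sfam_smooth[OF smooth_A]]) (auto simp: Q_def)
  then obtain C1 where C1: "C1 \<ge> 0" "\<And>p y. p \<in> Q \<Longrightarrow> norm (y - p) \<le> 1 \<Longrightarrow> norm (A y) \<le> C1 * norm (y - p) ^ k" by blast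
  obtain C2 where C2: "C2 \<ge> 0" "\<forall>y\<in>K. norm (A y) \<le> C2"
    using compact_norm_bound[OF compact_K smooth_continuous[OF smooth_A]] by blast
  have "norm (A y) \<le> (C1 + C2) * norm (y - z) ^ k" if z: "z \<notin> K" for z y
  proof (cases "y \<in> K")
    case True
    show ?thesis
    proof (cases "norm (y - z) \<le> 1")
      case close: True
      have "norm z \<le> RK + 1" using RK[OF True] close norm_triangle_ineq2[of z y] by (simp add: norm_minus_commute)
      then have "z \<in> Q" using flat[OF z] by (auto simp: Q_def)
      from C1(2)[OF this close] have "norm (A y) \<le> C1 * norm (y - z) ^ k" .
      also have "\<dots> \<le> (C1 + C2) * norm (y - z) ^ k" using C2 by (intro mult_right_mono) auto
      finally show ?thesis .
    next
      case False
      have "norm (A y) \<le> (C1 + C2) * 1" using C1 C2 True by force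
      also have "\<dots> \<le> (C1 + C2) * norm (y - z) ^ k" using False C1 C2 by (intro mult_left_mono one_le_power) auto
      finally show ?thesis .
    qed
  qed (simp add: A0 C1 C2)
  then show ?thesis using C1 C2 by (intro exI[of _ "C1 + C2"]) auto
qed

end

text \<open>The reciprocal of the integral of \<open>exp (- |z|\<^sup>2 / (2 \<epsilon>))\<close>, the modulus of the
  initial exponential factor of a beam.\<close>

definition beam_normalization :: "'n::finite itself \<Rightarrow> real \<Rightarrow> real" where
  "beam_normalization _ \<epsilon> = 1 / (gauss_int TYPE(real^'n) (1/2) * sqrt \<epsilon> ^ CARD('n))"

lemma beam_normalization_pos: "\<epsilon> > 0 \<Longrightarrow> beam_normalization TYPE('n::finite) \<epsilon> > 0"
  using gauss_int_pos[of "1/2", where 'a="real^'n"] by (simp add: beam_normalization_def)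

context gaussian_beams
begin

section \<open>The beams at time zero\<close>

lemma K0_P: "{0} \<times> K \<subseteq> P"
  using T by (auto simp: P_def)

lemma foldr_partial_of_real:
  fixes f :: "real^'n \<Rightarrow> real"
  assumes "smooth f"
  shows "foldr partial is (\<lambda>y. complex_of_real (f y)) = (\<lambda>y. of_real (foldr partial is f y))"
proof (induction "is")
  case (Cons i "is")
  show ?case
    unfolding foldr.simps o_def Cons.IH
    by (rule ext) (rule partial_bounded_linear[OF bounded_linear_of_real smooth_differentiable[OF smooth_foldr_partial[OF assms]]])
qed simp

lemma Amps_initial: "z \<in> K \<Longrightarrow> Amps \<epsilon> (0, z) y = Amp 0 (0, z) y"
proof -
  assume z: "z \<in> K"
  have "Amp (Suc l) (0, z) y = 0" if "l < lmax" for l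
    unfolding Amp_def taylor_poly_def
    by (rule sum.neutral) (use amplitude_init[OF z, of "Suc l"] that in \<open>auto simp: lmax_def\<close>)
  then show ?thesis unfolding Amps_def by (subst sum.atMost_shift) simp
qed

text \<open>At time 0 the leading amplitude is the Taylor polynomial of A about z of degree
  \<open>k - 1\<close>, hence contact of order k.\<close>

lemma initial_amplitude:
  "\<exists>C. C \<ge> 0 \<and> (\<forall>z\<in>K. \<forall>y. norm (y - z) \<le> R \<longrightarrow> norm (Amp 0 (0, z) y - A y) \<le> C * norm (y - z) ^ k)"
proof -
  let ?Q = "{0::real} \<times> K"
  have s: "sfam ?Q (\<lambda>p y. Amp 0 p y - A y)"
    by (rule sfam_diff[OF sfam_subset[OF sfam_Am K0_P] sfam_smooth[OF smooth_A]]) simp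
  have "\<exists>C\<ge>0. \<forall>p\<in>?Q. \<forall>y. norm (y - xc p) \<le> R \<longrightarrow> norm (Amp 0 p y - A y) \<le> C * norm (y - xc p) ^ k"
  proof (rule sfam_vanish_bound[OF _ continuous_on_subset[OF continuous_xc K0_P] s])
    fix p and "is" :: "'n list" assume p: "p \<in> ?Q" and len: "length is < k"
    obtain z where z: "p = (0, z)" "z \<in> K" using p by auto
    have sz: "mi_size (count (mset is)) \<le> k - 1 - 2 * 0" using len by (simp add: mi_size_count)
    have "foldr partial is (Amp 0 p) (xc p) = mi_deriv (count (mset is)) (Amp 0 p) (xc p)"
      by (simp only: foldr_partial_eq_mi_deriv[OF smooth_Am])
    also have "\<dots> = acoef 0 (count (mset is)) p" by (simp only: Amp_def mi_deriv_taylor_poly sz if_True)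
    also have "\<dots> = mi_deriv (count (mset is)) A z" using amplitude_init[OF z(2) _ sz] by (simp add: z(1))
    also have "\<dots> = foldr partial is A (xc p)" by (simp only: foldr_partial_eq_mi_deriv[OF smooth_A] z(1) xc_0)
    finally show "foldr partial is (\<lambda>y. Amp 0 p y - A y) (xc p) = 0"
      by (simp add: foldr_partial_diff[OF smooth_Am smooth_A])
  qed (intro compact_Times compact_K compact_sing)
  then show ?thesis by simp
qed

text \<open>The imaginary shift of the initial Hessian is the second derivative of the quadratic
  subtracted here, so up to order \<open>k + 1\<close> the difference has no derivatives at
  z.\<close>

lemma initial_phase:
  "\<exists>C. C \<ge> 0 \<and> (\<forall>z\<in>K. \<forall>y. norm (y - z) \<le> R \<longrightarrow>
    norm (Phase (0, z) y - (of_real (S y) + \<i> * of_real ((norm (y - z))\<^sup>2 / 2))) \<le> C * norm (y - z) ^ (k + 2))"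
proof -
  let ?Q = "{0::real} \<times> K"
  define m :: "'n \<Rightarrow> 'n \<Rightarrow> complex" where "m i j = (if i = j then \<i> else 0)" for i j
  have sym: "m i j = m j i" for i j by (simp add: m_def)
  have xcQ: "continuous_on ?Q xc" by (rule continuous_on_subset[OF continuous_xc K0_P])
  have sS: "smooth (\<lambda>y. complex_of_real (S y))" unfolding smooth_iff_sfam by (intro sfam_of_real sfam_smooth S)
  have sq: "sfam ?Q (\<lambda>p y. quad m (xc p) y)" using sfam_quad[OF xcQ, of "\<lambda>i j _. m i j"] by (simp add: continuous_on_const)
  have s: "sfam ?Q (\<lambda>p y. Phase p y - (of_real (S y) + quad m (xc p) y))"
    by (intro sfam_diff sfam_add sfam_subset[OF sfam_Ph K0_P] sfam_smooth[OF sS] sq)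
  have "\<exists>C\<ge>0. \<forall>p\<in>?Q. \<forall>y. norm (y - xc p) \<le> R \<longrightarrow> norm (Phase p y - (of_real (S y) + quad m (xc p) y)) \<le> C * norm (y - xc p) ^ (k + 2)"
  proof (rule sfam_vanish_bound[OF _ xcQ s])
    fix p and "is" :: "'n list" assume p: "p \<in> ?Q" and len: "length is < k + 2"
    obtain z where z: "p = (0, z)" "z \<in> K" using p by auto
    have sqp: "smooth (quad m (xc p))" using sfam_imp_smooth[OF sq p] by simp
    have eq: "foldr partial is (\<lambda>y. Phase p y - (of_real (S y) + quad m (xc p) y)) (xc p)
      = foldr partial is (Phase p) z - (of_real (foldr partial is S z) + (case is of [i, j] \<Rightarrow> m i j | _ \<Rightarrow> 0))"
      unfolding foldr_partial_diff[OF smooth_Ph smooth_add[OF sS sqp]] foldr_partial_add[OF sS sqp] foldr_partial_of_real[OF S]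
        foldr_partial_quad[of m, OF sym] by (simp add: z(1))
    consider "is = []" | i where "is = [i]" | i j where "is = [i, j]" | "3 \<le> length is"
      by (cases "is"; cases "tl is"; cases "tl (tl is)") auto
    then show "foldr partial is (\<lambda>y. Phase p y - (of_real (S y) + quad m (xc p) y)) (xc p) = 0"
    proof cases
      case 1
      then show ?thesis unfolding eq using phase_init(1)[OF z(2)] by (simp add: z(1))
    next
      case (2 i)
      then show ?thesis unfolding eq using phase_init(2)[OF z(2), of i] by (simp add: z(1) grad_def)
    next
      case (3 i j)
      then show ?thesis unfolding eq using phase_init(3)[OF z(2), of i j] by (simp add: z(1) m_def)
    next
      case 4
      let ?\<alpha> = "count (mset is)"
      have sz: "3 \<le> mi_size ?\<alpha>" "mi_size ?\<alpha> \<le> k + 1" using 4 len by (simp_all add: mi_size_count)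
      have "foldr partial is (Phase p) (xc p) = mi_deriv ?\<alpha> (Phase p) (xc p)"
        by (simp only: foldr_partial_eq_mi_deriv[OF smooth_Ph])
      also have "\<dots> = coef ?\<alpha> p" by (simp only: Phase_def mi_deriv_taylor_poly sz if_True)
      also have "\<dots> = of_real (mi_deriv ?\<alpha> S z)" using phase_init(4)[OF z(2) sz] by (simp add: z(1))
      also have "\<dots> = of_real (foldr partial is S z)" by (simp only: foldr_partial_eq_mi_deriv[OF S])
      finally have "foldr partial is (Phase p) z = of_real (foldr partial is S z)" by (simp add: z(1))
      moreover have "(case is of [i, j] \<Rightarrow> m i j | _ \<Rightarrow> 0) = 0" using 4 by (auto split: list.splits)
      ultimately show ?thesis unfolding eq by simp
    qed
  qed (intro compact_Times compact_K compact_sing)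
  moreover have "quad m c y = \<i> * of_real ((norm (y - c))\<^sup>2 / 2)" for c y
  proof -
    have "quad m c y = 1/2 * (\<Sum>i\<in>UNIV. \<i> * (of_real ((y - c) $ i) * of_real ((y - c) $ i)))"
      unfolding quad_def m_def by (simp add: if_distrib[of "\<lambda>x. x * _"] sum.delta' cong: if_cong)
    also have "\<dots> = \<i> * of_real ((\<Sum>i\<in>UNIV. (y - c) $ i * (y - c) $ i) / 2)"
      by (simp add: sum_distrib_left[symmetric])
    also have "(\<Sum>i\<in>UNIV. (y - c) $ i * (y - c) $ i) = (norm (y - c))\<^sup>2"
      by (simp add: power2_norm_eq_inner inner_vec_def)
    finally show ?thesis .
  qed
  ultimately show ?thesis by simp
qed

text \<open>The bound covers every z, because the Gaussian weight of the datum has to be integrated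
  over the whole space to yield the normalization. Outside K there is no beam, and the flatness of A
  makes up for it. Inside K, beam and weighted datum differ by the errors of the amplitude, of the
  exponential factor and of the cutoff.\<close>

lemma initial_bound:
  "\<exists>C. C \<ge> 0 \<and> (\<exists>c>0. \<forall>\<epsilon>\<in>{0<..1}. \<forall>z y. norm (indicator K z *\<^sub>R beam_at \<epsilon> (0, z) y
     - wkb_data A S \<epsilon> y * of_real (exp (- (1/2) * (norm (z - y))\<^sup>2 / \<epsilon>))) \<le> C * sqrt \<epsilon> ^ k * exp (- c * (norm (z - y))\<^sup>2 / \<epsilon>))"
proof -
  obtain c1 where c1: "c1 > 0" "\<And>p y. p \<in> P \<Longrightarrow> y - xc p \<in> supp \<rho> \<Longrightarrow> c1 * (norm (y - xc p))\<^sup>2 \<le> Im (Phase p y)"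
    using Im_Ph_lower by blast
  \<comment> \<open>A rate of decay valid for the beam, c1, and for the weight of the datum,
    1/2.\<close>
  define c where "c = min c1 (1/2)"
  have c: "c > 0" "c \<le> 1/2" "c \<le> c1" using c1(1) by (auto simp: c_def)
  obtain r where r: "r > 0" "\<forall>z\<in>ball 0 r. \<rho> z = 1" using cut_at_one by blast
  obtain R where R: "\<And>w. w \<in> supp \<rho> \<Longrightarrow> norm w \<le> R"
    using compact_imp_bounded[OF supp_rho] unfolding bounded_iff by blast
  obtain Ca where Ca: "Ca \<ge> 0 \<and> (\<forall>z\<in>K. \<forall>y. norm (y - z) \<le> R \<longrightarrow> norm (Amp 0 (0, z) y - A y) \<le> Ca * norm (y - z) ^ k)"
    using initial_amplitude[of R] by (elim exE)
  obtain Cp where Cp: "Cp \<ge> 0 \<and> (\<forall>z\<in>K. \<forall>y. norm (y - z) \<le> R \<longrightarrow>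
    norm (Phase (0, z) y - (of_real (S y) + \<i> * of_real ((norm (y - z))\<^sup>2 / 2))) \<le> Cp * norm (y - z) ^ (k + 2))"
    using initial_phase[of R] by (elim exE)
  obtain Cf where Cf: "Cf \<ge> 0" "\<And>z y. z \<notin> K \<Longrightarrow> norm (A y) \<le> Cf * norm (y - z) ^ k" using A_flat by blast
  obtain CA where CA0: "CA \<ge> 0" "\<forall>y\<in>K. norm (A y) \<le> CA"
    using compact_norm_bound[OF compact_K smooth_continuous[OF smooth_A]] by blast
  have CA: "norm (A y) \<le> CA" for y
  proof (cases "y \<in> K")
    case False
    then have "A y = 0" using closure_subset[of "{x. A x \<noteq> 0}"] unfolding K_def supp_def by blast
    then show ?thesis using CA0(1) by simp
  qed (use CA0 in auto)
  obtain Cr where Cr: "Cr \<ge> 0" "\<forall>w\<in>supp \<rho>. norm (\<rho> w) \<le> Cr"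
    using compact_norm_bound[OF supp_rho smooth_continuous[OF smooth_rho]] by blast
  obtain G1 where G1: "G1 \<ge> 0" "\<forall>s\<ge>0. \<forall>\<epsilon>>0. s ^ k * exp (- c * s\<^sup>2 / \<epsilon>) \<le> G1 * sqrt \<epsilon> ^ k * exp (- (c/2) * s\<^sup>2 / \<epsilon>)"
    using power_gauss_bound[OF c(1), of k] by blast
  obtain G2 where G2: "G2 \<ge> 0" "\<forall>s\<ge>0. \<forall>\<epsilon>>0. s ^ (k + 2) * exp (- c * s\<^sup>2 / \<epsilon>) \<le> G2 * sqrt \<epsilon> ^ (k + 2) * exp (- (c/2) * s\<^sup>2 / \<epsilon>)"
    using power_gauss_bound[OF c(1), of "k + 2"] by blast
  define Q where "Q = Cr * Ca + Cf + CA * (1 + Cr) / r ^ k"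
  define C where "C = Q * G1 + Cr * CA * Cp * G2"
  have Q: "Q \<ge> 0" using Cr Ca Cf CA0 r by (auto simp: Q_def intro!: add_nonneg_nonneg divide_nonneg_nonneg)
  have C: "C \<ge> 0" using Q Cr CA0 Cp G1 G2 by (auto simp: C_def)
  have "norm (indicator K z *\<^sub>R beam_at \<epsilon> (0, z) y - wkb_data A S \<epsilon> y * of_real (exp (- (1/2) * (norm (z - y))\<^sup>2 / \<epsilon>)))
      \<le> C * sqrt \<epsilon> ^ k * exp (- (c/2) * (norm (z - y))\<^sup>2 / \<epsilon>)"
    if \<epsilon>: "\<epsilon> \<in> {0<..1}" for \<epsilon> z y
  proof -
    define n where "n = norm (y - z)"
    have nn: "norm (z - y) = n" "n \<ge> 0" by (simp_all add: n_def norm_minus_commute)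
    define s where "s = sqrt \<epsilon>"
    have e: "\<epsilon> > 0" "\<epsilon> \<le> 1" using \<epsilon> by auto
    have s: "s > 0" "\<epsilon> = s\<^sup>2" using e by (auto simp: s_def)
    define E where "E = exp (- c * n\<^sup>2 / \<epsilon>)"
    define E' where "E' = exp (- (c/2) * n\<^sup>2 / \<epsilon>)"
    define g where "g = exp (- (1/2) * n\<^sup>2 / \<epsilon>)"
    have gE: "0 \<le> g" "g \<le> E"
    proof -
      have "c * n\<^sup>2 / \<epsilon> \<le> (1/2) * n\<^sup>2 / \<epsilon>" using c(2) e by (intro divide_right_mono mult_right_mono) auto
      then show "0 \<le> g" "g \<le> E" by (simp_all add: g_def E_def)
    qed
    have b1: "n ^ k * E \<le> G1 * s ^ k * E'" using G1(2) nn(2) e(1) unfolding E_def E'_def s_def by blast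
    have b2: "n ^ (k + 2) * E \<le> G2 * s ^ (k + 2) * E'" using G2(2) nn(2) e(1) unfolding E_def E'_def s_def by blast
    have w: "wkb_data A S \<epsilon> y * of_real g = A y * (exp (\<i> * of_real (S y / \<epsilon>)) * of_real g)" by (simp add: wkb_data_def)
    have nw: "norm (exp (\<i> * of_real (S y / \<epsilon>)) * of_real g) = g" using gE(1) by (simp add: norm_mult)
    \<comment> \<open>At distance at least r a constant can be exchanged for the power k of the
      distance.\<close>
    have far: "q \<le> q / r ^ k * n ^ k" if "q \<ge> 0" "r \<le> n" for q
    proof -
      have "q = q / r ^ k * r ^ k" using r by simp
      also have "\<dots> \<le> q / r ^ k * n ^ k" using that r by (intro mult_left_mono power_mono) auto
      finally show ?thesis .
    qed
    have fin1: "q * n ^ k * E \<le> C * s ^ k * E'" if q: "q \<le> Q" for q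
    proof -
      have "q * n ^ k * E \<le> Q * (n ^ k * E)" using q nn by (simp add: mult.assoc E_def mult_right_mono)
      also have "\<dots> \<le> Q * (G1 * s ^ k * E')" by (rule mult_left_mono[OF b1 Q])
      also have "\<dots> = (Q * G1) * (s ^ k * E')" by (simp add: mult_ac)
      also have "\<dots> \<le> C * (s ^ k * E')" unfolding C_def using s Cr CA0 Cp G2
        by (intro mult_right_mono) (auto simp: E'_def)
      finally show ?thesis by (simp add: mult_ac)
    qed
    have "norm (indicator K z *\<^sub>R beam_at \<epsilon> (0, z) y - wkb_data A S \<epsilon> y * of_real g) \<le> C * s ^ k * E'"
    proof (cases "z \<in> K")
      case False
      then have "norm (indicator K z *\<^sub>R beam_at \<epsilon> (0, z) y - wkb_data A S \<epsilon> y * of_real g) = norm (A y) * g"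
        unfolding w by (use gE(1) False in \<open>simp add: norm_mult nw[unfolded norm_mult]\<close>)
      also have "\<dots> \<le> (Cf * n ^ k) * E" using Cf(2)[OF False, of y] gE Cf(1) nn by (intro mult_mono) (auto simp: n_def)
      also have "\<dots> \<le> C * s ^ k * E'" by (rule fin1) (use Cr Ca CA0 r in \<open>auto simp: Q_def\<close>)
      finally show ?thesis .
    next
      case True
      let ?p = "(0, z)"
      have pP: "?p \<in> P" using True K0_P by auto
      let ?E = "osc \<epsilon> ?p y" and ?EE = "exp (\<i> * of_real (S y / \<epsilon>)) * complex_of_real g"
      \<comment> \<open>Telescoping: the amplitude, the exponential factor and the cutoff are
        replaced in turn.\<close>
      have D: "indicator K z *\<^sub>R beam_at \<epsilon> ?p y - wkb_data A S \<epsilon> y * of_real g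
        = cut_at ?p y * (Amp 0 ?p y - A y) * ?E + cut_at ?p y * A y * (?E - ?EE) + (cut_at ?p y - 1) * A y * ?EE"
      proof -
        have bm0: "beam_at \<epsilon> ?p y = cut_at ?p y * Amp 0 ?p y * ?E" by (simp add: beam_at_def Amps_initial[OF True])
        have ind: "indicator K z *\<^sub>R beam_at \<epsilon> ?p y = beam_at \<epsilon> ?p y" using True by simp
        have alg: "r * m * E - a * E0 = r * (m - a) * E + r * a * (E - E0) + (r - 1) * a * E0" for r m a E E0 :: complex
          by (simp add: algebra_simps)
        show ?thesis unfolding w ind unfolding bm0 by (rule alg)
      qed
      show ?thesis
      proof (cases "y - z \<in> supp \<rho>")
        \<comment> \<open>Here the beam vanishes, but y is at least r away from z, so the weight of
          the datum is itself small.\<close>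
        case False
        then have rz: "cut_at ?p y = 0" "\<not> n < r"
        proof -
          show "cut_at ?p y = 0" using False by (simp add: cut_at_def supp_zero)
          show "\<not> n < r"
          proof
            assume "n < r"
            then have "\<rho> (y - z) = 1" using r(2) by (auto simp: n_def)
            then show False using supp_zero[OF False] by simp
          qed
        qed
        have "norm (indicator K z *\<^sub>R beam_at \<epsilon> ?p y - wkb_data A S \<epsilon> y * of_real g) = norm (A y) * g"
          unfolding D rz(1) by (use gE(1) False in \<open>simp add: norm_mult nw[unfolded norm_mult]\<close>)
        also have "\<dots> \<le> CA * E" using CA[of y] gE CA0 by (intro mult_mono) auto
        also have "\<dots> \<le> (CA / r ^ k * n ^ k) * E" using far[OF CA0(1)] rz(2) by (intro mult_right_mono) (auto simp: E_def)
        also have "\<dots> \<le> C * s ^ k * E'"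
        proof (rule fin1)
          have "CA / r ^ k \<le> CA * (1 + Cr) / r ^ k" using Cr CA0 r by (intro divide_right_mono) (auto simp: algebra_simps)
          then show "CA / r ^ k \<le> Q" using Cr Ca Cf by (simp add: Q_def add_increasing)
        qed
        finally show ?thesis .
      next
        case sup: True
        have nR: "norm (y - z) \<le> R" by (rule R[OF sup])
        have im: "c * n\<^sup>2 \<le> Im (Phase ?p y)"
        proof -
          have "c * n\<^sup>2 \<le> c1 * n\<^sup>2" using c(3) by (intro mult_right_mono) auto
          also have "\<dots> \<le> Im (Phase ?p y)" using c1(2)[OF pP, of y] sup by (simp add: n_def)
          finally show ?thesis .
        qed
        have nE: "norm ?E \<le> E" unfolding E_def by (rule norm_Ex_le[OF e(1) im])
        have nr: "norm (cut_at ?p y) \<le> Cr" using Cr(2) sup by (auto simp: cut_at_def)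
        have t1: "norm (cut_at ?p y * (Amp 0 ?p y - A y) * ?E) \<le> (Cr * Ca) * n ^ k * E"
        proof -
          have "norm (Amp 0 ?p y - A y) \<le> Ca * n ^ k" using Ca True nR by (simp add: n_def)
          then have "norm (cut_at ?p y) * norm (Amp 0 ?p y - A y) * norm ?E \<le> Cr * (Ca * n ^ k) * E"
            using nr nE Cr(1) Ca nn(2) by (intro mult_mono) auto
          then show ?thesis by (simp add: norm_mult mult_ac)
        qed
        have t2: "norm (cut_at ?p y * A y * (?E - ?EE)) \<le> Cr * CA * Cp * G2 * (s ^ k * E')"
        proof -
          let ?a = "\<i> / of_real \<epsilon> * Phase ?p y" and ?b = "\<i> / of_real \<epsilon> * (of_real (S y) + \<i> * of_real (n\<^sup>2 / 2))"
          have b: "?b = \<i> * of_real (S y / \<epsilon>) + of_real (- (1/2) * n\<^sup>2 / \<epsilon>)"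
            using e(1) by (simp add: field_simps)
          have E0: "?EE = exp ?b" unfolding b exp_add g_def by (simp only: exp_of_real)
          have Ra: "Re ?a \<le> - c * n\<^sup>2 / \<epsilon>"
          proof -
            have "Re ?a = - Im (Phase ?p y) / \<epsilon>" by (simp add: Re_divide_of_real)
            also have "\<dots> \<le> - (c * n\<^sup>2) / \<epsilon>" using im e(1) by (intro divide_right_mono) auto
            finally show ?thesis by simp
          qed
          have Rb: "Re ?b \<le> - c * n\<^sup>2 / \<epsilon>"
          proof -
            have "Re ?b = - ((1/2) * n\<^sup>2 / \<epsilon>)" unfolding b by simp
            also have "\<dots> \<le> - (c * n\<^sup>2 / \<epsilon>)" using c(2) e(1) by (intro le_imp_neg_le divide_right_mono mult_right_mono) auto
            finally show ?thesis by simp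
          qed
          have ab: "?a - ?b = \<i> / of_real \<epsilon> * (Phase ?p y - (of_real (S y) + \<i> * of_real (n\<^sup>2 / 2)))"
            by (simp only: right_diff_distrib)
          \<comment> \<open>Division by \<epsilon> costs two powers of
            \<open>sqrt \<epsilon>\<close>; contact of order \<open>k + 2\<close> of the phase pays
            for them.\<close>
          have "norm (?a - ?b) \<le> (Cp * n ^ (k + 2)) / \<epsilon>"
          proof -
            have "norm (Phase ?p y - (of_real (S y) + \<i> * of_real (n\<^sup>2 / 2))) \<le> Cp * n ^ (k + 2)"
              using Cp True nR unfolding n_def by blast
            then show ?thesis unfolding ab norm_mult using e(1) by (simp add: norm_divide divide_right_mono)
          qed
          then have "norm (?E - ?EE) \<le> E * ((Cp * n ^ (k + 2)) / \<epsilon>)"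
            unfolding E0 osc_def E_def
            by (intro order.trans[OF exp_diff_bound[OF Ra Rb]] mult_left_mono) auto
          also have "\<dots> = Cp / \<epsilon> * (n ^ (k + 2) * E)" by (simp add: mult_ac)
          also have "\<dots> \<le> Cp / \<epsilon> * (G2 * s ^ (k + 2) * E')" using Cp e(1) by (intro mult_left_mono b2) auto
          also have "\<dots> = Cp * G2 * (s ^ k * E')" using s by (simp add: power_add power2_eq_square)
          finally have "norm (?E - ?EE) \<le> Cp * G2 * (s ^ k * E')" .
          then have "norm (cut_at ?p y) * norm (A y) * norm (?E - ?EE) \<le> Cr * CA * (Cp * G2 * (s ^ k * E'))"
            using nr CA[of y] Cr(1) CA0(1) by (intro mult_mono) auto
          then show ?thesis by (simp add: norm_mult mult_ac)
        qed
        have t3: "norm ((cut_at ?p y - 1) * A y * ?EE) \<le> (CA * (1 + Cr) / r ^ k) * n ^ k * E"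
        proof (cases "n < r")
          case True
          then have "cut_at ?p y = 1" using r(2) by (simp add: cut_at_def n_def)
          then show ?thesis using CA0 Cr r nn by (simp add: E_def)
        next
          case False
          have "norm (cut_at ?p y - 1) \<le> 1 + Cr" using norm_triangle_ineq4[of "cut_at ?p y" 1] nr by simp
          then have "norm (cut_at ?p y - 1) * norm (A y) * norm ?EE \<le> (1 + Cr) * CA * E"
            unfolding nw using CA[of y] gE CA0 Cr(1) by (intro mult_mono) auto
          also have "\<dots> \<le> ((CA * (1 + Cr)) / r ^ k * n ^ k) * E"
            using far[of "CA * (1 + Cr)"] False CA0 Cr(1) by (intro mult_right_mono) (auto simp: E_def mult.commute)
          finally show ?thesis by (simp add: norm_mult)
        qed
        have "norm (indicator K z *\<^sub>R beam_at \<epsilon> ?p y - wkb_data A S \<epsilon> y * of_real g)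
          \<le> (Cr * Ca) * n ^ k * E + Cr * CA * Cp * G2 * (s ^ k * E') + (CA * (1 + Cr) / r ^ k) * n ^ k * E"
          unfolding D by (intro order.trans[OF norm_triangle_ineq] add_mono t1 t2 t3)
        also have "\<dots> \<le> Q * (n ^ k * E) + Cr * CA * Cp * G2 * (s ^ k * E')"
        proof -
          have "0 \<le> Cf * (n ^ k * E)" using Cf(1) nn by (simp add: E_def)
          then show ?thesis by (simp add: Q_def distrib_right mult.assoc)
        qed
        also have "Q * (n ^ k * E) \<le> Q * (G1 * s ^ k * E')" by (rule mult_left_mono[OF b1 Q])
        finally show ?thesis by (simp add: C_def algebra_simps)
      qed
    qed
    then show ?thesis unfolding nn(1) s_def E'_def g_def .
  qed
  then show ?thesis using C c(1) by (intro exI[of _ C] conjI exI[of _ "c/2"]) auto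
qed

section \<open>Superposition\<close>

definition superpose :: "(real \<times> (real^'n) \<Rightarrow> real^'n \<Rightarrow> complex) \<Rightarrow> real \<Rightarrow> real^'n \<Rightarrow> complex" where
  "superpose f t y = (LINT z:K|lborel. f (t, z) y)"

lemma continuous_slice:
  assumes "sfam P f" "t \<in> {0..T}"
  shows "continuous_on K (\<lambda>z. f (t, z) y)"
  by (rule sfam_continuous_comp[OF assms(1)]) (use assms(2) in \<open>auto intro!: continuous_intros simp: P_def\<close>)

lemma integrable_slice:
  fixes f :: "real \<times> (real^'n) \<Rightarrow> real^'n \<Rightarrow> complex"
  assumes "sfam P f" "t \<in> {0..T}"
  shows "set_integrable lborel K (\<lambda>z. f (t, z) y)"
  by (rule integrable_continuous_compact[OF compact_K continuous_slice[OF assms]])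

text \<open>Continuity of a parameter integral was shown for compact parameter sets, so it is used
  over closed balls and then localised around each point.\<close>

lemma superpose_continuous:
  assumes "sfam P f"
  shows "continuous_on ({0..T} \<times> UNIV) (\<lambda>q. superpose f (fst q) (snd q))"
proof -
  have loc: "continuous_on ({0..T} \<times> cball 0 m) (\<lambda>q. superpose f (fst q) (snd q))" for m
    unfolding superpose_def
  proof (rule continuous_on_set_integral[OF compact_K])
    show "compact ({0..T} \<times> cball (0 :: real^'n) m)" by (intro compact_Times compact_Icc compact_cball)
    show "continuous_on (K \<times> ({0..T} \<times> cball 0 m)) (\<lambda>p. f (fst (snd p), fst p) (snd (snd p)))"
      by (rule sfam_continuous_comp[OF assms]) (auto intro!: continuous_intros simp: P_def)
  qed
  show ?thesis
    unfolding continuous_on_eq_continuous_within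
  proof
    fix q assume q: "q \<in> {0..T} \<times> (UNIV :: (real^'n) set)"
    define m where "m = norm (snd q) + 1"
    let ?U = "UNIV \<times> ball 0 m :: (real \<times> (real^'n)) set"
    have "continuous (at q within {0..T} \<times> cball 0 m) (\<lambda>q. superpose f (fst q) (snd q))"
      using loc[of m] unfolding continuous_on_eq_continuous_within
      by (rule bspec) (use q in \<open>simp add: m_def mem_Times_iff\<close>)
    moreover have "at q within {0..T} \<times> cball 0 m = at q within {0..T} \<times> UNIV"
    proof (rule at_within_nhd[of _ ?U])
      show "q \<in> ?U" by (simp add: m_def mem_Times_iff)
      show "open ?U" by (intro open_Times open_ball open_UNIV)
    qed auto
    ultimately show "continuous (at q within {0..T} \<times> UNIV) (\<lambda>q. superpose f (fst q) (snd q))" by simp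
  qed
qed

lemma superpose_partial:
  assumes f: "sfam P f" and t: "t \<in> {0..T}"
  shows "((\<lambda>h. superpose f t (y + h *\<^sub>R axis i 1)) has_vector_derivative superpose (\<lambda>p. partial i (f p)) t y) (at 0)"
proof -
  have "((\<lambda>h. superpose f t (y + h *\<^sub>R axis i 1)) has_vector_derivative superpose (\<lambda>p. partial i (f p)) t (y + 0 *\<^sub>R axis i 1)) (at 0 within {-1..1})"
    unfolding superpose_def
  proof (rule has_vector_derivative_set_integral[OF compact_K])
    show "continuous_on K (\<lambda>z. f (t, z) (y + s *\<^sub>R axis i 1))" for s by (rule continuous_slice[OF f t])
    show "continuous_on (K \<times> {-1..1}) (\<lambda>p. partial i (f (t, fst p)) (y + snd p *\<^sub>R axis i 1))"
      by (rule sfam_continuous_comp[OF sfam_partial[OF f]]) (use t in \<open>auto intro!: continuous_intros simp: P_def\<close>)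
    show "((\<lambda>h. f (t, z) (y + h *\<^sub>R axis i 1)) has_vector_derivative partial i (f (t, z)) (y + s *\<^sub>R axis i 1)) (at s within {-1..1})"
      if "z \<in> K" for z s
      by (rule has_vector_derivative_at_within[OF differentiable_imp_partial[OF sfam_differentiable[OF f P_I[OF t that]]]])
  qed auto
  then show ?thesis by (simp add: at_within_Icc_at)
qed

lemma superpose_time:
  assumes t: "t \<in> {0..T}"
  shows "((\<lambda>s. superpose (beam_at \<epsilon>) s y) has_vector_derivative superpose (beam_t \<epsilon>) t y) (at t within {0..T})"
  unfolding superpose_def
proof (rule has_vector_derivative_set_integral[OF compact_K _ _ _ t])
  show "continuous_on K (\<lambda>z. beam_at \<epsilon> (s, z) y)" if "s \<in> {0..T}" for s by (rule continuous_slice[OF sfam_bm that])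
  show "((\<lambda>s. beam_at \<epsilon> (s, z) y) has_vector_derivative beam_t \<epsilon> (s, z) y) (at s within {0..T})" if "z \<in> K" "s \<in> {0..T}" for z s
    by (rule beam_at_time_deriv[OF that(2,1)])
  show "continuous_on (K \<times> {0..T}) (\<lambda>p. beam_t \<epsilon> (snd p, fst p) y)"
    by (rule sfam_continuous_comp[OF sfam_bt]) (auto intro!: continuous_intros simp: P_def)
qed

lemma superpose_add: "sfam P f \<Longrightarrow> sfam P g \<Longrightarrow> t \<in> {0..T} \<Longrightarrow> superpose (\<lambda>p y. f p y + g p y) t y = superpose f t y + superpose g t y"
  unfolding superpose_def by (rule set_integral_add(2)) (auto intro: integrable_slice)

lemma superpose_sum:
  "finite J \<Longrightarrow> (\<And>j. j \<in> J \<Longrightarrow> sfam P (f j)) \<Longrightarrow> t \<in> {0..T} \<Longrightarrow> superpose (\<lambda>p y. \<Sum>j\<in>J. f j p y) t y = (\<Sum>j\<in>J. superpose (f j) t y)"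
proof (induction J rule: finite_induct)
  case (insert j J)
  have "superpose (\<lambda>p y. f j p y + (\<Sum>j\<in>J. f j p y)) t y = superpose (f j) t y + superpose (\<lambda>p y. \<Sum>j\<in>J. f j p y) t y"
    using insert by (intro superpose_add sfam_sum) auto
  then show ?case using insert by simp
qed (simp add: superpose_def set_lebesgue_integral_def)

lemma superpose_cmult: "superpose (\<lambda>p y. c y * f p y) t y = c y * superpose f t y"
  unfolding superpose_def by simp

lemma superpose_res:
  assumes t: "t \<in> {0..T}"
  shows "superpose (residual \<epsilon>) t y = - \<i> * of_real \<epsilon> * superpose (beam_t \<epsilon>) t y
    - of_real (\<epsilon>\<^sup>2 / 2) * (\<Sum>i\<in>UNIV. superpose (\<lambda>p. partial i (partial i (beam_at \<epsilon> p))) t y) + of_real (V y) * superpose (beam_at \<epsilon>) t y"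
proof -
  have s: "sfam P (\<lambda>p. partial i (partial i (beam_at \<epsilon> p)))" for i by (intro sfam_partial sfam_bm)
  have sl: "sfam P (\<lambda>p y. \<Sum>i\<in>UNIV. partial i (partial i (beam_at \<epsilon> p)) y)" by (intro sfam_sum s)
  have s1: "sfam P (\<lambda>p y. (- \<i> * of_real \<epsilon>) * beam_t \<epsilon> p y)" by (intro sfam_mult sfam_const continuous_on_const sfam_bt)
  have s2: "sfam P (\<lambda>p y. (- of_real (\<epsilon>\<^sup>2 / 2)) * (\<Sum>i\<in>UNIV. partial i (partial i (beam_at \<epsilon> p)) y))"
    by (intro sfam_mult sfam_const continuous_on_const sl)
  have s3: "sfam P (\<lambda>p y. of_real (V y) * beam_at \<epsilon> p y)" by (intro sfam_mult sfam_of_real sfam_smooth V sfam_bm)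
  have "residual \<epsilon> = (\<lambda>p y. ((- \<i> * of_real \<epsilon>) * beam_t \<epsilon> p y + (- of_real (\<epsilon>\<^sup>2 / 2)) * (\<Sum>i\<in>UNIV. partial i (partial i (beam_at \<epsilon> p)) y))
     + of_real (V y) * beam_at \<epsilon> p y)"
    by (intro ext) (simp add: residual_def laplacian_def)
  then show ?thesis
    by (simp only: superpose_add[OF sfam_add[OF s1 s2] s3 t] superpose_add[OF s1 s2 t] superpose_cmult[where c="\<lambda>_. - \<i> * of_real \<epsilon>"]
        superpose_cmult[where c="\<lambda>_. - of_real (\<epsilon>\<^sup>2 / 2)"] superpose_cmult[where c="\<lambda>y. of_real (V y)"] superpose_sum[OF finite_class.finite_UNIV s t])
      simp
qed

lemma superposition_eq:
  assumes "t \<in> {0..T}"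
  shows "beam_superposition (beam_normalization TYPE('n) \<epsilon>) k X A S \<rho> \<phi> a \<epsilon> t y = of_real (beam_normalization TYPE('n) \<epsilon>) * superpose (beam_at \<epsilon>) t y"
  unfolding beam_superposition_def level_set_integral_def phase_space_beam_def superpose_def K_def[symmetric]
    inv_f_f[OF flow_inj[OF V flow assms]] ini_def[symmetric] gaussian_beam_eq ..

text \<open>The normalized Gaussian weights integrate to 1, so the datum can itself be written as an
  integral over z and subtracted under the integral sign. The integral of the remaining Gaussian
  bound scales like the inverse of the normalization, so no power of \<epsilon> is lost.\<close>

lemma initial_error:
  "\<exists>C. C \<ge> 0 \<and> (\<forall>\<epsilon>\<in>{0<..1}. \<forall>y. norm (of_real (beam_normalization TYPE('n) \<epsilon>) * superpose (beam_at \<epsilon>) 0 y - wkb_data A S \<epsilon> y) \<le> C * sqrt \<epsilon> ^ k)"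
proof -
  obtain C where C: "C \<ge> 0 \<and> (\<exists>c>0. \<forall>\<epsilon>\<in>{0<..1}. \<forall>z y. norm (indicator K z *\<^sub>R beam_at \<epsilon> (0, z) y
     - wkb_data A S \<epsilon> y * of_real (exp (- (1/2) * (norm (z - y))\<^sup>2 / \<epsilon>))) \<le> C * sqrt \<epsilon> ^ k * exp (- c * (norm (z - y))\<^sup>2 / \<epsilon>))"
    using initial_bound by (elim exE)
  from conjunct2[OF C] obtain c where c: "c > 0 \<and> (\<forall>\<epsilon>\<in>{0<..1}. \<forall>z y. norm (indicator K z *\<^sub>R beam_at \<epsilon> (0, z) y
     - wkb_data A S \<epsilon> y * of_real (exp (- (1/2) * (norm (z - y))\<^sup>2 / \<epsilon>))) \<le> C * sqrt \<epsilon> ^ k * exp (- c * (norm (z - y))\<^sup>2 / \<epsilon>))"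
    by (elim exE)
  define G0 where "G0 = gauss_int TYPE(real^'n) (1/2)"
  have G0_pos: "G0 > 0" unfolding G0_def by (rule gauss_int_pos) simp
  define Gc where "Gc = gauss_int TYPE(real^'n) c"
  have Gc: "Gc > 0" unfolding Gc_def by (rule gauss_int_pos) (use c in simp)
  have "norm (of_real (beam_normalization TYPE('n) \<epsilon>) * superpose (beam_at \<epsilon>) 0 y - wkb_data A S \<epsilon> y) \<le> (C * Gc / G0) * sqrt \<epsilon> ^ k" if \<epsilon>: "\<epsilon> \<in> {0<..1}" for \<epsilon> y
  proof -
    have e: "\<epsilon> > 0" using \<epsilon> by simp
    define h where "h z = indicator K z *\<^sub>R beam_at \<epsilon> (0, z) y" for z
    define g where "g z = exp (- (1/2) * (norm (z - y))\<^sup>2 / \<epsilon>)" for z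
    define n where "n = sqrt \<epsilon> ^ CARD('n)"
    have n: "n > 0" using e by (simp add: n_def)
    have hb: "has_bochner_integral lborel g (n * G0)"
      using has_bochner_integral_gauss_scaled[of "1/2" \<epsilon> y] e by (simp add: g_def[abs_def] n_def G0_def)
    have hbc: "has_bochner_integral lborel (\<lambda>z. exp (- c * (norm (z - y))\<^sup>2 / \<epsilon>)) (n * Gc)"
      using has_bochner_integral_gauss_scaled[of c \<epsilon> y] e c by (simp add: Gc_def n_def)
    have ih: "integrable lborel h"
      using integrable_slice[OF sfam_bm, of 0 \<epsilon> y] T by (simp add: h_def[abs_def] set_integrable_def)
    have ig: "integrable lborel (\<lambda>z. complex_of_real (g z))" using hb by (simp add: has_bochner_integral_iff)
    have Zg: "of_real (beam_normalization TYPE('n) \<epsilon>) * (LINT z|lborel. complex_of_real (g z)) = 1"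
    proof -
      have "(LINT z|lborel. complex_of_real (g z)) = of_real (n * G0)" using hb by (simp add: has_bochner_integral_iff)
      moreover have "beam_normalization TYPE('n) \<epsilon> * (n * G0) = 1" using n G0_pos e by (simp add: beam_normalization_def n_def G0_def e less_imp_neq[OF e, symmetric])
      ultimately show ?thesis by (simp only: of_real_mult[symmetric] of_real_1)
    qed
    have "of_real (beam_normalization TYPE('n) \<epsilon>) * superpose (beam_at \<epsilon>) 0 y - wkb_data A S \<epsilon> y
      = of_real (beam_normalization TYPE('n) \<epsilon>) * (LINT z|lborel. h z) - wkb_data A S \<epsilon> y * (of_real (beam_normalization TYPE('n) \<epsilon>) * (LINT z|lborel. complex_of_real (g z)))"
      unfolding Zg by (simp add: superpose_def h_def set_lebesgue_integral_def)
    also have "\<dots> = of_real (beam_normalization TYPE('n) \<epsilon>) * (LINT z|lborel. h z - wkb_data A S \<epsilon> y * of_real (g z))"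
    proof -
      have "(LINT z|lborel. h z - wkb_data A S \<epsilon> y * of_real (g z)) = (LINT z|lborel. h z) - wkb_data A S \<epsilon> y * (LINT z|lborel. complex_of_real (g z))"
        using ih ig by simp
      then show ?thesis by (simp add: right_diff_distrib mult_ac)
    qed
    finally have "norm (of_real (beam_normalization TYPE('n) \<epsilon>) * superpose (beam_at \<epsilon>) 0 y - wkb_data A S \<epsilon> y) = beam_normalization TYPE('n) \<epsilon> * norm (LINT z|lborel. h z - wkb_data A S \<epsilon> y * of_real (g z))"
      using beam_normalization_pos[OF e, where 'n='n] by (simp add: norm_mult)
    also have "norm (LINT z|lborel. h z - wkb_data A S \<epsilon> y * of_real (g z)) \<le> (LINT z|lborel. (C * sqrt \<epsilon> ^ k) * exp (- c * (norm (z - y))\<^sup>2 / \<epsilon>))"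
    proof (rule order.trans[OF integral_norm_bound], rule Bochner_Integration.integral_mono)
      show "integrable lborel (\<lambda>z. norm (h z - wkb_data A S \<epsilon> y * of_real (g z)))"
        using ih ig by (intro integrable_norm Bochner_Integration.integrable_diff integrable_mult_right) auto
      show "integrable lborel (\<lambda>z. (C * sqrt \<epsilon> ^ k) * exp (- c * (norm (z - y))\<^sup>2 / \<epsilon>))"
        using hbc by (intro integrable_mult_right) (simp add: has_bochner_integral_iff)
      show "norm (h z - wkb_data A S \<epsilon> y * of_real (g z)) \<le> (C * sqrt \<epsilon> ^ k) * exp (- c * (norm (z - y))\<^sup>2 / \<epsilon>)" for z
        unfolding h_def g_def using c \<epsilon> by blast
    qed
    also have "\<dots> = (C * sqrt \<epsilon> ^ k) * (n * Gc)" using hbc by (simp add: has_bochner_integral_iff)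
    also have "beam_normalization TYPE('n) \<epsilon> * ((C * sqrt \<epsilon> ^ k) * (n * Gc)) = (C * Gc / G0) * sqrt \<epsilon> ^ k"
      using n by (simp add: beam_normalization_def n_def G0_def e less_imp_neq[OF e, symmetric])
    finally show ?thesis using beam_normalization_pos[OF e, where 'n='n] by (simp add: mult_left_mono)
  qed
  then show ?thesis using C Gc G0_pos by (intro exI[of _ "C * Gc / G0"]) auto
qed

end

section \<open>From residual and initial error to the L2 bound\<close>

lemma integrable_sq_bounded_support:
  fixes d :: "real^'n::finite \<Rightarrow> complex"
  assumes "\<And>y. norm (d y) \<le> C" "\<And>y. norm y > r \<Longrightarrow> d y = 0" "C \<ge> 0"
  shows "L2_norm d \<le> C * sqrt (measure lborel (cball (0 :: real^'n) r))"
proof -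
  let ?B = "cball (0 :: real^'n) r"
  have "(LINT y|lborel. (norm (d y))\<^sup>2) \<le> (LINT y|lborel. indicator ?B y *\<^sub>R C\<^sup>2)"
  proof (rule integral_mono')
    show "integrable lborel (\<lambda>y. indicator ?B y *\<^sub>R C\<^sup>2)"
      using integrable_continuous_compact[OF compact_cball continuous_on_const] unfolding set_integrable_def .
    show "(norm (d y))\<^sup>2 \<le> indicator ?B y *\<^sub>R C\<^sup>2" for y
      using assms(1)[of y] assms(2)[of y] by (cases "y \<in> ?B") (auto intro: power_mono)
    show "0 \<le> indicator ?B y *\<^sub>R C\<^sup>2" for y by simp
  qed
  also have "\<dots> = C\<^sup>2 * measure lborel ?B"
    using emeasure_lborel_compact_finite[OF compact_cball, of "0 :: real^'n" r] by simp
  finally show ?thesis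
    unfolding L2_norm_def using assms(3)
    by (metis real_sqrt_le_mono real_sqrt_mult real_sqrt_abs abs_of_nonneg)
qed

text \<open>The balance of the residual term: k half powers from the beams, the root of a Gaussian
  integral from their L2 norm, and a whole Gaussian integral in the denominator from the
  normalization.\<close>

lemma sqrt_powr_quotient:
  assumes "\<epsilon> > 0"
  shows "sqrt \<epsilon> ^ k * sqrt (sqrt \<epsilon> ^ n) / sqrt \<epsilon> ^ n = \<epsilon> powr (real k / 2 - real n / 4)"
proof -
  have p: "sqrt \<epsilon> ^ j = \<epsilon> powr (real j / 2)" for j
  proof -
    have "sqrt \<epsilon> ^ j = (\<epsilon> powr (1/2)) powr real j" using assms by (simp add: powr_half_sqrt powr_realpow)
    then show ?thesis by (simp add: powr_powr)
  qed
  have "sqrt (\<epsilon> powr (real n / 2)) = \<epsilon> powr (real n / 4)"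
    using powr_half_sqrt[of "\<epsilon> powr (real n / 2)"] by (simp add: powr_powr)
  then have "sqrt \<epsilon> ^ k * sqrt (sqrt \<epsilon> ^ n) / sqrt \<epsilon> ^ n = \<epsilon> powr (real k / 2) * \<epsilon> powr (real n / 4) / \<epsilon> powr (real n / 2)"
    unfolding p by simp
  also have "\<dots> = \<epsilon> powr (real k / 2 + real n / 4 - real n / 2)" by (simp only: powr_add powr_diff)
  also have "real k / 2 + real n / 4 - real n / 2 = real k / 2 - real n / 4" by simp
  finally show ?thesis .
qed

context gaussian_beams
begin

text \<open>The initial error enters through its pointwise bound on a fixed ball, the residual
  through its L2 norm, divided by \<epsilon> and accumulated over time by
  \<open>energy_estimate\<close>. The measure of the support stays inside the constant here.\<close>

theorem superposition_error:
  assumes sol: "\<And>\<epsilon>. \<epsilon> > 0 \<Longrightarrow> schrodinger_solution V (wkb_data A S \<epsilon>) \<epsilon> T (\<psi> \<epsilon>)"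
  shows "\<exists>C\<ge>0. \<forall>\<epsilon>\<in>{0<..<1}. \<forall>t\<in>{0..T}.
    square_integrable (\<lambda>y. beam_superposition (beam_normalization TYPE('n) \<epsilon>) k X A S \<rho> \<phi> a \<epsilon> t y - \<psi> \<epsilon> t y) \<and>
    L2_norm (\<lambda>y. beam_superposition (beam_normalization TYPE('n) \<epsilon>) k X A S \<rho> \<phi> a \<epsilon> t y - \<psi> \<epsilon> t y)
      \<le> C * \<epsilon> powr (real k / 2 - real CARD('n) / 4)"
proof -
  have "\<exists>C. C \<ge> 0 \<and> (\<exists>c>0. \<forall>\<epsilon>\<in>{0<..1}. \<forall>p\<in>P. \<forall>y. norm (residual \<epsilon> p y) \<le> C * sqrt \<epsilon> ^ (k + 2) * exp (- c * (norm (y - xc p))\<^sup>2 / \<epsilon>))"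
    by (rule residual_bound)
  then obtain C1 where C1: "C1 \<ge> 0 \<and> (\<exists>c>0. \<forall>\<epsilon>\<in>{0<..1}. \<forall>p\<in>P. \<forall>y. norm (residual \<epsilon> p y) \<le> C1 * sqrt \<epsilon> ^ (k + 2) * exp (- c * (norm (y - xc p))\<^sup>2 / \<epsilon>))"
    by (elim exE)
  from conjunct2[OF C1] obtain c where c: "c > 0 \<and> (\<forall>\<epsilon>\<in>{0<..1}. \<forall>p\<in>P. \<forall>y. norm (residual \<epsilon> p y) \<le> C1 * sqrt \<epsilon> ^ (k + 2) * exp (- c * (norm (y - xc p))\<^sup>2 / \<epsilon>))"
    by (elim exE)
  obtain C0 where C0: "C0 \<ge> 0 \<and> (\<forall>\<epsilon>\<in>{0<..1}. \<forall>y. norm (of_real (beam_normalization TYPE('n) \<epsilon>) * superpose (beam_at \<epsilon>) 0 y - wkb_data A S \<epsilon> y) \<le> C0 * sqrt \<epsilon> ^ k)"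
    using initial_error by (elim exE)
  obtain R1 where R1: "R1 \<ge> 0" "\<forall>p\<in>P. norm (xc p) \<le> R1" using compact_norm_bound[OF compact_P continuous_xc] by blast
  obtain R2 where R2: "R2 \<ge> 0" "\<forall>w\<in>supp \<rho>. norm w \<le> R2" using compact_norm_bound[OF supp_rho continuous_on_id] by blast
  \<comment> \<open>The centres stay in a ball of radius R1 and the cutoff reaches R2 further, so
    this ball contains the supports of all beams at all times, and K as well.\<close>
  define r where "r = R1 + R2"
  have r: "r \<ge> 0" using R1 R2 by (simp add: r_def)
  have out: "y - xc p \<notin> supp \<rho>" if "p \<in> P" "norm y > r" for p y
  proof
    assume "y - xc p \<in> supp \<rho>"
    then have "norm (y - xc p) \<le> R2" using R2 by blast
    moreover have "norm (xc p) \<le> R1" using R1 that(1) by blast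
    ultimately show False using that(2) norm_triangle_sub[of y "xc p"] by (simp add: r_def)
  qed
  have Iout: "superpose (beam_at \<epsilon>) t y = 0" if "t \<in> {0..T}" "norm y > r" for \<epsilon> t y
  proof -
    have "indicat_real K z *\<^sub>R beam_at \<epsilon> (t, z) y = 0" for z
      using beam_at_outside(1)[OF out[OF P_I[OF that(1)] that(2)]] by (cases "z \<in> K") auto
    then show ?thesis unfolding superpose_def set_lebesgue_integral_def by (simp only: integral_zero)
  qed
  have wout: "wkb_data A S \<epsilon> y = 0" if "norm y > r" for \<epsilon> y
  proof -
    have "y \<notin> K"
    proof
      assume "y \<in> K"
      then have "norm (xc (0, y)) \<le> R1" using R1(2) T by (auto simp: P_def simp del: xc_0)
      then show False using that R2(1) by (simp add: r_def)
    qed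
    then have "A y = 0" using closure_subset[of "{x. A x \<noteq> 0}"] unfolding K_def supp_def by blast
    then show ?thesis by (simp add: wkb_data_def)
  qed
  define n where "n = CARD('n)"
  define m where "m = measure lborel K"
  define Gc where "Gc = gauss_int TYPE(real^'n) (2 * c)"
  define G0 where "G0 = gauss_int TYPE(real^'n) (1/2)"
  define B where "B = sqrt (measure lborel (cball (0 :: real^'n) r))"
  have m: "m \<ge> 0" by (simp add: m_def)
  have Gc: "Gc > 0" unfolding Gc_def by (rule gauss_int_pos) (use c in simp)
  have G0: "G0 > 0" unfolding G0_def by (rule gauss_int_pos) simp
  \<comment> \<open>The summands 1 make q below strictly positive, as \<open>energy_estimate\<close>
    demands, even if the residual constant or the measure of K is zero.\<close>
  define Cq where "Cq = (C1 + 1) * (m + 1) * sqrt Gc / G0"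
  have Cq: "Cq > 0" using C1 m Gc G0 by (simp add: Cq_def)
  define C where "C = C0 * B + Cq * T"
  have C: "C \<ge> 0" using C0 Cq T by (simp add: C_def B_def)
  have main: "square_integrable (\<lambda>y. beam_superposition (beam_normalization TYPE('n) \<epsilon>) k X A S \<rho> \<phi> a \<epsilon> t y - \<psi> \<epsilon> t y) \<and>
    L2_norm (\<lambda>y. beam_superposition (beam_normalization TYPE('n) \<epsilon>) k X A S \<rho> \<phi> a \<epsilon> t y - \<psi> \<epsilon> t y)
      \<le> C * \<epsilon> powr (real k / 2 - real CARD('n) / 4)" if \<epsilon>: "\<epsilon> \<in> {0<..<1}" and t: "t \<in> {0..T}" for \<epsilon> t
  proof -
    have e: "\<epsilon> > 0" "\<epsilon> \<le> 1" "\<epsilon> \<in> {0<..1}" using \<epsilon> by auto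
    define s where "s = sqrt \<epsilon>"
    have s: "s > 0" "s * s = \<epsilon>" using e by (auto simp: s_def)
    define Z where "Z = beam_normalization TYPE('n) \<epsilon>"
    have Z: "Z > 0" "Z = 1 / (G0 * s ^ n)" using beam_normalization_pos[OF e(1), where 'n='n] by (simp_all add: Z_def beam_normalization_def G0_def s_def n_def)
    define u where "u t y = of_real Z * superpose (beam_at \<epsilon>) t y" for t y
    define q where "q = Z * ((C1 + 1) * s ^ (k + 2)) * ((m + 1) * sqrt (s ^ n * Gc))"
    have q: "q > 0" unfolding q_def using Z C1 m Gc s by (intro mult_pos_pos) auto
    have s2: "sfam P (\<lambda>p. partial i (beam_at \<epsilon> p))" "sfam P (\<lambda>p. partial i (partial i (beam_at \<epsilon> p)))" for i
      by (intro sfam_partial sfam_bm)+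
    note est = energy_estimate[OF T e(1) r sol[OF e(1)], where u=u and ut="\<lambda>t y. of_real Z * superpose (beam_t \<epsilon>) t y"
        and ui="\<lambda>i t y. of_real Z * superpose (\<lambda>p. partial i (beam_at \<epsilon> p)) t y"
        and uii="\<lambda>i t y. of_real Z * superpose (\<lambda>p. partial i (partial i (beam_at \<epsilon> p))) t y"
        and R="\<lambda>t y. of_real Z * superpose (residual \<epsilon>) t y" and q=q]
    have h1: "u t y = 0" if "t \<in> {0..T}" "norm y > r" for t y using Iout[OF that] by (simp add: u_def)
    have h2: "((\<lambda>s. u s y) has_vector_derivative of_real Z * superpose (beam_t \<epsilon>) t y) (at t within {0..T})" if "t \<in> {0..T}" for t y
      unfolding u_def by (intro has_vector_derivative_mult_right superpose_time that)
    have h3: "((\<lambda>h. u t (y + h *\<^sub>R axis i 1)) has_vector_derivative of_real Z * superpose (\<lambda>p. partial i (beam_at \<epsilon> p)) t y) (at 0)" if "t \<in> {0..T}" for t y i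
      unfolding u_def by (intro has_vector_derivative_mult_right superpose_partial sfam_bm that)
    have h4: "((\<lambda>h. of_real Z * superpose (\<lambda>p. partial i (beam_at \<epsilon> p)) t (y + h *\<^sub>R axis i 1)) has_vector_derivative of_real Z * superpose (\<lambda>p. partial i (partial i (beam_at \<epsilon> p))) t y) (at 0)"
      if "t \<in> {0..T}" for t y i
      by (intro has_vector_derivative_mult_right superpose_partial s2 that)
    have cI: "continuous_on ({0..T} \<times> UNIV) (\<lambda>p. of_real Z * superpose f (fst p) (snd p))" if "sfam P f" for f
      by (intro continuous_intros superpose_continuous that)
    have h5: "- \<i> * of_real \<epsilon> * (of_real Z * superpose (beam_t \<epsilon>) t y) - of_real (\<epsilon>\<^sup>2 / 2) * (\<Sum>i\<in>UNIV. of_real Z * superpose (\<lambda>p. partial i (partial i (beam_at \<epsilon> p))) t y)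
      + of_real (V y) * u t y = of_real Z * superpose (residual \<epsilon>) t y" if "t \<in> {0..T}" for t y
      unfolding superpose_res[OF that] u_def sum_distrib_left[symmetric] by (simp add: algebra_simps)
    \<comment> \<open>The residual bound reduces this to a superposition of Gaussians centred at
      \<open>xc (t, z)\<close>; q is its L2 bound times the normalization, enlarged to be
      positive.\<close>
    have h6: "(LINT y:cball 0 (r + 1)|lborel. (norm (of_real Z * superpose (residual \<epsilon>) t y))\<^sup>2) \<le> q\<^sup>2" if t: "t \<in> {0..T}" for t
    proof -
      define g where "g y z = exp (- c * (norm (y - xc (t, z)))\<^sup>2 / \<epsilon>)" for y z
      let ?B = "cball (0 :: real^'n) (r + 1)"
      define D where "D = Z * (C1 * s ^ (k + 2))"
      have xct: "continuous_on K (\<lambda>z. xc (t, z))"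
        by (rule continuous_on_compose2[OF continuous_xc]) (use t in \<open>auto intro!: continuous_intros simp: P_def\<close>)
      have cg: "continuous_on K (\<lambda>z. g y z)" for y unfolding g_def using e(1) by (intro continuous_intros xct) auto
      have pt: "norm (of_real Z * superpose (residual \<epsilon>) t y) \<le> D * (LINT z:K|lborel. g y z)" for y
      proof -
        have "norm (superpose (residual \<epsilon>) t y) \<le> (LINT z:K|lborel. norm (residual \<epsilon> (t, z) y))"
          unfolding superpose_def by (rule set_integral_norm_bound[OF integrable_slice[OF sfam_res t]])
        also have "\<dots> \<le> (LINT z:K|lborel. (C1 * s ^ (k + 2)) * g y z)"
        proof (rule set_integral_mono)
          show "set_integrable lborel K (\<lambda>z. norm (residual \<epsilon> (t, z) y))"
            by (intro integrable_continuous_compact compact_K continuous_on_norm continuous_slice sfam_res t)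
          show "set_integrable lborel K (\<lambda>z. (C1 * s ^ (k + 2)) * g y z)"
            by (intro integrable_continuous_compact compact_K continuous_intros cg)
          show "norm (residual \<epsilon> (t, z) y) \<le> (C1 * s ^ (k + 2)) * g y z" if "z \<in> K" for z
            using c e(3) P_I[OF t that] unfolding g_def s_def by blast
        qed
        also have "\<dots> = (C1 * s ^ (k + 2)) * (LINT z:K|lborel. g y z)" by simp
        finally have "Z * norm (superpose (residual \<epsilon>) t y) \<le> Z * ((C1 * s ^ (k + 2)) * (LINT z:K|lborel. g y z))"
          using Z(1) by (intro mult_left_mono) auto
        then show ?thesis using Z(1) by (simp add: norm_mult D_def mult.assoc)
      qed
      have cgy: "continuous_on ?B (\<lambda>y. LINT z:K|lborel. g y z)"
      proof (rule continuous_on_set_integral[OF compact_K compact_cball])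
        show "continuous_on (K \<times> ?B) (\<lambda>p. g (snd p) (fst p))"
          unfolding g_def using e(1) by (intro continuous_intros continuous_on_compose2[OF xct]) auto
      qed
      have cR: "continuous_on ?B (\<lambda>y. superpose (residual \<epsilon>) t y)"
      proof -
        have "continuous_on ?B (\<lambda>y. (t, y))" by (intro continuous_intros)
        moreover have "(\<lambda>y. (t, y)) ` ?B \<subseteq> {0..T} \<times> UNIV" using t by auto
        ultimately show ?thesis
          using continuous_on_compose2[OF superpose_continuous[OF sfam_res], of ?B "\<lambda>y. (t, y)" \<epsilon>] by simp
      qed
      have "(LINT y:?B|lborel. (norm (of_real Z * superpose (residual \<epsilon>) t y))\<^sup>2) \<le> (LINT y:?B|lborel. D\<^sup>2 * (LINT z:K|lborel. g y z)\<^sup>2)"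
      proof (rule set_integral_mono)
        show "set_integrable lborel ?B (\<lambda>y. (norm (of_real Z * superpose (residual \<epsilon>) t y))\<^sup>2)"
          by (intro integrable_continuous_compact compact_cball continuous_intros cR)
        show "set_integrable lborel ?B (\<lambda>y. D\<^sup>2 * (LINT z:K|lborel. g y z)\<^sup>2)"
          by (intro integrable_continuous_compact compact_cball continuous_intros cgy)
        show "(norm (of_real Z * superpose (residual \<epsilon>) t y))\<^sup>2 \<le> D\<^sup>2 * (LINT z:K|lborel. g y z)\<^sup>2" for y
          using power_mono[OF pt norm_ge_zero, of y 2] by (simp only: power_mult_distrib)
      qed
      also have "\<dots> = D\<^sup>2 * (LINT y:?B|lborel. (LINT z:K|lborel. g y z)\<^sup>2)" by simp
      also have "\<dots> \<le> D\<^sup>2 * (m\<^sup>2 * (s ^ n * Gc))"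
      proof (rule mult_left_mono)
        show "(LINT y:?B|lborel. (LINT z:K|lborel. g y z)\<^sup>2) \<le> m\<^sup>2 * (s ^ n * Gc)"
          using gauss_superposition[OF compact_K xct _ e(1) compact_cball, of c 0 "r + 1"] c
          by (simp add: g_def m_def s_def n_def Gc_def)
      qed simp
      also have "\<dots> = (D * (m * sqrt (s ^ n * Gc)))\<^sup>2"
        using s Gc by (simp add: power_mult_distrib)
      also have "\<dots> \<le> q\<^sup>2"
      proof (rule power_mono)
        show "D * (m * sqrt (s ^ n * Gc)) \<le> q"
          unfolding D_def q_def using Z C1 m Gc s by (intro mult_mono) auto
        show "0 \<le> D * (m * sqrt (s ^ n * Gc))" unfolding D_def using Z C1 m Gc s by simp
      qed
      finally show ?thesis .
    qed
    have cu: "continuous_on ({0..T} \<times> UNIV) (\<lambda>p. u (fst p) (snd p))" unfolding u_def by (rule cI[OF sfam_bm])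
    note E = est[OF h1 h2 h3 h4 cu cI[OF sfam_bt] cI[OF s2(1)] cI[OF s2(2)] h5 cI[OF sfam_res] q h6 t]
    have eq: "(\<lambda>y. beam_superposition (beam_normalization TYPE('n) \<epsilon>) k X A S \<rho> \<phi> a \<epsilon> t y - \<psi> \<epsilon> t y) = (\<lambda>y. u t y - \<psi> \<epsilon> t y)"
      by (rule ext) (simp add: superposition_eq[OF t] u_def Z_def)
    have init: "L2_norm (\<lambda>y. u 0 y - \<psi> \<epsilon> 0 y) \<le> (C0 * s ^ k) * B"
    proof -
      have p0: "\<psi> \<epsilon> 0 y = wkb_data A S \<epsilon> y" for y using sol[OF e(1)] unfolding schrodinger_solution_def by blast
      show ?thesis unfolding B_def p0
      proof (rule integrable_sq_bounded_support)
        show "norm (u 0 y - wkb_data A S \<epsilon> y) \<le> C0 * s ^ k" for y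
          using C0 e(3) unfolding u_def Z_def s_def by blast
        show "u 0 y - wkb_data A S \<epsilon> y = 0" if "norm y > r" for y
          using h1[OF _ that, of 0] wout[OF that] T by simp
        show "0 \<le> C0 * s ^ k" using C0 s by simp
      qed
    qed
    let ?P = "\<epsilon> powr (real k / 2 - real CARD('n) / 4)"
    have quot: "s ^ k * sqrt (s ^ n) / s ^ n = ?P" unfolding s_def n_def by (rule sqrt_powr_quotient[OF e(1)])
    \<comment> \<open>The initial error has the better exponent k/2; since \<epsilon> is at most 1,
      it may be weakened to the common one.\<close>
    have "s ^ k \<le> ?P"
    proof -
      have "s ^ k = \<epsilon> powr (real k / 2 - real 0 / 4)" using sqrt_powr_quotient[OF e(1), of k 0] by (simp add: s_def)
      also have "\<dots> \<le> ?P" using e by (intro powr_mono') auto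
      finally show ?thesis .
    qed
    then have "(C0 * B) * s ^ k \<le> (C0 * B) * ?P"
      by (rule mult_left_mono) (use C0 in \<open>simp add: B_def\<close>)
    then have "(C0 * s ^ k) * B \<le> C0 * B * ?P" by (simp add: mult_ac)
    moreover have "q / \<epsilon> * t \<le> Cq * T * ?P"
    proof -
      have "q / \<epsilon> = Cq * (s ^ k * sqrt (s ^ n) / s ^ n)"
        unfolding q_def Cq_def Z(2) s(2)[symmetric] using s(1) by (simp add: real_sqrt_mult power_add)
      then have "q / \<epsilon> = Cq * ?P" unfolding quot .
      moreover have "Cq * ?P * t \<le> Cq * ?P * T" using Cq t by (intro mult_left_mono) auto
      ultimately show ?thesis by (simp add: mult_ac)
    qed
    ultimately have "L2_norm (\<lambda>y. u t y - \<psi> \<epsilon> t y) \<le> C * ?P"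
      using E(2) init by (simp add: C_def distrib_right)
    then show ?thesis unfolding eq using E(1) by blast
  qed
  show ?thesis using C main by blast
qed

end

text \<open>By continuity a ball around y lies in the support. Positivity of the measure allows the
  final bound to carry it as an explicit factor.\<close>

lemma measure_supp_pos:
  fixes A :: "real^'n::finite \<Rightarrow> complex"
  assumes A: "continuous_on UNIV A" and K: "compact (supp A)" and y: "A y \<noteq> 0"
  shows "measure lborel (supp A) > 0"
proof -
  have "open {x. A x \<noteq> 0}"
    using open_Collect_neq[OF A continuous_on_const[of UNIV 0]] .
  then obtain d where d: "d > 0" "ball y d \<subseteq> {x. A x \<noteq> 0}" using y open_contains_ball by blast
  then have sub: "ball y d \<subseteq> supp A" unfolding supp_def using closure_subset by blast
  have "0 < measure lborel (ball y d)" using d(1) by (rule content_ball_pos)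
  also have "\<dots> \<le> measure lborel (supp A)"
    unfolding measure_def using emeasure_lborel_compact_finite[OF K] borel_closed[OF compact_imp_closed[OF K]]
    by (intro enn2real_mono emeasure_mono sub) (auto simp: less_top)
  finally show ?thesis .
qed

theorem theorem6p2:
  fixes V S \<rho> :: "real^'n::finite \<Rightarrow> real"
    and A :: "real^'n \<Rightarrow> complex"
    and T :: real
    and k :: nat
    and X :: "real \<Rightarrow> 'n phase \<Rightarrow> 'n phase"
    and \<phi> :: "('n \<Rightarrow> nat) \<Rightarrow> real \<Rightarrow> 'n phase \<Rightarrow> complex"
    and a :: "nat \<Rightarrow> ('n \<Rightarrow> nat) \<Rightarrow> real \<Rightarrow> 'n phase \<Rightarrow> complex"
    and \<psi> :: "real \<Rightarrow> real \<Rightarrow> real^'n \<Rightarrow> complex"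
  assumes "T > 0" and "k \<ge> 1"
    and "smooth V" and "smooth S" and "test_function A"
    and "hamiltonian_flow V T X"
    and "\<And>X0. X0 \<in> Omega0 A S \<Longrightarrow> phase_system V S T k X \<phi> X0"
    and "\<And>X0. X0 \<in> Omega0 A S \<Longrightarrow> amplitude_system A T k X \<phi> a X0"
    and "cutoff A S T k X \<phi> \<rho>"
    and "\<And>\<epsilon>. \<epsilon> > 0 \<Longrightarrow> schrodinger_solution V (wkb_data A S \<epsilon>) \<epsilon> T (\<psi> \<epsilon>)"
  shows "\<exists>\<epsilon>0>0. \<exists>Z :: real \<Rightarrow> real. \<exists>c1>0. \<exists>c2>0. \<exists>C. \<forall>\<epsilon>\<in>{0<..<\<epsilon>0}.
      c1 * \<epsilon> powr (- real CARD('n) / 2) \<le> Z \<epsilon> \<and> Z \<epsilon> \<le> c2 * \<epsilon> powr (- real CARD('n) / 2) \<and>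
      (\<forall>t\<in>{0..T}.
        let d = (\<lambda>y. beam_superposition (Z \<epsilon>) k X A S \<rho> \<phi> a \<epsilon> t y - \<psi> \<epsilon> t y) in
        square_integrable d \<and>
        L2_norm d \<le> C * measure lborel (supp A) * \<epsilon> powr (real k / 2 - real CARD('n) / 4))"
proof -
  interpret gaussian_beams V S \<rho> A T k X \<phi> a
    by unfold_locales (use assms in auto)
  define G0 where "G0 = gauss_int TYPE(real^'n) (1/2)"
  have G0: "G0 > 0" unfolding G0_def by (rule gauss_int_pos) simp
  \<comment> \<open>The normalization is an exact multiple of the power of \<epsilon>, so both
    comparison constants can be taken as \<open>1 / G0\<close>.\<close>
  have Zeq: "beam_normalization TYPE('n) \<epsilon> = 1 / G0 * \<epsilon> powr (- real CARD('n) / 2)" if "\<epsilon> > 0" for \<epsilon>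
  proof -
    have "sqrt \<epsilon> ^ CARD('n) = (\<epsilon> powr (1/2)) powr real CARD('n)" using that by (simp add: powr_half_sqrt powr_realpow)
    then have "sqrt \<epsilon> ^ CARD('n) = \<epsilon> powr (real CARD('n) / 2)" by (simp add: powr_powr)
    then show ?thesis by (simp add: beam_normalization_def G0_def powr_minus_divide)
  qed
  have err: "\<exists>C. \<forall>\<epsilon>\<in>{0<..<1}. \<forall>t\<in>{0..T}.
    square_integrable (\<lambda>y. beam_superposition (beam_normalization TYPE('n) \<epsilon>) k X A S \<rho> \<phi> a \<epsilon> t y - \<psi> \<epsilon> t y) \<and>
    L2_norm (\<lambda>y. beam_superposition (beam_normalization TYPE('n) \<epsilon>) k X A S \<rho> \<phi> a \<epsilon> t y - \<psi> \<epsilon> t y)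
      \<le> C * measure lborel (supp A) * \<epsilon> powr (real k / 2 - real CARD('n) / 4)"
  proof (cases "\<exists>y. A y \<noteq> 0")
    case True
    then have m: "measure lborel (supp A) > 0"
      using measure_supp_pos[OF smooth_continuous[OF smooth_A]] compact_K unfolding K_def by blast
    from superposition_error[of \<psi>, OF assms(10)] obtain C where C: "\<forall>\<epsilon>\<in>{0<..<1}. \<forall>t\<in>{0..T}.
      square_integrable (\<lambda>y. beam_superposition (beam_normalization TYPE('n) \<epsilon>) k X A S \<rho> \<phi> a \<epsilon> t y - \<psi> \<epsilon> t y) \<and>
      L2_norm (\<lambda>y. beam_superposition (beam_normalization TYPE('n) \<epsilon>) k X A S \<rho> \<phi> a \<epsilon> t y - \<psi> \<epsilon> t y)
        \<le> C * \<epsilon> powr (real k / 2 - real CARD('n) / 4)" by blast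
    \<comment> \<open>The constant may depend on A, so it can be divided by the positive measure of
      the support.\<close>
    show ?thesis
      by (rule exI[of _ "C / measure lborel (supp A)"]) (use C m in simp)
  next
    \<comment> \<open>With empty support the claimed bound is zero. There are no beams to integrate,
      and conservation of the norm forces the solution to have norm zero.\<close>
    case False
    then have A0: "A y = 0" for y by simp
    have supp0: "supp A = {}" by (simp add: supp_def A0)
    have "square_integrable (\<lambda>y. beam_superposition (beam_normalization TYPE('n) \<epsilon>) k X A S \<rho> \<phi> a \<epsilon> t y - \<psi> \<epsilon> t y) \<and>
      L2_norm (\<lambda>y. beam_superposition (beam_normalization TYPE('n) \<epsilon>) k X A S \<rho> \<phi> a \<epsilon> t y - \<psi> \<epsilon> t y) = 0"
      if \<epsilon>: "\<epsilon> > 0" and t: "t \<in> {0..T}" for \<epsilon> t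
    proof -
      have b0: "beam_superposition (beam_normalization TYPE('n) \<epsilon>) k X A S \<rho> \<phi> a \<epsilon> t y = 0" for y
        by (simp add: beam_superposition_def level_set_integral_def supp0 set_lebesgue_integral_def)
      have "square_integrable (\<psi> \<epsilon> t)" "L2_norm (\<psi> \<epsilon> t) = L2_norm (wkb_data A S \<epsilon>)"
        using assms(10)[OF \<epsilon>] t unfolding schrodinger_solution_def by blast+
      moreover have "L2_norm (wkb_data A S \<epsilon>) = 0" by (simp add: L2_norm_def wkb_data_def A0)
      ultimately show ?thesis unfolding b0 by (simp add: square_integrable_def L2_norm_def)
    qed
    then show ?thesis by (intro exI[of _ 0]) simp
  qed
  then obtain C where C: "\<forall>\<epsilon>\<in>{0<..<1}. \<forall>t\<in>{0..T}.
    square_integrable (\<lambda>y. beam_superposition (beam_normalization TYPE('n) \<epsilon>) k X A S \<rho> \<phi> a \<epsilon> t y - \<psi> \<epsilon> t y) \<and>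
    L2_norm (\<lambda>y. beam_superposition (beam_normalization TYPE('n) \<epsilon>) k X A S \<rho> \<phi> a \<epsilon> t y - \<psi> \<epsilon> t y)
      \<le> C * measure lborel (supp A) * \<epsilon> powr (real k / 2 - real CARD('n) / 4)" by (elim exE)
  have inv: "1 / G0 > 0" using G0 by simp
  show ?thesis
    by (rule exI[of _ 1], rule conjI[OF zero_less_one], rule exI[of _ "beam_normalization TYPE('n)"],
        rule exI[of _ "1 / G0"], rule conjI[OF inv], rule exI[of _ "1 / G0"], rule conjI[OF inv], rule exI[of _ C])
      (use C Zeq in \<open>simp add: Let_def\<close>)
qed

end
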